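(* Let $X$, $U=U_1\times\cdots\times U_p$, $U_{d,1}$, $U_{d,3}$ be Hilbert spaces, $U_d=U_{d,1}\times U\times U_{d,3}$, and let $\phi$, $(r_k)$, $(\delta_k)$, $(\mathfrak B,\mathfrak A,\mathfrak C)$, $B_{d,1}$, $\kappa\ge0$, $A$, $A^\kappa$, $P^\kappa_c$, $P^\kappa_d$ be as in the context. Assume: (a) $B_{d,1}\in\mathcal L(U_{d,1},X)$ and $(\mathfrak B,\mathfrak A,\mathfrak C)$ with $\mathfrak B=\begin{bmatrix}\mathfrak B_c\\\mathfrak B_d\end{bmatrix}$ is a well-posed boundary node on $(U\times U_{d,3},X,U)$, and $$\operatorname{Re}\langle\mathfrak Ax,x\rangle_X\le\operatorname{Re}\langle\mathfrak B_cx,\mathfrak Cx\rangle_U,\qquad x\in\operatorname{Ker}(\mathfrak B_d);$$ (b) either $\kappa=0$ and the semigroup generated by $A$ is strongly stable; or $\kappa>0$, $\|r_k\|<\delta_k$ for all $k\in\{1,\dots,p\}$, and the semigroup generated by $A^\kappa$ is strongly stable; (c) $\pm i\omega_k\in\rho(A^\kappa)$ and $P_c^\kappa(\pm i\omega_k)$ is boundedly invertible for every $k\in\{1,\dots,q\}$; if $a_0\ne0$ or $c_0\ne0$, then also $0\in\rho(A^\kappa)$ and $P_c^\kappa(0)$ is boundedly invertible. Let $u_{\mathrm{reg}}$ be as in the context. Then for every $x_0\in X$ and every $w_d$ and $y_{ref}$ of the trigonometric form in the context, the boundary control system with the control law $u(t)=-\kappa e(t)+u_{\mathrm{reg}}(t)$,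 $t\ge0$, $e=y-y_{ref}$, has a unique generalised solution $(x,u_{\mathrm{reg}}+\kappa y_{ref},w_d,y)$ satisfying $x(0)=x_0$. If the coefficients $(a_k,b_k,c_k,d_k)_k$ of $y_{ref}$ and $w_d$ are such that $u_{\mathrm{reg}}(t)\in U_\phi^\delta$ for some $\delta>0$ and for all $t\ge0$, then for every $x_0\in X$ the state trajectory $x$ is uniformly bounded and the following hold. - If $\kappa>0$, then there exists a set $\Omega\subset[0,\infty)$ of finite measure such that $e\in L^2([0,\infty)\setminus\Omega;U)$ and $e\in L^1(\Omega;U)$. - If $\kappa=0$, then $\|e\|_{L^2(t,t+1)}\to0$ as $t\to\infty$. If, in addition, the semigroup $\mathbb T$ generated by $A$ is exponentially stable, then $t\mapsto e^{\alpha t}e(t)\in L^2(0,\infty;U)$ for some $\alpha>0$. If $x_0\in D(\mathfrak A)$, $w_d=(w_{d,1},w_{d,2},w_{d,3})^\top$ and $y_{ref}$ are such that $\mathfrak B_cx_0=\phi(u_{\mathrm{reg}}(0)+\kappa y_{ref}(0)-\kappa\mathfrak Cx_0)+w_{d,2}(0)$ and $\mathfrak B_dx_0=w_{d,3}(0)$, then $(x,u_{\mathrm{reg}}+\kappa y_{ref},w_d,y)$ is a classical solution and $e\in H^1_{loc}(0,\infty;U)$.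
   Context: All Hilbert spaces are complex. $L^2_{loc}(0,\infty;\cdot)$ and $H^1_{loc}(0,\infty;\cdot)$ are the functions whose restrictions to $(0,\tau)$ are in $L^2$, resp. $H^1$, for every $\tau>0$. $\mathbf P_\tau f$ is the restriction of $f$ to $[0,\tau]$. Strongly stable semigroup: $\mathbb T_tx\to0$ for all $x$. Saturation: $\phi(u)=(\phi_1(u_1),\dots,\phi_p(u_p))^\top$ on $U=U_1\times\cdots\times U_p$ with given $r_k\in U_k$, $\delta_k>0$, $\phi_k(u)=r_k+\frac{\delta_k(u-r_k)}{\max\{\delta_k,\|u-r_k\|\}}$. For $0<\delta<\min_k\delta_k$: $U_\phi^\delta=\{(u_1,\dots,u_p)^\top\in U:\|u_k-r_k\|\le\delta_k-\delta,\ k=1,\dots,p\}$. Boundary node. $(\mathfrak B,\mathfrak A,\mathfrak C)$, $\mathfrak B=\begin{bmatrix}\mathfrak B_c\\\mathfrak B_d\end{bmatrix}$, is a boundary node on $(U\times U_{d,3},X,U)$ if $\mathfrak A:D(\mathfrak A)\subset X\to X$, $\mathfrak B\in\mathcal L(D(\mathfrak A),U\times U_{d,3})$, $\mathfrak C\in\mathcal L(D(\mathfrak A),U)$ ($D(\mathfrak A)$ with the graph norm), the restriction $A:=\mathfrak A|_{\operatorname{Ker}(\mathfrak B)}$ with $D(A)=\operatorname{Ker}(\mathfrak B)$ generates a strongly continuous semigroup $\mathbb T$ on $X$, and there is $\mathfrak B^r\in\mathcal L(U\times U_{d,3},D(\mathfrak A))$ with $\mathfrak B\mathfrak B^r=I$.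 Boundary control system: with $w_d=(w_{d,1},w_{d,2},w_{d,3})^\top:[0,\infty)\to U_d=U_{d,1}\times U\times U_{d,3}$, $$( * )\quad \dot x(t)=\mathfrak Ax(t)+B_{d,1}w_{d,1}(t),\ x(0)=x_0;\quad \mathfrak B_cx(t)=\phi(u(t))+w_{d,2}(t);\quad \mathfrak B_dx(t)=w_{d,3}(t);\quad y(t)=\mathfrak Cx(t).$$ Consider $u=u_1-\kappa y$. A tuple $(x,u_1,w_d,y)$ is a classical solution of $( * )$ on $[0,\infty)$ if $x\in C^1([0,\infty);X)$, $u_1,y\in C([0,\infty);U)$, $w_d\in C([0,\infty);U_d)$, $x(t)\in D(\mathfrak A)$ and the identities in $( * )$ hold for all $t\ge0$. It is a generalised solution if $x\in C([0,\infty);X)$, $u_1,y\in L^2_{loc}(0,\infty;U)$, $w_d\in L^2_{loc}(0,\infty;U_d)$ and there is a sequence of classical solutions $(x^k,u_1^k,w_d^k,y^k)_k$ whose restrictions $\mathbf P_\tau$ converge to those of $(x,u_1,w_d,y)$ in $C([0,\tau];X)\times L^2(0,\tau;U)\times L^2(0,\tau;U_d)\times L^2(0,\tau;U)$ for every $\tau>0$. The boundary node is well-posed if there exist $\tau,M_\tau>0$ such that all classical solutions of $( * )$ with $\phi=\mathrm{id}$, $w_{d,1}\equiv0$, $w_{d,2}\equiv0$ satisfy $$\|x(\tau)\|_X^2+\int_0^\tau\|y(t)\|_U^2dt\le M_\tau\Bigl(\|x_0\|_X^2+\int_0^\tau\|u(t)\|_U^2+\|w_{d,3}(t)\|^2_{U_{d,3}}dt\Bigr).$$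 Closed loop: $A^\kappa=\mathfrak A|_{\operatorname{Ker}(\mathfrak B_c+\kappa\mathfrak C)\cap\operatorname{Ker}(\mathfrak B_d)}$ with domain $\operatorname{Ker}(\mathfrak B_c+\kappa\mathfrak C)\cap\operatorname{Ker}(\mathfrak B_d)$. For $\lambda\in\rho(A^\kappa)$, $P_c^\kappa(\lambda)\in\mathcal L(U)$ and $P_d^\kappa(\lambda)\in\mathcal L(U_d,U)$ are defined by: $y=P_c^\kappa(\lambda)u+P_d^\kappa(\lambda)w$, $w=(w_1,w_2,w_3)^\top\in U_d$, iff $y=\mathfrak Cx$ where $x\in D(\mathfrak A)$ is the unique solution of $(\lambda-\mathfrak A)x=B_{d,1}w_1$, $(\mathfrak B_c+\kappa\mathfrak C)x=u+w_2$, $\mathfrak B_dx=w_3$. Signals: for given $\omega_1,\dots,\omega_q\in(0,\infty)$, $\omega_0=0$, $a_k,b_k\in U$, $c_k,d_k\in U_d$: $y_{ref}(t)=a_0+\sum_{k=1}^q(a_k\cos\omega_kt+b_k\sin\omega_kt)$, $w_d(t)=c_0+\sum_{k=1}^q(c_k\cos\omega_kt+d_k\sin\omega_kt)$. Feedforward: $u_{\mathrm{reg}}(t)=f_0+\frac12\sum_{k=1}^q[(f_k+g_k)\cos(\omega_kt)+i(f_k-g_k)\sin(\omega_kt)]$ with $f_0=P_c^\kappa(0)^{-1}((I-\kappa P_c^\kappa(0))a_0-P_d^\kappa(0)c_0)$, $f_k=P_c^\kappa(i\omega_k)^{-1}[(I-\kappa P_c^\kappa(i\omega_k))(a_k-ib_k)-P_d^\kappa(i\omega_k)(c_k-id_k)]$,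 $g_k=P_c^\kappa(-i\omega_k)^{-1}[(I-\kappa P_c^\kappa(-i\omega_k))(a_k+ib_k)-P_d^\kappa(-i\omega_k)(c_k+id_k)]$; if $a_0=0$ and $c_0=0$ then $f_0:=0$ even if $P_c^\kappa(0)$ is not invertible (or $0\notin\rho(A^\kappa)$). *)

theory Defs
  imports "HOL-Analysis.Analysis"
begin

section \<open>Complex Hilbert spaces\<close>

text \<open>
  The class extends a real Hilbert space by a complex scalar multiplication and a complex inner
  product (linear in the first argument) whose real part is the given real inner product. The
  norm is therefore the one induced by the complex inner product. No separability is assumed.
\<close>

class scaleC =
  fixes scaleC :: "complex \<Rightarrow> 'a \<Rightarrow> 'a"  (infixr \<open>*\<^sub>C\<close> 75)

class complex_inner = real_inner + scaleC +
  fixes cinner :: "'a \<Rightarrow> 'a \<Rightarrow> complex"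
  assumes scaleC_add_right: "c *\<^sub>C (x + y) = c *\<^sub>C x + c *\<^sub>C y"
    and scaleC_add_left: "(c + d) *\<^sub>C x = c *\<^sub>C x + d *\<^sub>C x"
    and scaleC_scaleC: "c *\<^sub>C (d *\<^sub>C x) = (c * d) *\<^sub>C x"
    and scaleC_of_real: "complex_of_real s *\<^sub>C x = s *\<^sub>R x"
    and cinner_commute: "cinner x y = cnj (cinner y x)"
    and cinner_add_left: "cinner (x + y) z = cinner x z + cinner y z"
    and cinner_scaleC_left: "cinner (c *\<^sub>C x) y = c * cinner x y"
    and Re_cinner: "Re (cinner x y) = inner x y"

class chilbert_space = complex_inner + banach

instantiation complex :: chilbert_space
begin
definition scaleC_complex_def: "c *\<^sub>C (x::complex) = c * x"
definition cinner_complex_def: "cinner (x::complex) y = x * cnj y"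
instance
  by standard (auto simp: scaleC_complex_def cinner_complex_def algebra_simps
      scaleR_conv_of_real inner_complex_def)
end

instantiation prod :: (chilbert_space, chilbert_space) chilbert_space
begin
definition scaleC_prod_def: "c *\<^sub>C (x::'a \<times> 'b) = (c *\<^sub>C fst x, c *\<^sub>C snd x)"
definition cinner_prod_def:
  "cinner (x::'a \<times> 'b) y = cinner (fst x) (fst y) + cinner (snd x) (snd y)"
instance
proof
  fix x y :: "'a \<times> 'b"
  show "cinner x y = cnj (cinner y x)"
    unfolding cinner_prod_def complex_cnj_add
    using cinner_commute[of "fst x" "fst y"] cinner_commute[of "snd x" "snd y"] by simp
qed (auto simp: scaleC_prod_def cinner_prod_def scaleC_add_right scaleC_add_left scaleC_scaleC
      scaleC_of_real cinner_add_left cinner_scaleC_left Re_cinner inner_prod_def algebra_simps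
      prod_eq_iff)
end

instantiation vec :: (chilbert_space, finite) chilbert_space
begin
definition scaleC_vec_def: "c *\<^sub>C (x::'a ^ 'b) = (\<chi> i. c *\<^sub>C (x $ i))"
definition cinner_vec_def: "cinner (x::'a ^ 'b) y = (\<Sum>i\<in>UNIV. cinner (x $ i) (y $ i))"
instance
proof
  fix x y :: "'a ^ 'b"
  show "cinner x y = cnj (cinner y x)"
    unfolding cinner_vec_def cnj_sum
    by (rule sum.cong[OF refl]) (rule cinner_commute)
qed (auto simp: scaleC_vec_def cinner_vec_def scaleC_add_right scaleC_add_left scaleC_scaleC
      scaleC_of_real cinner_add_left cinner_scaleC_left Re_cinner inner_vec_def sum.distrib
      sum_distrib_left vec_eq_iff)
end

definition csubspace :: "'a::chilbert_space set \<Rightarrow> bool" where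
  "csubspace V \<longleftrightarrow> 0 \<in> V \<and> (\<forall>x\<in>V. \<forall>y\<in>V. x + y \<in> V) \<and> (\<forall>c. \<forall>x\<in>V. c *\<^sub>C x \<in> V)"

text \<open>
  The Hilbert space \<open>U\<^sub>1 \<times> \<dots> \<times> U\<^sub>p\<close>. The factors may be different spaces, so they are closed
  subspaces of one common Hilbert space \<open>'v\<close> (any finite family of Hilbert spaces embeds
  isometrically into its direct sum), and the product is a closed subspace of \<open>'v ^ 'p\<close>.
  Consequently, operators into or out of the product carry its carrier set as a parameter.
\<close>

definition prod_space :: "('p \<Rightarrow> 'v set) \<Rightarrow> ('v ^ 'p) set" where
  "prod_space Us = {u. \<forall>k. u $ k \<in> Us k}"

text \<open>The space \<open>U\<^sub>d\<^sub>,\<^sub>1 \<times> U \<times> U\<^sub>d\<^sub>,\<^sub>3\<close> in which the disturbances take their values.\<close>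

definition dist_space :: "'u set \<Rightarrow> ('d1 \<times> 'u \<times> 'd3) set" where
  "dist_space U = UNIV \<times> U \<times> UNIV"


section \<open>Bounded linear operators, semigroups, resolvent sets\<close>

definition clinear_on ::
  "'a::chilbert_space set \<Rightarrow> 'b::chilbert_space set \<Rightarrow> ('a \<Rightarrow> 'b) \<Rightarrow> bool" where
  "clinear_on V W f \<longleftrightarrow> (\<forall>x\<in>V. f x \<in> W)
     \<and> (\<forall>x\<in>V. \<forall>y\<in>V. f (x + y) = f x + f y) \<and> (\<forall>c. \<forall>x\<in>V. f (c *\<^sub>C x) = c *\<^sub>C f x)"

text \<open>The operators in \<open>\<L>(V, W)\<close>, where \<open>V\<close> and \<open>W\<close> are normed by \<open>N\<close> and \<open>M\<close>.\<close>

definition bounded_clinear_on ::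
  "'a::chilbert_space set \<Rightarrow> ('a \<Rightarrow> real) \<Rightarrow> 'b::chilbert_space set \<Rightarrow> ('b \<Rightarrow> real)
     \<Rightarrow> ('a \<Rightarrow> 'b) \<Rightarrow> bool" where
  "bounded_clinear_on V N W M f \<longleftrightarrow> clinear_on V W f \<and> (\<exists>K. \<forall>x\<in>V. M (f x) \<le> K * N x)"

definition boundedly_invertible_on :: "'a::chilbert_space set \<Rightarrow> ('a \<Rightarrow> 'a) \<Rightarrow> bool" where
  "boundedly_invertible_on V P \<longleftrightarrow>
     (\<forall>u\<in>V. P u \<in> V) \<and>
     (\<exists>R. bounded_clinear_on V norm V norm R \<and> (\<forall>u\<in>V. R (P u) = u \<and> P (R u) = u))"

definition c0_semigroup :: "(real \<Rightarrow> 'x::chilbert_space \<Rightarrow> 'x) \<Rightarrow> bool" where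
  "c0_semigroup T \<longleftrightarrow>
     (\<forall>t\<ge>0. bounded_clinear_on UNIV norm UNIV norm (T t)) \<and>
     T 0 = id \<and> (\<forall>s\<ge>0. \<forall>t\<ge>0. T (s + t) = T s \<circ> T t) \<and>
     (\<forall>x. continuous_on {0..} (\<lambda>t. T t x))"

text \<open>The operator \<open>A\<close> with domain exactly \<open>D\<close> is the infinitesimal generator of \<open>T\<close>.\<close>

definition generates ::
  "'x::chilbert_space set \<Rightarrow> ('x \<Rightarrow> 'x) \<Rightarrow> (real \<Rightarrow> 'x \<Rightarrow> 'x) \<Rightarrow> bool" where
  "generates D A T \<longleftrightarrow> c0_semigroup T \<and>
     (\<forall>x z. ((\<lambda>h. (T h x - x) /\<^sub>R h) \<longlongrightarrow> z) (at_right 0) \<longleftrightarrow> x \<in> D \<and> A x = z)"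

definition strongly_stable :: "(real \<Rightarrow> 'x::chilbert_space \<Rightarrow> 'x) \<Rightarrow> bool" where
  "strongly_stable T \<longleftrightarrow> (\<forall>x. ((\<lambda>t. T t x) \<longlongrightarrow> 0) at_top)"

definition exponentially_stable :: "(real \<Rightarrow> 'x::chilbert_space \<Rightarrow> 'x) \<Rightarrow> bool" where
  "exponentially_stable T \<longleftrightarrow>
     (\<exists>M. \<exists>\<beta>>0. \<forall>t\<ge>0. \<forall>x. norm (T t x) \<le> M * exp (- \<beta> * t) * norm x)"

definition resolvent_set :: "'x::chilbert_space set \<Rightarrow> ('x \<Rightarrow> 'x) \<Rightarrow> complex set" where
  "resolvent_set D A = {\<mu>. bij_betw (\<lambda>x. \<mu> *\<^sub>C x - A x) D UNIV \<and>
     (\<exists>K. \<forall>x\<in>D. norm x \<le> K * norm (\<mu> *\<^sub>C x - A x))}"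


section \<open>Function spaces\<close>

text \<open>
  The Bochner integral of the library is restricted to second countable spaces. Here strong
  (Bochner) measurability of a function with values in a possibly nonseparable space is expressed
  by \<^const>\<open>measurable_on\<close> (almost everywhere limit of continuous functions). In the definition
  of \<open>H\<^sup>1\<close> only integrals of \<open>L\<^sup>2\<close> functions over compact intervals occur; these are Bochner
  integrable, and there the Henstock-Kurzweil integral agrees with the Bochner integral.
\<close>

definition L1_on :: "real set \<Rightarrow> 'a::real_normed_vector set \<Rightarrow> (real \<Rightarrow> 'a) \<Rightarrow> bool" where
  "L1_on S V f \<longleftrightarrow> f measurable_on S \<and> (AE t in lebesgue. t \<in> S \<longrightarrow> f t \<in> V) \<and>
     set_integrable lebesgue S (\<lambda>t. norm (f t))"

definition L2_on :: "real set \<Rightarrow> 'a::real_normed_vector set \<Rightarrow> (real \<Rightarrow> 'a) \<Rightarrow> bool" where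
  "L2_on S V f \<longleftrightarrow> f measurable_on S \<and> (AE t in lebesgue. t \<in> S \<longrightarrow> f t \<in> V) \<and>
     set_integrable lebesgue S (\<lambda>t. (norm (f t))\<^sup>2)"

definition L2_norm :: "real set \<Rightarrow> (real \<Rightarrow> 'a::real_normed_vector) \<Rightarrow> real" where
  "L2_norm S f = sqrt (LINT t:S|lebesgue. (norm (f t))\<^sup>2)"

definition L2_loc :: "'a::real_normed_vector set \<Rightarrow> (real \<Rightarrow> 'a) \<Rightarrow> bool" where
  "L2_loc V f \<longleftrightarrow> (\<forall>\<tau>>0. L2_on {0<..<\<tau>} V f)"

definition H1_on :: "real set \<Rightarrow> 'a::real_normed_vector set \<Rightarrow> (real \<Rightarrow> 'a) \<Rightarrow> bool" where
  "H1_on I V f \<longleftrightarrow> L2_on I V f \<and>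
     (\<exists>h g. L2_on I V g \<and> (AE t in lebesgue. t \<in> I \<longrightarrow> f t = h t) \<and>
        (\<forall>s\<in>I. \<forall>t\<in>I. s \<le> t \<longrightarrow> (g has_integral (h t - h s)) {s..t}))"

definition H1_loc :: "'a::real_normed_vector set \<Rightarrow> (real \<Rightarrow> 'a) \<Rightarrow> bool" where
  "H1_loc V f \<longleftrightarrow> (\<forall>\<tau>>0. H1_on {0<..<\<tau>} V f)"


section \<open>Saturation\<close>

definition saturation ::
  "('p \<Rightarrow> 'v::chilbert_space) \<Rightarrow> ('p \<Rightarrow> real) \<Rightarrow> 'v ^ 'p \<Rightarrow> 'v ^ 'p" where
  "saturation r \<delta> u =
     (\<chi> k. r k + (\<delta> k / max (\<delta> k) (norm (u $ k - r k))) *\<^sub>R (u $ k - r k))"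

definition sat_interior ::
  "('p \<Rightarrow> 'v::chilbert_space set) \<Rightarrow> ('p \<Rightarrow> 'v) \<Rightarrow> ('p \<Rightarrow> real) \<Rightarrow> real \<Rightarrow> ('v ^ 'p) set" where
  "sat_interior Us r \<delta> \<epsilon> = {u \<in> prod_space Us. \<forall>k. norm (u $ k - r k) \<le> \<delta> k - \<epsilon>}"


section \<open>Boundary control systems\<close>

text \<open>
  The operators \<open>\<AA>\<close> (with domain \<open>Dom\<close>), \<open>\<BB>\<^sub>c\<close>, \<open>\<BB>\<^sub>d\<close>, \<open>\<CC>\<close> and \<open>B\<^sub>d\<^sub>,\<^sub>1\<close>. The operators on \<open>Dom\<close> are
  total functions whose values outside \<open>Dom\<close> are never used.
\<close>

record ('x, 'u, 'd1, 'd3) bcs =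
  Dom :: "'x set"
  opA :: "'x \<Rightarrow> 'x"
  opBc :: "'x \<Rightarrow> 'u"
  opBd :: "'x \<Rightarrow> 'd3"
  opC :: "'x \<Rightarrow> 'u"
  opB1 :: "'d1 \<Rightarrow> 'x"

definition graph_norm :: "('x::chilbert_space, 'u, 'd1, 'd3) bcs \<Rightarrow> 'x \<Rightarrow> real" where
  "graph_norm S x = sqrt ((norm x)\<^sup>2 + (norm (opA S x))\<^sup>2)"

definition ker_B :: "('x, 'u::zero, 'd1, 'd3::zero) bcs \<Rightarrow> 'x set" where
  "ker_B S = {x \<in> Dom S. opBc S x = 0 \<and> opBd S x = 0}"

definition boundary_node ::
  "'u::chilbert_space set \<Rightarrow> ('x::chilbert_space, 'u, 'd1, 'd3::chilbert_space) bcs \<Rightarrow> bool" where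
  "boundary_node U S \<longleftrightarrow>
     csubspace (Dom S) \<and> clinear_on (Dom S) UNIV (opA S) \<and>
     bounded_clinear_on (Dom S) (graph_norm S) (U \<times> UNIV) norm (\<lambda>x. (opBc S x, opBd S x)) \<and>
     bounded_clinear_on (Dom S) (graph_norm S) U norm (opC S) \<and>
     (\<exists>T. generates (ker_B S) (opA S) T) \<and>
     (\<exists>Br. bounded_clinear_on (U \<times> UNIV) norm (Dom S) (graph_norm S) Br \<and>
        (\<forall>z\<in>U \<times> UNIV. (opBc S (Br z), opBd S (Br z)) = z))"

text \<open>
  Classical solutions of
    \<open>x' = \<AA> x + B\<^sub>d\<^sub>,\<^sub>1 w\<^sub>d\<^sub>,\<^sub>1\<close>, \<open>\<BB>\<^sub>c x = \<phi>(u\<^sub>1 - \<kappa> y) + w\<^sub>d\<^sub>,\<^sub>2\<close>, \<open>\<BB>\<^sub>d x = w\<^sub>d\<^sub>,\<^sub>3\<close>, \<open>y = \<CC> x\<close>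
  on \<open>[0,\<infinity>)\<close>; the initial state is \<open>x 0\<close>. Values of the functions at negative times are irrelevant.
\<close>

definition classical_solution ::
  "'u::chilbert_space set \<Rightarrow> ('x::chilbert_space, 'u, 'd1::chilbert_space, 'd3::chilbert_space) bcs
     \<Rightarrow> ('u \<Rightarrow> 'u) \<Rightarrow> real
     \<Rightarrow> (real \<Rightarrow> 'x) \<Rightarrow> (real \<Rightarrow> 'u) \<Rightarrow> (real \<Rightarrow> 'd1 \<times> 'u \<times> 'd3) \<Rightarrow> (real \<Rightarrow> 'u) \<Rightarrow> bool" where
  "classical_solution U S \<phi> \<kappa> x u1 wd y \<longleftrightarrow>
     (\<exists>x'. continuous_on {0..} x' \<and>
        (\<forall>t\<ge>0. (x has_vector_derivative x' t) (at t within {0..}) \<and>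
           x' t = opA S (x t) + opB1 S (fst (wd t)))) \<and>
     continuous_on {0..} u1 \<and> continuous_on {0..} y \<and> continuous_on {0..} wd \<and>
     (\<forall>t\<ge>0. u1 t \<in> U \<and> y t \<in> U \<and> wd t \<in> dist_space U \<and> x t \<in> Dom S \<and>
        opBc S (x t) = \<phi> (u1 t - \<kappa> *\<^sub>R y t) + fst (snd (wd t)) \<and>
        opBd S (x t) = snd (snd (wd t)) \<and>
        y t = opC S (x t))"

definition generalised_solution ::
  "'u::chilbert_space set \<Rightarrow> ('x::chilbert_space, 'u, 'd1::chilbert_space, 'd3::chilbert_space) bcs
     \<Rightarrow> ('u \<Rightarrow> 'u) \<Rightarrow> real
     \<Rightarrow> (real \<Rightarrow> 'x) \<Rightarrow> (real \<Rightarrow> 'u) \<Rightarrow> (real \<Rightarrow> 'd1 \<times> 'u \<times> 'd3) \<Rightarrow> (real \<Rightarrow> 'u) \<Rightarrow> bool" where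
  "generalised_solution U S \<phi> \<kappa> x u1 wd y \<longleftrightarrow>
     continuous_on {0..} x \<and> L2_loc U u1 \<and> L2_loc U y \<and> L2_loc (dist_space U) wd \<and>
     (\<exists>xs u1s wds ys.
        (\<forall>k::nat. classical_solution U S \<phi> \<kappa> (xs k) (u1s k) (wds k) (ys k)) \<and>
        (\<forall>\<tau>>0. uniform_limit {0..\<tau>} xs x sequentially \<and>
           (\<lambda>k. L2_norm {0<..<\<tau>} (\<lambda>t. u1s k t - u1 t)) \<longlonglongrightarrow> 0 \<and>
           (\<lambda>k. L2_norm {0<..<\<tau>} (\<lambda>t. wds k t - wd t)) \<longlonglongrightarrow> 0 \<and>
           (\<lambda>k. L2_norm {0<..<\<tau>} (\<lambda>t. ys k t - y t)) \<longlonglongrightarrow> 0))"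

text \<open>
  Well-posedness concerns the input \<open>u\<close> itself. With \<open>\<phi> = id\<close> the tuple with \<open>u = u\<^sub>1 - \<kappa> y\<close> is a
  classical solution for feedback gain \<open>0\<close>, so no feedback is needed here.
\<close>

definition well_posed ::
  "'u::chilbert_space set \<Rightarrow> ('x::chilbert_space, 'u, 'd1::chilbert_space, 'd3::chilbert_space) bcs
     \<Rightarrow> bool" where
  "well_posed U S \<longleftrightarrow>
     (\<exists>\<tau>>0. \<exists>M>0. \<forall>x u wd y.
        classical_solution U S id 0 x u wd y \<longrightarrow>
        (\<forall>t\<ge>0. fst (wd t) = 0 \<and> fst (snd (wd t)) = 0) \<longrightarrow>
        (norm (x \<tau>))\<^sup>2 + (LINT t:{0..\<tau>}|lebesgue. (norm (y t))\<^sup>2)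
          \<le> M * ((norm (x 0))\<^sup>2 +
               (LINT t:{0..\<tau>}|lebesgue. (norm (u t))\<^sup>2 + (norm (snd (snd (wd t))))\<^sup>2)))"

text \<open>The domain of \<open>A\<^sup>\<kappa>\<close>, the restriction of \<open>\<AA>\<close>.\<close>

definition cl_dom ::
  "real \<Rightarrow> ('x, 'u::real_vector, 'd1, 'd3::zero) bcs \<Rightarrow> 'x set" where
  "cl_dom \<kappa> S = {x \<in> Dom S. opBc S x + \<kappa> *\<^sub>R opC S x = 0 \<and> opBd S x = 0}"

definition cl_state ::
  "real \<Rightarrow> ('x::chilbert_space, 'u::real_vector, 'd1, 'd3) bcs
     \<Rightarrow> complex \<Rightarrow> 'u \<Rightarrow> 'd1 \<times> 'u \<times> 'd3 \<Rightarrow> 'x" where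
  "cl_state \<kappa> S \<mu> u w = (THE x. x \<in> Dom S \<and>
     \<mu> *\<^sub>C x - opA S x = opB1 S (fst w) \<and>
     opBc S x + \<kappa> *\<^sub>R opC S x = u + fst (snd w) \<and>
     opBd S x = snd (snd w))"

text \<open>The transfer functions \<open>P\<^sub>c\<^sup>\<kappa>\<close> and \<open>P\<^sub>d\<^sup>\<kappa>\<close>.\<close>

definition Pc ::
  "real \<Rightarrow> ('x::chilbert_space, 'u::real_vector, 'd1::zero, 'd3::zero) bcs
     \<Rightarrow> complex \<Rightarrow> 'u \<Rightarrow> 'u" where
  "Pc \<kappa> S \<mu> u = opC S (cl_state \<kappa> S \<mu> u 0)"

definition Pd ::
  "real \<Rightarrow> ('x::chilbert_space, 'u::real_vector, 'd1::zero, 'd3::zero) bcs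
     \<Rightarrow> complex \<Rightarrow> 'd1 \<times> 'u \<times> 'd3 \<Rightarrow> 'u" where
  "Pd \<kappa> S \<mu> w = opC S (cl_state \<kappa> S \<mu> 0 w)"


section \<open>Reference signals, disturbances and feedforward input\<close>

text \<open>
  \<open>a\<^sub>0 + \<Sum>\<^sub>k (a\<^sub>k cos \<omega>\<^sub>k t + b\<^sub>k sin \<omega>\<^sub>k t)\<close>; the values \<open>b 0\<close> and \<open>\<omega> 0\<close> are not used.
\<close>

definition trig_signal ::
  "nat \<Rightarrow> (nat \<Rightarrow> real) \<Rightarrow> (nat \<Rightarrow> 'a::real_vector) \<Rightarrow> (nat \<Rightarrow> 'a) \<Rightarrow> real \<Rightarrow> 'a" where
  "trig_signal q \<omega> a b t =
     a 0 + (\<Sum>k=1..q. cos (\<omega> k * t) *\<^sub>R a k + sin (\<omega> k * t) *\<^sub>R b k)"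

text \<open>\<open>P\<^sub>c\<^sup>\<kappa>(\<mu>)\<^sup>-\<^sup>1 [(I - \<kappa> P\<^sub>c\<^sup>\<kappa>(\<mu>)) \<alpha> - P\<^sub>d\<^sup>\<kappa>(\<mu>) \<beta>]\<close>\<close>

definition ff_coeff ::
  "'u::chilbert_space set \<Rightarrow> ('x::chilbert_space, 'u, 'd1::chilbert_space, 'd3::chilbert_space) bcs
     \<Rightarrow> real \<Rightarrow> complex \<Rightarrow> 'u \<Rightarrow> 'd1 \<times> 'u \<times> 'd3 \<Rightarrow> 'u" where
  "ff_coeff U S \<kappa> \<mu> \<alpha> \<beta> =
     inv_into U (Pc \<kappa> S \<mu>) ((\<alpha> - \<kappa> *\<^sub>R Pc \<kappa> S \<mu> \<alpha>) - Pd \<kappa> S \<mu> \<beta>)"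

definition feedforward ::
  "'u::chilbert_space set \<Rightarrow> ('x::chilbert_space, 'u, 'd1::chilbert_space, 'd3::chilbert_space) bcs
     \<Rightarrow> real \<Rightarrow> nat \<Rightarrow> (nat \<Rightarrow> real) \<Rightarrow> (nat \<Rightarrow> 'u) \<Rightarrow> (nat \<Rightarrow> 'u)
     \<Rightarrow> (nat \<Rightarrow> 'd1 \<times> 'u \<times> 'd3) \<Rightarrow> (nat \<Rightarrow> 'd1 \<times> 'u \<times> 'd3) \<Rightarrow> real \<Rightarrow> 'u" where
  "feedforward U S \<kappa> q \<omega> a b c d t =
     (let f0 = (if a 0 = 0 \<and> c 0 = 0 then 0 else ff_coeff U S \<kappa> 0 (a 0) (c 0));
          f = (\<lambda>k. ff_coeff U S \<kappa> (\<i> * of_real (\<omega> k)) (a k - \<i> *\<^sub>C b k) (c k - \<i> *\<^sub>C d k));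
          g = (\<lambda>k. ff_coeff U S \<kappa> (- \<i> * of_real (\<omega> k)) (a k + \<i> *\<^sub>C b k) (c k + \<i> *\<^sub>C d k))
      in f0 + (1 / 2) *\<^sub>R (\<Sum>k=1..q. cos (\<omega> k * t) *\<^sub>R (f k + g k)
                 + (\<i> * of_real (sin (\<omega> k * t))) *\<^sub>C (f k - g k)))"

end

(*
  Subtracting the solution of the regulator equations (a trigonometric state xr with input u_reg and
  output y_ref) turns the closed loop into z' = A z, B_d z = 0, B_c z = N t (C z), where
  N t y = phi (u_reg t - kappa y) - u_reg t is monotone decreasing in y because phi is a metric
  projection.  For inputs that are sums of exponentials the linear system is solved with the
  resolvent; these inputs are dense, so the nonlinear feedback is reached through approximate
  solutions with a small residual B_c z - N t (C z) in L2.  Monotonicity and impedance passivity make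
  approximate solutions a Cauchy sequence (L2 convergence of the outputs is extracted from their weak
  convergence), and the same energy balance gives uniqueness and the regularity of classical
  solutions.  If u_reg stays inside the saturation limits by a margin, then phi (u_reg) = u_reg and
  -(N t y, y) >= c min (|y|, |y|^2) for kappa > 0, which the energy balance integrates to the
  L1 + L2 bound of the error; for kappa = 0 the error is the output of the semigroup generated by A.
*)
theory Submission
  imports Defs
begin

section \<open>Square integrals of continuous functions\<close>

text \<open>Approximate solutions are continuous, and \<open>l2n\<close> is a seminorm on continuous
  functions; measurable limits enter later through a Riesz-Fischer lemma. The control operator is
  never extended beyond the state space: the input \<open>exp (\<mu> * t) v\<close> is answered by
  \<open>exp (\<mu> * t) p\<close> with \<open>A p = \<mu> p\<close> and \<open>B_c p = v\<close>.
  Two obstacles shape the proof. Inputs and outputs are bounded only by the graph norm, so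
  convergence of states yields no more than convergence of the primitives of inputs and outputs; a
  sequence that is also Cauchy in the mean square then converges strongly, because averages over
  short intervals are close to its members uniformly. The approximating disturbances of a
  generalised solution converge merely in the mean square, so the difference of two approximants is
  no trajectory of the undisturbed system; time averages of the limiting difference are. Firm
  nonexpansiveness of the projection, more than monotonicity, makes the energy balance control the
  inputs. Energy estimates use the real inner product; the complex structure serves the frequency
  response at \<open>i \<omega>\<close> and \<open>- i \<omega>\<close>.\<close>

definition l2n :: "real => (real => 'a::real_normed_vector) => real" where
  "l2n \<tau> f = sqrt (integral {0..\<tau>} (%t. (norm (f t))\<^sup>2))"

lemma integrable_cont [intro]:
  fixes f :: "real => 'a::banach"
  assumes "continuous_on {a..b} f" shows "f integrable_on {a..b}"
  using assms by (rule integrable_continuous_real)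

lemma l2n_nonneg [simp]: "0 <= l2n \<tau> f"
proof (cases "(%t. (norm (f t))\<^sup>2) integrable_on {0..\<tau>}")
  case True
  then show ?thesis unfolding l2n_def by (simp add: integral_nonneg)
qed (simp add: l2n_def not_integrable_integral)

lemma l2n_sq:
  assumes "continuous_on {0..\<tau>} f"
  shows "(l2n \<tau> f)\<^sup>2 = integral {0..\<tau>} (%t. (norm (f t))\<^sup>2)"
  unfolding l2n_def
  by (intro real_sqrt_pow2 integral_nonneg integrable_cont continuous_intros assms) auto

lemma l2n_cong: "(!!t. 0 <= t ==> t <= \<tau> ==> f t = g t) ==> l2n \<tau> f = l2n \<tau> g"
  unfolding l2n_def by (intro arg_cong[where f=sqrt] integral_cong) auto

lemma l2n_mono_fun:
  assumes "continuous_on {0..\<tau>} f" "continuous_on {0..\<tau>} g"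
    "!!t. 0 <= t ==> t <= \<tau> ==> norm (f t) <= norm (g t)"
  shows "l2n \<tau> f <= l2n \<tau> g"
  unfolding l2n_def
  by (intro real_sqrt_le_mono integral_le integrable_cont continuous_intros assms)
     (use assms in \<open>auto intro!: power_mono\<close>)

lemma l2n_mono_time:
  assumes "continuous_on {0..\<tau>'} f" "\<tau> <= \<tau>'"
  shows "l2n \<tau> f <= l2n \<tau>' f"
proof -
  have "continuous_on {0..\<tau>} f" using assms by (auto intro: continuous_on_subset)
  then show ?thesis
    unfolding l2n_def using assms
    by (intro real_sqrt_le_mono integral_subset_le integrable_cont continuous_intros) auto
qed

lemma l2n_norm: "l2n \<tau> (%t. norm (f t)) = l2n \<tau> f"
  by (simp add: l2n_def)

lemma l2n_scaleR: "l2n \<tau> (%t. c *\<^sub>R f t) = \<bar>c\<bar> * l2n \<tau> f"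
  by (simp add: l2n_def power_mult_distrib real_sqrt_mult)

lemma l2n_minus: "l2n \<tau> (%t. - f t) = l2n \<tau> f"
  by (simp add: l2n_def)

lemma l2n_commute: "l2n \<tau> (%t. f t - g t) = l2n \<tau> (%t. g t - f t)"
  by (simp add: l2n_def norm_minus_commute)

lemma l2n_zero [simp]: "l2n \<tau> (%t. 0) = 0"
  by (simp add: l2n_def)

text \<open>The squared norm of \<open>f - s g\<close> is a nonnegative quadratic in
  \<open>s\<close>, so its discriminant is nonpositive. A vanishing leading coefficient
  \<open>b\<close> is a separate case.\<close>

lemma l2n_inner:
  fixes f g :: "real => 'a::real_inner"
  assumes f: "continuous_on {0..\<tau>} f" and g: "continuous_on {0..\<tau>} g"
  shows "\<bar>integral {0..\<tau>} (%t. f t \<bullet> g t)\<bar> <= l2n \<tau> f * l2n \<tau> g"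
proof -
  define a b c where "a = integral {0..\<tau>} (%t. (norm (f t))\<^sup>2)"
    and "b = integral {0..\<tau>} (%t. (norm (g t))\<^sup>2)" and "c = integral {0..\<tau>} (%t. f t \<bullet> g t)"
  have b0: "b \<ge> 0" unfolding b_def
    by (intro integral_nonneg integrable_cont continuous_intros g) auto
  have q: "0 <= a - 2 * s * c + s\<^sup>2 * b" for s
  proof -
    have "0 <= integral {0..\<tau>} (%t. (norm (f t - s *\<^sub>R g t))\<^sup>2)"
      by (intro integral_nonneg integrable_cont continuous_intros f g) auto
    also have "(%t. (norm (f t - s *\<^sub>R g t))\<^sup>2)
        = (%t. ((norm (f t))\<^sup>2 - 2 * s * (f t \<bullet> g t)) + s\<^sup>2 * (norm (g t))\<^sup>2)"
      by (auto simp: power2_norm_eq_inner inner_diff inner_commute[of "g _" "f _"] algebra_simps power2_eq_square[of s])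
    also have "integral {0..\<tau>} \<dots> = (a - 2 * s * c) + s\<^sup>2 * b"
      unfolding a_def b_def c_def
      by (subst integral_add integral_diff integral_mult_right;
          (intro integrable_cont continuous_intros f g)?)+ simp
    finally show ?thesis .
  qed
  have "c\<^sup>2 <= a * b"
  proof (cases "b = 0")
    case True
    have "c = 0"
    proof (rule ccontr)
      assume "c \<noteq> 0"
      \<comment> \<open>With \<open>b = 0\<close> the bound \<open>q\<close> is affine in
        \<open>s\<close>; this \<open>s\<close> makes its right-hand side equal to
        \<open>-1\<close>.\<close>
      then have "2 * ((a + 1) / (2 * c)) * c = a + 1" by simp
      then show False using q[of "(a + 1) / (2 * c)"] True by simp
    qed
    then show ?thesis using True by simp
  next
    case False
    then have "b > 0" using b0 by simp
    then show ?thesis using q[of "c / b"] by (simp add: field_simps power2_eq_square)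
  qed
  then have "sqrt (c\<^sup>2) <= sqrt (a * b)" by (rule real_sqrt_le_mono)
  then show ?thesis unfolding a_def b_def c_def l2n_def by (simp add: real_sqrt_mult)
qed

lemma l2n_norm_mult:
  assumes f: "continuous_on {0..\<tau>} f" and g: "continuous_on {0..\<tau>} g"
  shows "integral {0..\<tau>} (%t. norm (f t) * norm (g t)) <= l2n \<tau> f * l2n \<tau> g"
  using l2n_inner[of \<tau> "%t. norm (f t)" "%t. norm (g t)"] f g
  by (simp add: l2n_norm continuous_on_norm)

lemma l2n_triangle:
  assumes f: "continuous_on {0..\<tau>} f" and g: "continuous_on {0..\<tau>} g"
  shows "l2n \<tau> (%t. f t + g t) <= l2n \<tau> f + l2n \<tau> g"
proof (rule power2_le_imp_le)
  have "(l2n \<tau> (%t. f t + g t))\<^sup>2 = integral {0..\<tau>} (%t. (norm (f t + g t))\<^sup>2)"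
    by (intro l2n_sq continuous_intros f g)
  also have "\<dots> <= integral {0..\<tau>} (%t. ((norm (f t))\<^sup>2 + 2 * (norm (f t) * norm (g t))) + (norm (g t))\<^sup>2)"
  proof (intro integral_le integrable_cont continuous_intros f g)
    fix t
    have "(norm (f t + g t))\<^sup>2 <= (norm (f t) + norm (g t))\<^sup>2"
      by (intro power_mono norm_triangle_ineq) auto
    then show "(norm (f t + g t))\<^sup>2 <= (norm (f t))\<^sup>2 + 2 * (norm (f t) * norm (g t)) + (norm (g t))\<^sup>2"
      by (simp add: power2_sum algebra_simps)
  qed
  also have "\<dots> = (l2n \<tau> f)\<^sup>2 + 2 * integral {0..\<tau>} (%t. norm (f t) * norm (g t)) + (l2n \<tau> g)\<^sup>2"
    unfolding l2n_sq[OF f] l2n_sq[OF g]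
    by (subst integral_add integral_mult_right; (intro integrable_cont continuous_intros f g)?)+ simp
  also have "\<dots> <= (l2n \<tau> f + l2n \<tau> g)\<^sup>2"
    using l2n_norm_mult[OF f g] by (simp add: power2_sum)
  finally show "(l2n \<tau> (%t. f t + g t))\<^sup>2 <= (l2n \<tau> f + l2n \<tau> g)\<^sup>2" .
qed simp

lemma l2n_diff:
  assumes "continuous_on {0..\<tau>} f" "continuous_on {0..\<tau>} g"
  shows "l2n \<tau> (%t. f t - g t) <= l2n \<tau> f + l2n \<tau> g"
  using l2n_triangle[of \<tau> f "%t. - g t"] assms by (simp add: l2n_minus continuous_on_minus)

lemma l2n_dist_triangle:
  assumes "continuous_on {0..\<tau>} f" "continuous_on {0..\<tau>} g" "continuous_on {0..\<tau>} h"
  shows "l2n \<tau> (%t. f t - h t) <= l2n \<tau> (%t. f t - g t) + l2n \<tau> (%t. g t - h t)"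
  using l2n_triangle[of \<tau> "%t. f t - g t" "%t. g t - h t"] assms by (simp add: continuous_on_diff)

lemma l2n_le_add:
  assumes "continuous_on {0..\<tau>} f" "continuous_on {0..\<tau>} g"
  shows "l2n \<tau> f <= l2n \<tau> (%t. f t - g t) + l2n \<tau> g"
  using l2n_triangle[of \<tau> "%t. f t - g t" g] assms by (simp add: continuous_on_diff)

lemma l2n_bound:
  assumes "continuous_on {0..\<tau>} f" "!!t. 0 <= t ==> t <= \<tau> ==> norm (f t) <= B" "0 <= \<tau>" "0 <= B"
  shows "l2n \<tau> f <= sqrt \<tau> * B"
proof -
  have "l2n \<tau> f <= l2n \<tau> (%t. B)"
    by (intro l2n_mono_fun) (use assms in auto)
  also have "\<dots> = sqrt \<tau> * B"
    using assms by (simp add: l2n_def real_sqrt_mult)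
  finally show ?thesis .
qed

lemma norm_integral_le_l2n:
  fixes f :: "real => 'a::banach"
  assumes f: "continuous_on {0..\<tau>} f" and "0 <= s" "s <= t" "t <= \<tau>"
  shows "norm (integral {s..t} f) <= sqrt \<tau> * l2n \<tau> f"
proof -
  have "norm (integral {s..t} f) <= integral {s..t} (%t. norm (f t))"
    using assms by (intro integral_norm_bound_integral integrable_cont continuous_intros)
      (auto intro: continuous_on_subset)
  also have "\<dots> <= integral {0..\<tau>} (%t. norm (f t))"
    using assms by (intro integral_subset_le integrable_cont continuous_intros)
      (auto intro: continuous_on_subset)
  also have "\<dots> <= l2n \<tau> (%t. 1::real) * l2n \<tau> f"
    using l2n_norm_mult[of \<tau> "%t. 1::real" f] f by simp
  also have "l2n \<tau> (%t. 1::real) = sqrt \<tau>" using assms by (simp add: l2n_def)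
  finally show ?thesis .
qed

lemma l2n_eq_0:
  assumes f: "continuous_on {0..\<tau>} f" and 0: "l2n \<tau> f = 0" and t: "0 <= t" "t <= \<tau>" "0 < \<tau>"
  shows "f t = 0"
proof -
  have i: "integral {0..\<tau>} (%t. (norm (f t))\<^sup>2) = 0" using 0 by (simp add: l2n_def)
  have "((%t. (norm (f t))\<^sup>2) has_integral 0) (cbox 0 \<tau>)"
    using i integrable_integral[OF integrable_cont[of 0 \<tau> "%t. (norm (f t))\<^sup>2"]] f
    by (simp add: continuous_intros)
  then have "(norm (f t))\<^sup>2 = 0"
    by (rule has_integral_0_cbox_imp_0[rotated 2])
       (use f t in \<open>auto intro!: continuous_intros\<close>)
  then show ?thesis by simp
qed

lemma integral_shift_le:
  fixes f :: "real => 'a::banach"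
  shows "integral {a..b} (%t. f (t + h)) = integral {a+h..b+h} f"
  using integral_shift_real_ivl[of "a+h" h "b+h" f] by simp

lemma continuous_on_shift:
  assumes "continuous_on {0..} f" "h \<ge> 0"
  shows "continuous_on {0..} (%t::real. f (t + h))"
  by (rule continuous_on_compose2[OF assms(1)]) (use assms in \<open>auto intro!: continuous_intros\<close>)

lemma l2n_shift:
  assumes f: "continuous_on {0..} f" and h: "h \<ge> 0"
  shows "l2n \<tau> (%t. f (t + h)) <= l2n (\<tau> + h) f"
  unfolding l2n_def integral_shift_le[of 0 \<tau> "%t. (norm (f t))\<^sup>2" h]
  by (intro real_sqrt_le_mono integral_subset_le integrable_cont continuous_intros)
     (use h in \<open>auto intro: continuous_on_subset[OF f]\<close>)

lemma continuous_on_sub0: "continuous_on {0..} f ==> 0 <= a ==> continuous_on {a..(b::real)} f"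
  by (auto intro: continuous_on_subset)

text \<open>Every Riemann sum is a real linear combination of values of \<open>f\<close>, hence lies
  in \<open>S\<close>, and the integral is a limit of such sums. With the graph of a closed operator
  as \<open>S\<close> this moves the operator under the integral.\<close>

lemma has_integral_in_subspace:
  fixes f :: "real => 'a::real_normed_vector"
  assumes "subspace S" "closed S" "(f has_integral I) {a..b}" "!!t. a <= t ==> t <= b ==> f t \<in> S"
  shows "I \<in> S"
proof -
  have "I \<in> closure S"
    unfolding closure_approachable
  proof (intro allI impI)
    fix e :: real assume "e > 0"
    then obtain \<gamma> where \<gamma>: "gauge \<gamma>" "!!\<D>. \<D> tagged_division_of (cbox a b) ==> \<gamma> fine \<D> ==>
        norm ((\<Sum>(x,k)\<in>\<D>. measure lborel k *\<^sub>R f x) - I) < e"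
      using assms(3) unfolding has_integral box_real[symmetric] by metis
    obtain \<D> where D: "\<D> tagged_division_of (cbox a b)" "\<gamma> fine \<D>"
      using fine_division_exists[OF \<gamma>(1)] by blast
    have "(\<Sum>(x,k)\<in>\<D>. measure lborel k *\<^sub>R f x) \<in> S"
    proof (rule subspace_sum[OF assms(1)])
      fix p assume p: "p \<in> \<D>"
      obtain x k where xk: "p = (x,k)" by force
      then have "x \<in> cbox a b" using D(1) p by (metis tagged_division_ofD(2,3) subsetD)
      then show "(case p of (x,k) => measure lborel k *\<^sub>R f x) \<in> S"
        using assms(4)[of x] xk by (auto intro: subspace_scale[OF assms(1)])
    qed
    then show "\<exists>y\<in>S. dist y I < e"
      using \<gamma>(2)[OF D] by (auto simp: dist_norm)
  qed
  then show ?thesis using assms(2) by simp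
qed

lemma integral_in_subspace:
  fixes f :: "real => 'a::banach"
  assumes "subspace S" "closed S" "continuous_on {a..b} f" "!!t. a <= t ==> t <= b ==> f t \<in> S"
  shows "integral {a..b} f \<in> S"
  using has_integral_in_subspace[OF assms(1,2) integrable_integral[OF integrable_cont[OF assms(3)]]]
    assms(4) by auto

lemma integral_Pair:
  fixes f :: "real => 'a::banach" and g :: "real => 'b::banach"
  assumes "continuous_on {a..b} f" "continuous_on {a..b} g"
  shows "integral {a..b} (%t. (f t, g t)) = (integral {a..b} f, integral {a..b} g)"
proof -
  have "(%t. (f t, g t)) integrable_on {a..b}"
    by (intro integrable_cont continuous_intros assms)
  from integral_linear[OF this bounded_linear_fst] integral_linear[OF this bounded_linear_snd]
  show ?thesis by (simp add: o_def prod_eq_iff)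
qed

lemma integral_split:
  fixes f :: "real => 'a::banach"
  assumes "continuous_on {0..} f" "0 <= a" "a <= b"
  shows "integral {a..b} f = integral {0..b} f - integral {0..a} f"
  using Henstock_Kurzweil_Integration.integral_combine[OF assms(2,3) integrable_cont[of 0 b f]] continuous_on_sub0[OF assms(1)]
  by (simp add: algebra_simps)

section \<open>Steklov averages\<close>

text \<open>The forward Steklov average. Looking forward keeps it defined on all of
  \<open>{0..}\<close>, at the price that estimates on \<open>{0..\<tau>}\<close> involve
  \<open>f\<close> up to \<open>\<tau> + h\<close>.\<close>

definition stek :: "real => (real => 'a::banach) => real => 'a" where
  "stek h f t = integral {t..t+h} f /\<^sub>R h"

lemma stek_eq:
  assumes "continuous_on {0..} f" "0 <= t" "0 < h"
  shows "stek h f t = (integral {0..t+h} f - integral {0..t} f) /\<^sub>R h"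
  using integral_split[of f t "t+h"] assms by (simp add: stek_def)



lemma antideriv:
  fixes f :: "real => 'a::banach"
  assumes f: "continuous_on {0..} f" and t: "t \<ge> 0"
  shows "((%t. integral {0..t} f) has_vector_derivative f t) (at t within {0..})"
proof -
  have "((%t. integral {0..t} f) has_vector_derivative f t) (at t within {0..t+1})"
    by (intro integral_has_vector_derivative continuous_on_sub0[OF f]) (use t in auto)
  moreover have "at t within {0..t+1} = at t within {0..}"
    by (rule at_within_nhd[of t "{..<t+1}"]) (use t in auto)
  ultimately show ?thesis by simp
qed

lemma continuous_on_antideriv:
  fixes f :: "real => 'a::banach"
  assumes f: "continuous_on {0..} f"
  shows "continuous_on {0..} (%t. integral {0..t} f)"
  using antideriv[OF f] unfolding continuous_on_eq_continuous_within
  by (meson atLeast_iff has_vector_derivative_continuous)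

lemma continuous_on_of_deriv:
  fixes f :: "real => 'a::real_normed_vector"
  assumes "!!t. t \<in> S ==> (f has_vector_derivative f' t) (at t within S)"
  shows "continuous_on S f"
  using assms unfolding continuous_on_eq_continuous_within
  by (meson has_vector_derivative_continuous)

lemma integral_deriv:
  fixes f :: "real => 'a::banach"
  assumes "!!t. t \<ge> 0 ==> (f has_vector_derivative f' t) (at t within {0..})" "0 <= a" "a <= b"
  shows "integral {a..b} f' = f b - f a"
proof (rule integral_unique, rule fundamental_theorem_of_calculus)
  fix x assume "x \<in> {a..b}"
  then show "(f has_vector_derivative f' x) (at x within {a..b})"
    using assms by (intro has_vector_derivative_within_subset[OF assms(1)]) auto
qed (use assms in auto)

lemma continuous_on_stek:
  assumes f: "continuous_on {0..} f" and h: "0 < h"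
  shows "continuous_on {0..} (stek h f)"
proof -
  have "continuous_on {0..} (%t. (integral {0..t+h} f - integral {0..t} f) /\<^sub>R h)"
    using h by (intro continuous_intros continuous_on_antideriv[OF f]
        continuous_on_shift[OF continuous_on_antideriv[OF f]]) auto
  then show ?thesis
    by (rule continuous_on_eq) (use h f in \<open>auto simp: stek_eq\<close>)
qed

lemma stek_diff:
  assumes "continuous_on {0..} f" "continuous_on {0..} g" "0 < h" "0 <= t"
  shows "stek h (%t. f t - g t) t = stek h f t - stek h g t"
proof -
  have "integral {t..t+h} (%t. f t - g t) = integral {t..t+h} f - integral {t..t+h} g"
    by (intro integral_diff integrable_cont continuous_on_sub0 assms)
  then show ?thesis by (simp add: stek_def scaleR_right_diff_distrib)
qed

text \<open>Cauchy-Schwarz over the averaging window bounds the square of the average by the average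
  of the square; after the integrals are exchanged, each inner integral is the seminorm of a
  translate of \<open>f\<close>.\<close>

lemma l2n_stek:
  fixes f :: "real => 'a::banach"
  assumes f: "continuous_on {0..} f" and h: "0 < h" and \<tau>: "0 <= \<tau>"
  shows "l2n \<tau> (stek h f) <= l2n (\<tau> + h) f"
proof (rule power2_le_imp_le)
  let ?F = "%t s. (norm (f (t + s)))\<^sup>2"
  have c2: "continuous_on (cbox (0,0) (\<tau>,h)) (%(t,s). ?F t s)"
  proof -
    have "continuous_on (cbox (0,0) (\<tau>,h)) (%p. (norm (f (fst p + snd p)))\<^sup>2)"
      by (intro continuous_intros continuous_on_compose2[OF f]) (auto simp: cbox_Pair_eq)
    then show ?thesis by (simp add: case_prod_unfold)
  qed
  have pt: "(norm (stek h f t))\<^sup>2 <= integral {0..h} (?F t) / h" if t: "t \<in> {0..\<tau>}" for t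
  proof -
    have cf: "continuous_on {0..h} (%s. f (s + t))"
      using continuous_on_shift[OF f, of t] t by (auto intro: continuous_on_subset)
    have "norm (integral {0..h} (%s. f (s + t))) <= sqrt h * l2n h (%s. f (s + t))"
      by (rule norm_integral_le_l2n[OF cf]) (use h in auto)
    moreover have "integral {0..h} (%s. f (s + t)) = h *\<^sub>R stek h f t"
      using h by (simp add: integral_shift_le stek_def add.commute)
    ultimately have "h * norm (stek h f t) <= sqrt h * l2n h (%s. f (s + t))"
      using h by simp
    then have "(h * norm (stek h f t))\<^sup>2 <= (sqrt h * l2n h (%s. f (s + t)))\<^sup>2"
      using h by (intro power_mono) auto
    also have "\<dots> = h * integral {0..h} (?F t)"
      using h cf by (simp add: power_mult_distrib l2n_sq add.commute)
    finally show ?thesis using h by (simp add: power2_eq_square field_simps)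
  qed
  have ci: "continuous_on {0..\<tau>} (%t. integral {0..h} (?F t))"
    using integral_continuous_on_param[of "{0..\<tau>}" 0 h ?F] c2 by (simp add: cbox_Pair_eq)
  have "(l2n \<tau> (stek h f))\<^sup>2 = integral {0..\<tau>} (%t. (norm (stek h f t))\<^sup>2)"
    by (intro l2n_sq continuous_on_sub0 continuous_on_stek f h) auto
  also have "\<dots> <= integral {0..\<tau>} (%t. integral {0..h} (?F t) / h)"
    using pt h by (intro integral_le integrable_cont continuous_intros ci continuous_on_sub0
        continuous_on_stek f) auto
  also have "\<dots> = integral {0..\<tau>} (%t. integral {0..h} (?F t)) / h"
    by simp
  also have "integral {0..\<tau>} (%t. integral {0..h} (?F t)) = integral {0..h} (%s. integral {0..\<tau>} (%t. ?F t s))"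
    using integral_swap_continuous[OF c2] by simp
  also have "\<dots> <= integral {0..h} (%s. (l2n (\<tau> + h) f)\<^sup>2)"
  proof (rule integral_le)
    show "(%s. (l2n (\<tau> + h) f)\<^sup>2) integrable_on {0..h}" by (rule integrable_cont) simp
    show "(%s. integral {0..\<tau>} (%t. ?F t s)) integrable_on {0..h}"
    proof (rule integrable_cont)
      have "continuous_on (cbox (0,0) (h,\<tau>)) (%p. (norm (f (snd p + fst p)))\<^sup>2)"
        by (intro continuous_intros continuous_on_compose2[OF f]) (auto simp: cbox_Pair_eq)
      then show "continuous_on {0..h} (%s. integral {0..\<tau>} (%t. ?F t s))"
        using integral_continuous_on_param[of "{0..h}" 0 \<tau> "%s t. ?F t s"] by (simp add: case_prod_unfold cbox_Pair_eq)
    qed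
    fix s assume s: "s \<in> {0..h}"
    have "integral {0..\<tau>} (%t. ?F t s) = (l2n \<tau> (%t. f (t + s)))\<^sup>2"
      using s by (subst l2n_sq) (auto intro!: continuous_on_sub0 continuous_on_shift f)
    also have "\<dots> <= (l2n (\<tau> + h) f)\<^sup>2"
    proof (rule power_mono)
      have "l2n \<tau> (%t. f (t + s)) <= l2n (\<tau> + s) f" using s by (intro l2n_shift f) auto
      also have "\<dots> <= l2n (\<tau> + h) f" using s by (intro l2n_mono_time continuous_on_sub0 f) auto
      finally show "l2n \<tau> (%t. f (t + s)) <= l2n (\<tau> + h) f" .
    qed simp
    finally show "integral {0..\<tau>} (%t. ?F t s) <= (l2n (\<tau> + h) f)\<^sup>2" .
  qed
  also have "\<dots> = h * (l2n (\<tau> + h) f)\<^sup>2" using h by simp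
  finally show "(l2n \<tau> (stek h f))\<^sup>2 <= (l2n (\<tau> + h) f)\<^sup>2" using h by (simp add: field_simps)
qed simp

lemma stek_close:
  fixes f :: "real => 'a::banach"
  assumes f: "continuous_on {0..} f" and e: "0 < e"
  obtains h0 where "0 < h0" "!!h t. 0 < h ==> h <= h0 ==> 0 <= t ==> t <= \<tau> ==> norm (stek h f t - f t) <= e"
proof -
  have "uniformly_continuous_on {0..\<tau>+1} f"
    by (intro compact_uniformly_continuous continuous_on_sub0 f) auto
  then obtain d where d: "d > 0" "!!x y. x \<in> {0..\<tau>+1} ==> y \<in> {0..\<tau>+1} ==> dist y x < d ==> dist (f y) (f x) < e"
    using e unfolding uniformly_continuous_on_def by metis
  show ?thesis
  proof (rule that[of "min 1 (d/2)"])
    fix h t :: real assume h: "0 < h" "h <= min 1 (d/2)" and t: "0 <= t" "t <= \<tau>"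
    have "integral {t..t+h} (%s. f s - f t) = integral {t..t+h} f - h *\<^sub>R f t"
      using h t by (subst integral_diff) (auto intro!: continuous_on_sub0 f)
    then have eq: "stek h f t - f t = integral {t..t+h} (%s. f s - f t) /\<^sub>R h"
      using h by (simp add: stek_def scaleR_right_diff_distrib)
    have "norm (integral {t..t+h} (%s. f s - f t)) <= e * ((t + h) - t)"
    proof (rule integral_bound)
      show "continuous_on {t..t + h} (%s. f s - f t)"
        by (intro continuous_intros continuous_on_sub0 f t)
      fix s assume "s \<in> {t..t+h}"
      then have "dist (f s) (f t) < e" using h t d(1) by (intro d(2)) (auto simp: dist_real_def)
      then show "norm (f s - f t) <= e" by (simp add: dist_norm)
    qed (use h in auto)
    then show "norm (stek h f t - f t) <= e" unfolding eq using h by (simp add: field_simps)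
  qed (use d in auto)
qed

section \<open>Cauchy sequences in the mean\<close>

definition l2cauchy :: "real => (nat => real => 'a::real_normed_vector) => bool" where
  "l2cauchy \<tau> f \<longleftrightarrow> (\<forall>e>0. \<exists>N. \<forall>m\<ge>N. \<forall>n\<ge>N. l2n \<tau> (%t. f m t - f n t) <= e)"

lemma l2cauchy_bounded:
  assumes c: "!!n. continuous_on {0..} (f n)" and L: "l2cauchy \<tau> f"
  obtains B where "0 <= B" "!!n. l2n \<tau> (f n) <= B"
proof -
  obtain N where N: "!!m n. m \<ge> N ==> n \<ge> N ==> l2n \<tau> (%t. f m t - f n t) <= 1"
    using L unfolding l2cauchy_def by (meson zero_less_one)
  define B where "B = (\<Sum>n\<le>N. l2n \<tau> (f n)) + 1"
  have le: "l2n \<tau> (f k) <= (\<Sum>n\<le>N. l2n \<tau> (f n))" if "k <= N" for k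
    using that by (intro member_le_sum) auto
  have "l2n \<tau> (f n) <= B" for n
  proof (cases "n <= N")
    case True then show ?thesis using le[of n] by (simp add: B_def)
  next
    case False
    have "l2n \<tau> (f n) <= l2n \<tau> (%t. f n t - f N t) + l2n \<tau> (f N)"
      by (intro l2n_le_add continuous_on_sub0 c) auto
    also have "\<dots> <= 1 + (\<Sum>n\<le>N. l2n \<tau> (f n))"
      using False N[of n N] le[of N] by auto
    finally show ?thesis by (simp add: B_def)
  qed
  moreover have "0 <= B" unfolding B_def by (intro add_nonneg_nonneg sum_nonneg) auto
  ultimately show ?thesis using that by blast
qed

text \<open>One window \<open>h0\<close> works for all late members: averaging does not increase the
  seminorm, so only the single function \<open>f N\<close> has to be close to its average. The
  horizon \<open>\<tau> + 1\<close> leaves room for windows of length at most one.\<close>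

lemma l2cauchy_stek:
  fixes f :: "nat => real => 'a::banach"
  assumes c: "!!n. continuous_on {0..} (f n)" and L: "l2cauchy (\<tau> + 1) f" and \<tau>: "0 <= \<tau>" and e: "0 < e"
  obtains h0 N where "0 < h0" "h0 <= 1"
    "!!h n. 0 < h ==> h <= h0 ==> n \<ge> N ==> l2n \<tau> (%t. stek h (f n) t - f n t) <= e"
proof -
  obtain N where N: "!!m n. m \<ge> N ==> n \<ge> N ==> l2n (\<tau>+1) (%t. f m t - f n t) <= e/3"
    using L e unfolding l2cauchy_def by (meson zero_less_divide_iff zero_less_numeral)
  define e' where "e' = e / (3 * (sqrt \<tau> + 1))"
  have e': "0 < e'" "sqrt \<tau> * e' <= e / 3"
    using e \<tau> by (auto simp: e'_def field_simps add_pos_nonneg intro!: divide_pos_pos add_nonneg_pos)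
  obtain h0 where h0: "0 < h0" "!!h t. 0 < h ==> h <= h0 ==> 0 <= t ==> t <= \<tau> ==> norm (stek h (f N) t - f N t) <= e'"
    using stek_close[OF c[of N] e'(1), of \<tau>] by metis
  show ?thesis
  proof (rule that[of "min h0 1" N])
    fix h :: real and n :: nat assume h: "0 < h" "h <= min h0 1" and n: "N <= n"
    note cc = continuous_on_sub0[OF c] continuous_on_sub0[OF continuous_on_stek[OF c h(1)]]
    let ?d = "%t. f n t - f N t"
    have cd: "continuous_on {0..} ?d" by (intro continuous_intros c)
    have 1: "l2n \<tau> (stek h ?d) <= e / 3"
    proof -
      have "l2n \<tau> (stek h ?d) <= l2n (\<tau> + h) ?d" by (intro l2n_stek cd h \<tau>)
      also have "\<dots> <= l2n (\<tau> + 1) ?d" using h by (intro l2n_mono_time continuous_on_sub0 cd) auto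
      finally show ?thesis using N[of n N] n by simp
    qed
    have 2: "l2n \<tau> (%t. stek h (f N) t - f N t) <= e / 3"
      by (rule order_trans[OF l2n_bound e'(2)]) (use h0 h \<tau> e' in \<open>auto intro!: continuous_intros cc\<close>)
    have 3: "l2n \<tau> ?d <= e / 3"
      by (rule order_trans[OF l2n_mono_time[of "\<tau>+1"]]) (use N[of n N] n in \<open>auto intro!: continuous_on_sub0 cd\<close>)
    have "l2n \<tau> (%t. stek h (f n) t - f n t) = l2n \<tau> (%t. stek h ?d t + (stek h (f N) t - f N t) - ?d t)"
      by (intro l2n_cong) (simp add: stek_diff c h)
    also have "\<dots> <= l2n \<tau> (%t. stek h ?d t + (stek h (f N) t - f N t)) + l2n \<tau> ?d"
      by (intro l2n_diff continuous_intros cc continuous_on_sub0[OF continuous_on_stek[OF cd h(1)]]) auto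
    also have "\<dots> <= (l2n \<tau> (stek h ?d) + l2n \<tau> (%t. stek h (f N) t - f N t)) + l2n \<tau> ?d"
      by (intro add_right_mono l2n_triangle continuous_intros cc continuous_on_sub0[OF continuous_on_stek[OF cd h(1)]]) auto
    finally show "l2n \<tau> (%t. stek h (f n) t - f n t) <= e" using 1 2 3 by simp
  qed (use h0 in auto)
qed

text \<open>An average over a fixed window is a difference of two primitives divided by
  \<open>h0\<close>, hence small for late \<open>n\<close>; by the Cauchy property it is also close
  to \<open>f n\<close>, uniformly in \<open>n\<close>. Convergence of primitives acts here as weak
  convergence.\<close>

lemma l2cauchy_weak_to_strong:
  fixes f :: "nat => real => 'a::banach"
  assumes c: "!!n. continuous_on {0..} (f n)" and L: "l2cauchy (\<tau> + 1) f" and \<tau>: "0 <= \<tau>"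
    and u: "uniform_limit {0..\<tau>+1} (%n t. integral {0..t} (f n)) (%t. 0) sequentially"
  shows "(%n. l2n \<tau> (f n)) \<longlonglongrightarrow> 0"
proof (rule LIMSEQ_I)
  fix r :: real assume r: "r > 0"
  obtain h0 N where h0: "0 < h0" "h0 <= 1"
    "!!h n. 0 < h ==> h <= h0 ==> n \<ge> N ==> l2n \<tau> (%t. stek h (f n) t - f n t) <= r/3"
    by (rule l2cauchy_stek[OF c L \<tau>, of "r/3"]) (use r in auto)
  \<comment> \<open>Primitives below \<open>e\<close> give averages of norm at most
    \<open>2 * e / h0\<close>, hence a seminorm of at most \<open>r / 3\<close>; the
    \<open>1\<close> added to \<open>sqrt \<tau>\<close> covers \<open>\<tau> = 0\<close>.\<close>
  define e where "e = h0 * (r / (6 * (sqrt \<tau> + 1)))"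
  have "sqrt \<tau> * (2 * (r / (6 * (sqrt \<tau> + 1)))) <= r / 3"
    using r \<tau> by (auto simp: field_simps add_pos_nonneg intro!: divide_pos_pos add_nonneg_pos)
  moreover have e0: "e > 0" unfolding e_def using r h0 \<tau> by (intro mult_pos_pos divide_pos_pos add_nonneg_pos) auto
  ultimately have e: "e > 0" "sqrt \<tau> * (2 * e / h0) <= r / 3" using h0 by (auto simp: e_def)
  obtain N' where N': "!!n t. n \<ge> N' ==> 0 <= t ==> t <= \<tau> + 1 ==> norm (integral {0..t} (f n)) < e"
  proof -
    obtain N' where "\<forall>n\<ge>N'. \<forall>t\<in>{0..\<tau>+1}. dist (integral {0..t} (f n)) 0 < e"
      using uniform_limitD[OF u e(1)] unfolding eventually_sequentially by blast
    then show ?thesis by (intro that[of N']) auto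
  qed
  have "norm (l2n \<tau> (f n) - 0) < r" if n: "n \<ge> max N N'" for n
  proof -
    note cs = continuous_on_sub0[OF continuous_on_stek[OF c h0(1)]] continuous_on_sub0[OF c]
    have "norm (stek h0 (f n) t) <= 2 * e / h0" if t: "0 <= t" "t <= \<tau>" for t
    proof -
      have "norm (integral {0..t+h0} (f n) - integral {0..t} (f n)) <= e + e"
        by (rule order_trans[OF norm_triangle_ineq4], rule add_mono)
           (use N'[of n "t+h0"] N'[of n t] n t h0 in auto)
      then show ?thesis using t h0(1) c by (simp add: stek_eq divide_inverse mult.commute[of _ "inverse h0"])
    qed
    then have "l2n \<tau> (stek h0 (f n)) <= sqrt \<tau> * (2 * e / h0)"
      using \<tau> e h0 by (intro l2n_bound cs) auto
    moreover have "l2n \<tau> (f n) <= l2n \<tau> (%t. f n t - stek h0 (f n) t) + l2n \<tau> (stek h0 (f n))"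
      by (intro l2n_le_add cs) auto
    moreover have "l2n \<tau> (%t. f n t - stek h0 (f n) t) <= r/3"
      unfolding l2n_commute[of \<tau> "f n"] using h0 n by auto
    ultimately show ?thesis using e(2) r by simp
  qed
  then show "\<exists>no. \<forall>n\<ge>no. norm (l2n \<tau> (f n) - 0) < r" by blast
qed

section \<open>Minimising sequences in decreasing convex sets\<close>

text \<open>\<open>q\<close> stands for the squared norm, \<open>d\<close> for the squared distance,
  and \<open>par\<close> is the parallelogram identity. The infima of \<open>q\<close> over the
  decreasing sets increase and stay below \<open>K\<close>, hence converge, and the midpoint of two
  near minimisers cannot fall below the earlier infimum. This does the work of a weak limit followed
  by Mazur's lemma.\<close>

lemma minimising_sequence_cauchy:
  fixes C :: "nat => 'w set" and q :: "'w => real"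
  assumes dec: "!!m n. m <= n ==> C n \<subseteq> C m"
    and mid: "!!m v w. v \<in> C m ==> w \<in> C m ==> mid v w \<in> C m"
    and par: "!!v w. v \<in> C 0 ==> w \<in> C 0 ==> d v w = 2 * q v + 2 * q w - 4 * q (mid v w)"
    and pos: "!!v. v \<in> C 0 ==> 0 <= q v" and bd: "!!m. \<exists>v\<in>C m. q v <= K"
    and sym: "!!v w. d v w = d w v"
  obtains v where "!!m. v m \<in> C m" "!!e. 0 < e ==> \<exists>N. \<forall>m\<ge>N. \<forall>n\<ge>N. d (v m) (v n) <= e"
proof -
  define a where "a m = Inf (q ` C m)" for m
  have C0: "C m \<subseteq> C 0" for m using dec by simp
  have bb: "bdd_below (q ` C m)" for m
    using pos C0 by (intro bdd_belowI2[of _ 0]) auto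
  have al: "a m <= q v" if "v \<in> C m" for m v
    unfolding a_def using that bb by (intro cInf_lower) auto
  have aK: "a m <= K" for m using bd[of m] al by fastforce
  have amono: "a m <= a n" if "m <= n" for m n
    unfolding a_def using bd[of n] dec[OF that] by (intro cInf_superset_mono bb) auto
  have "\<exists>v\<in>C m. q v < a m + 1 / (real m + 1)" for m
  proof -
    have "q ` C m \<noteq> {}" using bd by auto
    then show ?thesis using cInf_lessD[of "q ` C m" "a m + 1 / (real m + 1)"] by (auto simp: a_def)
  qed
  then obtain v where v: "!!m. v m \<in> C m" "!!m. q (v m) < a m + 1 / (real m + 1)" by metis
  have "convergent a"
    using incseq_convergent[of a K] amono aK unfolding incseq_def convergent_def by metis
  then have ca: "Cauchy a" by (rule convergent_Cauchy)
  have key: "d (v m) (v n) <= 2 * (a n - a m) + 4 / (real m + 1)" if "m <= n" for m n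
  proof -
    have "v n \<in> C m" using v(1) dec[OF that] by auto
    then have "a m <= q (mid (v m) (v n))" by (intro al mid v)
    moreover have "1 / (real n + 1) <= 1 / (real m + 1)" using that by (simp add: frac_le)
    moreover have "4 / (real m + 1) = 4 * (1 / (real m + 1))" by simp
    ultimately show ?thesis using v(2)[of m] v(2)[of n] par[of "v m" "v n"] v(1) C0
      by (smt (verit) subsetD)
  qed
  show ?thesis
  proof (rule that[of v])
    fix e :: real assume e: "0 < e"
    obtain N1 where N1: "!!m n. m \<ge> N1 ==> n \<ge> N1 ==> norm (a m - a n) < e / 4"
      using CauchyD[OF ca, of "e/4"] e by auto
    obtain N2 where N2: "4 / (real N2 + 1) < e / 2"
    proof -
      obtain n where "8 / e < real n" using reals_Archimedean2 by blast
      then have "4 / (real n + 1) < e / 2" using e by (simp add: field_simps)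
      then show ?thesis by (rule that)
    qed
    have "d (v m) (v n) <= e" if "m \<ge> max N1 N2" "n \<ge> max N1 N2" "m <= n" for m n
    proof -
      have "4 / (real m + 1) <= 4 / (real N2 + 1)" using that by (simp add: frac_le)
      moreover have "d (v m) (v n) <= 2 * (a n - a m) + 4 / (real m + 1)" using key that by simp
      moreover have "a n - a m < e / 4"
        using N1[of n m] that abs_ge_self[of "a n - a m"] unfolding real_norm_def
        by (meson le_less_trans max.boundedE)
      ultimately show ?thesis using N2 by simp
    qed
    then have "\<forall>m\<ge>max N1 N2. \<forall>n\<ge>max N1 N2. d (v m) (v n) <= e"
      by (metis linear sym)
    then show "\<exists>N. \<forall>m\<ge>N. \<forall>n\<ge>N. d (v m) (v n) <= e" by blast
  qed (use v in auto)
qed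

text \<open>Tilt \<open>\<phi>\<close> by the slope \<open>e\<close> and take the last time
  \<open>c\<close> at which the tilted function is nonpositive; the one-sided bound carries it
  beyond \<open>c\<close>. This is the tool for semigroup orbits, for which \<open>generates\<close>
  supplies right-hand limits only.\<close>

lemma right_dini_nonpos_imp_le:
  fixes \<phi> :: "real => real"
  assumes c: "continuous_on {a..b} \<phi>" and ab: "a <= b"
    and dini: "!!t e. a <= t ==> t < b ==> 0 < e ==> \<forall>\<^sub>F h in at_right 0. \<phi> (t + h) <= \<phi> t + e * h"
  shows "\<phi> b <= \<phi> a"
proof (rule field_le_epsilon)
  fix e' :: real assume e': "e' > 0"
  define e where "e = e' / (b - a + 1)"
  have e: "e > 0" "e * (b - a) <= e'" using e' ab by (auto simp: e_def field_simps)
  define \<psi> where "\<psi> t = \<phi> t - \<phi> a - e * (t - a)" for t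
  have "\<psi> b <= 0"
  proof (rule ccontr)
    assume nb: "\<not> \<psi> b <= 0"
    define S where "S = {t\<in>{a..b}. \<psi> t <= 0}"
    have "continuous_on {a..b} \<psi>" unfolding \<psi>_def by (intro continuous_intros c)
    then have "closed S" unfolding S_def
      using continuous_on_closed_Collect_le[of "{a..b}" \<psi> "%_. 0"] by simp
    moreover have S: "bdd_above S" "a \<in> S" using ab by (auto simp: S_def \<psi>_def intro!: bdd_aboveI[of _ b])
    ultimately have c: "Sup S \<in> S" by (intro closed_contains_Sup) auto
    define c where "c = Sup S"
    have cS: "c \<in> S" using c by (simp add: c_def)
    then have cS: "c \<in> S" "a <= c" "c < b" "\<psi> c <= 0"
      using nb unfolding S_def by (auto simp: order_less_le)
    have "\<forall>\<^sub>F h in at_right 0. \<phi> (c + h) <= \<phi> c + e * h & h < b - c & 0 < h"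
      using dini[OF cS(2,3) e(1)] eventually_at_right_real[of 0 "b-c"] cS(3)
      by (simp add: eventually_conj_iff)
    then obtain h where h: "\<phi> (c + h) <= \<phi> c + e * h" "h < b - c" "0 < h"
      using eventually_happens[of _ "at_right (0::real)"] by auto
    have "\<psi> (c + h) <= \<psi> c" using h by (simp add: \<psi>_def algebra_simps)
    then have "c + h \<in> S" using cS h by (auto simp: S_def)
    then have "c + h <= c" unfolding c_def using S(1) by (rule cSup_upper)
    then show False using h by simp
  qed
  then show "\<phi> b <= \<phi> a + e'" using e by (simp add: \<psi>_def)
qed

section \<open>Contraction semigroups\<close>

lemma clinear_on_scaleR:
  assumes "clinear_on V W f" "x \<in> V" shows "f (c *\<^sub>R x) = c *\<^sub>R f x"
  using assms unfolding clinear_on_def by (metis scaleC_of_real)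

lemma csubspace_subspace: "csubspace V ==> subspace V"
  unfolding csubspace_def subspace_def by (metis scaleC_of_real)

lemma bounded_clinear_on_UNIV:
  assumes "bounded_clinear_on UNIV norm UNIV norm f"
  shows "bounded_linear f"
proof -
  from assms obtain K where K: "clinear_on UNIV UNIV f" "!!x. norm (f x) <= K * norm x"
    unfolding bounded_clinear_on_def by auto
  show ?thesis
    by (rule bounded_linear_intro[of f K])
       (use K clinear_on_scaleR[OF K(1)] in \<open>auto simp: clinear_on_def mult.commute\<close>)
qed

lemma has_vector_derivative_at_right_0:
  assumes "(f has_vector_derivative D) (at 0 within {0..})"
  shows "((%h. (f h - f 0) /\<^sub>R h) \<longlongrightarrow> D) (at_right (0::real))"
proof -
  have "((%y. (f y - (f 0 + y *\<^sub>R D)) /\<^sub>R \<bar>y\<bar>) \<longlongrightarrow> 0) (at_right 0)"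
    using assms unfolding has_vector_derivative_def has_derivative_within at_within_Ici_at_right
    by (simp add: inverse_eq_divide)
  moreover have "\<forall>\<^sub>F y in at_right (0::real). (f y - (f 0 + y *\<^sub>R D)) /\<^sub>R \<bar>y\<bar> = (f y - f 0) /\<^sub>R y - D"
    using eventually_at_right_less[of "0::real"]
    by (rule eventually_mono) (simp add: algebra_simps)
  ultimately have "((%y. (f y - f 0) /\<^sub>R y - D) \<longlongrightarrow> 0) (at_right 0)"
    by (simp add: tendsto_cong)
  then show ?thesis by (simp add: LIM_zero_iff)
qed

lemma norm_add_scaleR_sq:
  fixes v w :: "'a::real_inner"
  shows "(norm (v + h *\<^sub>R w))\<^sup>2 = (norm v)\<^sup>2 + h * (2 * (v \<bullet> w) + h * (norm w)\<^sup>2)"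
  unfolding power2_norm_eq_inner inner_add_left inner_add_right inner_scaleR_left inner_scaleR_right
    inner_commute[of w v]
  by algebra

text \<open>\<open>A x \<bullet> x\<close> is the real part of the complex inner product.
  Contractivity, the derivative along orbits and the resolvent at positive \<open>\<mu>\<close> are
  all derived from dissipativity and the right-hand limit in \<open>generates\<close>.\<close>

locale dissipative_semigroup =
  fixes D :: "'x::chilbert_space set" and A :: "'x => 'x" and T :: "real => 'x => 'x"
  assumes gen: "generates D A T" and dissipative: "x \<in> D ==> A x \<bullet> x <= 0"
begin

lemma T_linear: "0 <= t ==> bounded_linear (T t)"
  using gen bounded_clinear_on_UNIV unfolding generates_def c0_semigroup_def by auto

lemma T_add: "0 <= s ==> 0 <= t ==> T (s + t) x = T s (T t x)"
  using gen unfolding generates_def c0_semigroup_def by auto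

lemma T_0 [simp]: "T 0 x = x"
  using gen unfolding generates_def c0_semigroup_def by auto

lemma T_cont: "continuous_on {0..} (%t. T t x)"
  using gen unfolding generates_def c0_semigroup_def by auto

lemma generator_iff: "((%h. (T h x - x) /\<^sub>R h) \<longlongrightarrow> z) (at_right 0) \<longleftrightarrow> x \<in> D & A x = z"
  using gen unfolding generates_def by auto

lemma T_D:
  assumes x: "x \<in> D" and t: "0 <= t"
  shows "T t x \<in> D & A (T t x) = T t (A x)"
proof -
  interpret bounded_linear "T t" using t by (rule T_linear)
  have "((%h. T t ((T h x - x) /\<^sub>R h)) \<longlongrightarrow> T t (A x)) (at_right 0)"
    by (intro tendsto) (use x generator_iff in auto)
  moreover have "\<forall>\<^sub>F h in at_right 0. T t ((T h x - x) /\<^sub>R h) = (T h (T t x) - T t x) /\<^sub>R h"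
    using eventually_at_right_less[of "0::real"]
    by (rule eventually_mono)
       (use t T_add[of _ t x] T_add[of t _ x] in \<open>simp add: scaleR diff add.commute\<close>)
  ultimately show ?thesis
    using generator_iff[of "T t x" "T t (A x)"] by (simp add: tendsto_cong)
qed

text \<open>The Laplace integral cut off at time \<open>a\<close>, which avoids convergence at
  infinity and leaves the term with \<open>T a y\<close>. For \<open>\<mu> = 0\<close> it is the
  time average behind density of the domain; for positive \<open>\<mu>\<close> it leads to the
  resolvent.\<close>

lemma T_integral:
  fixes a \<mu> :: real and y :: 'x
  assumes a: "0 <= a"
  defines "w \<equiv> integral {0..a} (%s. exp (- \<mu> * s) *\<^sub>R T s y)"
  shows "w \<in> D & A w = \<mu> *\<^sub>R w + exp (- \<mu> * a) *\<^sub>R T a y - y"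
proof -
  define g where "g s = exp (- \<mu> * s) *\<^sub>R T s y" for s
  have g: "continuous_on {0..} g"
    unfolding g_def by (intro continuous_intros T_cont)
  define G where "G t = integral {0..t} g" for t
  have G': "(G has_vector_derivative g t) (at t within {0..})" if "t \<ge> 0" for t
    unfolding G_def using antideriv[OF g that] .
  have w: "w = G a" unfolding w_def G_def g_def by simp
  \<comment> \<open>The semigroup shifts the integration window, and substitution turns the shift
    into the factor \<open>exp (\<mu> * h)\<close>. Differentiation at \<open>h = 0\<close> then
    concerns only the primitive \<open>G\<close>.\<close>
  have eq: "T h w = exp (\<mu> * h) *\<^sub>R (G (a + h) - G h)" if h: "h \<ge> 0" for h
  proof -
    interpret bounded_linear "T h" using h by (rule T_linear)
    have "T h w = integral {0..a} (%s. T h (g s))"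
      using integral_linear[of g "{0..a}" "T h"] integrable_cont[OF continuous_on_sub0[OF g]] bounded_linear_axioms
      by (simp add: w G_def o_def)
    also have "\<dots> = integral {0..a} (%s. exp (\<mu> * h) *\<^sub>R g (s + h))"
    proof (rule integral_cong)
      fix s assume s: "s \<in> {0..a}"
      then have "T h (T s y) = T (s + h) y" using T_add[of h s y] h by (simp add: add.commute)
      then show "T h (g s) = exp (\<mu> * h) *\<^sub>R g (s + h)"
        unfolding g_def by (simp add: scaleR exp_add[symmetric] algebra_simps)
    qed
    also have "\<dots> = exp (\<mu> * h) *\<^sub>R integral {h..a+h} g"
      by (simp add: integral_shift_le)
    also have "integral {h..a+h} g = G (a + h) - G h"
      unfolding G_def by (rule integral_split[OF g]) (use h a in auto)
    finally show ?thesis .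
  qed
  have Ga: "((%h. G (a + h)) has_vector_derivative g a) (at 0 within {0..})"
  proof -
    have "((%h. a + h) has_vector_derivative 1) (at 0 within {0..})"
      by (auto intro!: derivative_eq_intros)
    moreover have "(G has_vector_derivative g a) (at (a + 0) within (%h. a + h) ` {0..})"
    proof (rule has_vector_derivative_within_subset)
      show "(G has_vector_derivative g a) (at (a + 0) within {0..})" using G'[OF a] by simp
    qed (use a in auto)
    ultimately show ?thesis using vector_diff_chain_within[of "%h. a + h" 1 0 "{0..}" G "g a"]
      by (simp add: o_def)
  qed
  have "((%h. exp (\<mu> * h) *\<^sub>R (G (a + h) - G h)) has_vector_derivative
      (exp (\<mu> * 0) *\<^sub>R (g a - g 0) + (exp (\<mu> * 0) * \<mu>) *\<^sub>R (G (a + 0) - G 0))) (at 0 within {0..})"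
    by (rule has_vector_derivative_scaleR)
       (auto intro!: derivative_eq_intros has_vector_derivative_diff Ga G')
  moreover have "G 0 = 0" by (simp add: G_def)
  ultimately have "((%h. exp (\<mu> * h) *\<^sub>R (G (a + h) - G h)) has_vector_derivative
      (g a - y + \<mu> *\<^sub>R w)) (at 0 within {0..})" by (simp add: w g_def)
  from has_vector_derivative_at_right_0[OF this] \<open>G 0 = 0\<close>
  have "((%h. (exp (\<mu> * h) *\<^sub>R (G (a + h) - G h) - w) /\<^sub>R h) \<longlongrightarrow> g a - y + \<mu> *\<^sub>R w) (at_right 0)"
    by (simp add: w)
  moreover have "\<forall>\<^sub>F h in at_right 0. (exp (\<mu> * h) *\<^sub>R (G (a + h) - G h) - w) /\<^sub>R h = (T h w - w) /\<^sub>R h"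
    using eventually_at_right_less[of "0::real"] by (rule eventually_mono) (simp add: eq)
  ultimately have "((%h. (T h w - w) /\<^sub>R h) \<longlongrightarrow> g a - y + \<mu> *\<^sub>R w) (at_right 0)"
    by (simp add: tendsto_cong)
  then show ?thesis using generator_iff[of w] by (simp add: g_def algebra_simps)
qed

lemma D_dense: "closure D = UNIV"
proof -
  have "x \<in> closure D" for x
    unfolding closure_approachable
  proof (intro allI impI)
    fix e :: real assume e: "e > 0"
    obtain h where h: "0 < h" "!!h' t. 0 < h' ==> h' <= h ==> 0 <= t ==> t <= 0 ==> norm (stek h' (%t. T t x) t - T t x) <= e/2"
      using stek_close[OF T_cont[of x], of "e/2" 0] e by auto
    have "integral {0..h} (%s. exp (- 0 * s) *\<^sub>R T s (inverse h *\<^sub>R x)) \<in> D" using T_integral[of h 0 "inverse h *\<^sub>R x"] h by auto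
    also have "integral {0..h} (%s. exp (- 0 * s) *\<^sub>R T s (inverse h *\<^sub>R x)) = integral {0..h} (%s. inverse h *\<^sub>R T s x)"
      by (intro integral_cong) (auto simp: linear_simps(5)[OF T_linear])
    also have "\<dots> = stek h (%t. T t x) 0" by (simp add: stek_def)
    finally have "stek h (%t. T t x) 0 \<in> D" .
    moreover have "dist (stek h (%t. T t x) 0) x < e" using h(2)[of h 0] h(1) e by (simp add: dist_norm)
    ultimately show "\<exists>y\<in>D. dist y x < e" by blast
  qed
  then show ?thesis by auto
qed

text \<open>For \<open>x\<close> in \<open>D\<close> the squared norm of the orbit has right
  derivative \<open>2 * (T s x \<bullet> A (T s x))\<close>, which dissipativity makes nonpositive;
  density carries the bound to all states.\<close>

lemma T_contraction: assumes "0 <= t" shows "norm (T t x) <= norm x"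
proof -
  have D: "norm (T t x) <= norm x" if x: "x \<in> D" for x
  proof -
    have "(norm (T t x))\<^sup>2 <= (norm (T 0 x))\<^sup>2"
    proof (rule right_dini_nonpos_imp_le[of 0 t "%s. (norm (T s x))\<^sup>2"])
      show "continuous_on {0..t} (%s. (norm (T s x))\<^sup>2)"
        by (intro continuous_intros continuous_on_sub0[OF T_cont]) auto
      fix s e :: real assume s: "0 <= s" "s < t" and e: "0 < e"
      let ?v = "T s x" let ?w = "%h. (T h ?v - ?v) /\<^sub>R h"
      have v: "?v \<in> D" using T_D[OF x] s by auto
      have lim: "(?w \<longlongrightarrow> A ?v) (at_right 0)" using generator_iff v by auto
      have "((%h. 2 * (?v \<bullet> ?w h) + h * (norm (?w h))\<^sup>2) \<longlongrightarrow> 2 * (?v \<bullet> A ?v) + 0 * (norm (A ?v))\<^sup>2) (at_right 0)"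
        by (intro tendsto_intros lim)
      moreover have "2 * (?v \<bullet> A ?v) + 0 * (norm (A ?v))\<^sup>2 < e"
        using dissipative[OF v] e by (simp add: inner_commute)
      ultimately have "\<forall>\<^sub>F h in at_right 0. 2 * (?v \<bullet> ?w h) + h * (norm (?w h))\<^sup>2 < e"
        by (rule order_tendstoD(2))
      then show "\<forall>\<^sub>F h in at_right 0. (norm (T (s + h) x))\<^sup>2 <= (norm (T s x))\<^sup>2 + e * h"
        using eventually_at_right_less[of "0::real"]
      proof eventually_elim
        fix h :: real assume h: "2 * (?v \<bullet> ?w h) + h * (norm (?w h))\<^sup>2 < e" "0 < h"
        have Th: "T (s + h) x = ?v + h *\<^sub>R ?w h"
          using T_add[of h s x] h(2) s by (simp add: add.commute)
        have "(norm (T (s + h) x))\<^sup>2 = (norm ?v)\<^sup>2 + h * (2 * (?v \<bullet> ?w h) + h * (norm (?w h))\<^sup>2)"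
          unfolding Th by (rule norm_add_scaleR_sq)
        also have "\<dots> <= (norm ?v)\<^sup>2 + h * e"
          using h by (intro add_left_mono mult_left_mono) auto
        finally show "(norm (T (s + h) x))\<^sup>2 <= (norm (T s x))\<^sup>2 + e * h" by (simp add: mult.commute)
      qed
    qed (use assms in auto)
    then show ?thesis using power2_le_imp_le[of "norm (T t x)" "norm x"] by simp
  qed
  have "closed {x. norm (T t x) <= norm x}"
    by (intro closed_Collect_le continuous_intros linear_continuous_on T_linear assms)
  then have "closure D \<subseteq> {x. norm (T t x) <= norm x}" using D by (intro closure_minimal) auto
  then show ?thesis using D_dense by auto
qed

text \<open>The norm of the defect \<open>F\<close> in the integrated equation has right derivative
  zero, so \<open>F\<close> stays zero. Being a primitive of a continuous function, the orbit then
  has the two-sided derivative that the one-sided generator limit does not give.\<close>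

lemma T_deriv:
  assumes x: "x \<in> D" and t: "0 <= t"
  shows "((%t. T t x) has_vector_derivative A (T t x)) (at t within {0..})"
proof -
  define F where "F t = T t x - x - integral {0..t} (%s. T s (A x))" for t
  have F0: "F 0 = 0" by (simp add: F_def)
  have "F t = 0" if t: "0 <= t" for t
  proof -
    have "norm (F t) <= norm (F 0)"
    proof (rule right_dini_nonpos_imp_le[of 0 t "%s. norm (F s)"])
      show "continuous_on {0..t} (%s. norm (F s))" unfolding F_def
        by (intro continuous_intros continuous_on_sub0 T_cont continuous_on_antideriv) auto
      fix s e :: real assume s: "0 <= s" "s < t" and e: "0 < e"
      let ?v = "T s x"
      have "((%h. (T h ?v - ?v) /\<^sub>R h) \<longlongrightarrow> T s (A x)) (at_right 0)"
        using generator_iff[of ?v] T_D[OF x s(1)] by auto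
      moreover have "((%h. stek h (%s. T s (A x)) s) \<longlongrightarrow> T s (A x)) (at_right 0)"
      proof (rule tendstoI)
        fix e :: real assume "0 < e"
        then obtain h0 where "0 < h0" "!!h t. 0 < h ==> h <= h0 ==> 0 <= t ==> t <= s ==> norm (stek h (%s. T s (A x)) t - T t (A x)) <= e/2"
          using stek_close[OF T_cont[of "A x"], of "e/2" s] by (auto simp del: divide_le_eq_numeral1)
        then show "\<forall>\<^sub>F h in at_right 0. dist (stek h (%s. T s (A x)) s) (T s (A x)) < e"
          using eventually_at_right_real[of 0 h0] s \<open>0 < e\<close>
          by (auto simp: dist_norm elim!: eventually_mono intro: le_less_trans[of _ "e/2"])
      qed
      ultimately have "((%h. norm ((T h ?v - ?v) /\<^sub>R h - stek h (%s. T s (A x)) s)) \<longlongrightarrow> norm (T s (A x) - T s (A x))) (at_right 0)"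
        by (intro tendsto_norm tendsto_diff)
      then have "((%h. norm ((T h ?v - ?v) /\<^sub>R h - stek h (%s. T s (A x)) s)) \<longlongrightarrow> 0) (at_right 0)" by simp
      then have "\<forall>\<^sub>F h in at_right 0. norm ((T h ?v - ?v) /\<^sub>R h - stek h (%s. T s (A x)) s) < e"
        using e by (rule order_tendstoD(2))
      then show "\<forall>\<^sub>F h in at_right 0. norm (F (s + h)) <= norm (F s) + e * h"
        using eventually_at_right_less[of "0::real"]
      proof eventually_elim
        fix h :: real assume h: "norm ((T h ?v - ?v) /\<^sub>R h - stek h (%s. T s (A x)) s) < e" "0 < h"
        have "F (s + h) - F s = h *\<^sub>R ((T h ?v - ?v) /\<^sub>R h - stek h (%s. T s (A x)) s)"
          using T_add[of h s x] h(2) s unfolding F_def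
          by (simp add: add.commute[of h s]) (simp add: stek_eq[OF T_cont] scaleR_right_diff_distrib)
        then have "norm (F (s + h) - F s) <= h * e" using h by simp
        then show "norm (F (s + h)) <= norm (F s) + e * h"
          using norm_triangle_sub[of "F (s + h)" "F s"] by (simp add: mult.commute)
      qed
    qed (use t in auto)
    then show ?thesis using F0 by simp
  qed
  then have eq: "T t x = x + integral {0..t} (%s. T s (A x))" if "0 <= t" for t
    using that by (force simp: F_def algebra_simps)
  have "((%t. x + integral {0..t} (%s. T s (A x))) has_vector_derivative T t (A x)) (at t within {0..})"
    using has_vector_derivative_add[OF has_vector_derivative_const antideriv[OF T_cont t]] by simp
  then have "((%t. T t x) has_vector_derivative T t (A x)) (at t within {0..})"
    by (rule has_vector_derivative_transform[rotated 2]) (use t eq in auto)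
  then show ?thesis using T_D[OF x t] by simp
qed

text \<open>For the Laplace integral over \<open>{0..1}\<close> the boundary terms amount to
  \<open>y - exp (- \<mu>) T 1 y\<close>. Banach's theorem finds the \<open>y\<close> for which this
  equals \<open>f\<close>, since \<open>T 1\<close> is a contraction and
  \<open>exp (- \<mu>) < 1\<close>.\<close>

lemma resolvent_onto:
  assumes l: "0 < \<mu>"
  obtains x where "x \<in> D" "\<mu> *\<^sub>R x - A x = f"
proof -
  interpret bounded_linear "T 1" by (rule T_linear) simp
  have "\<exists>!y. f + exp (- \<mu>) *\<^sub>R T 1 y = y"
  proof (rule banach_fix_type[of "exp (- \<mu>)"])
    show "\<forall>x y. dist (f + exp (- \<mu>) *\<^sub>R T 1 x) (f + exp (- \<mu>) *\<^sub>R T 1 y) <= exp (- \<mu>) * dist x y"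
    proof (intro allI)
      fix x y
      have "norm (T 1 (x - y)) <= norm (x - y)" by (rule T_contraction) simp
      then show "dist (f + exp (- \<mu>) *\<^sub>R T 1 x) (f + exp (- \<mu>) *\<^sub>R T 1 y) <= exp (- \<mu>) * dist x y"
        by (simp add: dist_norm scaleR_right_diff_distrib[symmetric] diff[symmetric])
    qed
  qed (use l in auto)
  then obtain y where y: "f + exp (- \<mu>) *\<^sub>R T 1 y = y" by auto
  then have f: "f = y - exp (- \<mu>) *\<^sub>R T 1 y" by (metis add_diff_cancel_right')
  define w where "w = integral {0..1} (%s. exp (- \<mu> * s) *\<^sub>R T s y)"
  have "w \<in> D & A w = \<mu> *\<^sub>R w + exp (- \<mu>) *\<^sub>R T 1 y - y"
    unfolding w_def using T_integral[of 1 \<mu> y] by simp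
  then show ?thesis by (intro that[of w]) (simp_all add: f)
qed

lemma resolvent_bound:
  assumes "0 < \<mu>" "x \<in> D" shows "\<mu> * norm x <= norm (\<mu> *\<^sub>R x - A x)"
proof (cases "x = 0")
  case False
  have "\<mu> * (norm x)\<^sup>2 <= (\<mu> *\<^sub>R x - A x) \<bullet> x"
    using dissipative[OF assms(2)] by (simp add: inner_diff_left power2_norm_eq_inner)
  also have "\<dots> <= norm (\<mu> *\<^sub>R x - A x) * norm x" by (rule norm_cauchy_schwarz)
  finally show ?thesis using False by (simp add: power2_eq_square)
qed simp

end

section \<open>Vector-valued polynomials in the exponential function\<close>

text \<open>The exponents start at one: for a positive exponent \<open>\<mu>\<close> the resolvent
  provides a state \<open>p\<close> with \<open>A p = \<mu> p\<close> and prescribed boundary value.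
  Coefficients stay in \<open>V\<close>, which keeps the inputs in \<open>U\<close>.\<close>

inductive expo :: "'a::real_vector set => (real => 'a) => bool" for V where
  exp: "v \<in> V ==> expo V (%t. exp (real (Suc j) * t) *\<^sub>R v)"
| add: "expo V u ==> expo V w ==> expo V (%t. u t + w t)"

lemma expo_scaleR:
  assumes "subspace V" "expo V u" shows "expo V (%t. c *\<^sub>R u t)"
  using assms(2)
proof induction
  case (exp v j)
  then show ?case
    using expo.exp[of "c *\<^sub>R v" V j] subspace_scale[OF assms(1)] by (simp add: mult.commute)
next
  case (add u w)
  then show ?case using expo.add by (simp add: scaleR_add_right)
qed

lemma expo_exp_mult:
  assumes "expo V u" shows "expo V (%t. exp t *\<^sub>R u t)"
  using assms
proof induction
  case (exp v j)
  then show ?case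
    using expo.exp[of v V "Suc j"] by (simp add: exp_add[symmetric] algebra_simps)
next
  case (add u w)
  then show ?case using expo.add by (simp add: scaleR_add_right)
qed

lemma expo_affine_mult:
  assumes V: "subspace V" and u: "expo V u" shows "expo V (%t. (c * exp t + d) *\<^sub>R u t)"
  using expo.add[OF expo_scaleR[OF V expo_exp_mult[OF u], of c] expo_scaleR[OF V u, of d]]
  by (simp add: scaleR_add_left)

lemma expo_affine_power:
  assumes V: "subspace V" and u: "expo V u" shows "expo V (%t. (c * exp t + d) ^ k *\<^sub>R u t)"
proof (induction k)
  case (Suc k)
  from expo_affine_mult[OF V this, of c d] show ?case by (simp add: mult.assoc)
qed (simp add: u)

lemma expo_sum:
  assumes "subspace V" "!!k. k <= n ==> expo V (u k)" shows "expo V (%t. \<Sum>k\<le>(n::nat). u k t)"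
  using assms(2)
proof (induction n)
  case (Suc n)
  then show ?case using expo.add[of V "%t. \<Sum>k\<le>n. u k t" "u (Suc n)"] by simp
qed simp

lemma expo_continuous:
  fixes u :: "real => 'a::real_normed_vector"
  shows "expo V u ==> continuous_on S u"
proof (induction rule: expo.induct)
  case (exp v j) show ?case by (intro continuous_intros)
next
  case (add u w) then show ?case by (intro continuous_intros)
qed

text \<open>Bernstein's argument by Chebyshev's inequality. The weights are real and nonnegative, so
  it works for values in any normed space, and the approximant is a linear combination of values of
  \<open>f\<close>, which later keeps it in a subspace.\<close>

lemma Bernstein_approx:
  fixes f :: "real => 'a::real_normed_vector"
  assumes f: "continuous_on {0..1} f" and e: "0 < e"
  obtains n where "0 < n" "!!x. 0 <= x ==> x <= 1 ==>
     norm ((\<Sum>k\<le>n. Bernstein n k x *\<^sub>R f (real k / real n)) - f x) <= e"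
proof -
  have "bounded (f ` {0..1})"
    by (intro compact_imp_bounded compact_continuous_image f) simp
  then obtain M where M: "0 < M" "!!x. x \<in> {0..1} ==> norm (f x) <= M"
    unfolding bounded_pos by auto
  have "uniformly_continuous_on {0..1} f"
    by (intro compact_uniformly_continuous f) simp
  then obtain d where d: "0 < d" "!!x y. x \<in> {0..1} ==> y \<in> {0..1} ==> \<bar>y - x\<bar> < d ==> norm (f y - f x) < e / 2"
    using e unfolding uniformly_continuous_on_def dist_norm real_norm_def by (metis half_gt_zero)
  \<comment> \<open>Nodes at distance at least \<open>d\<close> contribute at most
    \<open>2 * M / d\<^sup>2\<close> times the variance, and the variance is at most
    \<open>1 / n\<close>; this choice makes the product smaller than \<open>e / 2\<close>.\<close>
  obtain n0 where "4 * M / (e * d\<^sup>2) < real n0" using reals_Archimedean2 by blast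
  then have n: "0 < Suc n0" "4 * M / (e * d\<^sup>2) < real (Suc n0)" by auto
  define n where "n = Suc n0"
  note n = n[folded n_def]
  show ?thesis
  proof (rule that[OF n(1)])
    fix x :: real assume x: "0 <= x" "x <= 1"
    let ?B = "%k. Bernstein n k x" and ?x = "%k. real k / real n"
    \<comment> \<open>The variance of a binomial proportion, assembled from the moments of order
      zero, one and two.\<close>
    have var: "(\<Sum>k\<le>n. ?B k * (?x k - x)\<^sup>2) = x * (1 - x) / n"
    proof -
      have sq: "(real k - real n * x)\<^sup>2 = real k * (real k - 1) + (1 - 2 * real n * x) * real k + (real n)\<^sup>2 * x\<^sup>2" for k
        by (simp add: power2_eq_square algebra_simps)
      have "(\<Sum>k\<le>n. (real k - real n * x)\<^sup>2 * ?B k)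
          = (\<Sum>k\<le>n. real k * (real k - 1) * ?B k) + (1 - 2 * real n * x) * (\<Sum>k\<le>n. real k * ?B k)
            + (real n)\<^sup>2 * x\<^sup>2 * (\<Sum>k\<le>n. ?B k)"
        unfolding sum_distrib_left sum.distrib[symmetric] sq by (intro sum.cong refl) (simp add: algebra_simps)
      also have "\<dots> = real n * (x * (1 - x))"
        unfolding sum_Bernstein sum_k_Bernstein sum_kk_Bernstein by (simp add: power2_eq_square algebra_simps)
      finally have "(\<Sum>k\<le>n. (real k - real n * x)\<^sup>2 * ?B k) = real n * (x * (1 - x))" .
      moreover have "?B k * (?x k - x)\<^sup>2 = (real k - real n * x)\<^sup>2 * ?B k / (real n)\<^sup>2" for k
        using n by (simp add: power2_eq_square field_simps)
      ultimately show ?thesis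
        using n by (simp add: sum_divide_distrib[symmetric] power2_eq_square)
    qed
    have pt: "norm (f (?x k) - f x) <= e / 2 + 2 * M / d\<^sup>2 * (?x k - x)\<^sup>2" if k: "k <= n" for k
    proof (cases "\<bar>?x k - x\<bar> < d")
      case True
      have "norm (f (?x k) - f x) < e / 2" using x k n True by (intro d(2)) auto
      moreover have "0 <= 2 * M / d\<^sup>2 * (?x k - x)\<^sup>2" using M by simp
      ultimately show ?thesis by linarith
    next
      case False
      then have "d\<^sup>2 <= (?x k - x)\<^sup>2" using d(1) by (metis abs_le_square_iff abs_of_pos linorder_not_less)
      then have "1 <= (?x k - x)\<^sup>2 / d\<^sup>2" using d(1) by simp
      then have "2 * M * 1 <= 2 * M * ((?x k - x)\<^sup>2 / d\<^sup>2)" using M by (intro mult_left_mono) auto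
      moreover have "norm (f (?x k) - f x) <= M + M"
        by (rule order_trans[OF norm_triangle_ineq4], intro add_mono M) (use x k n in auto)
      ultimately show ?thesis using e by simp
    qed
    have "(\<Sum>k\<le>n. ?B k *\<^sub>R f (?x k)) - f x = (\<Sum>k\<le>n. ?B k *\<^sub>R (f (?x k) - f x))"
      by (simp add: scaleR_right_diff_distrib sum_subtractf scaleR_left.sum[symmetric])
    then have "norm ((\<Sum>k\<le>n. ?B k *\<^sub>R f (?x k)) - f x) <= (\<Sum>k\<le>n. ?B k * norm (f (?x k) - f x))"
      using x by (auto intro!: sum_norm_le simp: Bernstein_nonneg)
    also have "\<dots> <= (\<Sum>k\<le>n. ?B k * (e / 2 + 2 * M / d\<^sup>2 * (?x k - x)\<^sup>2))"
      using x pt by (intro sum_mono mult_left_mono) (auto simp: Bernstein_nonneg)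
    also have "\<dots> = (\<Sum>k\<le>n. ?B k) * (e / 2) + 2 * M / d\<^sup>2 * (\<Sum>k\<le>n. ?B k * (?x k - x)\<^sup>2)"
      by (simp add: sum_distrib_left sum_distrib_right sum.distrib[symmetric] algebra_simps del: sum_Bernstein)
    also have "\<dots> = e / 2 + 2 * M / d\<^sup>2 * (x * (1 - x) / n)" by (simp add: var)
    also have "\<dots> <= e / 2 + 2 * M / d\<^sup>2 * (1 / n)"
    proof -
      have "x * (1 - x) <= 1 * 1" using x by (intro mult_mono) auto
      then show ?thesis using M n by (intro add_left_mono mult_left_mono divide_right_mono) auto
    qed
    also have "\<dots> <= e"
      using n d(1) e by (simp add: field_simps)
    finally show "norm ((\<Sum>k\<le>n. ?B k *\<^sub>R f (?x k)) - f x) <= e" .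
  qed
qed

text \<open>The substitution \<open>x = (exp t - 1) / D\<close> turns polynomials on
  \<open>{0..1}\<close> into polynomials in \<open>exp t\<close>. Bernstein polynomials interpolate
  at the left end point, which gives the exact value at time zero.\<close>

lemma expo_approx:
  fixes g :: "real => 'a::real_normed_vector"
  assumes V: "subspace V" and g: "continuous_on {0..\<tau>} g" "!!t. 0 <= t ==> t <= \<tau> ==> g t \<in> V"
    and \<tau>: "0 < \<tau>" and e: "0 < e"
  obtains u where "expo V u" "u 0 = g 0" "!!t. 0 <= t ==> t <= \<tau> ==> norm (u t - g t) <= e"
proof -
  define D where "D = exp \<tau> - 1"
  have D: "D > 0" using \<tau> by (simp add: D_def)
  define \<theta> where "\<theta> x = ln (1 + D * x)" for x
  have \<theta>: "0 <= \<theta> x" "\<theta> x <= \<tau>" if "0 <= x" "x <= 1" for x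
  proof -
    have 1: "1 <= 1 + D * x" using that D by simp
    then show "0 <= \<theta> x" by (simp add: \<theta>_def)
    have "1 + D * x <= exp \<tau>"
    proof -
      have "D * x <= D" using that D by (simp add: mult_left_le)
      then show ?thesis by (simp add: D_def)
    qed
    then have "ln (1 + D * x) <= ln (exp \<tau>)" using 1 by (intro ln_mono) auto
    then show "\<theta> x <= \<tau>" by (simp add: \<theta>_def)
  qed
  have \<theta>c: "continuous_on {0..1} \<theta>" unfolding \<theta>_def
    using D by (intro continuous_intros) (auto simp: add_nonneg_eq_0_iff intro!: add_pos_nonneg less_imp_neq[THEN not_sym])
  \<comment> \<open>The factor \<open>exp (- \<theta> x)\<close> taken out here returns as
    \<open>exp t\<close> in \<open>u\<close>, so that every exponent in \<open>u\<close> is at least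
    one; the tolerance \<open>e * exp (- \<tau>)\<close> below pays for it.\<close>
  define f where "f x = exp (- \<theta> x) *\<^sub>R g (\<theta> x)" for x
  have f: "continuous_on {0..1} f" unfolding f_def
    by (intro continuous_intros \<theta>c continuous_on_compose2[OF g(1) \<theta>c]) (use \<theta> in auto)
  obtain n where n: "0 < n" "!!x. 0 <= x ==> x <= 1 ==>
      norm ((\<Sum>k\<le>n. Bernstein n k x *\<^sub>R f (real k / real n)) - f x) <= e * exp (- \<tau>)"
    using Bernstein_approx[OF f, of "e * exp (- \<tau>)"] e by auto
  define u where "u t = exp t *\<^sub>R (\<Sum>k\<le>n. Bernstein n k ((exp t - 1) / D) *\<^sub>R f (real k / real n))" for t
  have fV: "f x \<in> V" if "0 <= x" "x <= 1" for x
    unfolding f_def using \<theta>[OF that] by (intro subspace_scale[OF V] g)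
  have "expo V (%t. \<Sum>k\<le>n. exp t *\<^sub>R Bernstein n k ((exp t - 1) / D) *\<^sub>R f (real k / real n))"
  proof (rule expo_sum[OF V])
    fix k assume k: "k <= n"
    let ?v = "f (real k / real n)"
    have "?v \<in> V" using k n by (intro fV) auto
    from expo.exp[OF this, of 0] have "expo V (%t. exp t *\<^sub>R ?v)" by simp
    from expo_scaleR[OF V expo_affine_power[OF V expo_affine_power[OF V this, of "- 1/D" "1 + 1/D" "n - k"], of "1/D" "- 1/D" k], of "real (n choose k)"]
    have E: "expo V (%t. real (n choose k) *\<^sub>R (1 / D * exp t + - 1 / D) ^ k *\<^sub>R (- 1 / D * exp t + (1 + 1 / D)) ^ (n - k) *\<^sub>R exp t *\<^sub>R ?v)" .
    have "1 / D * exp t + - 1 / D = (exp t - 1) / D" "- 1 / D * exp t + (1 + 1 / D) = 1 - (exp t - 1) / D" for t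
      using D by (auto simp: field_simps)
    then have eq: "real (n choose k) *\<^sub>R (1 / D * exp t + - 1 / D) ^ k *\<^sub>R (- 1 / D * exp t + (1 + 1 / D)) ^ (n - k) *\<^sub>R exp t *\<^sub>R ?v
        = exp t *\<^sub>R Bernstein n k ((exp t - 1) / D) *\<^sub>R ?v" for t
      by (simp only: scaleR_scaleR Bernstein_def) (simp only: mult_ac)
    show "expo V (%t. exp t *\<^sub>R Bernstein n k ((exp t - 1) / D) *\<^sub>R ?v)"
      using E unfolding eq .
  qed
  then have 1: "expo V u" by (simp add: u_def[abs_def] scaleR_sum_right)
  have B0: "Bernstein n k 0 = (if k = 0 then 1 else 0)" for k by (simp add: Bernstein_def)
  have "u 0 = (\<Sum>k\<le>n. if k = 0 then f (real k / real n) else 0)"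
    unfolding u_def by (simp only: exp_zero diff_self div_0 scaleR_one, intro sum.cong refl) (simp add: B0)
  then have 2: "u 0 = g 0" by (simp add: f_def \<theta>_def)
  have 3: "norm (u t - g t) <= e" if t: "0 <= t" "t <= \<tau>" for t
  proof -
    define x where "x = (exp t - 1) / D"
    have x: "0 <= x" "x <= 1" using t D by (auto simp: x_def D_def)
    have "\<theta> x = t" using D by (simp add: \<theta>_def x_def)
    then have "g t = exp t *\<^sub>R f x" by (simp add: f_def exp_minus)
    then have "u t - g t = exp t *\<^sub>R ((\<Sum>k\<le>n. Bernstein n k x *\<^sub>R f (real k / real n)) - f x)"
      by (simp add: u_def x_def scaleR_right_diff_distrib)
    then have "norm (u t - g t) <= exp t * (e * exp (- \<tau>))" using n(2)[OF x] by simp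
    also have "\<dots> <= exp \<tau> * (e * exp (- \<tau>))" using t e by (intro mult_right_mono) auto
    also have "\<dots> = e" by (simp add: exp_minus)
    finally show ?thesis .
  qed
  show ?thesis by (rule that[OF 1 2 3])
qed

lemma l2n_exp_decay:
  assumes "0 < m" "0 <= \<tau>" shows "l2n \<tau> (%t. exp (- m * t) *\<^sub>R d) <= norm d / sqrt m"
proof -
  have "((%t. (norm (exp (- m * t) *\<^sub>R d))\<^sup>2) has_integral
      (- exp (- 2 * m * \<tau>) / (2 * m) * (norm d)\<^sup>2 - - exp (- 2 * m * 0) / (2 * m) * (norm d)\<^sup>2)) {0..\<tau>}"
  proof (rule fundamental_theorem_of_calculus)
    fix x assume "x \<in> {0..\<tau>}"
    have "((%t. - exp (- 2 * m * t) / (2 * m) * (norm d)\<^sup>2) has_real_derivative exp (- 2 * m * x) * (norm d)\<^sup>2) (at x within {0..\<tau>})"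
      using assms by (auto intro!: derivative_eq_intros simp: field_simps)
    moreover have "exp (- 2 * m * x) * (norm d)\<^sup>2 = (norm (exp (- m * x) *\<^sub>R d))\<^sup>2"
      by (simp add: power_mult_distrib exp_double[symmetric] mult.assoc)
    ultimately show "((%t. - exp (- 2 * m * t) / (2 * m) * (norm d)\<^sup>2) has_vector_derivative (norm (exp (- m * x) *\<^sub>R d))\<^sup>2) (at x within {0..\<tau>})"
      by (simp add: has_real_derivative_iff_has_vector_derivative)
  qed (use assms in auto)
  from integral_unique[OF this]
  have "integral {0..\<tau>} (%t. (norm (exp (- m * t) *\<^sub>R d))\<^sup>2) = (1 - exp (- 2 * m * \<tau>)) / (2 * m) * (norm d)\<^sup>2"
    by (simp only:) (simp add: algebra_simps diff_divide_distrib)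
  also have "\<dots> <= 1 / m * (norm d)\<^sup>2"
    using assms by (intro mult_right_mono frac_le) auto
  finally have "l2n \<tau> (%t. exp (- m * t) *\<^sub>R d) <= sqrt (1 / m * (norm d)\<^sup>2)"
    unfolding l2n_def by (rule real_sqrt_le_mono)
  then show ?thesis by (simp add: real_sqrt_mult real_sqrt_divide)
qed

text \<open>In the mean square the initial value is free: the boundary layer
  \<open>exp (- m * t) *\<^sub>R d\<close> moves \<open>g 0\<close> to \<open>c\<close> at
  arbitrarily small cost. A classical trajectory starts with the input dictated by its initial
  state, which need not be the value of the desired input.\<close>

lemma expo_approx_l2n:
  fixes g :: "real => 'a::real_normed_vector"
  assumes V: "subspace V" and g: "continuous_on {0..\<tau>} g" "!!t. 0 <= t ==> t <= \<tau> ==> g t \<in> V"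
    and c: "c \<in> V" and \<tau>: "0 < \<tau>" and e: "0 < e"
  obtains u where "expo V u" "u 0 = c" "l2n \<tau> (%t. u t - g t) <= e"
proof -
  define d where "d = c - g 0"
  \<comment> \<open>Large enough for the layer to cost at most \<open>e / 2\<close>; the summand
    \<open>1\<close> keeps \<open>m\<close> positive when \<open>d = 0\<close>.\<close>
  define m where "m = (2 * norm d / e)\<^sup>2 + 1"
  have m: "0 < m" by (simp add: m_def add_nonneg_pos)
  define h where "h t = g t + exp (- m * t) *\<^sub>R d" for t
  have dV: "d \<in> V" unfolding d_def using g(2)[of 0] \<tau> c by (intro subspace_diff[OF V]) auto
  have h: "continuous_on {0..\<tau>} h" unfolding h_def by (intro continuous_intros g)
  obtain u where u: "expo V u" "u 0 = h 0" "!!t. 0 <= t ==> t <= \<tau> ==> norm (u t - h t) <= e / (2 * sqrt \<tau>)"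
    by (rule expo_approx[OF V h _ \<tau>, of "e / (2 * sqrt \<tau>)"])
       (use e \<tau> g dV in \<open>auto simp: h_def intro!: subspace_add[OF V] subspace_scale[OF V]\<close>)
  note cu = expo_continuous[OF u(1)]
  have "l2n \<tau> (%t. u t - g t) <= l2n \<tau> (%t. u t - h t) + l2n \<tau> (%t. h t - g t)"
    by (intro l2n_dist_triangle cu h g)
  moreover have "l2n \<tau> (%t. u t - h t) <= sqrt \<tau> * (e / (2 * sqrt \<tau>))" (is "_ <= ?r")
    by (intro l2n_bound continuous_intros cu h u) (use \<tau> e in auto)
  moreover have "l2n \<tau> (%t. h t - g t) <= norm d / sqrt m"
    using l2n_exp_decay[OF m, of \<tau> d] \<tau> by (simp add: h_def)
  moreover have "norm d / sqrt m <= e / 2"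
  proof -
    have "2 * norm d / e <= sqrt m"
      by (rule real_le_rsqrt) (simp add: m_def)
    then show ?thesis using e m by (simp add: field_simps)
  qed
  moreover have "?r = e / 2" using \<tau> by simp
  ultimately have "l2n \<tau> (%t. u t - g t) <= e" by linarith
  then show ?thesis using u by (intro that) (auto simp: h_def d_def)
qed

lemma lint_sq:
  assumes "continuous_on {0..\<tau>} f"
  shows "(LINT t:{0..\<tau>}|lebesgue. (norm (f t))\<^sup>2) = (l2n \<tau> f)\<^sup>2"
  unfolding l2n_sq[OF assms]
  by (intro set_lebesgue_integral_eq_integral absolutely_integrable_continuous_real continuous_intros assms)

section \<open>Boundary nodes\<close>

text \<open>The linear plant by itself. Passivity is stated for the real inner product, the real
  part of the complex one.\<close>

locale passive_node =
  fixes U :: "'u::chilbert_space set"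
    and S :: "('x::chilbert_space, 'u, 'd1::chilbert_space, 'd3::chilbert_space) bcs"
  assumes U_csubspace: "csubspace U" and U_closed: "closed U"
    and node: "boundary_node U S" and wp: "well_posed U S"
    and B1: "bounded_clinear_on UNIV norm UNIV norm (opB1 S)"
    and imp_passive: "!!x. x \<in> Dom S ==> opBd S x = 0 ==> opA S x \<bullet> x <= opBc S x \<bullet> opC S x"
begin

lemma U_subspace: "subspace U" using U_csubspace by (rule csubspace_subspace)

lemma Dom_subspace: "subspace (Dom S)"
  using node csubspace_subspace unfolding boundary_node_def by auto

lemma clinears:
  "clinear_on (Dom S) UNIV (opA S)" "clinear_on (Dom S) (U \<times> UNIV) (%x. (opBc S x, opBd S x))"
  "clinear_on (Dom S) U (opC S)"
  using node unfolding boundary_node_def bounded_clinear_on_def by auto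

lemma op_add:
  assumes "x \<in> Dom S" "y \<in> Dom S"
  shows "opA S (x + y) = opA S x + opA S y" "opBc S (x + y) = opBc S x + opBc S y"
    "opBd S (x + y) = opBd S x + opBd S y" "opC S (x + y) = opC S x + opC S y"
  using clinears assms unfolding clinear_on_def by auto

lemma op_scaleR:
  assumes "x \<in> Dom S"
  shows "opA S (c *\<^sub>R x) = c *\<^sub>R opA S x" "opBc S (c *\<^sub>R x) = c *\<^sub>R opBc S x"
    "opBd S (c *\<^sub>R x) = c *\<^sub>R opBd S x" "opC S (c *\<^sub>R x) = c *\<^sub>R opC S x"
  using clinears[THEN clinear_on_scaleR, OF assms, of c] by auto

lemma op_0: "0 \<in> Dom S" "opA S 0 = 0" "opBc S 0 = 0" "opBd S 0 = 0" "opC S 0 = 0"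
  using subspace_0[OF Dom_subspace] op_scaleR[of 0 0] by auto

lemma op_diff:
  assumes "x \<in> Dom S" "y \<in> Dom S"
  shows "opA S (x - y) = opA S x - opA S y" "opBc S (x - y) = opBc S x - opBc S y"
    "opBd S (x - y) = opBd S x - opBd S y" "opC S (x - y) = opC S x - opC S y"
  using op_add[OF assms(1) subspace_neg[OF Dom_subspace assms(2)]] op_scaleR[OF assms(2), of "-1"] by auto

lemma op_U: "x \<in> Dom S ==> opBc S x \<in> U" "x \<in> Dom S ==> opC S x \<in> U"
  using clinears unfolding clinear_on_def by auto

lemma Dom_simps:
  "x \<in> Dom S ==> y \<in> Dom S ==> x + y \<in> Dom S" "x \<in> Dom S ==> y \<in> Dom S ==> x - y \<in> Dom S"
  "x \<in> Dom S ==> c *\<^sub>R x \<in> Dom S"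
  using Dom_subspace by (auto simp: subspace_add subspace_diff subspace_scale)

lemma B1_linear: "bounded_linear (opB1 S)" using B1 by (rule bounded_clinear_on_UNIV)

lemma graph_norm_le: "graph_norm S x <= norm x + norm (opA S x)"
  unfolding graph_norm_def by (rule sqrt_sum_squares_le_sum) auto

lemma le_graph_norm: "norm x <= graph_norm S x" "norm (opA S x) <= graph_norm S x" "0 <= graph_norm S x"
  unfolding graph_norm_def by (auto intro!: real_le_rsqrt)

lemma op_bound:
  obtains K where "0 < K" "!!x. x \<in> Dom S ==> norm (opBc S x) <= K * (norm x + norm (opA S x))"
    "!!x. x \<in> Dom S ==> norm (opBd S x) <= K * (norm x + norm (opA S x))"
    "!!x. x \<in> Dom S ==> norm (opC S x) <= K * (norm x + norm (opA S x))"
proof -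
  obtain K1 K2 where K: "!!x. x \<in> Dom S ==> norm (opBc S x, opBd S x) <= K1 * graph_norm S x"
    "!!x. x \<in> Dom S ==> norm (opC S x) <= K2 * graph_norm S x"
    using node unfolding boundary_node_def bounded_clinear_on_def by auto
  define K where "K = \<bar>K1\<bar> + \<bar>K2\<bar> + 1"
  have le: "K1 * graph_norm S x <= K * (norm x + norm (opA S x))"
           "K2 * graph_norm S x <= K * (norm x + norm (opA S x))" for x
    by (intro mult_mono graph_norm_le, auto simp: K_def intro: le_graph_norm)+
  show ?thesis
  proof (rule that[of K])
    fix x assume x: "x \<in> Dom S"
    show "norm (opBc S x) <= K * (norm x + norm (opA S x))"
      using norm_fst_le[of "opBc S x" "opBd S x"] K(1)[OF x] le(1)[of x] by simp
    show "norm (opBd S x) <= K * (norm x + norm (opA S x))"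
      using norm_snd_le[of "opBd S x" "opBc S x"] K(1)[OF x] le(1)[of x] by simp
    show "norm (opC S x) <= K * (norm x + norm (opA S x))"
      using K(2)[OF x] le(2)[of x] by simp
  qed (simp add: K_def)
qed

lemma right_inverse:
  obtains Br K where "!!z. fst z \<in> U ==> Br z \<in> Dom S" "!!z. fst z \<in> U ==> opBc S (Br z) = fst z"
    "!!z. fst z \<in> U ==> opBd S (Br z) = snd z"
    "!!y z. fst y \<in> U ==> fst z \<in> U ==> Br (y - z) = Br y - Br z" "0 <= K"
    "!!z. fst z \<in> U ==> norm (Br z) <= K * norm z" "!!z. fst z \<in> U ==> norm (opA S (Br z)) <= K * norm z"
proof -
  obtain Br where "bounded_clinear_on (U \<times> UNIV) norm (Dom S) (graph_norm S) Br"
    and inv: "!!z. z \<in> U \<times> UNIV ==> (opBc S (Br z), opBd S (Br z)) = z"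
    using node unfolding boundary_node_def by auto
  then obtain K where cl: "clinear_on (U \<times> UNIV) (Dom S) Br"
    and K: "!!z. z \<in> U \<times> UNIV ==> graph_norm S (Br z) <= K * norm z"
    unfolding bounded_clinear_on_def by blast
  have UU: "z \<in> U \<times> UNIV" if "fst z \<in> U" for z :: "'u \<times> 'd3" using that by (cases z) auto
  have K': "graph_norm S (Br z) <= \<bar>K\<bar> * norm z" if "fst z \<in> U" for z
    by (rule order_trans[OF K[OF UU[OF that]]]) (simp add: mult_right_mono)
  show ?thesis
  proof (rule that[of Br "\<bar>K\<bar>"])
    fix y z :: "'u \<times> 'd3" assume y: "fst y \<in> U" and z: "fst z \<in> U"
    have add: "\<forall>p\<in>U \<times> UNIV. \<forall>q\<in>U \<times> UNIV. Br (p + q) = Br p + Br q"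
      using cl unfolding clinear_on_def by blast
    have "(-1) *\<^sub>R z \<in> U \<times> UNIV"
      by (rule UU) (use z subspace_neg[OF U_subspace] in simp)
    then have "Br (y + (-1) *\<^sub>R z) = Br y + Br ((-1) *\<^sub>R z)"
      by (rule add[rule_format, OF UU[OF y]])
    then show "Br (y - z) = Br y - Br z" using clinear_on_scaleR[OF cl UU[OF z], of "-1"] by simp
  next
    fix z :: "'u \<times> 'd3" assume z: "fst z \<in> U"
    show "Br z \<in> Dom S" using cl UU[OF z] unfolding clinear_on_def by auto
    show "opBc S (Br z) = fst z" "opBd S (Br z) = snd z" using inv[OF UU[OF z]] by (cases z; simp)+
    show "norm (Br z) <= \<bar>K\<bar> * norm z" "norm (opA S (Br z)) <= \<bar>K\<bar> * norm z"
      using K'[OF z] le_graph_norm[of "Br z"] by auto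
  qed simp
qed

lemma dissipative_semigroup_generates:
  "generates (ker_B S) (opA S) T ==> dissipative_semigroup (ker_B S) (opA S) T"
proof unfold_locales
  fix x assume "x \<in> ker_B S"
  then show "opA S x \<bullet> x <= 0" using imp_passive[of x] by (simp add: ker_B_def)
qed

text \<open>One semigroup fixed by choice for the existence arguments; the stability results are
  stated for an arbitrary \<open>T\<close> generated by the same operator.\<close>

definition Tsg :: "real => 'x => 'x" where
  "Tsg = (SOME T. generates (ker_B S) (opA S) T)"

sublocale sg: dissipative_semigroup "ker_B S" "opA S" Tsg
proof (rule dissipative_semigroup_generates)
  show "generates (ker_B S) (opA S) Tsg"
    unfolding Tsg_def using node unfolding boundary_node_def by (metis someI)
qed

lemma ker_B_Dom: "x \<in> ker_B S ==> x \<in> Dom S" by (simp add: ker_B_def)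

lemma ker_B_diff: "x \<in> ker_B S ==> y \<in> ker_B S ==> x - y \<in> ker_B S"
  by (simp add: ker_B_def op_diff Dom_simps)

text \<open>A lifting \<open>b\<close> of the boundary value is corrected inside
  \<open>ker_B\<close> by the resolvent at \<open>\<mu>\<close>. The state \<open>p\<close> is the
  amplitude of the response to an exponential input.\<close>

lemma static_solution:
  assumes "0 < \<mu>" "v \<in> U"
  obtains p where "p \<in> Dom S" "opA S p = \<mu> *\<^sub>R p" "opBc S p = v" "opBd S p = 0"
proof -
  obtain b where b: "b \<in> Dom S" "opBc S b = v" "opBd S b = 0"
    using right_inverse assms(2) by (metis fst_conv snd_conv)
  obtain k where k: "k \<in> ker_B S" "\<mu> *\<^sub>R k - opA S k = opA S b - \<mu> *\<^sub>R b"
    using sg.resolvent_onto[OF assms(1)] by metis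
  have kD: "k \<in> Dom S" "opBc S k = 0" "opBd S k = 0" using k(1) by (auto simp: ker_B_def)
  show ?thesis
    by (rule that[of "b + k"]) (use k(2) b kD in \<open>auto simp: op_add Dom_simps algebra_simps\<close>)
qed

section \<open>Closedness of the boundary node\<close>

definition graph :: "('x \<times> 'x \<times> 'u \<times> 'u \<times> 'd3) set" where
  "graph = (%x. (x, opA S x, opBc S x, opC S x, opBd S x)) ` Dom S"

lemma graph_iff: "(x, a, u, y, w) \<in> graph \<longleftrightarrow>
    x \<in> Dom S & a = opA S x & u = opBc S x & y = opC S x & w = opBd S x"
  unfolding graph_def by auto

lemma graph_subspace: "subspace graph"
  unfolding subspace_def
proof (intro conjI ballI allI)
  show "0 \<in> graph" by (simp add: zero_prod_def graph_iff op_0)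
next
  fix p q assume "p \<in> graph" "q \<in> graph"
  then show "p + q \<in> graph" by (cases p; cases q) (auto simp: graph_iff op_add Dom_simps)
next
  fix c p assume "p \<in> graph"
  then show "c *\<^sub>R p \<in> graph" by (cases p) (auto simp: graph_iff op_scaleR Dom_simps)
qed

text \<open>Convergent boundary values are lifted by the bounded right inverse; the remainder lies
  in \<open>ker_B\<close>, where the restriction of \<open>opA\<close> is closed because it has a
  bounded resolvent at one. All operators share one graph so that limits and integrals pass through
  them together.\<close>

lemma graph_closed: "closed graph"
  unfolding closed_sequential_limits
proof (intro allI impI)
  fix P :: "nat => 'x \<times> 'x \<times> 'u \<times> 'u \<times> 'd3" and p
  assume "(\<forall>n. P n \<in> graph) & P \<longlonglongrightarrow> p"
  then have P: "!!n. P n \<in> graph" "P \<longlonglongrightarrow> p" by auto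
  define X where "X n = fst (P n)" for n
  have PX: "P n = (X n, opA S (X n), opBc S (X n), opC S (X n), opBd S (X n))" "X n \<in> Dom S" for n
    using P(1)[of n] unfolding X_def graph_def by auto
  obtain x a u y w where p: "p = (x, a, u, y, w)" by (cases p) auto
  have lim: "X \<longlonglongrightarrow> x" "(%n. opA S (X n)) \<longlonglongrightarrow> a" "(%n. opBc S (X n)) \<longlonglongrightarrow> u"
    "(%n. opC S (X n)) \<longlonglongrightarrow> y" "(%n. opBd S (X n)) \<longlonglongrightarrow> w"
    using P(2) tendsto_fst[OF P(2)] tendsto_snd[OF P(2)] tendsto_fst[OF tendsto_snd[OF P(2)]]
      tendsto_fst[OF tendsto_snd[OF tendsto_snd[OF P(2)]]]
      tendsto_fst[OF tendsto_snd[OF tendsto_snd[OF tendsto_snd[OF P(2)]]]]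
      tendsto_snd[OF tendsto_snd[OF tendsto_snd[OF tendsto_snd[OF P(2)]]]]
    by (simp_all add: PX(1) p)
  obtain Br K where Br: "!!z. fst z \<in> U ==> Br z \<in> Dom S" "!!z. fst z \<in> U ==> opBc S (Br z) = fst z"
    "!!z. fst z \<in> U ==> opBd S (Br z) = snd z"
    "!!y z. fst y \<in> U ==> fst z \<in> U ==> Br (y - z) = Br y - Br z" "0 <= K"
    "!!z. fst z \<in> U ==> norm (Br z) <= K * norm z" "!!z. fst z \<in> U ==> norm (opA S (Br z)) <= K * norm z"
    by (rule right_inverse) (rule that)
  have "!!n. opBc S (X n) \<in> U" using PX(2) op_U by blast
  then have uU: "u \<in> U" using closed_sequentially[OF U_closed _ lim(3)] by simp
  define b where "b = (u, w)"
  define B where "B n = (opBc S (X n), opBd S (X n))" for n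
  have bU: "fst b \<in> U" "fst (B n) \<in> U" for n using uU op_U PX(2) by (auto simp: b_def B_def)
  have dU: "fst (B n - b) \<in> U" for n using bU subspace_diff[OF U_subspace] by simp
  have Bb: "(%n. B n - b) \<longlonglongrightarrow> 0" unfolding B_def b_def
    by (rule LIM_zero[OF tendsto_Pair[OF lim(3,5)]])
  then have Kb: "(%n. K * norm (B n - b)) \<longlonglongrightarrow> 0"
    by (intro tendsto_mult_right_zero tendsto_norm_zero)
  have "(%n. Br (B n) - Br b) \<longlonglongrightarrow> 0"
  proof (rule Lim_null_comparison[OF _ Kb], rule always_eventually, rule allI)
    fix n show "norm (Br (B n) - Br b) <= K * norm (B n - b)"
      using Br(6)[OF dU[of n]] Br(4)[OF bU(2,1), of n] by simp
  qed
  then have 1: "(%n. Br (B n)) \<longlonglongrightarrow> Br b" by (simp add: LIM_zero_iff)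
  have "(%n. opA S (Br (B n)) - opA S (Br b)) \<longlonglongrightarrow> 0"
  proof (rule Lim_null_comparison[OF _ Kb], rule always_eventually, rule allI)
    fix n show "norm (opA S (Br (B n)) - opA S (Br b)) <= K * norm (B n - b)"
      using Br(7)[OF dU[of n]] op_diff(1)[OF Br(1)[OF bU(2)] Br(1)[OF bU(1)], of n] Br(4)[OF bU(2,1), of n]
      by simp
  qed
  then have 2: "(%n. opA S (Br (B n))) \<longlonglongrightarrow> opA S (Br b)" by (simp add: LIM_zero_iff)
  define k where "k n = X n - Br (B n)" for n
  have k: "k n \<in> ker_B S" "opA S (k n) = opA S (X n) - opA S (Br (B n))" for n
    unfolding k_def ker_B_def using Br(1-3)[OF bU(2)] PX(2)
    by (auto simp: op_diff Dom_simps B_def)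
  define a' where "a' = a - opA S (Br b)"
  have klim: "k \<longlonglongrightarrow> x - Br b" "(%n. opA S (k n)) \<longlonglongrightarrow> a'"
    unfolding k(2) a'_def by (auto simp: k_def[abs_def] intro!: tendsto_diff lim 1 2)
  \<comment> \<open>The resolvent provides the candidate limit in \<open>ker_B\<close>; the
    resolvent estimate then forces \<open>k n\<close> to converge to it.\<close>
  obtain k' where k': "k' \<in> ker_B S" "1 *\<^sub>R k' - opA S k' = (x - Br b) - a'"
    using sg.resolvent_onto[of 1] by (metis zero_less_one)
  have "(%n. k n - k') \<longlonglongrightarrow> 0"
  proof (rule Lim_null_comparison)
    show "(%n. norm ((k n - opA S (k n)) - ((x - Br b) - a'))) \<longlonglongrightarrow> 0"
      using tendsto_diff[OF klim] by (intro tendsto_norm_zero) (simp add: LIM_zero)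
    show "\<forall>\<^sub>F n in sequentially. norm (k n - k') <= norm ((k n - opA S (k n)) - ((x - Br b) - a'))"
    proof (rule always_eventually, rule allI)
      fix n
      have "norm (k n - k') <= norm ((k n - k') - opA S (k n - k'))"
        using sg.resolvent_bound[of 1 "k n - k'"] ker_B_diff[OF k(1) k'(1)] by simp
      also have "(k n - k') - opA S (k n - k') = (k n - opA S (k n)) - ((x - Br b) - a')"
        using k'(2) unfolding op_diff(1)[OF ker_B_Dom[OF k(1)] ker_B_Dom[OF k'(1)], of n] by (simp add: algebra_simps)
      finally show "norm (k n - k') <= norm ((k n - opA S (k n)) - ((x - Br b) - a'))" .
    qed
  qed
  then have "k \<longlonglongrightarrow> k'" by (simp add: LIM_zero_iff)
  then have kk: "x - Br b = k'" using klim(1) LIMSEQ_unique by blast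
  then have ak: "opA S k' = a'" using k'(2) by simp
  have xe: "x = k' + Br b" using kk by (metis diff_add_cancel)
  have k'D: "k' \<in> Dom S" "opBc S k' = 0" "opBd S k' = 0" using k'(1) by (auto simp: ker_B_def)
  have x: "x \<in> Dom S" "opA S x = a" "opBc S x = u" "opBd S x = w"
    unfolding xe using Br(1-3)[OF bU(1)] k'D ak by (auto simp: op_add Dom_simps a'_def b_def)
  obtain K2 where K2: "!!x. x \<in> Dom S ==> norm (opC S x) <= K2 * (norm x + norm (opA S x))"
    by (rule op_bound) (rule that)
  have "(%n. opC S (X n) - opC S x) \<longlonglongrightarrow> 0"
  proof (rule Lim_null_comparison)
    show "(%n. K2 * (norm (X n - x) + norm (opA S (X n) - a))) \<longlonglongrightarrow> 0"
      using lim(1,2) by (intro tendsto_mult_right_zero tendsto_add_zero tendsto_norm_zero) (simp_all add: LIM_zero)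
    show "\<forall>\<^sub>F n in sequentially. norm (opC S (X n) - opC S x) <= K2 * (norm (X n - x) + norm (opA S (X n) - a))"
      using K2[OF Dom_simps(2)[OF PX(2) x(1)]] op_diff(1,4)[OF PX(2) x(1)] x(2)
      by (intro always_eventually allI) simp
  qed
  then have "y = opC S x" using LIMSEQ_unique[OF lim(4)] by (simp add: LIM_zero_iff)
  then show "p \<in> graph" using x by (simp add: p graph_iff)
qed

text \<open>Operators bounded by the graph norm map \<open>X\<close> to Cauchy sequences as soon as
  \<open>X\<close> and its image under \<open>opA\<close> converge; closedness of the graph
  identifies the limits.\<close>

lemma op_limit:
  assumes D: "!!n::nat. X n \<in> Dom S" and x: "X \<longlonglongrightarrow> x" and a: "(%n. opA S (X n)) \<longlonglongrightarrow> a"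
  shows "x \<in> Dom S" "opA S x = a" "(%n. opBc S (X n)) \<longlonglongrightarrow> opBc S x"
    "(%n. opC S (X n)) \<longlonglongrightarrow> opC S x" "(%n. opBd S (X n)) \<longlonglongrightarrow> opBd S x"
proof -
  obtain K where K: "0 < K" "!!x. x \<in> Dom S ==> norm (opBc S x) <= K * (norm x + norm (opA S x))"
    "!!x. x \<in> Dom S ==> norm (opBd S x) <= K * (norm x + norm (opA S x))"
    "!!x. x \<in> Dom S ==> norm (opC S x) <= K * (norm x + norm (opA S x))"
    by (rule op_bound) (rule that)
  have cg: "convergent (%n. f (X n))" if f: "!!x y. x \<in> Dom S ==> y \<in> Dom S ==> f (x - y) = f x - f y"
      "!!x. x \<in> Dom S ==> norm (f x) <= K * (norm x + norm (opA S x))" for f :: "'x => 'c::banach"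
  proof (rule Cauchy_convergent, rule CauchyI)
    fix e :: real assume e: "e > 0"
    obtain N1 where N1: "!!m n. m \<ge> N1 ==> n \<ge> N1 ==> norm (X m - X n) < e / (2 * K)"
      using CauchyD[OF LIMSEQ_imp_Cauchy[OF x], of "e / (2 * K)"] e K(1) by auto
    obtain N2 where N2: "!!m n. m \<ge> N2 ==> n \<ge> N2 ==> norm (opA S (X m) - opA S (X n)) < e / (2 * K)"
      using CauchyD[OF LIMSEQ_imp_Cauchy[OF a], of "e / (2 * K)"] e K(1) by auto
    have "norm (f (X m) - f (X n)) < e" if "m \<ge> max N1 N2" "n \<ge> max N1 N2" for m n
    proof -
      have "norm (f (X m) - f (X n)) <= K * (norm (X m - X n) + norm (opA S (X m) - opA S (X n)))"
        using f(1)[OF D D, of m n] f(2)[of "X m - X n"] D by (simp add: op_diff Dom_simps)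
      also have "\<dots> < K * (e / (2 * K) + e / (2 * K))"
        using N1[of m n] N2[of m n] that K(1) by (intro mult_strict_left_mono add_strict_mono) auto
      also have "\<dots> = e" using K(1) by (simp add: field_simps)
      finally show ?thesis .
    qed
    then show "\<exists>M. \<forall>m\<ge>M. \<forall>n\<ge>M. norm (f (X m) - f (X n)) < e" by blast
  qed
  obtain u where u: "(%n. opBc S (X n)) \<longlonglongrightarrow> u" using cg[OF op_diff(2) K(2)] by (auto simp: convergent_def)
  obtain w where w: "(%n. opBd S (X n)) \<longlonglongrightarrow> w" using cg[OF op_diff(3) K(3)] by (auto simp: convergent_def)
  obtain y where y: "(%n. opC S (X n)) \<longlonglongrightarrow> y" using cg[OF op_diff(4) K(4)] by (auto simp: convergent_def)
  have "(x, a, u, y, w) \<in> graph"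
  proof (rule closed_sequentially[OF graph_closed])
    show "(%n. (X n, opA S (X n), opBc S (X n), opC S (X n), opBd S (X n))) \<longlonglongrightarrow> (x, a, u, y, w)"
      by (intro tendsto_Pair x a u y w)
    show "(X n, opA S (X n), opBc S (X n), opC S (X n), opBd S (X n)) \<in> graph" for n
      using D by (simp add: graph_iff)
  qed
  then show "x \<in> Dom S" "opA S x = a" "(%n. opBc S (X n)) \<longlonglongrightarrow> opBc S x"
    "(%n. opC S (X n)) \<longlonglongrightarrow> opC S x" "(%n. opBd S (X n)) \<longlonglongrightarrow> opBd S x"
    using u w y by (auto simp: graph_iff)
qed

lemma op_continuous:
  assumes D: "!!t. t \<in> I ==> f t \<in> Dom S" and f: "continuous_on I f" and a: "continuous_on I (%t. opA S (f t))"
  shows "continuous_on I (%t::real. opBc S (f t))" "continuous_on I (%t. opC S (f t))" "continuous_on I (%t. opBd S (f t))"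
proof -
  have lim: "(%n. opBc S (f (x n))) \<longlonglongrightarrow> opBc S (f l) & (%n. opC S (f (x n))) \<longlonglongrightarrow> opC S (f l)
      & (%n. opBd S (f (x n))) \<longlonglongrightarrow> opBd S (f l)"
    if x: "!!n. x n \<in> I" "l \<in> I" "x \<longlonglongrightarrow> l" for x l
  proof -
    have fx: "(%n. f (x n)) \<longlonglongrightarrow> f l" and ax: "(%n. opA S (f (x n))) \<longlonglongrightarrow> opA S (f l)"
      using x f[unfolded continuous_on_sequentially comp_def] a[unfolded continuous_on_sequentially comp_def]
      by blast+
    show ?thesis using op_limit(3-5)[of "%n. f (x n)", OF D[OF x(1)] fx ax] by simp
  qed
  show "continuous_on I (%t. opBc S (f t))" "continuous_on I (%t. opC S (f t))" "continuous_on I (%t. opBd S (f t))"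
    unfolding continuous_on_sequentially comp_def using lim by auto
qed

lemma op_integral:
  fixes a b :: real
  assumes D: "!!t. a <= t ==> t <= b ==> f t \<in> Dom S" and f: "continuous_on {a..b} f"
    and a: "continuous_on {a..b} (%t. opA S (f t))"
  shows "integral {a..b} f \<in> Dom S" "opA S (integral {a..b} f) = integral {a..b} (%t. opA S (f t))"
    "opBc S (integral {a..b} f) = integral {a..b} (%t. opBc S (f t))"
    "opC S (integral {a..b} f) = integral {a..b} (%t. opC S (f t))"
    "opBd S (integral {a..b} f) = integral {a..b} (%t. opBd S (f t))"
proof -
  note c = op_continuous[of "{a..b}" f, OF _ f a]
  have "integral {a..b} (%t. (f t, opA S (f t), opBc S (f t), opC S (f t), opBd S (f t))) \<in> graph"
    by (rule integral_in_subspace[OF graph_subspace graph_closed])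
       (use D c f a in \<open>auto simp: graph_iff intro!: continuous_intros\<close>)
  moreover have "integral {a..b} (%t. (f t, opA S (f t), opBc S (f t), opC S (f t), opBd S (f t)))
     = (integral {a..b} f, integral {a..b} (%t. opA S (f t)), integral {a..b} (%t. opBc S (f t)),
        integral {a..b} (%t. opC S (f t)), integral {a..b} (%t. opBd S (f t)))"
    using D c f a by (simp add: integral_Pair continuous_on_Pair)
  ultimately show "integral {a..b} f \<in> Dom S" "opA S (integral {a..b} f) = integral {a..b} (%t. opA S (f t))"
    "opBc S (integral {a..b} f) = integral {a..b} (%t. opBc S (f t))"
    "opC S (integral {a..b} f) = integral {a..b} (%t. opC S (f t))"
    "opBd S (integral {a..b} f) = integral {a..b} (%t. opBd S (f t))"
    by (auto simp: graph_iff)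
qed

section \<open>Trajectories of the undisturbed system, with input \<open>opBc S (z t)\<close> and
  output \<open>opC S (z t)\<close>\<close>

definition lsol :: "(real => 'x) => bool" where
  "lsol z \<longleftrightarrow> (\<forall>t\<ge>0. z t \<in> Dom S & opBd S (z t) = 0 &
      (z has_vector_derivative opA S (z t)) (at t within {0..})) &
    continuous_on {0..} (%t. opA S (z t))"

lemma lsolD:
  assumes "lsol z" "0 <= t"
  shows "z t \<in> Dom S" "opBd S (z t) = 0" "(z has_vector_derivative opA S (z t)) (at t within {0..})"
    "opBc S (z t) \<in> U" "opC S (z t) \<in> U"
  using assms op_U unfolding lsol_def by auto

lemma lsol_cont:
  assumes z: "lsol z"
  shows "continuous_on {0..} z" "continuous_on {0..} (%t. opA S (z t))"
    "continuous_on {0..} (%t. opBc S (z t))" "continuous_on {0..} (%t. opC S (z t))"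
proof -
  show 1: "continuous_on {0..} z"
    by (rule continuous_on_of_deriv) (use lsolD[OF z] in auto)
  show 2: "continuous_on {0..} (%t. opA S (z t))" using z unfolding lsol_def by auto
  show "continuous_on {0..} (%t. opBc S (z t))" "continuous_on {0..} (%t. opC S (z t))"
    using op_continuous[OF _ 1 2] lsolD(1)[OF z] by auto
qed

lemma lsol_diff:
  assumes z: "lsol z" and w: "lsol w" shows "lsol (%t. z t - w t)"
  unfolding lsol_def
proof (intro conjI allI impI)
  fix t :: real assume t: "0 <= t"
  note zt = lsolD[OF z t] and wt = lsolD[OF w t]
  show "z t - w t \<in> Dom S" "opBd S (z t - w t) = 0" using zt wt by (auto simp: Dom_simps op_diff)
  show "((%t. z t - w t) has_vector_derivative opA S (z t - w t)) (at t within {0..})"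
    using has_vector_derivative_diff[OF zt(3) wt(3)] zt wt by (simp add: op_diff)
next
  have "continuous_on {0..} (%t. opA S (z t) - opA S (w t))" by (intro continuous_intros lsol_cont z w)
  then show "continuous_on {0..} (%t. opA S (z t - w t))"
    by (rule continuous_on_eq) (use lsolD(1)[OF z] lsolD(1)[OF w] in \<open>simp add: op_diff\<close>)
qed

lemma lsol_scaleR:
  assumes z: "lsol z" shows "lsol (%t. c *\<^sub>R z t)"
  unfolding lsol_def
proof (intro conjI allI impI)
  fix t :: real assume t: "0 <= t"
  note zt = lsolD[OF z t]
  show "c *\<^sub>R z t \<in> Dom S" "opBd S (c *\<^sub>R z t) = 0" using zt by (auto simp: Dom_simps op_scaleR)
  show "((%t. c *\<^sub>R z t) has_vector_derivative opA S (c *\<^sub>R z t)) (at t within {0..})"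
    using bounded_linear.has_vector_derivative[OF bounded_linear_scaleR_right zt(3)] zt by (simp add: op_scaleR)
next
  have "continuous_on {0..} (%t. c *\<^sub>R opA S (z t))" by (intro continuous_intros lsol_cont z)
  then show "continuous_on {0..} (%t. opA S (c *\<^sub>R z t))"
    by (rule continuous_on_eq) (use lsolD(1)[OF z] in \<open>simp add: op_scaleR\<close>)
qed

lemma lsol_add:
  assumes z: "lsol z" and w: "lsol w" shows "lsol (%t. z t + w t)"
  using lsol_diff[OF z lsol_scaleR[OF w, of "-1"]] by simp

lemma lsol_shift:
  assumes z: "lsol z" and h: "0 <= h" shows "lsol (%t. z (t + h))"
  unfolding lsol_def
proof (intro conjI allI impI)
  fix t :: real assume t: "0 <= t"
  then have th: "0 <= t + h" using h by simp
  note zt = lsolD[OF z th]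
  show "z (t + h) \<in> Dom S" "opBd S (z (t + h)) = 0" using zt by auto
  have "((%t. t + h) has_vector_derivative 1) (at t within {0..})"
    by (auto intro!: derivative_eq_intros)
  moreover have "(z has_vector_derivative opA S (z (t + h))) (at (t + h) within (%t. t + h) ` {0..})"
    by (rule has_vector_derivative_within_subset[OF zt(3)]) (use h in auto)
  ultimately show "((%t. z (t + h)) has_vector_derivative opA S (z (t + h))) (at t within {0..})"
    using vector_diff_chain_within[of "%t. t + h" 1 t "{0..}" z] by (simp add: o_def)
next
  show "continuous_on {0..} (%t. opA S (z (t + h)))"
    by (rule continuous_on_shift[OF lsol_cont(2)[OF z] h])
qed

text \<open>Since \<open>z 0 = 0\<close>, also \<open>opA S (z 0) = 0\<close>, and resting at zero
  up to time \<open>s\<close> joins \<open>z\<close> without a jump of the derivative. The delay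
  transfers a bound for one long horizon to the shorter ones.\<close>

lemma lsol_prepend:
  assumes z: "lsol z" and s: "0 <= s" and z0: "z 0 = 0"
  shows "lsol (%t. z (max 0 (t - s)))"
  unfolding lsol_def
proof (intro conjI allI impI)
  let ?a = "%t. opA S (z (max 0 (t - s)))"
  have c: "continuous_on {0..} ?a"
    by (rule continuous_on_compose2[OF lsol_cont(2)[OF z]]) (auto intro!: continuous_intros)
  then show "continuous_on {0..} ?a" .
  fix t :: real assume t: "0 <= t"
  show "z (max 0 (t - s)) \<in> Dom S" "opBd S (z (max 0 (t - s))) = 0" using lsolD[OF z] by auto
  \<comment> \<open>Differentiability at the joint comes from writing the delayed trajectory as a
    primitive of the continuous function \<open>?a\<close>.\<close>
  have eq: "integral {0..r} ?a = z (max 0 (r - s))" if r: "0 <= r" for r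
  proof -
    have 0: "integral {0..q} ?a = 0" if "q <= s" for q
    proof -
      have "integral {0..q} ?a = integral {0..q} (%t. 0)"
        by (intro integral_cong) (use that in \<open>simp add: max_absorb1 z0 op_0\<close>)
      then show ?thesis by simp
    qed
    show ?thesis
    proof (cases "r <= s")
      case True then show ?thesis using 0 z0 by (simp add: max_def)
    next
      case False
      have "integral {0..r} ?a = integral {0..s} ?a + integral {s..r} ?a"
        using integral_split[OF c s, of r] False by simp
      also have "integral {s..r} ?a = integral {0..r-s} (%t. ?a (t + s))"
      proof -
        have "integral {0..r-s} (%t. ?a (t + s)) = integral {0+s..(r-s)+s} ?a" by (rule integral_shift_le)
        then show ?thesis by simp
      qed
      also have "\<dots> = integral {0..r-s} (%t. opA S (z t))"
        by (intro integral_cong) auto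
      also have "\<dots> = z (r - s) - z 0"
        by (rule integral_deriv) (use False lsolD(3)[OF z] in auto)
      finally show ?thesis using 0[of s] False z0 by (simp add: max_def)
    qed
  qed
  show "((%t. z (max 0 (t - s))) has_vector_derivative ?a t) (at t within {0..})"
    by (rule has_vector_derivative_transform[OF _ _ antideriv[OF c t]]) (use t eq in auto)
qed

text \<open>Passivity bounds \<open>opA S (z s) \<bullet> z s\<close>, half the derivative of the
  squared norm, by the supplied power.\<close>

lemma lsol_energy:
  assumes z: "lsol z" and t: "0 <= t"
  shows "(norm (z t))\<^sup>2 <= (norm (z 0))\<^sup>2 + 2 * integral {0..t} (%s. opBc S (z s) \<bullet> opC S (z s))"
proof -
  have "integral {0..t} (%s. 2 * (opA S (z s) \<bullet> z s)) = (z t \<bullet> z t) - (z 0 \<bullet> z 0)"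
  proof (rule integral_deriv)
    fix s :: real assume s: "0 <= s"
    note d = lsolD(3)[OF z s]
    have "((%s. z s \<bullet> z s) has_derivative (%h. z s \<bullet> (h *\<^sub>R opA S (z s)) + (h *\<^sub>R opA S (z s)) \<bullet> z s)) (at s within {0..})"
      using has_derivative_inner[OF d[unfolded has_vector_derivative_def] d[unfolded has_vector_derivative_def]] .
    then show "((%s. z s \<bullet> z s) has_vector_derivative 2 * (opA S (z s) \<bullet> z s)) (at s within {0..})"
      unfolding has_vector_derivative_def by (simp add: inner_commute mult.assoc mult.left_commute)
  qed (use t in auto)
  moreover have "integral {0..t} (%s. 2 * (opA S (z s) \<bullet> z s)) <= integral {0..t} (%s. 2 * (opBc S (z s) \<bullet> opC S (z s)))"
  proof (rule integral_le)
    fix s assume "s \<in> {0..t}"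
    then show "2 * (opA S (z s) \<bullet> z s) <= 2 * (opBc S (z s) \<bullet> opC S (z s))"
      using imp_passive lsolD(1,2)[OF z, of s] by auto
  qed (intro integrable_cont continuous_intros continuous_on_sub0 lsol_cont z order_refl)+
  ultimately show ?thesis by (simp add: power2_norm_eq_inner)
qed

lemma lsol_well_posed:
  obtains \<tau> K where "0 < \<tau>" "0 < K"
    "!!z. lsol z ==> norm (z \<tau>) <= K * (norm (z 0) + l2n \<tau> (%t. opBc S (z t)))"
    "!!z. lsol z ==> l2n \<tau> (%t. opC S (z t)) <= K * (norm (z 0) + l2n \<tau> (%t. opBc S (z t)))"
proof -
  from wp[unfolded well_posed_def] obtain \<tau> M where \<tau>: "0 < \<tau>" "0 < M"
    and wp': "\<forall>x u wd y. classical_solution U S id 0 x u wd y -->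
        (\<forall>t\<ge>0. fst (wd t) = 0 & fst (snd (wd t)) = 0) -->
        (norm (x \<tau>))\<^sup>2 + (LINT t:{0..\<tau>}|lebesgue. (norm (y t))\<^sup>2)
          <= M * ((norm (x 0))\<^sup>2 + (LINT t:{0..\<tau>}|lebesgue. (norm (u t))\<^sup>2 + (norm (snd (snd (wd t))))\<^sup>2))"
    by blast
  have *: "norm (z \<tau>) <= sqrt M * (norm (z 0) + l2n \<tau> (%t. opBc S (z t))) &
      l2n \<tau> (%t. opC S (z t)) <= sqrt M * (norm (z 0) + l2n \<tau> (%t. opBc S (z t)))" if z: "lsol z" for z
  proof -
    let ?u = "%t. opBc S (z t)" and ?y = "%t. opC S (z t)"
    have B0: "opB1 S 0 = 0" using linear_simps(3)[OF B1_linear] .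
    have "classical_solution U S id 0 z ?u (%t. (0, 0, 0)) ?y"
      unfolding classical_solution_def
      using lsolD[OF z] lsol_cont[OF z] B0 subspace_0[OF U_subspace] by (auto simp: dist_space_def)
    from wp'[rule_format, OF this]
    have "(norm (z \<tau>))\<^sup>2 + (l2n \<tau> ?y)\<^sup>2 <= M * ((norm (z 0))\<^sup>2 + (l2n \<tau> ?u)\<^sup>2)"
      by (simp add: lint_sq continuous_on_sub0 lsol_cont z)
    also have "\<dots> <= M * (norm (z 0) + l2n \<tau> ?u)\<^sup>2"
      using \<tau> by (intro mult_left_mono) (auto simp: power2_sum)
    also have "\<dots> = (sqrt M * (norm (z 0) + l2n \<tau> ?u))\<^sup>2" using \<tau> by (simp add: power_mult_distrib)
    finally have le: "(norm (z \<tau>))\<^sup>2 + (l2n \<tau> ?y)\<^sup>2 <= (sqrt M * (norm (z 0) + l2n \<tau> ?u))\<^sup>2" .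
    have 0: "0 <= sqrt M * (norm (z 0) + l2n \<tau> ?u)" using \<tau> by simp
    have "(norm (z \<tau>))\<^sup>2 <= (sqrt M * (norm (z 0) + l2n \<tau> ?u))\<^sup>2"
      using le zero_le_power2[of "l2n \<tau> ?y"] by linarith
    moreover have "(l2n \<tau> ?y)\<^sup>2 <= (sqrt M * (norm (z 0) + l2n \<tau> ?u))\<^sup>2"
      using le zero_le_power2[of "norm (z \<tau>)"] by linarith
    ultimately show ?thesis using 0 by (auto intro: power2_le_imp_le)
  qed
  show ?thesis by (rule that[of \<tau> "sqrt M"]) (use \<tau> * in auto)
qed

end

lemma l2n_split:
  assumes f: "continuous_on {0..} f" and "0 <= a" "0 <= b"
  shows "l2n (a + b) f <= l2n a f + l2n b (%t. f (t + a))"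
proof -
  have c: "continuous_on {0..} (%t. (norm (f t))\<^sup>2)" by (intro continuous_intros f)
  have "integral {0..a+b} (%t. (norm (f t))\<^sup>2) = integral {0..a} (%t. (norm (f t))\<^sup>2) + integral {a..a+b} (%t. (norm (f t))\<^sup>2)"
    using integral_split[OF c, of a "a+b"] assms by simp
  also have "integral {a..a+b} (%t. (norm (f t))\<^sup>2) = integral {0..b} (%t. (norm (f (t + a)))\<^sup>2)"
    using integral_shift_le[of 0 b "%t. (norm (f t))\<^sup>2" a] by (simp add: add.commute)
  finally show ?thesis
    unfolding l2n_def
    by (simp only:) (intro sqrt_add_le_add_sqrt integral_nonneg integrable_cont continuous_on_sub0[OF c]
        continuous_intros continuous_on_sub0[OF continuous_on_shift[OF f]]; use assms in auto)
qed

section \<open>Well-posedness on arbitrary horizons and solvability for dense inputs\<close>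

context passive_node
begin

text \<open>Well-posedness on the horizon \<open>\<sigma>\<close> with the intermediate states
  included; \<open>1 <= K\<close> lets \<open>K\<close> absorb other constants.\<close>

definition good :: "real => real => bool" where
  "good \<sigma> K \<longleftrightarrow> 0 < \<sigma> & 1 <= K & (\<forall>z. lsol z -->
     (\<forall>t\<in>{0..\<sigma>}. norm (z t) <= K * (norm (z 0) + l2n \<sigma> (%t. opBc S (z t)))) &
     l2n \<sigma> (%t. opC S (z t)) <= K * (norm (z 0) + l2n \<sigma> (%t. opBc S (z t))))"

lemma goodD:
  assumes "good \<sigma> K"
  shows "0 < \<sigma>" "1 <= K"
    "lsol z ==> 0 <= t ==> t <= \<sigma> ==> norm (z t) <= K * (norm (z 0) + l2n \<sigma> (%t. opBc S (z t)))"
    "lsol z ==> l2n \<sigma> (%t. opC S (z t)) <= K * (norm (z 0) + l2n \<sigma> (%t. opBc S (z t)))"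
  using assms unfolding good_def by auto

lemma lsol_energy_l2n:
  assumes z: "lsol z" and t: "0 <= t"
  shows "(norm (z t))\<^sup>2 <= (norm (z 0))\<^sup>2 + 2 * l2n t (%t. opBc S (z t)) * l2n t (%t. opC S (z t))"
proof -
  have "\<bar>integral {0..t} (%s. opBc S (z s) \<bullet> opC S (z s))\<bar> <= l2n t (%t. opBc S (z t)) * l2n t (%t. opC S (z t))"
    by (intro l2n_inner continuous_on_sub0 lsol_cont z order_refl)
  then show ?thesis using lsol_energy[OF z t] by linarith
qed

text \<open>Iterating well-posedness over multiples of \<open>\<tau>0\<close> controls the output
  and the states at the end points. Intermediate states follow from the energy inequality, in which
  input and output on \<open>{0..t}\<close> are already bounded.\<close>

lemma good_exists:
  assumes "0 <= \<tau>"
  obtains \<sigma> K where "\<tau> <= \<sigma>" "good \<sigma> K"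
proof -
  obtain \<tau>0 K0 where \<tau>0: "0 < \<tau>0" "0 < K0"
    and wp1: "!!z. lsol z ==> norm (z \<tau>0) <= K0 * (norm (z 0) + l2n \<tau>0 (%t. opBc S (z t)))"
    and wp2: "!!z. lsol z ==> l2n \<tau>0 (%t. opC S (z t)) <= K0 * (norm (z 0) + l2n \<tau>0 (%t. opBc S (z t)))"
    by (rule lsol_well_posed) (rule that)
  define h where "h n = real n * \<tau>0" for n
  have h0: "0 <= h n" "h (Suc n) = h n + \<tau>0" for n using \<tau>0 by (auto simp: h_def algebra_simps)
  have W: "\<exists>K\<ge>1. \<forall>z. lsol z --> norm (z (h n)) <= K * (norm (z 0) + l2n (h n) (%t. opBc S (z t))) &
      l2n (h n) (%t. opC S (z t)) <= K * (norm (z 0) + l2n (h n) (%t. opBc S (z t)))" for n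
  proof (induction n)
    case 0
    then show ?case by (intro exI[of _ 1]) (auto simp: h_def l2n_def)
  next
    case (Suc n)
    then obtain K where K: "1 <= K" "!!z. lsol z ==> norm (z (h n)) <= K * (norm (z 0) + l2n (h n) (%t. opBc S (z t)))"
      "!!z. lsol z ==> l2n (h n) (%t. opC S (z t)) <= K * (norm (z 0) + l2n (h n) (%t. opBc S (z t)))" by auto
    show ?case
    \<comment> \<open>\<open>K\<close> bounds the output on the first \<open>n\<close> windows; the
      last window restarts from a state of at most \<open>K\<close> times the size of the data, and
      \<open>K0 * (K + 1)\<close> bounds its share.\<close>
    proof (intro exI[of _ "K + K0 * (K + 1)"] conjI allI impI)
      show "1 <= K + K0 * (K + 1)" using K(1) \<tau>0 by (intro add_increasing2 mult_nonneg_nonneg) auto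
      fix z assume z: "lsol z"
      let ?u = "%t. opBc S (z t)" and ?y = "%t. opC S (z t)"
      let ?X = "norm (z 0) + l2n (h (Suc n)) ?u"
      have zs: "lsol (%t. z (t + h n))" by (rule lsol_shift[OF z h0(1)])
      have X0: "0 <= ?X" by simp
      have X1: "norm (z 0) + l2n (h n) ?u <= ?X"
        using \<tau>0 by (intro add_left_mono l2n_mono_time continuous_on_sub0 lsol_cont z) (auto simp: h0(2))
      have a: "norm (z (h n)) <= K * ?X"
        by (rule order_trans[OF K(2)[OF z]]) (use K(1) X1 in \<open>intro mult_left_mono, auto\<close>)
      have b: "l2n \<tau>0 (%t. ?u (t + h n)) <= ?X"
      proof -
        have "l2n \<tau>0 (%t. ?u (t + h n)) <= l2n (\<tau>0 + h n) ?u" by (rule l2n_shift[OF lsol_cont(3)[OF z] h0(1)])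
        also have "\<tau>0 + h n = h (Suc n)" by (simp add: h0)
        finally show ?thesis using norm_ge_zero[of "z 0"] by linarith
      qed
      have c: "K0 * (norm (z (h n)) + l2n \<tau>0 (%t. ?u (t + h n))) <= K0 * (K + 1) * ?X"
      proof -
        have "norm (z (h n)) + l2n \<tau>0 (%t. ?u (t + h n)) <= (K + 1) * ?X"
          using a b by (simp add: algebra_simps)
        then show ?thesis using \<tau>0 mult_left_mono[of _ _ K0] by (simp add: mult.assoc)
      qed
      have KX: "0 <= K * ?X" using K(1) X0 by simp
      have "norm (z (h (Suc n))) <= K0 * (K + 1) * ?X"
        using wp1[OF zs] c by (simp add: h0 add.commute)
      then show "norm (z (h (Suc n))) <= (K + K0 * (K + 1)) * ?X"
        unfolding distrib_right[of K] using KX by linarith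
      have "l2n (h (Suc n)) ?y <= l2n (h n) ?y + l2n \<tau>0 (%t. ?y (t + h n))"
        unfolding h0(2) by (rule l2n_split[OF lsol_cont(4)[OF z] h0(1)]) (use \<tau>0 in simp)
      also have "l2n (h n) ?y <= K * ?X"
        by (rule order_trans[OF K(3)[OF z]]) (use K(1) X1 in \<open>intro mult_left_mono, auto\<close>)
      also have "l2n \<tau>0 (%t. ?y (t + h n)) <= K0 * (K + 1) * ?X"
        using wp2[OF zs] c by simp
      finally show "l2n (h (Suc n)) ?y <= (K + K0 * (K + 1)) * ?X"
        unfolding distrib_right[of K] by simp
    qed
  qed
  obtain n where n: "\<tau> / \<tau>0 < real n" using reals_Archimedean2 by blast
  then have n': "\<tau> < h n" using \<tau>0 by (simp add: h_def field_simps)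
  then have n': "\<tau> <= h n" "0 < h n" using assms by auto
  obtain K where K: "1 <= K" "!!z. lsol z ==> l2n (h n) (%t. opC S (z t)) <= K * (norm (z 0) + l2n (h n) (%t. opBc S (z t)))"
    using W[of n] by auto
  \<comment> \<open>\<open>1 + 2 * K\<close> is the factor in the energy inequality when the input
    has norm at most \<open>X\<close> and the output at most \<open>K * X\<close>; being at least
    one, it exceeds its own square root.\<close>
  have "good (h n) (1 + 2 * K)"
    unfolding good_def
  proof (intro conjI allI impI ballI)
    fix z assume z: "lsol z"
    let ?u = "%t. opBc S (z t)" and ?y = "%t. opC S (z t)"
    define X where "X = norm (z 0) + l2n (h n) ?u"
    have X0: "0 <= X" "norm (z 0) <= X" "l2n (h n) ?u <= X" by (auto simp: X_def)
    have y: "l2n (h n) ?y <= K * X" using K(2)[OF z] by (simp add: X_def)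
    have "K * X <= (1 + 2 * K) * X" using X0 K(1) by (intro mult_right_mono) auto
    then show "l2n (h n) ?y <= (1 + 2 * K) * (norm (z 0) + l2n (h n) ?u)"
      using y unfolding X_def by linarith
    fix t assume t: "t \<in> {0..h n}"
    have "(norm (z t))\<^sup>2 <= (norm (z 0))\<^sup>2 + 2 * l2n t ?u * l2n t ?y"
      using lsol_energy_l2n[OF z] t by auto
    also have "\<dots> <= X\<^sup>2 + 2 * X * (K * X)"
    proof -
      have "l2n t ?u <= X"
        using X0(3) t l2n_mono_time[of "h n" ?u t] continuous_on_sub0[OF lsol_cont(3)[OF z], of 0 "h n"] by simp
      moreover have "l2n t ?y <= K * X"
        using y t l2n_mono_time[of "h n" ?y t] continuous_on_sub0[OF lsol_cont(4)[OF z], of 0 "h n"] by simp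
      ultimately have "l2n t ?u * l2n t ?y <= X * (K * X)"
        using X0 by (intro mult_mono) auto
      moreover have "(norm (z 0))\<^sup>2 <= X\<^sup>2" using X0 by (intro power_mono) auto
      ultimately show ?thesis by simp
    qed
    also have "\<dots> = (1 + 2 * K) * X\<^sup>2" by (simp add: power2_eq_square algebra_simps)
    also have "\<dots> <= ((1 + 2 * K) * X)\<^sup>2"
    proof -
      have "(1 + 2 * K) * 1 <= (1 + 2 * K) * (1 + 2 * K)" using K(1) by (intro mult_left_mono) auto
      then show ?thesis unfolding power_mult_distrib by (intro mult_right_mono) (auto simp: power2_eq_square)
    qed
    finally have "norm (z t) <= (1 + 2 * K) * X"
      by (rule power2_le_imp_le) (use X0 K in auto)
    then show "norm (z t) <= (1 + 2 * K) * (norm (z 0) + l2n (h n) ?u)" by (simp add: X_def)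
  qed (use n' K in auto)
  then show ?thesis using n' that by blast
qed

text \<open>Causality: delaying \<open>z\<close> by \<open>\<sigma> - h\<close> preserves both
  norms, so the constant of the long horizon serves every shorter \<open>h\<close> and does not
  deteriorate as \<open>h\<close> tends to zero.\<close>

lemma output_estimate_zero:
  assumes g: "good \<sigma> K" and z: "lsol z" and z0: "z 0 = 0" and h: "0 <= h" "h <= \<sigma>"
  shows "l2n h (%t. opC S (z t)) <= K * l2n h (%t. opBc S (z t))"
proof -
  define s where "s = \<sigma> - h"
  have s: "0 <= s" "s + h = \<sigma>" "h + s = \<sigma>" using h by (auto simp: s_def)
  define w where "w t = z (max 0 (t - s))" for t
  have w: "lsol w" unfolding w_def by (rule lsol_prepend[OF z s(1) z0])
  have w0: "w 0 = 0" using s z0 by (simp add: w_def)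
  have ws: "w (t + s) = z t" if "0 <= t" for t using that by (simp add: w_def)
  have "l2n h (%t. opC S (z t)) = l2n h (%t. opC S (w (t + s)))"
    by (rule l2n_cong) (simp add: ws)
  also have "\<dots> <= l2n (h + s) (%t. opC S (w t))" by (rule l2n_shift[OF lsol_cont(4)[OF w] s(1)])
  also have "\<dots> <= K * l2n \<sigma> (%t. opBc S (w t))" using goodD(4)[OF g w] by (simp add: s w0)
  also have "l2n \<sigma> (%t. opBc S (w t)) <= l2n s (%t. opBc S (w t)) + l2n h (%t. opBc S (w (t + s)))"
    using l2n_split[OF lsol_cont(3)[OF w] s(1) h(1)] by (simp add: s)
  also have "l2n s (%t. opBc S (w t)) = l2n s (%t. 0::'u)"
    by (rule l2n_cong) (simp add: w_def max_absorb1 z0 op_0)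
  also have "l2n h (%t. opBc S (w (t + s))) = l2n h (%t. opBc S (z t))"
    by (rule l2n_cong) (simp add: ws)
  finally show ?thesis using goodD(2)[OF g] by simp
qed

lemma lsol_Tsg:
  assumes "generates (ker_B S) (opA S) T" and x: "x \<in> ker_B S"
  shows "lsol (%t. T t x)" "t \<ge> 0 ==> opBc S (T t x) = 0" "T 0 x = x"
proof -
  interpret T: dissipative_semigroup "ker_B S" "opA S" T
    by (rule dissipative_semigroup_generates[OF assms(1)])
  have k: "T t x \<in> ker_B S" if "0 <= t" for t using T.T_D[OF x that] by simp
  have "continuous_on {0..} (%t. opA S (T t x))"
    by (rule continuous_on_eq[OF T.T_cont[of "opA S x"]]) (use T.T_D[OF x] in auto)
  then show "lsol (%t. T t x)"
    unfolding lsol_def using k T.T_deriv[OF x] by (auto simp: ker_B_def)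
  show "t \<ge> 0 ==> opBc S (T t x) = 0" using k by (auto simp: ker_B_def)
  show "T 0 x = x" by simp
qed

lemma expo_solution:
  assumes "expo U u"
  shows "\<exists>p. lsol p & (\<forall>t\<ge>0. opBc S (p t) = u t)"
  using assms
proof induction
  case (exp v j)
  define \<mu> where "\<mu> = real (Suc j)"
  obtain p where p: "p \<in> Dom S" "opA S p = \<mu> *\<^sub>R p" "opBc S p = v" "opBd S p = 0"
    by (rule static_solution[of \<mu> v]) (use exp in \<open>auto simp: \<mu>_def\<close>)
  have "((%t. exp (\<mu> * t) *\<^sub>R p) has_vector_derivative opA S (exp (\<mu> * t) *\<^sub>R p)) (at t within {0..})" for t
  proof -
    have "((%t. exp (\<mu> * t)) has_real_derivative exp (\<mu> * t) * \<mu>) (at t within {0..})"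
      by (auto intro!: derivative_eq_intros)
    from has_vector_derivative_scaleR[OF this has_vector_derivative_const[of p]]
    show ?thesis by (simp add: p op_scaleR mult.commute)
  qed
  moreover have "continuous_on {0..} (%t. opA S (exp (\<mu> * t) *\<^sub>R p))"
    by (simp add: p op_scaleR) (intro continuous_intros)
  ultimately have "lsol (%t. exp (\<mu> * t) *\<^sub>R p)"
    unfolding lsol_def using p by (auto simp: op_scaleR Dom_simps)
  then show ?case using p unfolding \<mu>_def by (intro exI[of _ "%t. exp (real (Suc j) * t) *\<^sub>R p"]) (simp add: op_scaleR)
next
  case (add u w)
  then obtain p q where p: "lsol p" "\<forall>t\<ge>0. opBc S (p t) = u t" and q: "lsol q" "\<forall>t\<ge>0. opBc S (q t) = w t" by auto
  show ?case
    by (intro exI[of _ "%t. p t + q t"] conjI lsol_add p q)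
       (use p q lsolD(1) in \<open>auto simp: op_add\<close>)
qed

text \<open>The response to the exponentials has the right input but the wrong initial state. The
  difference lies in \<open>ker_B\<close> because \<open>opBc S z0 = u 0\<close>, and a semigroup
  orbit removes it without changing the input.\<close>

lemma lsol_exists:
  assumes u: "expo U u" and z0: "z0 \<in> Dom S" "opBd S z0 = 0" "opBc S z0 = u 0"
  obtains z where "lsol z" "z 0 = z0" "!!t. 0 <= t ==> opBc S (z t) = u t"
proof -
  obtain p where p: "lsol p" "!!t. t\<ge>0 ==> opBc S (p t) = u t" using expo_solution[OF u] by auto
  note p0 = lsolD[OF p(1), of 0]
  have k: "z0 - p 0 \<in> ker_B S" using z0 p0 p(2)[of 0] by (simp add: ker_B_def op_diff Dom_simps)
  note T = lsol_Tsg[OF sg.gen k]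
  show ?thesis
  proof (rule that[of "%t. p t + Tsg t (z0 - p 0)"])
    show "lsol (%t. p t + Tsg t (z0 - p 0))" by (intro lsol_add p T)
    show "p 0 + Tsg 0 (z0 - p 0) = z0" by (simp add: T)
    show "opBc S (p t + Tsg t (z0 - p 0)) = u t" if "0 <= t" for t
      using lsolD(1)[OF p(1) that] lsolD(1)[OF T(1) that] T(2)[OF that] p(2)[OF that] by (simp add: op_add)
  qed
qed

lemma lsol_approx:
  assumes z0: "z0 \<in> Dom S" "opBd S z0 = 0" and g: "continuous_on {0..\<tau>} g"
    "!!t. 0 <= t ==> t <= \<tau> ==> g t \<in> U" and \<tau>: "0 < \<tau>" and e: "0 < e"
  obtains z where "lsol z" "z 0 = z0" "l2n \<tau> (%t. opBc S (z t) - g t) <= e"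
proof -
  obtain u where u: "expo U u" "u 0 = opBc S z0" "l2n \<tau> (%t. u t - g t) <= e"
    using expo_approx_l2n[OF U_subspace g op_U(1)[OF z0(1)] \<tau> e] by metis
  obtain z where z: "lsol z" "z 0 = z0" "!!t. 0 <= t ==> opBc S (z t) = u t"
    using lsol_exists[OF u(1) z0 u(2)[symmetric]] by metis
  have "l2n \<tau> (%t. opBc S (z t) - g t) = l2n \<tau> (%t. u t - g t)"
    by (rule l2n_cong) (simp add: z)
  then show ?thesis using that z u by simp
qed

end

section \<open>Saturated feedback\<close>

lemma l2n_sq_combine:
  fixes f g :: "real => 'a::real_inner"
  assumes f: "continuous_on {0..\<tau>} f" and g: "continuous_on {0..\<tau>} g"
  shows "(l2n \<tau> (%t. a *\<^sub>R f t + b *\<^sub>R g t))\<^sup>2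
    = a\<^sup>2 * (l2n \<tau> f)\<^sup>2 + 2 * a * b * integral {0..\<tau>} (%t. f t \<bullet> g t) + b\<^sup>2 * (l2n \<tau> g)\<^sup>2"
proof -
  have "(l2n \<tau> (%t. a *\<^sub>R f t + b *\<^sub>R g t))\<^sup>2 = integral {0..\<tau>} (%t. (norm (a *\<^sub>R f t + b *\<^sub>R g t))\<^sup>2)"
    by (intro l2n_sq continuous_intros f g)
  also have "(%t. (norm (a *\<^sub>R f t + b *\<^sub>R g t))\<^sup>2) =
      (%t. a\<^sup>2 * (norm (f t))\<^sup>2 + 2 * a * b * (f t \<bullet> g t) + b\<^sup>2 * (norm (g t))\<^sup>2)"
  proof
    fix t
    show "(norm (a *\<^sub>R f t + b *\<^sub>R g t))\<^sup>2 = a\<^sup>2 * (norm (f t))\<^sup>2 + 2 * a * b * (f t \<bullet> g t) + b\<^sup>2 * (norm (g t))\<^sup>2"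
      unfolding power2_norm_eq_inner inner_add_left inner_add_right inner_scaleR_left inner_scaleR_right
        inner_commute[of "g t" "f t"] by algebra
  qed
  also have "integral {0..\<tau>} \<dots> = a\<^sup>2 * (l2n \<tau> f)\<^sup>2 + 2 * a * b * integral {0..\<tau>} (%t. f t \<bullet> g t) + b\<^sup>2 * (l2n \<tau> g)\<^sup>2"
    unfolding l2n_sq[OF f] l2n_sq[OF g]
    by (subst integral_add integral_mult_right; (intro integrable_cont continuous_intros f g)?)+ simp
  finally show ?thesis .
qed

lemma l2n_sq_affine_le:
  fixes f :: "real => 'a::real_normed_vector"
  assumes "continuous_on {0..\<tau>} f" "continuous_on {0..\<tau>} g"
    "!!t. 0 <= t ==> t <= \<tau> ==> norm (f t) <= norm (g t) + c" "0 <= c" "0 <= \<tau>"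
  shows "l2n \<tau> f <= l2n \<tau> g + sqrt \<tau> * c"
proof -
  have "l2n \<tau> f <= l2n \<tau> (%t. norm (g t) + c)"
    by (intro l2n_mono_fun continuous_intros assms) (use assms(3,4) in auto)
  also have "\<dots> <= l2n \<tau> (%t. norm (g t)) + l2n \<tau> (%t. c)"
    by (intro l2n_triangle continuous_intros assms)
  also have "l2n \<tau> (%t. c) = sqrt \<tau> * c" using assms by (simp add: l2n_def real_sqrt_mult)
  finally show ?thesis by (simp add: l2n_norm)
qed

locale sat_node = passive_node U S
  for U :: "'u::chilbert_space set"
    and S :: "('x::chilbert_space, 'u, 'd1::chilbert_space, 'd3::chilbert_space) bcs" +
  fixes \<Phi> :: "'u => 'u" and Q :: "'u set" and \<kappa> R L :: real and ur :: "real => 'u"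
  assumes \<Phi>_in: "\<Phi> w \<in> Q" and \<Phi>_VI: "k \<in> Q ==> (w - \<Phi> w) \<bullet> (k - \<Phi> w) <= 0"
    and \<Phi>_U: "w \<in> U ==> \<Phi> w \<in> U" and Q_bounded: "k \<in> Q ==> norm k <= R"
    and \<kappa>: "0 <= \<kappa>" and ur_U: "0 <= t ==> ur t \<in> U"
    and ur_lip: "0 <= s ==> 0 <= t ==> norm (ur t - ur s) <= L * \<bar>t - s\<bar>" and L: "0 <= L"
begin

section \<open>The projection and the error feedback\<close>

lemma \<Phi>_firm: "(norm (\<Phi> a - \<Phi> b))\<^sup>2 <= (\<Phi> a - \<Phi> b) \<bullet> (a - b)"
  using \<Phi>_VI[OF \<Phi>_in, of a b] \<Phi>_VI[OF \<Phi>_in, of b a]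
  by (simp add: power2_norm_eq_inner inner_diff inner_commute algebra_simps)

lemma \<Phi>_lip: "norm (\<Phi> a - \<Phi> b) <= norm (a - b)"
proof (cases "\<Phi> a = \<Phi> b")
  case False
  have "(norm (\<Phi> a - \<Phi> b))\<^sup>2 <= norm (\<Phi> a - \<Phi> b) * norm (a - b)"
    by (rule order_trans[OF \<Phi>_firm norm_cauchy_schwarz])
  then show ?thesis using False by (simp add: power2_eq_square)
qed simp

text \<open>Each of the two variational inequalities is tested with the other point. It serves to
  recognise the projection from another point of the same normal ray.\<close>

lemma \<Phi>_unique:
  assumes "p \<in> Q" "!!k. k \<in> Q ==> (w - p) \<bullet> (k - p) <= 0"
  shows "p = \<Phi> w"
proof -
  have "(p - \<Phi> w) \<bullet> (p - \<Phi> w) <= 0"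
    using assms(2)[OF \<Phi>_in, of w] \<Phi>_VI[OF assms(1), of w]
    by (simp add: inner_diff inner_commute algebra_simps)
  then show ?thesis using inner_ge_zero[of "p - \<Phi> w"] by (simp add: order_antisym)
qed

definition N :: "real => 'u => 'u" where "N t y = \<Phi> (ur t - \<kappa> *\<^sub>R y) - ur t"

text \<open>The factor \<open>\<kappa>\<close> stands on the left so that
  \<open>\<kappa> = 0\<close> is included; for positive \<open>\<kappa>\<close> the dissipated power
  controls the squared change of the feedback.\<close>

lemma N_firm: "\<kappa> * ((N t y1 - N t y2) \<bullet> (y1 - y2)) <= - (norm (N t y1 - N t y2))\<^sup>2"
proof -
  have "ur t - \<kappa> *\<^sub>R y1 - (ur t - \<kappa> *\<^sub>R y2) = - \<kappa> *\<^sub>R (y1 - y2)" by (simp add: algebra_simps)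
  then show ?thesis
    using \<Phi>_firm[of "ur t - \<kappa> *\<^sub>R y1" "ur t - \<kappa> *\<^sub>R y2"] unfolding N_def by simp
qed

lemma N_mono: "(N t y1 - N t y2) \<bullet> (y1 - y2) <= 0"
proof (cases "\<kappa> = 0")
  case True
  have "N t y1 = N t y2" unfolding N_def by (simp only: True) simp
  then show ?thesis by simp
next
  case False
  have "\<kappa> * ((N t y1 - N t y2) \<bullet> (y1 - y2)) <= 0"
    by (rule order_trans[OF N_firm]) simp
  then show ?thesis using False \<kappa> by (simp add: mult_le_0_iff)
qed

lemma N_lip: "norm (N t y1 - N t y2) <= \<kappa> * norm (y1 - y2)"
proof -
  have "ur t - \<kappa> *\<^sub>R y1 - (ur t - \<kappa> *\<^sub>R y2) = - \<kappa> *\<^sub>R (y1 - y2)" by (simp add: algebra_simps)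
  then show ?thesis
    using \<Phi>_lip[of "ur t - \<kappa> *\<^sub>R y1" "ur t - \<kappa> *\<^sub>R y2"] \<kappa> unfolding N_def by simp
qed

lemma N_time: assumes "0 <= s" "0 <= t" shows "norm (N t y - N s y) <= 2 * L * \<bar>t - s\<bar>"
proof -
  have "norm (N t y - N s y) <= norm (\<Phi> (ur t - \<kappa> *\<^sub>R y) - \<Phi> (ur s - \<kappa> *\<^sub>R y)) + norm (ur t - ur s)"
  proof -
    have "N t y - N s y = (\<Phi> (ur t - \<kappa> *\<^sub>R y) - \<Phi> (ur s - \<kappa> *\<^sub>R y)) - (ur t - ur s)"
      unfolding N_def by simp
    then show ?thesis by (simp only: norm_triangle_ineq4)
  qed
  also have "\<dots> <= norm (ur t - ur s) + norm (ur t - ur s)"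
    using \<Phi>_lip[of "ur t - \<kappa> *\<^sub>R y" "ur s - \<kappa> *\<^sub>R y"] by simp
  also have "\<dots> <= 2 * L * \<bar>t - s\<bar>" using ur_lip[OF assms] by simp
  finally show ?thesis .
qed

lemma N_U: "0 <= t ==> y \<in> U ==> N t y \<in> U"
  unfolding N_def by (intro subspace_diff[OF U_subspace] \<Phi>_U subspace_scale[OF U_subspace] ur_U)

lemma ur_cont: "continuous_on {0..} ur"
proof (rule continuous_onI)
  fix x e :: real assume x: "x \<in> {0..}" "0 < e"
  have "dist (ur y) (ur x) <= e" if "y \<in> {0..}" "dist y x < e / (L + 1)" for y
  proof -
    have "norm (ur y - ur x) <= L * \<bar>y - x\<bar>" using ur_lip that x by auto
    also have "\<dots> <= (L + 1) * \<bar>y - x\<bar>" by (rule mult_right_mono) auto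
    also have "\<dots> <= (L + 1) * (e / (L + 1))" using that L by (intro mult_left_mono) (auto simp: dist_real_def)
    also have "\<dots> = e" using L by simp
    finally show ?thesis by (simp add: dist_norm)
  qed
  then show "\<exists>d>0. \<forall>x'\<in>{0..}. dist x' x < d --> dist (ur x') (ur x) <= e"
    using x L by (intro exI[of _ "e / (L + 1)"]) auto
qed

lemma \<Phi>_cont: "continuous_on A f ==> continuous_on A (%t::real. \<Phi> (f t))"
  unfolding continuous_on_iff dist_norm using \<Phi>_lip by (meson le_less_trans)

lemma N_cont:
  assumes "continuous_on {0..} y" shows "continuous_on {0..} (%t. N t (y t))"
  unfolding N_def by (intro continuous_intros \<Phi>_cont ur_cont assms)

text \<open>The defect in the feedback equation. Added to the second component of the disturbance it
  turns any undisturbed trajectory into an exact solution, so small residuals mean small changes of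
  the disturbance.\<close>

definition resid :: "(real => 'x) => real => 'u" where
  "resid z t = opBc S (z t) - N t (opC S (z t))"

lemma resid_cont: "lsol z ==> continuous_on {0..} (resid z)"
  unfolding resid_def by (intro continuous_intros N_cont lsol_cont)

section \<open>Stability in terms of initial state and residual\<close>

lemma diff_cont:
  assumes "lsol z" "lsol w" "0 <= a"
  shows "continuous_on {a..b} (%t. opBc S (z t) - opBc S (w t))"
    "continuous_on {a..b} (%t. opC S (z t) - opC S (w t))" "continuous_on {a..b} (%t. resid z t - resid w t)"
  by (intro continuous_intros continuous_on_sub0 lsol_cont resid_cont assms)+

text \<open>The energy balance of the difference, multiplied by \<open>\<kappa>\<close> so that firm
  nonexpansiveness applies. Here \<open>u t - e t\<close> is the difference of the two feedback
  values; for \<open>\<kappa> = 0\<close> the estimate says that it vanishes in the mean.\<close>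

lemma stab_basic:
  assumes z: "lsol z" and w: "lsol w" and h: "0 <= h"
  defines "u \<equiv> %t. opBc S (z t) - opBc S (w t)" and "y \<equiv> %t. opC S (z t) - opC S (w t)"
    and "e \<equiv> %t. resid z t - resid w t"
  shows "2 * (l2n h (%t. u t - e t))\<^sup>2 <= \<kappa> * (norm (z 0 - w 0))\<^sup>2 + 2 * \<kappa> * l2n h e * l2n h y"
proof -
  note c = diff_cont[OF z w order_refl, of h, folded u_def y_def e_def]
  have d: "opBc S (z t - w t) = u t" "opC S (z t - w t) = y t" if "0 <= t" for t
    using lsolD(1)[OF z that] lsolD(1)[OF w that] by (auto simp: u_def y_def op_diff)
  have "0 <= (norm (z 0 - w 0))\<^sup>2 + 2 * integral {0..h} (%t. opBc S (z t - w t) \<bullet> opC S (z t - w t))"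
    using lsol_energy[OF lsol_diff[OF z w] h] zero_le_power2[of "norm (z h - w h)"] by linarith
  also have "integral {0..h} (%t. opBc S (z t - w t) \<bullet> opC S (z t - w t)) = integral {0..h} (%t. u t \<bullet> y t)"
    by (rule integral_cong) (use d in auto)
  finally have "0 <= \<kappa> * ((norm (z 0 - w 0))\<^sup>2 + 2 * integral {0..h} (%t. u t \<bullet> y t))"
    using \<kappa> by (intro mult_nonneg_nonneg)
  then have 1: "0 <= \<kappa> * (norm (z 0 - w 0))\<^sup>2 + 2 * (\<kappa> * integral {0..h} (%t. u t \<bullet> y t))"
    by (simp only: distrib_left mult.left_commute)
  have "\<kappa> * integral {0..h} (%t. u t \<bullet> y t) = integral {0..h} (%t. \<kappa> * (u t \<bullet> y t))" by simp
  also have "\<dots> <= integral {0..h} (%t. \<kappa> * (e t \<bullet> y t) - (norm (u t - e t))\<^sup>2)"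
  proof (rule integral_le)
    fix t assume "t \<in> {0..h}"
    have ue: "u t - e t = N t (opC S (z t)) - N t (opC S (w t))"
      by (simp add: u_def e_def resid_def)
    have "\<kappa> * ((u t - e t) \<bullet> y t) <= - (norm (u t - e t))\<^sup>2"
      unfolding ue unfolding y_def by (rule N_firm)
    then show "\<kappa> * (u t \<bullet> y t) <= \<kappa> * (e t \<bullet> y t) - (norm (u t - e t))\<^sup>2"
      by (simp add: inner_diff_left algebra_simps)
  qed (intro integrable_cont continuous_intros c)+
  also have "\<dots> = \<kappa> * integral {0..h} (%t. e t \<bullet> y t) - (l2n h (%t. u t - e t))\<^sup>2"
    unfolding l2n_sq[OF continuous_on_diff[OF c(1,3)]]
    by (subst integral_diff; (intro integrable_cont continuous_intros c)?) simp
  also have "\<dots> <= \<kappa> * (l2n h e * l2n h y) - (l2n h (%t. u t - e t))\<^sup>2"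
    using l2n_inner[OF c(3,2)] \<kappa> by (intro diff_right_mono mult_left_mono) auto
  finally show ?thesis using 1 by (simp add: algebra_simps)
qed

text \<open>The constant extracted from the quadratic inequality in \<open>stab_core\<close>; the
  outer factor \<open>K\<close> is the passage from inputs to states and outputs.\<close>

definition Mc :: "real => real" where "Mc K = K * (\<kappa> + 2 * \<kappa> * K + 3)"

lemma Mc_ge: "1 <= K ==> 1 <= Mc K"
proof -
  assume K: "1 <= K"
  have "1 * 1 <= K * (\<kappa> + 2 * \<kappa> * K + 3)" using K \<kappa> by (intro mult_mono) auto
  then show ?thesis by (simp add: Mc_def)
qed

text \<open>With \<open>X\<close> the norm of the feedback difference and \<open>E\<close> the size
  of the data, well-posedness bounds the output by \<open>K * (E + X)\<close>, and the energy
  balance becomes an inequality for \<open>X\<^sup>2\<close> whose right-hand side is of first order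
  in \<open>X\<close>.\<close>

lemma stab_core:
  assumes z: "lsol z" and w: "lsol w" and h: "0 <= h" and K: "1 <= K"
  defines "u \<equiv> %t. opBc S (z t) - opBc S (w t)" and "y \<equiv> %t. opC S (z t) - opC S (w t)"
    and "e \<equiv> %t. resid z t - resid w t"
  assumes y: "l2n h y <= K * (norm (z 0 - w 0) + l2n h u)"
  shows "l2n h u <= Mc K * (norm (z 0 - w 0) + l2n h e)" "l2n h y <= Mc K * (norm (z 0 - w 0) + l2n h e)"
    "K * (norm (z 0 - w 0) + l2n h u) <= Mc K * (norm (z 0 - w 0) + l2n h e)"
proof -
  note c = diff_cont[OF z w order_refl, of h, folded u_def y_def e_def]
  define a X \<epsilon> E where "a = norm (z 0 - w 0)" and "X = l2n h (%t. u t - e t)" and "\<epsilon> = l2n h e" and "E = a + \<epsilon>"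
  have pos: "0 <= a" "0 <= X" "0 <= \<epsilon>" "0 <= E" "a <= E" "\<epsilon> <= E" by (auto simp: a_def X_def \<epsilon>_def E_def)
  have uX: "l2n h u <= X + \<epsilon>" unfolding X_def \<epsilon>_def by (rule l2n_le_add[OF c(1,3)])
  have yX: "l2n h y <= K * (E + X)"
    by (rule order_trans[OF y]) (use uX K in \<open>auto simp: E_def a_def intro!: mult_left_mono\<close>)
  have "2 * X\<^sup>2 <= \<kappa> * a\<^sup>2 + 2 * \<kappa> * \<epsilon> * l2n h y"
    using stab_basic[OF z w h] unfolding X_def a_def \<epsilon>_def u_def e_def y_def .
  also have "\<dots> <= \<kappa> * E\<^sup>2 + 2 * \<kappa> * E * (K * (E + X))"
    using pos yX \<kappa> K by (intro add_mono mult_mono power_mono) auto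
  finally have q: "2 * X\<^sup>2 <= \<kappa> * E\<^sup>2 + 2 * \<kappa> * E * (K * (E + X))" .
  \<comment> \<open>If \<open>X\<close> exceeded this multiple of \<open>E\<close>, then
    \<open>E <= X\<close>, every term on the right would be at most a multiple of
    \<open>E * X\<close>, and division by \<open>X\<close> would contradict the coefficient.\<close>
  have X: "X <= (1 + \<kappa> + 2 * \<kappa> * K) * E"
  proof (rule ccontr)
    assume n: "\<not> X <= (1 + \<kappa> + 2 * \<kappa> * K) * E"
    have kK: "0 <= \<kappa> * K" using \<kappa> K by simp
    have "1 * E <= (1 + \<kappa> + 2 * \<kappa> * K) * E" using pos \<kappa> kK by (intro mult_right_mono) auto
    then have EX: "E <= X" "0 < X" using n pos by auto
    have "\<kappa> * E\<^sup>2 <= \<kappa> * (E * X)" using EX pos \<kappa> by (auto simp: power2_eq_square intro!: mult_left_mono)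
    moreover have "2 * \<kappa> * E * (K * (E + X)) <= 2 * \<kappa> * E * (K * (X + X))"
      using EX pos \<kappa> K by (intro mult_left_mono) auto
    ultimately have "2 * X * X <= (\<kappa> + 4 * (\<kappa> * K)) * E * X"
      using q by (simp add: power2_eq_square algebra_simps)
    then have 2: "2 * X <= (\<kappa> + 4 * (\<kappa> * K)) * E" using EX by simp
    have "(\<kappa> + 4 * (\<kappa> * K)) * E <= 2 * ((1 + \<kappa> + 2 * \<kappa> * K) * E)"
      using pos \<kappa> by (simp add: algebra_simps)
    then show False using 2 n by linarith
  qed
  have u: "l2n h u <= (\<kappa> + 2 * \<kappa> * K + 2) * E"
    using uX X pos by (simp add: algebra_simps)
  have au: "a + l2n h u <= (\<kappa> + 2 * \<kappa> * K + 3) * E"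
    using u pos by (simp add: algebra_simps)
  show 3: "K * (norm (z 0 - w 0) + l2n h u) <= Mc K * (norm (z 0 - w 0) + l2n h e)"
    using mult_left_mono[OF au, of K] K by (simp add: Mc_def a_def E_def \<epsilon>_def mult.assoc)
  show "l2n h y <= Mc K * (norm (z 0 - w 0) + l2n h e)" using y 3 by linarith
  have "l2n h u <= 1 * (norm (z 0 - w 0) + l2n h u)" by simp
  also have "\<dots> <= K * (norm (z 0 - w 0) + l2n h u)"
    using K by (intro mult_right_mono) auto
  finally show "l2n h u <= Mc K * (norm (z 0 - w 0) + l2n h e)" using 3 by linarith
qed

lemma diff_l2n:
  assumes z: "lsol z" and w: "lsol w"
  shows "l2n h (%t. opBc S (z t - w t)) = l2n h (%t. opBc S (z t) - opBc S (w t))"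
    "l2n h (%t. opC S (z t - w t)) = l2n h (%t. opC S (z t) - opC S (w t))"
  by (intro l2n_cong, simp add: op_diff lsolD(1)[OF z] lsolD(1)[OF w])+

lemma stab:
  assumes g: "good \<sigma> K" and z: "lsol z" and w: "lsol w"
  defines "E \<equiv> norm (z 0 - w 0) + l2n \<sigma> (%t. resid z t - resid w t)"
  shows "l2n \<sigma> (%t. opBc S (z t) - opBc S (w t)) <= Mc K * E"
    "l2n \<sigma> (%t. opC S (z t) - opC S (w t)) <= Mc K * E"
    "!!t. 0 <= t ==> t <= \<sigma> ==> norm (z t - w t) <= Mc K * E"
proof -
  note d = diff_l2n[OF z w] and gz = goodD[OF g]
  note dz = lsol_diff[OF z w]
  have h: "0 <= \<sigma>" using gz(1) by simp
  have y: "l2n \<sigma> (%t. opC S (z t) - opC S (w t)) <= K * (norm (z 0 - w 0) + l2n \<sigma> (%t. opBc S (z t) - opBc S (w t)))"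
    using gz(4)[OF dz] unfolding d .
  note sc = stab_core[OF z w h gz(2) y, folded E_def]
  show "l2n \<sigma> (%t. opBc S (z t) - opBc S (w t)) <= Mc K * E"
    "l2n \<sigma> (%t. opC S (z t) - opC S (w t)) <= Mc K * E" by (fact sc)+
  show "norm (z t - w t) <= Mc K * E" if "0 <= t" "t <= \<sigma>" for t
    using gz(3)[OF dz that] sc(3) unfolding d by linarith
qed

text \<open>One step of a projected iteration with parameter \<open>\<rho>\<close>, written for the
  input without its offset \<open>ur t\<close>. For positive \<open>\<rho>\<close> the fixed points
  satisfy \<open>opBc S (z t) = N t (opC S (z t))\<close>, since the two variational inequalities
  differ only by the factor \<open>\<rho>\<close>.\<close>

definition step :: "real => (real => 'x) => real => 'u" where
  "step \<rho> z t = \<Phi> (opBc S (z t) + ur t - \<rho> *\<^sub>R (opBc S (z t) + \<kappa> *\<^sub>R opC S (z t))) - ur t"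

lemma step_cont: "lsol z ==> continuous_on {0..} (step \<rho> z)"
  unfolding step_def by (intro continuous_intros \<Phi>_cont ur_cont lsol_cont)

lemma step_U: "lsol z ==> 0 <= t ==> step \<rho> z t \<in> U"
  unfolding step_def by (intro subspace_diff[OF U_subspace] subspace_add[OF U_subspace] \<Phi>_U
    subspace_scale[OF U_subspace] ur_U lsolD)

text \<open>Points of one normal ray have the same projection, so \<open>p = \<Phi> w\<close> is
  also the projection of \<open>w'\<close>, which differs from the argument of \<open>\<Phi>\<close>
  in the residual only by \<open>(1 / \<rho> - 1) *\<^sub>R \<eta>\<close>, a multiple of the step
  defect.\<close>

lemma resid_step:
  assumes "0 < \<rho>" "\<rho> <= 1"
  shows "norm (resid z t) <= norm ((1 / \<rho>) *\<^sub>R (opBc S (z t) - step \<rho> z t))"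
proof -
  let ?u = "opBc S (z t)" and ?y = "opC S (z t)"
  define w p \<eta> where "w = ?u + ur t - \<rho> *\<^sub>R (?u + \<kappa> *\<^sub>R ?y)" and "p = \<Phi> w" and "\<eta> = ?u + ur t - p"
  define w' where "w' = ur t - \<kappa> *\<^sub>R ?y + (1 / \<rho> - 1) *\<^sub>R \<eta>"
  have w': "w' - p = (1 / \<rho>) *\<^sub>R (w - p)"
    using assms(1) unfolding w'_def \<eta>_def w_def
    by (simp add: scaleR_diff_right scaleR_diff_left scaleR_add_right)
  have "p = \<Phi> w'"
  proof (rule \<Phi>_unique)
    show "p \<in> Q" unfolding p_def by (rule \<Phi>_in)
    fix k assume "k \<in> Q"
    then have "(w - p) \<bullet> (k - p) <= 0" unfolding p_def by (rule \<Phi>_VI)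
    then show "(w' - p) \<bullet> (k - p) <= 0"
      unfolding w' inner_scaleR_left using assms by (simp add: divide_nonpos_pos)
  qed
  then have "norm (p - \<Phi> (ur t - \<kappa> *\<^sub>R ?y)) <= norm ((1 / \<rho> - 1) *\<^sub>R \<eta>)"
    using \<Phi>_lip[of w' "ur t - \<kappa> *\<^sub>R ?y"] by (simp add: w'_def)
  also have "\<dots> = (1 / \<rho> - 1) * norm \<eta>" using assms by (simp add: field_simps)
  finally have 1: "norm (p - \<Phi> (ur t - \<kappa> *\<^sub>R ?y)) <= (1 / \<rho> - 1) * norm \<eta>" .
  have "resid z t = \<eta> + (p - \<Phi> (ur t - \<kappa> *\<^sub>R ?y))" by (simp add: resid_def N_def \<eta>_def)
  then have "norm (resid z t) <= norm \<eta> + (1 / \<rho> - 1) * norm \<eta>"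
    using norm_triangle_ineq[of \<eta> "p - \<Phi> (ur t - \<kappa> *\<^sub>R ?y)"] 1 by simp
  also have "\<dots> = (1 / \<rho>) * norm \<eta>" by (simp add: algebra_simps)
  also have "\<eta> = ?u - step \<rho> z t" by (simp add: \<eta>_def step_def p_def w_def)
  finally show ?thesis using assms by simp
qed

text \<open>The Lions--Stampacchia iteration for the variational inequality satisfied by the input
  is a contraction, since the input-output map of the passive system is monotone and bounded.\<close>

lemma step_contraction:
  assumes g: "good \<sigma> K" and z: "lsol z" and w: "lsol w" and zw: "z 0 = w 0"
  defines "\<rho> \<equiv> 1 / (1 + \<kappa>\<^sup>2 * K\<^sup>2)"
  shows "l2n \<sigma> (%t. step \<rho> z t - step \<rho> w t) <= sqrt (1 - \<rho>) * l2n \<sigma> (%t. opBc S (z t) - opBc S (w t))"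
proof -
  let ?u = "%t. opBc S (z t) - opBc S (w t)" and ?y = "%t. opC S (z t) - opC S (w t)"
  note c = diff_cont[OF z w order_refl, of \<sigma>] and gz = goodD[OF g] and d = diff_l2n[OF z w]
  have \<rho>: "0 < \<rho>" "\<rho> <= 1" "\<rho> * (1 + \<kappa>\<^sup>2 * K\<^sup>2) = 1"
  proof -
    have "0 < 1 + \<kappa>\<^sup>2 * K\<^sup>2" by (simp add: add_pos_nonneg)
    then show "0 < \<rho>" "\<rho> <= 1" "\<rho> * (1 + \<kappa>\<^sup>2 * K\<^sup>2) = 1" by (auto simp: \<rho>_def)
  qed
  have y: "l2n \<sigma> ?y <= K * l2n \<sigma> ?u"
    using gz(4)[OF lsol_diff[OF z w]] unfolding d by (simp add: zw)
  \<comment> \<open>With equal initial states the energy of the difference is supplied by input and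
    output alone, so their integrated product is nonnegative.\<close>
  have "(norm (z \<sigma> - w \<sigma>))\<^sup>2 <= 2 * integral {0..\<sigma>} (%t. opBc S (z t - w t) \<bullet> opC S (z t - w t))"
    using lsol_energy[OF lsol_diff[OF z w], of \<sigma>] gz(1) zw by simp
  then have "0 <= 2 * integral {0..\<sigma>} (%t. opBc S (z t - w t) \<bullet> opC S (z t - w t))"
    by (rule order_trans[OF zero_le_power2])
  also have "integral {0..\<sigma>} (%t. opBc S (z t - w t) \<bullet> opC S (z t - w t)) = integral {0..\<sigma>} (%t. ?u t \<bullet> ?y t)"
    by (rule integral_cong) (use lsolD(1)[OF z] lsolD(1)[OF w] in \<open>auto simp: op_diff\<close>)
  finally have I: "0 <= integral {0..\<sigma>} (%t. ?u t \<bullet> ?y t)" by simp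
  have "l2n \<sigma> (%t. step \<rho> z t - step \<rho> w t) <= l2n \<sigma> (%t. (1 - \<rho>) *\<^sub>R ?u t + (- (\<rho> * \<kappa>)) *\<^sub>R ?y t)"
  proof (rule l2n_mono_fun)
    fix t
    let ?a = "opBc S (z t) + ur t - \<rho> *\<^sub>R (opBc S (z t) + \<kappa> *\<^sub>R opC S (z t))"
    let ?b = "opBc S (w t) + ur t - \<rho> *\<^sub>R (opBc S (w t) + \<kappa> *\<^sub>R opC S (w t))"
    have "step \<rho> z t - step \<rho> w t = \<Phi> ?a - \<Phi> ?b" by (simp add: step_def)
    also have "norm (\<Phi> ?a - \<Phi> ?b) <= norm (?a - ?b)" by (rule \<Phi>_lip)
    also have "?a - ?b = (1 - \<rho>) *\<^sub>R ?u t + (- (\<rho> * \<kappa>)) *\<^sub>R ?y t"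
      by (simp add: algebra_simps)
    finally show "norm (step \<rho> z t - step \<rho> w t) <= norm ((1 - \<rho>) *\<^sub>R ?u t + (- (\<rho> * \<kappa>)) *\<^sub>R ?y t)" .
  qed (intro continuous_intros c continuous_on_sub0 step_cont z w order_refl)+
  also have "\<dots> <= sqrt (1 - \<rho>) * l2n \<sigma> ?u"
  proof (rule power2_le_imp_le)
    have "(l2n \<sigma> (%t. (1 - \<rho>) *\<^sub>R ?u t + (- (\<rho> * \<kappa>)) *\<^sub>R ?y t))\<^sup>2
      = (1 - \<rho>)\<^sup>2 * (l2n \<sigma> ?u)\<^sup>2 + 2 * (1 - \<rho>) * (- (\<rho> * \<kappa>)) * integral {0..\<sigma>} (%t. ?u t \<bullet> ?y t) + (- (\<rho> * \<kappa>))\<^sup>2 * (l2n \<sigma> ?y)\<^sup>2"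
      by (rule l2n_sq_combine[OF c(1,2)])
    also have "\<dots> <= (1 - \<rho>)\<^sup>2 * (l2n \<sigma> ?u)\<^sup>2 + 0 + (- (\<rho> * \<kappa>))\<^sup>2 * (K * l2n \<sigma> ?u)\<^sup>2"
    proof (intro add_mono mult_left_mono power_mono y order_refl)
      have "0 <= 2 * (1 - \<rho>) * (\<rho> * \<kappa>) * integral {0..\<sigma>} (%t. ?u t \<bullet> ?y t)"
        using \<rho> \<kappa> I by (intro mult_nonneg_nonneg) auto
      then show "2 * (1 - \<rho>) * (- (\<rho> * \<kappa>)) * integral {0..\<sigma>} (%t. ?u t \<bullet> ?y t) <= 0" by simp
    qed auto
    \<comment> \<open>\<open>\<rho>\<close> minimises \<open>(1 - \<rho>)\<^sup>2 + \<rho>\<^sup>2 *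
      \<kappa>\<^sup>2 * K\<^sup>2\<close>, and the minimum is \<open>1 - \<rho>\<close>.\<close>
    also have "\<dots> = ((1 - \<rho>)\<^sup>2 + \<rho> * (\<rho> * (1 + \<kappa>\<^sup>2 * K\<^sup>2)) - \<rho>\<^sup>2) * (l2n \<sigma> ?u)\<^sup>2"
      by (simp add: power_mult_distrib power2_eq_square algebra_simps)
    also have "\<dots> = (1 - \<rho>) * (l2n \<sigma> ?u)\<^sup>2" unfolding \<rho>(3) by (simp add: power2_eq_square algebra_simps)
    also have "\<dots> = (sqrt (1 - \<rho>) * l2n \<sigma> ?u)\<^sup>2" using \<rho> by (simp add: power_mult_distrib)
    finally show "(l2n \<sigma> (%t. (1 - \<rho>) *\<^sub>R ?u t + (- (\<rho> * \<kappa>)) *\<^sub>R ?y t))\<^sup>2 <= (sqrt (1 - \<rho>) * l2n \<sigma> ?u)\<^sup>2" .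
  qed (use \<rho> in simp)
  finally show ?thesis .
qed

text \<open>The iterate \<open>step \<rho> z\<close> is in general only close to the input of a
  trajectory, so the contraction is not iterated. Instead the infimum \<open>\<delta>\<close> of the
  defects \<open>d z\<close> satisfies \<open>\<delta> <= q * d z\<close> for every admissible
  \<open>z\<close>, which is impossible for a positive infimum.\<close>

lemma approx_solution:
  assumes g: "good \<sigma> K" and z0: "z0 \<in> Dom S" "opBd S z0 = 0" and e: "0 < e"
  obtains z where "lsol z" "z 0 = z0" "l2n \<sigma> (resid z) <= e"
proof -
  define \<rho> where "\<rho> = 1 / (1 + \<kappa>\<^sup>2 * K\<^sup>2)"
  have \<rho>: "0 < \<rho>" "\<rho> <= 1"
  proof -
    have "0 < 1 + \<kappa>\<^sup>2 * K\<^sup>2" by (simp add: add_pos_nonneg)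
    then show "0 < \<rho>" "\<rho> <= 1" by (auto simp: \<rho>_def)
  qed
  define q where "q = sqrt (1 - \<rho>)"
  have q: "0 <= q" "q < 1" using \<rho> by (auto simp: q_def real_sqrt_lt_1_iff)
  have \<sigma>: "0 < \<sigma>" using goodD(1)[OF g] .
  define d where "d z = l2n \<sigma> (%t. opBc S (z t) - step \<rho> z t)" for z
  define D where "D = d ` {z. lsol z & z 0 = z0}"
  have app: "\<exists>z. lsol z & z 0 = z0 & l2n \<sigma> (%t. opBc S (z t) - f t) <= e'"
    if "continuous_on {0..} f" "!!t. 0 <= t ==> f t \<in> U" "0 < e'" for f e'
    by (rule lsol_approx[OF z0 continuous_on_sub0[OF that(1) order_refl] that(2) \<sigma> that(3)]) auto
  have ne: "D \<noteq> {}"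
    using app[of "%t. 0" 1] subspace_0[OF U_subspace] by (auto simp: D_def)
  have bb: "bdd_below D" unfolding D_def d_def by (rule bdd_belowI2[of _ 0]) simp
  define \<delta> where "\<delta> = Inf D"
  have \<delta>0: "0 <= \<delta>" unfolding \<delta>_def using ne by (intro cInf_greatest) (auto simp: D_def d_def)
  have imp: "\<delta> <= q * d z" if z: "lsol z" "z 0 = z0" for z
  proof (rule field_le_epsilon)
    fix e' :: real assume e': "0 < e'"
    obtain w where w: "lsol w" "w 0 = z0" "l2n \<sigma> (%t. opBc S (w t) - step \<rho> z t) <= e' / 2"
      using app[OF step_cont[OF z(1)] step_U[OF z(1)], of "e'/2"] e' by (metis half_gt_zero)
    note cc = continuous_on_sub0[OF lsol_cont(3)[OF w(1)] order_refl] continuous_on_sub0[OF lsol_cont(3)[OF z(1)] order_refl]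
      continuous_on_sub0[OF step_cont[OF z(1)] order_refl] continuous_on_sub0[OF step_cont[OF w(1)] order_refl]
    have "d w <= l2n \<sigma> (%t. opBc S (w t) - step \<rho> z t) + l2n \<sigma> (%t. step \<rho> z t - step \<rho> w t)"
      unfolding d_def by (intro l2n_dist_triangle cc)
    also have "\<dots> <= e' / 2 + q * l2n \<sigma> (%t. opBc S (z t) - opBc S (w t))"
      using step_contraction[OF g z(1) w(1)] w z by (intro add_mono) (auto simp: q_def \<rho>_def)
    also have "l2n \<sigma> (%t. opBc S (z t) - opBc S (w t)) <= d z + e' / 2"
    proof -
      have "l2n \<sigma> (%t. opBc S (z t) - opBc S (w t)) <= d z + l2n \<sigma> (%t. step \<rho> z t - opBc S (w t))"
        unfolding d_def by (intro l2n_dist_triangle cc)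
      then show ?thesis using w(3) l2n_commute[of \<sigma> "step \<rho> z" "%t. opBc S (w t)"] by linarith
    qed
    also have "q * (d z + e' / 2) <= q * d z + e' / 2" using q e' by (simp add: algebra_simps)
    finally have "d w <= q * d z + e'" using q by (simp add: mult_left_mono)
    moreover have "\<delta> <= d w" unfolding \<delta>_def by (rule cInf_lower[OF _ bb]) (use w in \<open>auto simp: D_def\<close>)
    ultimately show "\<delta> <= q * d z + e'" by simp
  qed
  have "\<delta> < e * \<rho>"
  proof (rule ccontr)
    assume n: "\<not> \<delta> < e * \<rho>"
    then have p: "0 < \<delta>" using e \<rho> by (smt (verit) mult_pos_pos)
    \<comment> \<open>A trajectory within the factor \<open>2 - q\<close> of the infimum suffices,
      because \<open>q * (2 - q) = 1 - (1 - q)\<^sup>2\<close> is less than one.\<close>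
    have "\<delta> < (1 + (1 - q)) * \<delta>" using p q by (simp add: algebra_simps)
    then obtain z where z: "lsol z" "z 0 = z0" "d z < (1 + (1 - q)) * \<delta>"
      using cInf_lessD[OF ne] unfolding \<delta>_def D_def by auto
    have "\<delta> <= q * ((1 + (1 - q)) * \<delta>)" using imp[OF z(1,2)] z(3) q by (smt (verit) mult_left_mono)
    then have "1 <= q * (1 + (1 - q))" using p by (simp add: mult.assoc[symmetric])
    moreover have "q * (1 + (1 - q)) = 1 - (1 - q)\<^sup>2" by (simp add: power2_eq_square algebra_simps)
    ultimately show False using q by simp
  qed
  then obtain z where z: "lsol z" "z 0 = z0" "d z < e * \<rho>"
    using cInf_lessD[OF ne] unfolding \<delta>_def D_def by auto
  have "l2n \<sigma> (resid z) <= l2n \<sigma> (%t. (1 / \<rho>) *\<^sub>R (opBc S (z t) - step \<rho> z t))"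
    by (intro l2n_mono_fun resid_step \<rho> continuous_intros continuous_on_sub0 resid_cont lsol_cont step_cont z order_refl)
  also have "\<dots> = (1 / \<rho>) * d z" using \<rho> unfolding l2n_scaleR d_def by simp
  also have "\<dots> <= e" using z(3) \<rho> by (simp add: field_simps)
  finally show ?thesis using that z by blast
qed

end

section \<open>Limits of approximate solutions\<close>

lemma uniform_limit_norm:
  assumes "uniform_limit X f l sequentially" "0 < e"
  obtains M where "!!n x. M <= n ==> x \<in> X ==> norm (f n x - l x) <= e"
proof -
  obtain M where "\<forall>n\<ge>M. \<forall>x\<in>X. dist (f n x) (l x) < e"
    using uniform_limitD[OF assms] unfolding eventually_sequentially by blast
  then show ?thesis by (intro that[of M]) (auto simp: dist_norm less_imp_le)
qed

lemma uniform_limit_cont: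
  assumes "!!n. continuous_on {0..} (f n)" "uniform_limit {0..\<tau>} f l sequentially"
  shows "continuous_on {0..\<tau>::real} l"
  by (rule uniform_limit_theorem[OF _ assms(2)])
     (auto intro!: always_eventually continuous_on_sub0 assms(1))

lemma integral_tendsto:
  fixes f :: "nat => real => 'b::banach"
  assumes c: "!!n. continuous_on {0..} (f n)" and u: "uniform_limit {0..\<tau>} f l sequentially" and t: "0 <= t" "t <= \<tau>"
  shows "(%n. integral {0..t} (f n)) \<longlonglongrightarrow> integral {0..t} l"
proof -
  have "uniform_limit {0..t} f l sequentially"
    by (rule uniform_limit_on_subset[OF u]) (use t in auto)
  then obtain I J where IJ: "!!n. (f n has_integral I n) {0..t}" "(l has_integral J) {0..t}" "I \<longlonglongrightarrow> J"
    by (rule uniform_limit_integral[OF _ continuous_on_sub0[OF c order_refl] sequentially_bot]) (rule that)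
  then show ?thesis by (simp add: integral_unique[OF IJ(1)] integral_unique[OF IJ(2)])
qed

context sat_node
begin

text \<open>The \<open>n\<close>-th trajectory has residual at most \<open>1 / (real n + 1)\<close>
  up to time \<open>n\<close>, and stability makes the sequence Cauchy on each fixed horizon. The
  initial states converge in the state norm; no convergence of their boundary values enters.\<close>

lemma generalised_limit:
  assumes D: "!!n::nat. z0 n \<in> Dom S" "!!n. opBd S (z0 n) = 0" and lim: "z0 \<longlonglongrightarrow> x"
  obtains zs z where "!!n. lsol (zs n)" "!!n. zs n 0 = z0 n"
    "!!n \<tau>. \<tau> <= real n ==> l2n \<tau> (resid (zs n)) <= 1 / (real n + 1)"
    "!!\<tau>. 0 <= \<tau> ==> uniform_limit {0..\<tau>} zs z sequentially"
    "!!\<tau>. 0 <= \<tau> ==> l2cauchy \<tau> (%n t. opBc S (zs n t))"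
    "!!\<tau>. 0 <= \<tau> ==> l2cauchy \<tau> (%n t. opC S (zs n t))"
proof -
  have "\<exists>z. lsol z & z 0 = z0 n & (\<forall>\<tau>\<le>real n. l2n \<tau> (resid z) <= 1 / (real n + 1))" for n
  proof -
    obtain \<sigma> K where g: "real n <= \<sigma>" "good \<sigma> K" using good_exists[of "real n"] by auto
    obtain z where z: "lsol z" "z 0 = z0 n" "l2n \<sigma> (resid z) <= 1 / (real n + 1)"
      by (rule approx_solution[OF g(2) D(1)[of n] D(2)[of n], of "1 / (real n + 1)"]) auto
    have "l2n \<tau> (resid z) <= 1 / (real n + 1)" if "\<tau> <= real n" for \<tau>
      by (rule order_trans[OF l2n_mono_time[OF continuous_on_sub0[OF resid_cont[OF z(1)] order_refl]] z(3)])
         (use that g in auto)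
    then show ?thesis using z by blast
  qed
  then obtain zs where zs: "!!n. lsol (zs n)" "!!n. zs n 0 = z0 n"
    and re: "!!n \<tau>. \<tau> <= real n ==> l2n \<tau> (resid (zs n)) <= 1 / (real n + 1)"
    by metis
  have key: "\<exists>N. \<forall>m\<ge>N. \<forall>n\<ge>N. (\<forall>t\<in>{0..\<tau>}. norm (zs m t - zs n t) <= e) &
      l2n \<tau> (%t. opBc S (zs m t) - opBc S (zs n t)) <= e & l2n \<tau> (%t. opC S (zs m t) - opC S (zs n t)) <= e"
    if \<tau>: "0 <= \<tau>" and e: "0 < e" for \<tau> e
  proof -
    obtain \<sigma> K where g: "\<tau> <= \<sigma>" "good \<sigma> K" using good_exists[OF \<tau>] by auto
    \<comment> \<open>Three contributions of size \<open>e'\<close>: the initial states and the two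
      residuals.\<close>
    define e' where "e' = e / (3 * Mc K)"
    have M: "1 <= Mc K" by (rule Mc_ge[OF goodD(2)[OF g(2)]])
    have e': "0 < e'" using e M by (simp add: e'_def)
    obtain N1 where N1: "!!m n. m \<ge> N1 ==> n \<ge> N1 ==> norm (z0 m - z0 n) < e'"
      using CauchyD[OF LIMSEQ_imp_Cauchy[OF lim] e'] by blast
    obtain N2 where N2: "1 / e' + \<sigma> < real N2" using reals_Archimedean2 by blast
    show ?thesis
    proof (intro exI[of _ "max N1 N2"] allI impI)
      fix m n assume mn: "m \<ge> max N1 N2" "n \<ge> max N1 N2"
      have r: "l2n \<sigma> (resid (zs k)) <= e'" if "k \<ge> N2" for k
      proof -
        have k: "real N2 <= real k" using that by simp
        have p: "0 < 1 / e'" "0 < \<sigma>" using e' goodD(1)[OF g(2)] by auto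
        have "l2n \<sigma> (resid (zs k)) <= 1 / (real k + 1)" using k N2 p by (intro re) linarith
        also have "\<dots> <= 1 / (1 / e')" using k N2 p by (intro frac_le) linarith+
        finally show ?thesis by simp
      qed
      have "l2n \<sigma> (%t. resid (zs m) t - resid (zs n) t) <= l2n \<sigma> (resid (zs m)) + l2n \<sigma> (resid (zs n))"
        by (intro l2n_diff continuous_on_sub0 resid_cont zs order_refl)
      then have "norm (zs m 0 - zs n 0) + l2n \<sigma> (%t. resid (zs m) t - resid (zs n) t) <= 3 * e'"
        using r[of m] r[of n] N1[of m n] mn by (simp add: zs)
      then have "Mc K * (norm (zs m 0 - zs n 0) + l2n \<sigma> (%t. resid (zs m) t - resid (zs n) t)) <= Mc K * (3 * e')"
        using M by (intro mult_left_mono) auto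
      also have "\<dots> = e" using M by (simp add: e'_def)
      finally have le: "Mc K * (norm (zs m 0 - zs n 0) + l2n \<sigma> (%t. resid (zs m) t - resid (zs n) t)) <= e" .
      note st = stab[OF g(2) zs(1)[of m] zs(1)[of n]]
      note dc = diff_cont[OF zs(1)[of m] zs(1)[of n] order_refl, of \<sigma>]
      show "(\<forall>t\<in>{0..\<tau>}. norm (zs m t - zs n t) <= e) &
         l2n \<tau> (%t. opBc S (zs m t) - opBc S (zs n t)) <= e & l2n \<tau> (%t. opC S (zs m t) - opC S (zs n t)) <= e"
      proof (intro conjI ballI)
        show "norm (zs m t - zs n t) <= e" if "t \<in> {0..\<tau>}" for t
          by (rule order_trans[OF st(3) le]) (use that g(1) in auto)
        show "l2n \<tau> (%t. opBc S (zs m t) - opBc S (zs n t)) <= e"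
          by (rule order_trans[OF l2n_mono_time[OF dc(1) g(1)]]) (rule order_trans[OF st(1) le])
        show "l2n \<tau> (%t. opC S (zs m t) - opC S (zs n t)) <= e"
          by (rule order_trans[OF l2n_mono_time[OF dc(2) g(1)]]) (rule order_trans[OF st(2) le])
      qed
    qed
  qed
  define z where "z t = lim (%n. zs n t)" for t
  have ul: "uniform_limit {0..\<tau>} zs z sequentially" if \<tau>: "0 <= \<tau>" for \<tau>
  proof -
    have "uniformly_Cauchy_on {0..\<tau>} zs"
      unfolding uniformly_Cauchy_on_def
    proof (intro allI impI)
      fix e :: real assume "0 < e"
      then obtain N where "\<forall>m\<ge>N. \<forall>n\<ge>N. \<forall>t\<in>{0..\<tau>}. norm (zs m t - zs n t) <= e / 2"
        using key[OF \<tau>, of "e/2"] by auto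
      then show "\<exists>M. \<forall>x\<in>{0..\<tau>}. \<forall>m\<ge>M. \<forall>n\<ge>M. dist (zs m x) (zs n x) < e"
        using \<open>0 < e\<close> by (intro exI[of _ N]) (fastforce simp: dist_norm)
    qed
    then show ?thesis
      unfolding z_def[abs_def] by (intro uniformly_convergent_uniform_limit_iff[THEN iffD1] Cauchy_uniformly_convergent)
  qed
  show ?thesis
  proof (rule that[OF zs re ul])
    show "l2cauchy \<tau> (%n t. opBc S (zs n t))" "l2cauchy \<tau> (%n t. opC S (zs n t))" if "0 <= \<tau>" for \<tau>
      unfolding l2cauchy_def using key[OF that] by meson+
  qed auto
qed

section \<open>Regularity for compatible initial states\<close>

lemma affine_energy:
  assumes z: "lsol z" and z0: "z0 \<in> Dom S" "opBd S z0 = 0" and t: "0 <= t"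
  shows "(norm (z t - z0))\<^sup>2 <= (norm (z 0 - z0))\<^sup>2 + 2 * integral {0..t} (%s.
      (opBc S (z s) - opBc S z0) \<bullet> (opC S (z s) - opC S z0) + opA S z0 \<bullet> (z s - z0))"
proof -
  let ?w = "%s. z s - z0"
  have "integral {0..t} (%s. 2 * (opA S (z s) \<bullet> ?w s)) = (?w t \<bullet> ?w t) - (?w 0 \<bullet> ?w 0)"
  proof (rule integral_deriv)
    fix s :: real assume s: "0 <= s"
    have d: "(?w has_vector_derivative opA S (z s)) (at s within {0..})"
      using has_vector_derivative_diff[OF lsolD(3)[OF z s] has_vector_derivative_const[of z0]] by simp
    have "((%s. ?w s \<bullet> ?w s) has_derivative (%h. ?w s \<bullet> (h *\<^sub>R opA S (z s)) + (h *\<^sub>R opA S (z s)) \<bullet> ?w s)) (at s within {0..})"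
      using has_derivative_inner[OF d[unfolded has_vector_derivative_def] d[unfolded has_vector_derivative_def]] .
    moreover have "(%h. ?w s \<bullet> (h *\<^sub>R opA S (z s)) + (h *\<^sub>R opA S (z s)) \<bullet> ?w s) = (%h. h *\<^sub>R (2 * (opA S (z s) \<bullet> ?w s)))"
      unfolding inner_scaleR_left inner_scaleR_right inner_commute[of "?w s"] by auto
    ultimately show "((%s. ?w s \<bullet> ?w s) has_vector_derivative 2 * (opA S (z s) \<bullet> ?w s)) (at s within {0..})"
      unfolding has_vector_derivative_def by simp
  qed (use t in auto)
  moreover have "integral {0..t} (%s. 2 * (opA S (z s) \<bullet> ?w s)) <= integral {0..t} (%s. 2 * (
      (opBc S (z s) - opBc S z0) \<bullet> (opC S (z s) - opC S z0) + opA S z0 \<bullet> ?w s))"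
  proof (rule integral_le)
    fix s assume s: "s \<in> {0..t}"
    then have zs: "z s \<in> Dom S" "opBd S (z s) = 0" using lsolD(1,2)[OF z, of s] by auto
    have "opA S (z s) \<bullet> ?w s = opA S (?w s) \<bullet> ?w s + opA S z0 \<bullet> ?w s"
      using op_diff(1)[OF zs(1) z0(1)] by (simp add: inner_diff_left)
    also have "opA S (?w s) \<bullet> ?w s <= opBc S (?w s) \<bullet> opC S (?w s)"
      using zs z0 by (intro imp_passive) (auto simp: Dom_simps op_diff)
    finally show "2 * (opA S (z s) \<bullet> ?w s) <= 2 * ((opBc S (z s) - opBc S z0) \<bullet> (opC S (z s) - opC S z0) + opA S z0 \<bullet> ?w s)"
      using zs z0 by (simp add: op_diff)
  qed (intro integrable_cont continuous_intros continuous_on_sub0 lsol_cont z order_refl)+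
  ultimately show ?thesis unfolding integral_mult_right power2_norm_eq_inner by linarith
qed

text \<open>Compatibility keeps the difference quotients at time zero bounded. The energy is
  measured relative to \<open>z0\<close>; monotonicity removes the feedback difference, and what
  remains, the residual and the variation of \<open>N\<close> in time, has mean-square size of order
  \<open>h * sqrt h\<close> and meets an output deviation of order \<open>sqrt h\<close>.\<close>

lemma short_time:
  assumes g: "good \<sigma> K" and \<sigma>: "1 <= \<sigma>" and z0: "z0 \<in> Dom S" "opBd S z0 = 0" and compat: "opBc S z0 = N 0 (opC S z0)"
  obtains c where "0 <= c" "!!z h. lsol z ==> z 0 = z0 ==> 0 < h ==> h <= 1 ==> l2n \<sigma> (resid z) <= h\<^sup>2 ==> norm (z h - z0) <= c * h"
proof -
  let ?uu = "opBc S z0" and ?yy = "opC S z0"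
  \<comment> \<open>An auxiliary trajectory from \<open>z0\<close> with continuous output: the
    difference to it starts at zero, so the short-time output estimate applies.\<close>
  have "expo U (%t. exp (real (Suc 0) * t) *\<^sub>R ?uu)" by (intro expo.exp op_U z0)
  then obtain w where w: "lsol w" "w 0 = z0" "!!t. 0 <= t ==> opBc S (w t) = exp t *\<^sub>R ?uu"
    by (rule lsol_exists[OF _ z0]) auto
  \<comment> \<open>\<open>R1\<close> bounds \<open>N\<close> on \<open>{0..1}\<close> through
    boundedness of \<open>Q\<close>, \<open>R2\<close> bounds the auxiliary input, and
    \<open>R3\<close> below bounds the drift of the auxiliary output.\<close>
  define R1 R2 where "R1 = R + norm (ur 0) + L" and "R2 = exp 1 * norm ?uu"
  have "continuous_on {0..1} (%t. opC S (w t) - ?yy)"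
    by (intro continuous_intros continuous_on_sub0 lsol_cont w order_refl)
  then have "bounded ((%t. opC S (w t) - ?yy) ` {0..1})"
    by (intro compact_imp_bounded compact_continuous_image) auto
  then obtain R3 where R3: "0 < R3" "!!t. 0 <= t ==> t <= 1 ==> norm (opC S (w t) - ?yy) <= R3"
    unfolding bounded_pos by auto
  have R: "0 <= R" using order_trans[OF norm_ge_zero Q_bounded[OF \<Phi>_in]] .
  have R12: "0 <= R1" "0 <= R2" using R L by (auto simp: R1_def R2_def)
  have K: "1 <= K" using goodD(2)[OF g] .
  have Nb: "norm (N t y) <= R1" if "0 <= t" "t <= 1" for t y
  proof -
    have "norm (N t y) <= norm (\<Phi> (ur t - \<kappa> *\<^sub>R y)) + norm (ur t)" unfolding N_def by (rule norm_triangle_ineq4)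
    moreover have "norm (\<Phi> (ur t - \<kappa> *\<^sub>R y)) <= R" by (intro Q_bounded \<Phi>_in)
    moreover have "norm (ur t - ur 0) <= L"
      using ur_lip[of 0 t] that L mult_left_mono[of t 1 L] by auto
    moreover have "norm (ur t) <= norm (ur 0) + norm (ur t - ur 0)" by (rule norm_triangle_sub)
    ultimately show ?thesis by (simp add: R1_def)
  qed
  define Y where "Y = K * (1 + R1 + R2) + R3"
  have Y: "0 <= Y" using K R12 R3 by (simp add: Y_def)
  define c1 where "c1 = 2 * (2 * L + 1) * Y"
  have c1: "0 <= c1" using Y L by (simp add: c1_def)
  define a0 where "a0 = norm (opA S z0)"
  define c where "c = 1 + c1 + 2 * a0"
  show ?thesis
  proof (rule that[of c])
    show "0 <= c" using c1 by (simp add: c_def a0_def)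
    fix z h assume z: "lsol z" "z 0 = z0" and h: "0 < h" "h <= 1" and re: "l2n \<sigma> (resid z) <= h\<^sup>2"
    have h\<sigma>: "h <= \<sigma>" using h \<sigma> by simp
    have reh: "l2n h (resid z) <= h\<^sup>2"
      by (rule order_trans[OF l2n_mono_time re]) (use h\<sigma> in \<open>auto intro!: continuous_on_sub0 resid_cont z\<close>)
    have hs: "h\<^sup>2 <= sqrt h"
    proof -
      have "h\<^sup>2 <= 1 * h" unfolding power2_eq_square using h by (intro mult_right_mono) auto
      also have "1 * h = sqrt h * sqrt h" using h by simp
      also have "\<dots> <= sqrt h * 1" using h by (intro mult_left_mono) auto
      finally show ?thesis by simp
    qed
    note cz = continuous_on_sub0[OF lsol_cont(1)[OF z(1)] order_refl] continuous_on_sub0[OF lsol_cont(3)[OF z(1)] order_refl]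
      continuous_on_sub0[OF lsol_cont(4)[OF z(1)] order_refl] continuous_on_sub0[OF resid_cont[OF z(1)] order_refl]
      continuous_on_sub0[OF lsol_cont(3)[OF w(1)] order_refl] continuous_on_sub0[OF lsol_cont(4)[OF w(1)] order_refl]
    have u: "l2n h (%t. opBc S (z t) - opBc S (w t)) <= sqrt h * (1 + R1 + R2)"
    proof -
      have "l2n h (%t. opBc S (z t) - opBc S (w t)) <= l2n h (resid z) + sqrt h * (R1 + R2)"
      proof (rule l2n_sq_affine_le)
        fix t assume t: "0 <= t" "t <= h"
        have "opBc S (z t) - opBc S (w t) = resid z t + (N t (opC S (z t)) - exp t *\<^sub>R ?uu)"
          using w(3)[OF t(1)] by (simp add: resid_def)
        also have "norm \<dots> <= norm (resid z t) + norm (N t (opC S (z t)) - exp t *\<^sub>R ?uu)" by (rule norm_triangle_ineq)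
        also have "norm (N t (opC S (z t)) - exp t *\<^sub>R ?uu) <= R1 + R2"
        proof (rule order_trans[OF norm_triangle_ineq4], rule add_mono)
          show "norm (N t (opC S (z t))) <= R1" using Nb t h by auto
          show "norm (exp t *\<^sub>R ?uu) <= R2" unfolding R2_def using t h by (auto intro!: mult_right_mono)
        qed
        finally show "norm (opBc S (z t) - opBc S (w t)) <= norm (resid z t) + (R1 + R2)" by simp
      qed (use R12 h in \<open>auto intro!: continuous_intros cz\<close>)
      then show ?thesis using reh hs by (simp add: algebra_simps)
    qed
    have y: "l2n h (%t. opC S (z t) - ?yy) <= sqrt h * Y"
    proof -
      have "l2n h (%t. opC S (z t - w t)) <= K * l2n h (%t. opBc S (z t - w t))"
        by (rule output_estimate_zero[OF g lsol_diff[OF z(1) w(1)]]) (use z w h h\<sigma> in auto)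
      then have "l2n h (%t. opC S (z t) - opC S (w t)) <= K * l2n h (%t. opBc S (z t) - opBc S (w t))"
        unfolding diff_l2n[OF z(1) w(1)] .
      also have "\<dots> <= K * (sqrt h * (1 + R1 + R2))" using u K by (intro mult_left_mono) auto
      finally have 1: "l2n h (%t. opC S (z t) - opC S (w t)) <= K * (sqrt h * (1 + R1 + R2))" .
      have 2: "l2n h (%t. opC S (w t) - ?yy) <= sqrt h * R3"
        by (rule l2n_bound) (use R3 h in \<open>auto intro!: continuous_intros cz\<close>)
      have "l2n h (%t. opC S (z t) - ?yy) <= l2n h (%t. opC S (z t) - opC S (w t)) + l2n h (%t. opC S (w t) - ?yy)"
        by (intro l2n_dist_triangle continuous_intros cz)
      also have "\<dots> <= K * (sqrt h * (1 + R1 + R2)) + sqrt h * R3" using 1 2 by simp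
      finally show ?thesis by (simp add: Y_def algebra_simps)
    qed
    have "continuous_on {0..h} (%t. norm (z t - z0))" by (intro continuous_intros cz)
    then have "\<exists>s\<in>{0..h}. \<forall>t\<in>{0..h}. norm (z t - z0) <= norm (z s - z0)"
      using h by (intro continuous_attains_sup) auto
    then obtain s where s: "s \<in> {0..h}" "!!t. t \<in> {0..h} ==> norm (z t - z0) <= norm (z s - z0)"
      by blast
    define a where "a = norm (z s - z0)"
    have "a\<^sup>2 <= 2 * integral {0..s} (%t. (opBc S (z t) - ?uu) \<bullet> (opC S (z t) - ?yy) + opA S z0 \<bullet> (z t - z0))"
      using affine_energy[OF z(1) z0, of s] s by (simp add: a_def z)
    also have "integral {0..s} (%t. (opBc S (z t) - ?uu) \<bullet> (opC S (z t) - ?yy) + opA S z0 \<bullet> (z t - z0))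
        <= integral {0..s} (%t. (norm (resid z t) + 2 * L * h) * norm (opC S (z t) - ?yy) + a0 * a)"
    proof (rule integral_le)
      fix t assume t: "t \<in> {0..s}"
      then have th: "0 <= t" "t <= h" using s by auto
      let ?y = "opC S (z t) - ?yy"
      have "(opBc S (z t) - ?uu) \<bullet> ?y = (resid z t + (N t ?yy - N 0 ?yy)) \<bullet> ?y + (N t (opC S (z t)) - N t ?yy) \<bullet> ?y"
        by (simp add: resid_def compat inner_add_left inner_diff_left)
      also have "\<dots> <= (resid z t + (N t ?yy - N 0 ?yy)) \<bullet> ?y" using N_mono[of t "opC S (z t)" ?yy] by simp
      also have "\<dots> <= norm (resid z t + (N t ?yy - N 0 ?yy)) * norm ?y" by (rule norm_cauchy_schwarz)
      also have "\<dots> <= (norm (resid z t) + 2 * L * h) * norm ?y"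
      proof (rule mult_right_mono)
        have "norm (N t ?yy - N 0 ?yy) <= 2 * L * h"
          by (rule order_trans[OF N_time]) (use th L in \<open>auto intro!: mult_left_mono\<close>)
        then show "norm (resid z t + (N t ?yy - N 0 ?yy)) <= norm (resid z t) + 2 * L * h"
          using norm_triangle_ineq[of "resid z t" "N t ?yy - N 0 ?yy"] by linarith
      qed simp
      finally have 1: "(opBc S (z t) - ?uu) \<bullet> ?y <= (norm (resid z t) + 2 * L * h) * norm ?y" .
      have "opA S z0 \<bullet> (z t - z0) <= a0 * norm (z t - z0)" unfolding a0_def by (rule norm_cauchy_schwarz)
      also have "\<dots> <= a0 * a" using s(2)[of t] th unfolding a_def a0_def by (intro mult_left_mono) auto
      finally show "(opBc S (z t) - ?uu) \<bullet> ?y + opA S z0 \<bullet> (z t - z0) <= (norm (resid z t) + 2 * L * h) * norm ?y + a0 * a"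
        using 1 by linarith
    qed (intro integrable_cont continuous_intros cz)+
    also have "\<dots> <= integral {0..h} (%t. (norm (resid z t) + 2 * L * h) * norm (opC S (z t) - ?yy) + a0 * a)"
    proof (rule integral_subset_le)
      show "{0..s} \<subseteq> {0..h}" using s by auto
      show "\<forall>t\<in>{0..h}. 0 <= (norm (resid z t) + 2 * L * h) * norm (opC S (z t) - ?yy) + a0 * a"
        using L h by (intro ballI add_nonneg_nonneg mult_nonneg_nonneg) (auto simp: a0_def a_def)
    qed (intro integrable_cont continuous_intros cz)+
    also have "\<dots> = integral {0..h} (%t. (norm (resid z t) + 2 * L * h) * norm (opC S (z t) - ?yy)) + h * (a0 * a)"
      using h by (subst integral_add; (intro integrable_cont continuous_intros cz)?) simp
    also have "integral {0..h} (%t. (norm (resid z t) + 2 * L * h) * norm (opC S (z t) - ?yy))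
        <= l2n h (%t. norm (resid z t) + 2 * L * h) * l2n h (%t. opC S (z t) - ?yy)"
    proof -
      have "norm (norm (resid z t) + 2 * L * h) = norm (resid z t) + 2 * L * h" for t using L h by simp
      then show ?thesis
        using l2n_norm_mult[of h "%t. norm (resid z t) + 2 * L * h" "%t. opC S (z t) - ?yy"] cz
        by (simp add: continuous_intros)
    qed
    also have "\<dots> <= ((2 * L + 1) * h * sqrt h) * (sqrt h * Y)"
    proof (rule mult_mono[OF _ y])
      have "l2n h (%t. norm (resid z t) + 2 * L * h) <= l2n h (resid z) + sqrt h * (2 * L * h)"
        by (rule l2n_sq_affine_le) (use L h in \<open>auto intro!: continuous_intros cz\<close>)
      moreover have "h\<^sup>2 <= h * sqrt h"
      proof -
        have "h * h = (h * sqrt h) * sqrt h" using h by simp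
        also have "\<dots> <= (h * sqrt h) * 1" using h by (intro mult_left_mono) auto
        finally show ?thesis by (simp add: power2_eq_square)
      qed
      ultimately show "l2n h (%t. norm (resid z t) + 2 * L * h) <= (2 * L + 1) * h * sqrt h"
        using reh by (simp add: algebra_simps)
    qed (use L h in auto)
    also have "\<dots> = (2 * L + 1) * Y * h\<^sup>2" using h by (simp add: power2_eq_square)
    finally have q: "a\<^sup>2 <= c1 * h\<^sup>2 + 2 * a0 * h * a" by (simp add: c1_def algebra_simps)
    \<comment> \<open>The inequality \<open>q\<close> is homogeneous of degree two in
      \<open>h\<close> and \<open>a\<close>; if \<open>a\<close> exceeded \<open>c * h\<close>,
      dividing it by \<open>a\<close> would give a contradiction.\<close>
    have "a <= c * h"
    proof (rule ccontr)
      assume n: "\<not> a <= c * h"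
      have a00: "0 <= a0" by (simp add: a0_def)
      have "1 * h <= c * h" using h c1 a00 by (intro mult_right_mono) (auto simp: c_def)
      then have ha: "h <= a" "0 < a" using n h unfolding mult_1 by linarith+
      have "c1 * h\<^sup>2 <= c1 * (h * a)" unfolding power2_eq_square using c1 h ha by (intro mult_left_mono) auto
      then have "a * a <= ((c1 + 2 * a0) * h) * a" using q by (simp add: power2_eq_square algebra_simps)
      then have "a <= (c1 + 2 * a0) * h" using ha by simp
      then show False using n h by (simp add: c_def algebra_simps)
    qed
    then show "norm (z h - z0) <= c * h" using s(2)[of h] h by (simp add: a_def)
  qed
qed

text \<open>The translate by \<open>h\<close> is again an approximate solution: its residual changes
  only by the variation of \<open>N\<close> in time, at most \<open>2 * L * h\<close>. Stability and
  the short-time bound for the initial state give an estimate of order \<open>h\<close>. Residuals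
  are taken up to \<open>\<sigma> + 1\<close> because the translate looks ahead.\<close>

lemma translate_estimate:
  assumes g: "good \<sigma> K" and \<sigma>: "1 <= \<sigma>" and z0: "z0 \<in> Dom S" "opBd S z0 = 0" and compat: "opBc S z0 = N 0 (opC S z0)"
  obtains c where "0 <= c" "!!z h. lsol z ==> z 0 = z0 ==> 0 < h ==> h <= 1 ==> l2n (\<sigma> + 1) (resid z) <= h\<^sup>2 ==>
    norm (z h - z0) <= c * h & l2n \<sigma> (%t. opBc S (z (t + h)) - opBc S (z t)) <= c * h"
proof -
  obtain c0 where c0: "0 <= c0" "!!z h. lsol z ==> z 0 = z0 ==> 0 < h ==> h <= 1 ==> l2n \<sigma> (resid z) <= h\<^sup>2 ==> norm (z h - z0) <= c0 * h"
    using short_time[OF g \<sigma> z0 compat] by metis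
  define c where "c = max c0 (Mc K * (c0 + (2 + sqrt \<sigma> * (2 * L))))"
  show ?thesis
  proof (rule that[of c])
    show "0 <= c" using c0 by (simp add: c_def)
    fix z h assume z: "lsol z" "z 0 = z0" and h: "0 < h" "h <= 1" and re: "l2n (\<sigma> + 1) (resid z) <= h\<^sup>2"
    have h0: "0 <= h" using h by simp
    note rc = continuous_on_sub0[OF resid_cont[OF z(1)] order_refl]
    have re1: "l2n \<sigma> (resid z) <= h\<^sup>2" by (rule order_trans[OF l2n_mono_time[OF rc] re]) simp
    have re2: "l2n \<sigma> (%t. resid z (t + h)) <= h\<^sup>2"
    proof -
      have "l2n \<sigma> (%t. resid z (t + h)) <= l2n (\<sigma> + h) (resid z)" by (rule l2n_shift[OF resid_cont[OF z(1)] h0])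
      also have "\<dots> <= l2n (\<sigma> + 1) (resid z)" by (rule l2n_mono_time[OF rc]) (use h in simp)
      finally show ?thesis using re by simp
    qed
    let ?w = "%t. z (t + h)"
    have w: "lsol ?w" by (rule lsol_shift[OF z(1) h0])
    have st: "norm (z h - z0) <= c0 * h" by (rule c0(2)[OF z h re1])
    have "l2n \<sigma> (resid ?w) <= l2n \<sigma> (%t. resid z (t + h)) + sqrt \<sigma> * (2 * L * h)"
    proof (rule l2n_sq_affine_le)
      fix t assume t: "0 <= t" "t <= \<sigma>"
      have "resid ?w t = resid z (t + h) + (N (t + h) (opC S (z (t + h))) - N t (opC S (z (t + h))))"
        by (simp add: resid_def)
      then have "norm (resid ?w t) <= norm (resid z (t + h)) + norm (N (t + h) (opC S (z (t + h))) - N t (opC S (z (t + h))))"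
        by (simp only: norm_triangle_ineq)
      also have "norm (N (t + h) (opC S (z (t + h))) - N t (opC S (z (t + h)))) <= 2 * L * h"
        by (rule order_trans[OF N_time]) (use t h in auto)
      finally show "norm (resid ?w t) <= norm (resid z (t + h)) + 2 * L * h" by simp
    qed (use \<sigma> L h in \<open>auto intro!: continuous_on_sub0 resid_cont w continuous_on_shift z\<close>)
    then have "l2n \<sigma> (%t. resid ?w t - resid z t) <= 2 * h\<^sup>2 + sqrt \<sigma> * (2 * L * h)"
      using l2n_diff[OF continuous_on_sub0[OF resid_cont[OF w] order_refl] rc, of \<sigma>] re1 re2 by linarith
    also have "2 * h\<^sup>2 <= 2 * h" using h by (simp add: power2_eq_square)
    finally have e: "l2n \<sigma> (%t. resid ?w t - resid z t) <= (2 + sqrt \<sigma> * (2 * L)) * h"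
      by (simp add: algebra_simps)
    have "l2n \<sigma> (%t. opBc S (?w t) - opBc S (z t)) <= Mc K * (norm (?w 0 - z 0) + l2n \<sigma> (%t. resid ?w t - resid z t))"
      by (rule stab(1)[OF g w z(1)])
    also have "\<dots> <= Mc K * (c0 * h + (2 + sqrt \<sigma> * (2 * L)) * h)"
      using st e Mc_ge[OF goodD(2)[OF g]] by (intro mult_left_mono add_mono) (auto simp: z)
    also have "\<dots> = Mc K * (c0 + (2 + sqrt \<sigma> * (2 * L))) * h" by (simp add: algebra_simps)
    also have "\<dots> <= c * h" using h by (intro mult_right_mono) (auto simp: c_def)
    finally have 1: "l2n \<sigma> (%t. opBc S (?w t) - opBc S (z t)) <= c * h" .
    have "c0 * h <= c * h" using h by (intro mult_right_mono) (auto simp: c_def)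
    then show "norm (z h - z0) <= c * h & l2n \<sigma> (%t. opBc S (z (t + h)) - opBc S (z t)) <= c * h"
      using st 1 by linarith
  qed
qed

text \<open>Difference quotients of the approximate solutions are bounded in the norm
  of initial state and input. Minimising this norm over the convex sets of trajectories whose
  primitives are close to the limit gives strong convergence, without weak compactness.\<close>

lemma regular_approximation:
  assumes g: "good \<sigma> K" and \<sigma>: "1 <= \<sigma>" and z0: "z0 \<in> Dom S" "opBd S z0 = 0" and compat: "opBc S z0 = N 0 (opC S z0)"
    and zs: "!!n::nat. lsol (zs n)" "!!n. zs n 0 = z0"
    and re: "!!n \<tau>. \<tau> <= real n ==> l2n \<tau> (resid (zs n)) <= 1 / (real n + 1)"
    and ul: "!!\<tau>. 0 <= \<tau> ==> uniform_limit {0..\<tau>} zs z sequentially"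
  obtains q g where "!!m. lsol (q m)" "l2cauchy \<sigma> (%m t. opC S (q m t))"
    "uniform_limit {0..\<sigma>} q g sequentially"
    "!!t. 0 <= t ==> t <= \<sigma> ==> (%m. integral {0..t} (q m)) \<longlonglongrightarrow> z t - z0"
proof -
  obtain c where c: "0 <= c" "!!z h. lsol z ==> z 0 = z0 ==> 0 < h ==> h <= 1 ==> l2n (\<sigma> + 1) (resid z) <= h\<^sup>2 ==>
      norm (z h - z0) <= c * h & l2n \<sigma> (%t. opBc S (z (t + h)) - opBc S (z t)) <= c * h"
    by (rule translate_estimate[OF g \<sigma> z0 compat]) (rule that)
  \<comment> \<open>\<open>C m\<close> collects the trajectories whose primitives follow
    \<open>z t - z0\<close> up to \<open>1 / (real m + 1)\<close>: candidates for the derivative of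
    \<open>z\<close>.\<close>
  define C where "C m = {v. lsol v & (\<forall>t\<in>{0..\<sigma>}. norm (integral {0..t} v - (z t - z0)) <= 1 / (real m + 1))}" for m :: nat
  define qf where "qf v = (norm (v 0))\<^sup>2 + (l2n \<sigma> (%t. opBc S (v t)))\<^sup>2" for v
  define d where "d v w = (norm (v 0 - w 0))\<^sup>2 + (l2n \<sigma> (%t. opBc S (v t) - opBc S (w t)))\<^sup>2" for v w
  define mid where "mid v w = (%t. (1/2) *\<^sub>R (v t + w t))" for v w :: "real => 'x"
  have z00: "z 0 = z0"
  proof -
    have "(%n. zs n 0) \<longlonglongrightarrow> z 0" by (rule tendsto_uniform_limitI[OF ul[of 0]]) auto
    then show ?thesis by (simp add: zs(2) LIMSEQ_const_iff)
  qed
  have zc: "continuous_on {0..} z"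
  proof (rule continuous_on_subset[of "\<Union>n::nat. {0..<real n}"])
    show "continuous_on (\<Union>n::nat. {0..<real n}) z"
      unfolding continuous_on_eq_continuous_within
    proof
      fix x assume "x \<in> (\<Union>n::nat. {0..<real n})"
      then obtain n :: nat where n: "0 <= x" "x < real n" by auto
      have "continuous_on {0..real n} z" by (rule uniform_limit_cont[OF lsol_cont(1)[OF zs(1)] ul]) simp
      then have "continuous (at x within {0..real n}) z" using n by (simp add: continuous_on_eq_continuous_within)
      moreover have "at x within (\<Union>n::nat. {0..<real n}) = at x within {0..real n}"
      proof (rule at_within_nhd[of x "{..<real n}"])
        show "(\<Union>n. {0..<real n}) \<inter> {..<real n} - {x} = {0..real n} \<inter> {..<real n} - {x}" by auto
      qed (use n in auto)
      ultimately show "continuous (at x within (\<Union>n::nat. {0..<real n})) z" by simp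
    qed
    show "{0..} \<subseteq> (\<Union>n::nat. {0..<real n})" using reals_Archimedean2 by auto
  qed
  have bd: "\<exists>v\<in>C m. qf v <= c\<^sup>2 + c\<^sup>2" for m
  proof -
    \<comment> \<open>A quarter of the tolerance: at \<open>t\<close> and at \<open>0\<close> there
      is one error from replacing \<open>zs n\<close> by \<open>z\<close> and one from
      averaging.\<close>
    define e where "e = 1 / (4 * (real m + 1))"
    have e: "0 < e" "4 * e = 1 / (real m + 1)" by (auto simp: e_def divide_simps)
    obtain h0 where h0: "0 < h0" "!!h t. 0 < h ==> h <= h0 ==> 0 <= t ==> t <= \<sigma> ==> norm (stek h z t - z t) <= e"
      using stek_close[OF zc e(1), of \<sigma>] by metis
    define h where "h = min h0 1"
    have h: "0 < h" "h <= 1" "h <= h0" using h0 by (auto simp: h_def)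
    obtain N1 where N1: "!!n x. N1 <= n ==> x \<in> {0..\<sigma>+1} ==> norm (zs n x - z x) <= e"
      by (rule uniform_limit_norm[OF ul[of "\<sigma>+1"] e(1)]) (use \<sigma> in auto)
    \<comment> \<open>Beyond \<open>N2\<close> the residual is at most \<open>h\<^sup>2\<close>, as
      the translation estimate demands.\<close>
    obtain N2 where N2: "1 / h\<^sup>2 + \<sigma> + 1 < real N2" using reals_Archimedean2 by blast
    define n where "n = max N1 N2"
    have n: "N1 <= n" "real N2 <= real n" by (auto simp: n_def)
    have hp: "0 < 1 / h\<^sup>2" using h by simp
    have "l2n (\<sigma> + 1) (resid (zs n)) <= 1 / (real n + 1)" using N2 n hp by (intro re) linarith
    also have "\<dots> <= 1 / (1 / h\<^sup>2)" using N2 n hp \<sigma> by (intro frac_le) linarith+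
    finally have "l2n (\<sigma> + 1) (resid (zs n)) <= h\<^sup>2" by simp
    note est = c(2)[OF zs(1,2) h(1,2) this]
    note cz = lsol_cont(1)[OF zs(1)[of n]]
    define v where "v t = (1 / h) *\<^sub>R (zs n (t + h) - zs n t)" for t
    have v: "lsol v" unfolding v_def using h by (intro lsol_scaleR lsol_diff lsol_shift zs) auto
    have "v \<in> C m"
      unfolding C_def
    proof (intro CollectI conjI ballI v)
      fix t assume t: "t \<in> {0..\<sigma>}"
      \<comment> \<open>The primitive of a difference quotient is a difference of two Steklov
        averages.\<close>
      have "integral {0..t} v = (1 / h) *\<^sub>R (integral {0..t} (%t. zs n (t + h)) - integral {0..t} (zs n))"
        unfolding v_def using h
        by (subst integral_cmul, subst integral_diff) (auto intro!: integrable_cont continuous_on_sub0 continuous_on_shift cz)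
      also have "integral {0..t} (%t. zs n (t + h)) = integral {0..t+h} (zs n) - integral {0..h} (zs n)"
        using integral_shift_le[of 0 t "zs n" h] integral_split[OF cz, of h "t+h"] t h by simp
      also have "(1 / h) *\<^sub>R (integral {0..t+h} (zs n) - integral {0..h} (zs n) - integral {0..t} (zs n)) = stek h (zs n) t - stek h (zs n) 0"
        using t h cz by (simp add: stek_eq inverse_eq_divide algebra_simps)
      finally have iv: "integral {0..t} v = stek h (zs n) t - stek h (zs n) 0" .
      have cl: "norm (stek h (zs n) s - stek h z s) <= e" if s: "0 <= s" "s <= \<sigma>" for s
      proof -
        have "norm (integral {s..s+h} (%t. zs n t - z t)) <= e * ((s + h) - s)"
          by (rule integral_bound) (use s h N1 n in \<open>auto intro!: continuous_intros continuous_on_sub0 cz zc\<close>)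
        moreover have "stek h (zs n) s - stek h z s = integral {s..s+h} (%t. zs n t - z t) /\<^sub>R h"
          using stek_diff[OF cz zc h(1) s(1)] by (simp add: stek_def)
        ultimately show ?thesis using h by (simp add: field_simps)
      qed
      have "integral {0..t} v - (z t - z0) = ((stek h (zs n) t - stek h z t) + (stek h z t - z t))
          - ((stek h (zs n) 0 - stek h z 0) + (stek h z 0 - z 0))"
        unfolding iv by (simp add: z00)
      also have "norm \<dots> <= (e + e) + (e + e)"
        by (rule order_trans[OF norm_triangle_ineq4], intro add_mono order_trans[OF norm_triangle_ineq] cl h0(2) h)
           (use t \<sigma> in auto)
      finally show "norm (integral {0..t} v - (z t - z0)) <= 1 / (real m + 1)" using e(2) by simp
    qed
    moreover have "qf v <= c\<^sup>2 + c\<^sup>2"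
      unfolding qf_def
    proof (intro add_mono power_mono)
      have "norm (v 0) = norm (zs n h - z0) / h" unfolding v_def norm_scaleR using h by (simp add: zs)
      then show "norm (v 0) <= c" using est h by (simp add: pos_divide_le_eq)
      have "l2n \<sigma> (%t. opBc S (v t)) = l2n \<sigma> (%t. (1 / h) *\<^sub>R (opBc S (zs n (t + h)) - opBc S (zs n t)))"
        unfolding v_def by (intro l2n_cong) (use h in \<open>simp add: op_scaleR op_diff Dom_simps lsolD(1)[OF zs(1)]\<close>)
      also have "\<dots> <= c" using est h unfolding l2n_scaleR by (simp add: field_simps)
      finally show "l2n \<sigma> (%t. opBc S (v t)) <= c" .
    qed auto
    ultimately show ?thesis by blast
  qed
  have Cl: "lsol v" if "v \<in> C m" for v m using that by (simp add: C_def)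
  obtain v where v: "!!m. v m \<in> C m" "!!e. 0 < e ==> \<exists>N. \<forall>m\<ge>N. \<forall>n\<ge>N. d (v m) (v n) <= e"
  proof (rule minimising_sequence_cauchy[of C mid d qf])
    show "C n \<subseteq> C m" if "m <= n" for m n
    proof -
      have "1 / (real n + 1) <= 1 / (real m + 1)" using that by (simp add: frac_le)
      then show ?thesis unfolding C_def by force
    qed
    show "mid v w \<in> C m" if vw: "v \<in> C m" "w \<in> C m" for v w m
      unfolding C_def
    proof (intro CollectI conjI ballI)
      show "lsol (mid v w)" unfolding mid_def by (intro lsol_scaleR lsol_add Cl[OF vw(1)] Cl[OF vw(2)])
      fix t assume t: "t \<in> {0..\<sigma>}"
      have "integral {0..t} (mid v w) = (1/2) *\<^sub>R (integral {0..t} v + integral {0..t} w)"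
        unfolding mid_def
        by (subst integral_cmul, subst integral_add)
           (auto intro!: integrable_cont continuous_on_sub0 lsol_cont Cl[OF vw(1)] Cl[OF vw(2)])
      then have "integral {0..t} (mid v w) - (z t - z0) = (1/2) *\<^sub>R ((integral {0..t} v - (z t - z0)) + (integral {0..t} w - (z t - z0)))"
        by (simp add: algebra_simps scaleR_2[symmetric] flip: scaleR_add_left)
      also have "norm \<dots> <= (1/2) * (1 / (real m + 1) + 1 / (real m + 1))"
        unfolding norm_scaleR using vw t unfolding C_def
        by (intro mult_mono order_trans[OF norm_triangle_ineq] add_mono) auto
      finally show "norm (integral {0..t} (mid v w) - (z t - z0)) <= 1 / (real m + 1)" by simp
    qed
    show "d v w = 2 * qf v + 2 * qf w - 4 * qf (mid v w)" if vw: "v \<in> C 0" "w \<in> C 0" for v w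
    proof -
      let ?u = "%t. opBc S (v t)" and ?w = "%t. opBc S (w t)"
      note cu = continuous_on_sub0[OF lsol_cont(3)[OF Cl[OF vw(1)]] order_refl] continuous_on_sub0[OF lsol_cont(3)[OF Cl[OF vw(2)]] order_refl]
      have m: "l2n \<sigma> (%t. opBc S (mid v w t)) = l2n \<sigma> (%t. (1/2) *\<^sub>R ?u t + (1/2) *\<^sub>R ?w t)"
        unfolding mid_def by (intro l2n_cong)
          (simp add: op_scaleR op_add Dom_simps lsolD(1)[OF Cl[OF vw(1)]] lsolD(1)[OF Cl[OF vw(2)]] scaleR_add_right)
      have s: "(l2n \<sigma> (%t. ?u t - ?w t))\<^sup>2 = (l2n \<sigma> ?u)\<^sup>2 - 2 * integral {0..\<sigma>} (%t. ?u t \<bullet> ?w t) + (l2n \<sigma> ?w)\<^sup>2"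
        using l2n_sq_combine[OF cu, of \<sigma> 1 "-1"] by simp
      have m2: "4 * (l2n \<sigma> (%t. (1/2) *\<^sub>R ?u t + (1/2) *\<^sub>R ?w t))\<^sup>2 = (l2n \<sigma> ?u)\<^sup>2 + 2 * integral {0..\<sigma>} (%t. ?u t \<bullet> ?w t) + (l2n \<sigma> ?w)\<^sup>2"
        unfolding l2n_sq_combine[OF cu] by (simp add: power2_eq_square)
      have "4 * (norm (mid v w 0))\<^sup>2 + (norm (v 0 - w 0))\<^sup>2 = 2 * (norm (v 0))\<^sup>2 + 2 * (norm (w 0))\<^sup>2"
        unfolding mid_def power2_norm_eq_inner by (simp add: inner_diff inner_add inner_commute algebra_simps)
      then show ?thesis unfolding d_def qf_def m using s m2 by (simp add: algebra_simps)
    qed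
    show "0 <= qf v" for v by (simp add: qf_def)
    show "\<exists>v\<in>C m. qf v <= c\<^sup>2 + c\<^sup>2" for m by (rule bd)
    show "d v w = d w v" for v w unfolding d_def
      by (simp add: norm_minus_commute l2n_commute[of \<sigma> "%t. opBc S (v t)"])
  qed auto
  have vl: "lsol (v m)" for m by (rule Cl[OF v(1)])
  \<comment> \<open>\<open>d\<close> measures initial state and input only; well-posedness carries
    the Cauchy property over to states and outputs.\<close>
  have key: "\<exists>M. \<forall>m\<ge>M. \<forall>n\<ge>M. (\<forall>t\<in>{0..\<sigma>}. norm (v m t - v n t) <= e) & l2n \<sigma> (%t. opC S (v m t) - opC S (v n t)) <= e"
    if e: "0 < e" for e
  proof -
    define e' where "e' = e / (2 * K)"
    have K: "1 <= K" by (rule goodD(2)[OF g])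
    have e': "0 < e'" "K * (e' + e') = e" using e K by (auto simp: e'_def)
    obtain M where M: "!!m n. M <= m ==> M <= n ==> d (v m) (v n) <= e'\<^sup>2"
      using v(2)[of "e'\<^sup>2"] e' by auto
    show ?thesis
    proof (intro exI[of _ M] allI impI)
      fix m n assume mn: "M <= m" "M <= n"
      have dd: "d (v m) (v n) <= e'\<^sup>2" by (rule M[OF mn])
      have e'0: "0 <= e'" using e'(1) by simp
      have "(norm (v m 0 - v n 0))\<^sup>2 <= e'\<^sup>2" using dd unfolding d_def by (rule order_trans[rotated]) simp
      from power2_le_imp_le[OF this e'0] have 1: "norm (v m 0 - v n 0) <= e'" .
      have "(l2n \<sigma> (%t. opBc S (v m t) - opBc S (v n t)))\<^sup>2 <= e'\<^sup>2" using dd unfolding d_def by (rule order_trans[rotated]) simp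
      from power2_le_imp_le[OF this e'0] have 2: "l2n \<sigma> (%t. opBc S (v m t) - opBc S (v n t)) <= e'" .
      have le: "K * (norm (v m 0 - v n 0) + l2n \<sigma> (%t. opBc S (v m t - v n t))) <= e"
      proof -
        have "K * (norm (v m 0 - v n 0) + l2n \<sigma> (%t. opBc S (v m t) - opBc S (v n t))) <= K * (e' + e')"
          using K by (intro mult_left_mono add_mono 1 2) auto
        then show ?thesis unfolding diff_l2n[OF vl vl] e'(2) .
      qed
      note gd = goodD(3,4)[OF g lsol_diff[OF vl[of m] vl[of n]]]
      show "(\<forall>t\<in>{0..\<sigma>}. norm (v m t - v n t) <= e) & l2n \<sigma> (%t. opC S (v m t) - opC S (v n t)) <= e"
        using gd le unfolding diff_l2n(2)[OF vl vl] by force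
    qed
  qed
  have "uniformly_Cauchy_on {0..\<sigma>} v"
    unfolding uniformly_Cauchy_on_def
  proof (intro allI impI)
    fix e :: real assume "0 < e"
    then obtain M where "\<forall>m\<ge>M. \<forall>n\<ge>M. \<forall>t\<in>{0..\<sigma>}. norm (v m t - v n t) <= e / 2"
      using key[of "e/2"] by auto
    then show "\<exists>M. \<forall>x\<in>{0..\<sigma>}. \<forall>m\<ge>M. \<forall>n\<ge>M. dist (v m x) (v n x) < e"
      using \<open>0 < e\<close> by (intro exI[of _ M]) (fastforce simp: dist_norm)
  qed
  then obtain gl where gl: "uniform_limit {0..\<sigma>} v gl sequentially"
    using Cauchy_uniformly_convergent uniformly_convergent_on_def by blast
  show ?thesis
  proof (rule that[OF vl _ gl])
    show "l2cauchy \<sigma> (%m t. opC S (v m t))" unfolding l2cauchy_def using key by meson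
    fix t assume t: "0 <= t" "t <= \<sigma>"
    have "(%m. integral {0..t} (v m) - (z t - z0)) \<longlonglongrightarrow> 0"
    proof (rule Lim_null_comparison)
      show "\<forall>\<^sub>F m in sequentially. norm (integral {0..t} (v m) - (z t - z0)) <= 1 / (real m + 1)"
        using v(1) t by (intro always_eventually allI) (auto simp: C_def)
      show "(%m. 1 / (real m + 1)) \<longlonglongrightarrow> 0"
        using LIMSEQ_inverse_real_of_nat by (simp add: inverse_eq_divide add.commute)
    qed
    then show "(%m. integral {0..t} (v m)) \<longlonglongrightarrow> z t - z0" by (simp add: LIM_zero_iff)
  qed
qed

text \<open>The derivative of \<open>z\<close> is a uniform limit of trajectories whose primitives
  converge to \<open>z t - z0\<close>, and closedness then places \<open>z t\<close> in the domain.
  The last clause keeps the output as a limit of primitives of a mean-square Cauchy sequence, whose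
  limit will be the weak derivative of the output.\<close>

lemma classical_exists:
  assumes z0: "z0 \<in> Dom S" "opBd S z0 = 0" and compat: "opBc S z0 = N 0 (opC S z0)"
  obtains z where "lsol z" "z 0 = z0" "!!t. 0 <= t ==> resid z t = 0"
    "!!\<tau>. 0 <= \<tau> ==> \<exists>p. (\<forall>m::nat. continuous_on {0..} (p m) & (\<forall>t\<ge>0. p m t \<in> U)) & l2cauchy \<tau> p &
       (\<forall>t. 0 <= t --> t <= \<tau> --> (%m. integral {0..t} (p m)) \<longlonglongrightarrow> opC S (z t) - opC S z0)"
proof -
  obtain zs z where zs: "!!n. lsol (zs n)" "!!n. zs n 0 = z0"
    and re: "!!n \<tau>. \<tau> <= real n ==> l2n \<tau> (resid (zs n)) <= 1 / (real n + 1)"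
    and ul: "!!\<tau>. 0 <= \<tau> ==> uniform_limit {0..\<tau>} zs z sequentially"
    and cB: "!!\<tau>. 0 <= \<tau> ==> l2cauchy \<tau> (%n t. opBc S (zs n t))"
    by (rule generalised_limit[OF z0 tendsto_const]) (rule that)
  have z00: "z 0 = z0"
  proof -
    have "(%n. zs n 0) \<longlonglongrightarrow> z 0" by (rule tendsto_uniform_limitI[OF ul[of 0]]) auto
    then show ?thesis by (simp add: zs(2) LIMSEQ_const_iff)
  qed
  have loc: "\<exists>\<sigma>\<ge>\<tau>. 0 < \<sigma> & (\<forall>t\<in>{0..\<sigma>}. z t \<in> Dom S & opBd S (z t) = 0 & z t = z0 + integral {0..t} (%t. opA S (z t)))
      & continuous_on {0..\<sigma>} (%t. opA S (z t))
      & (\<exists>p. (\<forall>m::nat. continuous_on {0..} (p m) & (\<forall>t\<ge>0. p m t \<in> U)) & l2cauchy \<sigma> p &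
       (\<forall>t. 0 <= t --> t <= \<sigma> --> (%m. integral {0..t} (p m)) \<longlonglongrightarrow> opC S (z t) - opC S z0))"
    if \<tau>: "0 <= \<tau>" for \<tau>
  proof -
    obtain \<sigma> K where \<sigma>: "\<tau> + 1 <= \<sigma>" and g: "good \<sigma> K" using good_exists[of "\<tau> + 1"] \<tau> by auto
    have \<sigma>1: "1 <= \<sigma>" "\<tau> <= \<sigma>" using \<sigma> \<tau> by auto
    obtain q gl where q: "!!m. lsol (q m)" "l2cauchy \<sigma> (%m t. opC S (q m t))"
      "uniform_limit {0..\<sigma>} q gl sequentially"
      "!!t. 0 <= t ==> t <= \<sigma> ==> (%m. integral {0..t} (q m)) \<longlonglongrightarrow> z t - z0"
      by (rule regular_approximation[OF g \<sigma>1(1) z0 compat zs re ul]) (assumption | rule that)+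
    note cq = lsol_cont[OF q(1)]
    have gc: "continuous_on {0..\<sigma>} gl" by (rule uniform_limit_cont[OF cq(1) q(3)])
    have zg: "z t = z0 + integral {0..t} gl" if t: "0 <= t" "t <= \<sigma>" for t
      using LIMSEQ_unique[OF q(4)[OF t] integral_tendsto[OF cq(1) q(3) t]] by (simp add: algebra_simps)
    have ql: "(%m. q m t) \<longlonglongrightarrow> gl t" if "0 <= t" "t <= \<sigma>" for t
      by (rule tendsto_uniform_limitI[OF q(3)]) (use that in auto)
    \<comment> \<open>\<open>opA\<close> of a primitive of \<open>q m\<close> is
      \<open>q m t - q m 0\<close>, so the limit determines \<open>opA S (z t)\<close> as
      \<open>gl t\<close> plus a constant, and \<open>a\<close> is that constant.\<close>
    define a where "a = opA S z0 - gl 0"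
    have main: "z t \<in> Dom S & opA S (z t) = gl t + a & opBd S (z t) = 0 &
        (%m. integral {0..t} (%t. opC S (q m t))) \<longlonglongrightarrow> opC S (z t) - opC S z0"
      if t: "0 <= t" "t <= \<sigma>" for t
    proof -
      have I: "integral {0..t} (q m) \<in> Dom S" "opA S (integral {0..t} (q m)) = q m t - q m 0"
        "opC S (integral {0..t} (q m)) = integral {0..t} (%t. opC S (q m t))" "opBd S (integral {0..t} (q m)) = 0" for m
      proof -
        have D: "!!s. 0 <= s ==> s <= t ==> q m s \<in> Dom S" using lsolD(1)[OF q(1)] by auto
        note oi = op_integral[OF D continuous_on_sub0[OF cq(1) order_refl] continuous_on_sub0[OF cq(2) order_refl]]
        show "integral {0..t} (q m) \<in> Dom S" by (rule oi(1))
        show "opC S (integral {0..t} (q m)) = integral {0..t} (%t. opC S (q m t))" by (rule oi(4))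
        have "opA S (integral {0..t} (q m)) = integral {0..t} (%t. opA S (q m t))" by (rule oi(2))
        also have "\<dots> = q m t - q m 0" by (rule integral_deriv) (use t lsolD(3)[OF q(1)] in auto)
        finally show "opA S (integral {0..t} (q m)) = q m t - q m 0" .
        have "opBd S (integral {0..t} (q m)) = integral {0..t} (%t. opBd S (q m t))" by (rule oi(5))
        also have "\<dots> = integral {0..t} (%t. 0)" by (rule integral_cong) (use lsolD(2)[OF q(1)] in auto)
        finally show "opBd S (integral {0..t} (q m)) = 0" by simp
      qed
      have A: "(%m. opA S (integral {0..t} (q m))) \<longlonglongrightarrow> gl t - gl 0"
        unfolding I(2) by (intro tendsto_diff ql) (use t \<sigma>1 in auto)
      note ol = op_limit[OF I(1) q(4)[OF t] A]
      have zt: "z t = (z t - z0) + z0" by simp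
      have D: "z t \<in> Dom S" by (subst zt) (intro Dom_simps ol(1) z0)
      have "opA S (z t) = gl t + a"
        by (subst zt) (simp only: op_add(1)[OF ol(1) z0(1)] ol(2) a_def, simp)
      moreover have "opBd S (z t - z0) = 0"
        using ol(5) unfolding I(4) by (simp add: LIMSEQ_const_iff)
      then have "opBd S (z t) = 0" using op_diff(3)[OF D z0(1)] z0(2) by simp
      moreover have "(%m. integral {0..t} (%t. opC S (q m t))) \<longlonglongrightarrow> opC S (z t) - opC S z0"
        using ol(4) unfolding I(3) op_diff(4)[OF D z0(1)] .
      ultimately show ?thesis using D by blast
    qed
    have Ac: "continuous_on {0..\<sigma>} (%t. opA S (z t))"
    proof (rule continuous_on_eq)
      show "continuous_on {0..\<sigma>} (%t. gl t + a)" by (intro continuous_intros gc)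
    qed (use main in auto)
    have zc: "continuous_on {0..\<sigma>} z" by (rule uniform_limit_cont[OF lsol_cont(1)[OF zs(1)] ul]) (use \<sigma>1 in simp)
    \<comment> \<open>The primitives of \<open>zs n\<close> obey the integrated equation; its limit,
      compared with the integral of \<open>gl t + a\<close> over \<open>{0..\<sigma>}\<close>,
      leaves \<open>\<sigma> *\<^sub>R a = 0\<close>.\<close>
    have "a = 0"
    proof -
      have D: "!!s. 0 <= s ==> s <= \<sigma> ==> z s \<in> Dom S" using main by auto
      have 1: "opA S (integral {0..\<sigma>} z) = integral {0..\<sigma>} (%t. opA S (z t))" by (rule op_integral(2)[OF D zc Ac])
      also have "\<dots> = integral {0..\<sigma>} (%t. gl t + a)" by (rule integral_cong) (use main in auto)
      also have "\<dots> = integral {0..\<sigma>} gl + \<sigma> *\<^sub>R a"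
        using \<sigma>1 by (subst integral_add) (auto intro!: integrable_cont gc)
      finally have 1: "opA S (integral {0..\<sigma>} z) = (z \<sigma> - z0) + \<sigma> *\<^sub>R a" using zg[of \<sigma>] \<sigma>1 by simp
      have oi: "integral {0..\<sigma>} (zs n) \<in> Dom S" "opA S (integral {0..\<sigma>} (zs n)) = integral {0..\<sigma>} (%t. opA S (zs n t))" for n
        by (rule op_integral; use lsolD(1)[OF zs(1)] in \<open>auto intro!: continuous_on_sub0 lsol_cont zs\<close>)+
      have "integral {0..\<sigma>} (%t. opA S (zs n t)) = zs n \<sigma> - zs n 0" for n
        by (rule integral_deriv) (use \<sigma>1 lsolD(3)[OF zs(1)] in auto)
      then have Ai: "opA S (integral {0..\<sigma>} (zs n)) = zs n \<sigma> - z0" for n using oi(2)[of n] zs(2) by simp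
      have "(%n. zs n \<sigma>) \<longlonglongrightarrow> z \<sigma>" by (rule tendsto_uniform_limitI[OF ul[of \<sigma>]]) (use \<sigma>1 in auto)
      then have Al: "(%n. opA S (integral {0..\<sigma>} (zs n))) \<longlonglongrightarrow> z \<sigma> - z0" unfolding Ai by (intro tendsto_intros)
      have "opA S (integral {0..\<sigma>} z) = z \<sigma> - z0"
      proof (rule op_limit(2)[OF oi(1) _ Al])
        show "(%n. integral {0..\<sigma>} (zs n)) \<longlonglongrightarrow> integral {0..\<sigma>} z"
          by (rule integral_tendsto[OF lsol_cont(1)[OF zs(1)] ul[of \<sigma>]]) (use \<sigma>1 in auto)
      qed
      then show "a = 0" using 1 \<sigma>1 by simp
    qed
    have "z t = z0 + integral {0..t} (%t. opA S (z t))" if t: "0 <= t" "t <= \<sigma>" for t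
    proof -
      have "integral {0..t} (%t. opA S (z t)) = integral {0..t} gl"
        by (rule integral_cong) (use main t \<open>a = 0\<close> in auto)
      then show ?thesis using zg[OF t] by simp
    qed
    then show ?thesis
      using main \<sigma>1 Ac q(1,2) cq(4) lsolD(5)[OF q(1)]
      by (intro exI[of _ \<sigma>] conjI ballI exI[of _ "%m t. opC S (q m t)"]) auto
  qed
  have Ac: "continuous_on {0..} (%t. opA S (z t))"
    unfolding continuous_on_eq_continuous_within
  proof
    fix x :: real assume x: "x \<in> {0..}"
    obtain \<sigma> where \<sigma>: "x + 1 <= \<sigma>" "continuous_on {0..\<sigma>} (%t. opA S (z t))" using loc[of "x + 1"] x by auto
    then have "continuous (at x within {0..\<sigma>}) (%t. opA S (z t))" using x by (simp add: continuous_on_eq_continuous_within)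
    moreover have "at x within {0..} = at x within {0..\<sigma>}"
      by (rule at_within_nhd[of x "{..<\<sigma>}"]) (use \<sigma> x in auto)
    ultimately show "continuous (at x within {0..}) (%t. opA S (z t))" by simp
  qed
  have zt: "z t \<in> Dom S" "opBd S (z t) = 0" "z t = z0 + integral {0..t} (%t. opA S (z t))" if t: "0 <= t" for t
    using loc[OF t] t by auto
  have lz: "lsol z"
    unfolding lsol_def
  proof (intro conjI allI impI zt Ac)
    fix t :: real assume t: "0 <= t"
    have "((%t. z0 + integral {0..t} (%t. opA S (z t))) has_vector_derivative opA S (z t)) (at t within {0..})"
      using has_vector_derivative_add[OF has_vector_derivative_const antideriv[OF Ac t]] by simp
    then show "(z has_vector_derivative opA S (z t)) (at t within {0..})"
      by (rule has_vector_derivative_transform[rotated 2]) (use t zt(3) in auto)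
  qed
  \<comment> \<open>The inputs of \<open>zs n\<close> are Cauchy in the mean and their primitives
    converge to those of the input of \<open>z\<close>; hence they converge strongly, and the
    residual passes to the limit.\<close>
  have res: "resid z t = 0" if t: "0 <= t" for t
  proof -
    obtain \<sigma> K where \<sigma>: "t + 1 <= \<sigma>" and g: "good \<sigma> K" using good_exists[of "t + 1"] t by auto
    have s0: "0 <= \<sigma>" using \<sigma> t by simp
    define f where "f n t = opBc S (zs n t) - opBc S (z t)" for n t
    have fc: "continuous_on {0..} (f n)" for n unfolding f_def by (intro continuous_intros lsol_cont zs lz)
    have fL: "l2cauchy (\<sigma> + 1) f" using cB[of "\<sigma> + 1"] s0 unfolding l2cauchy_def f_def by simp
    obtain K2 where K2: "0 < K2" "!!x. x \<in> Dom S ==> norm (opBc S x) <= K2 * (norm x + norm (opA S x))"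
      by (rule op_bound) (rule that)
    \<comment> \<open>The primitive of an input difference is \<open>opBc\<close> of the primitive
      of a state difference; its graph norm is controlled by the states, since \<open>opA\<close> of
      that primitive is again a state difference.\<close>
    have fi: "norm (integral {0..s} (f n)) <= K2 * (\<sigma> + 2) * e"
      if s: "s \<in> {0..\<sigma>+1}" and e: "!!r. r \<in> {0..\<sigma>+1} ==> norm (zs n r - z r) <= e" for s n e
    proof -
      let ?d = "%t. zs n t - z t"
      have ld: "lsol ?d" by (rule lsol_diff[OF zs(1) lz])
      have D: "!!r. 0 <= r ==> r <= s ==> ?d r \<in> Dom S" using lsolD(1)[OF ld] by auto
      note oi = op_integral[OF D continuous_on_sub0[OF lsol_cont(1)[OF ld] order_refl] continuous_on_sub0[OF lsol_cont(2)[OF ld] order_refl]]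
      have "integral {0..s} (f n) = integral {0..s} (%t. opBc S (?d t))"
        by (rule integral_cong) (simp add: f_def op_diff lsolD(1)[OF zs(1)] lsolD(1)[OF lz])
      also have "\<dots> = opBc S (integral {0..s} ?d)" using oi(3) by simp
      finally have "norm (integral {0..s} (f n)) <= K2 * (norm (integral {0..s} ?d) + norm (opA S (integral {0..s} ?d)))"
        using K2(2)[OF oi(1)] by simp
      also have "opA S (integral {0..s} ?d) = ?d s - ?d 0"
      proof -
        have "opA S (integral {0..s} ?d) = integral {0..s} (%t. opA S (?d t))" by (rule oi(2))
        also have "\<dots> = ?d s - ?d 0" by (rule integral_deriv) (use s lsolD(3)[OF ld] in auto)
        finally show ?thesis .
      qed
      also have "?d 0 = 0" by (simp add: zs z00)
      also have "norm (integral {0..s} ?d) <= e * (s - 0)"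
        by (rule integral_bound) (use s e in \<open>auto intro!: continuous_on_sub0 lsol_cont ld\<close>)
      also have "e * (s - 0) <= e * (\<sigma> + 1)" using s order_trans[OF norm_ge_zero e[OF s]] by (intro mult_left_mono) auto
      also have "norm (?d s - 0) <= e" using e[OF s] by simp
      finally show ?thesis using K2(1) by (simp add: algebra_simps)
    qed
    have "uniform_limit {0..\<sigma>+1} (%n t. integral {0..t} (f n)) (%t. 0) sequentially"
      unfolding uniform_limit_iff
    proof (intro allI impI)
      fix e :: real assume e: "0 < e"
      define e' where "e' = e / (2 * (K2 * (\<sigma> + 2)))"
      have e': "0 < e'" "K2 * (\<sigma> + 2) * e' < e" using e K2(1) s0 by (auto simp: e'_def divide_simps)
      obtain M where M: "!!n x. M <= n ==> x \<in> {0..\<sigma>+1} ==> norm (zs n x - z x) <= e'"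
        by (rule uniform_limit_norm[OF ul[of "\<sigma>+1"] e'(1)]) (use s0 in auto)
      have "dist (integral {0..s} (f n)) 0 < e" if "M <= n" "s \<in> {0..\<sigma>+1}" for n s
        using fi[OF that(2) M[OF that(1)]] e'(2) by simp
      then show "\<forall>\<^sub>F n in sequentially. \<forall>x\<in>{0..\<sigma> + 1}. dist (integral {0..x} (f n)) 0 < e"
        unfolding eventually_sequentially by blast
    qed
    then have f0: "(%n. l2n \<sigma> (f n)) \<longlonglongrightarrow> 0" by (rule l2cauchy_weak_to_strong[OF fc fL s0])
    have bnd: "l2n \<sigma> (resid z) <= l2n \<sigma> (f n) + 1 / (real n + 1) + \<kappa> * (K * l2n \<sigma> (f n))" if n: "\<sigma> <= real n" for n
    proof -
      let ?y = "%t. opC S (zs n t) - opC S (z t)"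
      note c1 = continuous_on_sub0[OF resid_cont[OF zs(1)] order_refl] continuous_on_sub0[OF resid_cont[OF lz] order_refl]
        continuous_on_sub0[OF fc order_refl] diff_cont[OF zs(1) lz order_refl]
      have y: "l2n \<sigma> ?y <= K * l2n \<sigma> (f n)"
        using goodD(4)[OF g lsol_diff[OF zs(1) lz]] unfolding diff_l2n[OF zs(1) lz] by (simp add: zs z00 f_def[abs_def])
      have "l2n \<sigma> (resid z) <= l2n \<sigma> (%t. (norm (f n t) + norm (resid (zs n) t)) + norm (\<kappa> *\<^sub>R ?y t))"
      proof (rule l2n_mono_fun)
        fix t
        have "resid z t = resid (zs n) t - f n t + (N t (opC S (zs n t)) - N t (opC S (z t)))"
          by (simp add: resid_def f_def)
        then have "norm (resid z t) <= (norm (resid (zs n) t) + norm (f n t)) + norm (N t (opC S (zs n t)) - N t (opC S (z t)))"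
          by (metis (no_types, opaque_lifting) add_right_mono norm_triangle_ineq norm_triangle_ineq4 order_trans)
        then show "norm (resid z t) <= norm ((norm (f n t) + norm (resid (zs n) t)) + norm (\<kappa> *\<^sub>R ?y t))"
          using N_lip[of t "opC S (zs n t)" "opC S (z t)"] \<kappa> by simp
      qed (intro continuous_intros c1)+
      also have "\<dots> <= (l2n \<sigma> (%t. norm (f n t)) + l2n \<sigma> (%t. norm (resid (zs n) t))) + l2n \<sigma> (%t. norm (\<kappa> *\<^sub>R ?y t))"
        by (intro order_trans[OF l2n_triangle] add_right_mono l2n_triangle continuous_intros c1)
      also have "\<dots> = l2n \<sigma> (f n) + l2n \<sigma> (resid (zs n)) + \<kappa> * l2n \<sigma> ?y"
        using \<kappa> unfolding l2n_norm l2n_scaleR by simp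
      also have "\<dots> <= l2n \<sigma> (f n) + 1 / (real n + 1) + \<kappa> * (K * l2n \<sigma> (f n))"
        using re[OF n] y \<kappa> by (intro add_mono mult_left_mono) auto
      finally show ?thesis .
    qed
    have "(%n. l2n \<sigma> (f n) + 1 / (real n + 1) + \<kappa> * (K * l2n \<sigma> (f n))) \<longlonglongrightarrow> 0 + 0 + \<kappa> * (K * 0)"
    proof (intro tendsto_intros f0)
      show "(%n. 1 / (real n + 1)) \<longlonglongrightarrow> 0"
        using LIMSEQ_inverse_real_of_nat by (simp add: inverse_eq_divide add.commute)
    qed
    then have lim: "(%n. l2n \<sigma> (f n) + 1 / (real n + 1) + \<kappa> * (K * l2n \<sigma> (f n))) \<longlonglongrightarrow> 0" by simp
    have "l2n \<sigma> (resid z) <= 0"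
    proof (rule LIMSEQ_le_const[OF lim])
      obtain n0 :: nat where "\<sigma> < real n0" using reals_Archimedean2 by blast
      then show "\<exists>N. \<forall>n\<ge>N. l2n \<sigma> (resid z) <= l2n \<sigma> (f n) + 1 / (real n + 1) + \<kappa> * (K * l2n \<sigma> (f n))"
        by (intro exI[of _ n0] allI impI bnd) linarith
    qed
    then have "l2n \<sigma> (resid z) = 0" using l2n_nonneg[of \<sigma> "resid z"] by linarith
    then show ?thesis
      by (rule l2n_eq_0[rotated]) (use t \<sigma> in \<open>auto intro!: continuous_on_sub0 resid_cont lz\<close>)
  qed
  show ?thesis
  proof (rule that[OF lz z00 res])
    fix \<tau> :: real assume "0 <= \<tau>"
    from loc[OF this] obtain \<sigma> p where p: "\<tau> <= \<sigma>" "!!m::nat. continuous_on {0..} (p m)" "!!m t. t\<ge>0 ==> p m t \<in> U"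
      "l2cauchy \<sigma> p" "!!t. 0 <= t ==> t <= \<sigma> ==> (%m. integral {0..t} (p m)) \<longlonglongrightarrow> opC S (z t) - opC S z0"
      by blast
    have "l2cauchy \<tau> p"
      unfolding l2cauchy_def
    proof (intro allI impI)
      fix e :: real assume "0 < e"
      then obtain M where M: "\<forall>m\<ge>M. \<forall>n\<ge>M. l2n \<sigma> (%t. p m t - p n t) <= e" using p(4) unfolding l2cauchy_def by blast
      have "l2n \<tau> (%t. p m t - p n t) <= l2n \<sigma> (%t. p m t - p n t)" for m n
        by (intro l2n_mono_time p(1) continuous_intros continuous_on_sub0 p(2) order_refl)
      then show "\<exists>N. \<forall>m\<ge>N. \<forall>n\<ge>N. l2n \<tau> (%t. p m t - p n t) <= e" using M by (meson order_trans)
    qed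
    then show "\<exists>p. (\<forall>m::nat. continuous_on {0..} (p m) & (\<forall>t\<ge>0. p m t \<in> U)) & l2cauchy \<tau> p &
       (\<forall>t. 0 <= t --> t <= \<tau> --> (%m. integral {0..t} (p m)) \<longlonglongrightarrow> opC S (z t) - opC S z0)"
      using p by (intro exI[of _ p]) auto
  qed auto
qed

end

section \<open>Square integrable functions as limits of continuous functions\<close>

lemma measurable_on_subset:
  assumes f: "f measurable_on S" and T: "T \<subseteq> S" "T \<in> sets lebesgue"
  shows "f measurable_on T"
proof -
  have "(%x. if x \<in> T then (if x \<in> S then f x else 0) else 0) measurable_on UNIV"
    by (rule measurable_on_restrict[OF _ T(2)]) (use f in \<open>simp add: measurable_on_UNIV\<close>)
  moreover have "(%x. if x \<in> T then (if x \<in> S then f x else 0) else 0) = (%x. if x \<in> T then f x else 0)"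
    using T(1) by (auto simp: fun_eq_iff)
  ultimately show ?thesis by (simp add: measurable_on_UNIV)
qed

lemma measurable_on_cont:
  fixes f :: "real => 'a::real_normed_vector"
  assumes f: "continuous_on {0..} f" and S: "S \<in> sets lebesgue" "S \<subseteq> {0..}"
  shows "f measurable_on S"
proof -
  have "continuous_on UNIV (%t. f (max 0 t))"
    by (rule continuous_on_compose2[OF f]) (auto intro!: continuous_intros)
  from measurable_on_restrict[OF continuous_imp_measurable_on[OF this] S(1)]
  have "(%x. if x \<in> S then f (max 0 x) else 0) measurable_on UNIV" .
  moreover have "(%x. if x \<in> S then f (max 0 x) else 0) = (%x. if x \<in> S then f x else 0)"
    using S(2) by (force simp: max_def)
  ultimately show ?thesis by (simp add: measurable_on_UNIV)
qed

lemma measurable_on_norm_sq: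
  assumes f: "f measurable_on S"
  shows "set_borel_measurable lebesgue S (%t. (norm (f t))\<^sup>2)"
    "set_borel_measurable lebesgue S (%t. norm (f t))"
proof -
  have u: "(%x. if x \<in> S then f x else 0) measurable_on UNIV" using f by (simp add: measurable_on_UNIV)
  have "(%v. (norm v)\<^sup>2) \<circ> (%x. if x \<in> S then f x else 0) measurable_on UNIV"
    by (intro measurable_on_compose_continuous[OF u] continuous_intros)
  then have "(%v. (norm v)\<^sup>2) \<circ> (%x. if x \<in> S then f x else 0) \<in> borel_measurable lebesgue"
    by (rule measurable_on_imp_borel_measurable_lebesgue_UNIV)
  moreover have "norm \<circ> (%x. if x \<in> S then f x else 0) measurable_on UNIV"
    by (intro measurable_on_compose_continuous[OF u] continuous_on_norm_id)
  then have "norm \<circ> (%x. if x \<in> S then f x else 0) \<in> borel_measurable lebesgue"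
    by (rule measurable_on_imp_borel_measurable_lebesgue_UNIV)
  moreover have "(%v. (norm v)\<^sup>2) \<circ> (%x. if x \<in> S then f x else 0) = (%t. indicator S t *\<^sub>R (norm (f t))\<^sup>2)"
    "norm \<circ> (%x. if x \<in> S then f x else 0) = (%t. indicator S t *\<^sub>R norm (f t))"
    by (auto simp: indicator_def)
  ultimately show "set_borel_measurable lebesgue S (%t. (norm (f t))\<^sup>2)"
    "set_borel_measurable lebesgue S (%t. norm (f t))"
    unfolding set_borel_measurable_def by simp_all
qed

lemma norm_sq_add_le: "(norm (a + b))\<^sup>2 <= 2 * (norm a)\<^sup>2 + 2 * (norm (b::'a::real_normed_vector))\<^sup>2"
proof -
  have "(norm (a + b))\<^sup>2 <= (norm a + norm b)\<^sup>2" by (intro power_mono norm_triangle_ineq) auto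
  also have "\<dots> <= 2 * (norm a)\<^sup>2 + 2 * (norm b)\<^sup>2"
    using sum_squares_bound[of "norm a" "norm b"] by (simp add: power2_sum)
  finally show ?thesis .
qed

lemma norm_sq_diff_le: "(norm (a - b))\<^sup>2 <= 2 * (norm a)\<^sup>2 + 2 * (norm (b::'a::real_normed_vector))\<^sup>2"
  using norm_sq_add_le[of a "- b"] by simp

lemma set_integrable_sq_diff:
  assumes f: "f measurable_on S" "set_integrable lebesgue S (%t. (norm (f t))\<^sup>2)"
    and g: "g measurable_on S" "set_integrable lebesgue S (%t. (norm (g t))\<^sup>2)"
  shows "set_integrable lebesgue S (%t. (norm (f t - g t))\<^sup>2)"
proof (rule set_integrable_bound)
  show "set_integrable lebesgue S (%t. 2 * (norm (f t))\<^sup>2 + 2 * (norm (g t))\<^sup>2)"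
    by (intro set_integral_add set_integrable_mult_right f g)
  show "set_borel_measurable lebesgue S (%t. (norm (f t - g t))\<^sup>2)"
    by (intro measurable_on_norm_sq measurable_on_diff f g)
qed (auto intro!: always_eventually norm_sq_diff_le)

lemma set_lint_sq_triangle:
  fixes f g h :: "real => 'a::real_normed_vector"
  assumes "set_integrable lebesgue S (%t. (norm (f t - g t))\<^sup>2)" "set_integrable lebesgue S (%t. (norm (g t - h t))\<^sup>2)"
  shows "(LINT t:S|lebesgue. (norm (f t - h t))\<^sup>2)
    <= 2 * (LINT t:S|lebesgue. (norm (f t - g t))\<^sup>2) + 2 * (LINT t:S|lebesgue. (norm (g t - h t))\<^sup>2)"
proof (cases "set_integrable lebesgue S (%t. (norm (f t - h t))\<^sup>2)")
  case True
  have "(LINT t:S|lebesgue. (norm (f t - h t))\<^sup>2) <= (LINT t:S|lebesgue. 2 * (norm (f t - g t))\<^sup>2 + 2 * (norm (g t - h t))\<^sup>2)"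
  proof (rule set_integral_mono[OF True])
    show "set_integrable lebesgue S (%t. 2 * (norm (f t - g t))\<^sup>2 + 2 * (norm (g t - h t))\<^sup>2)"
      by (intro set_integral_add set_integrable_mult_right assms)
    show "(norm (f t - h t))\<^sup>2 <= 2 * (norm (f t - g t))\<^sup>2 + 2 * (norm (g t - h t))\<^sup>2" for t
      using norm_sq_add_le[of "f t - g t" "g t - h t"] by simp
  qed
  also have "\<dots> = 2 * (LINT t:S|lebesgue. (norm (f t - g t))\<^sup>2) + 2 * (LINT t:S|lebesgue. (norm (g t - h t))\<^sup>2)"
    using assms by (subst set_integral_add) (auto intro: set_integrable_mult_right)
  finally show ?thesis .
next
  \<comment> \<open>A nonintegrable integrand has integral zero by convention, so the inequality
    persists.\<close>
  case False
  have "0 <= (LINT t:S|lebesgue. (norm (k t))\<^sup>2)" for k :: "real => 'a"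
    unfolding set_lebesgue_integral_def by (rule integral_nonneg_AE) auto
  from this[of "%t. f t - g t"] this[of "%t. g t - h t"] False show ?thesis
    by (simp add: set_lebesgue_integral_def set_integrable_def not_integrable_integral_eq)
qed

lemma cont_sq_integrable:
  fixes f :: "real => 'a::real_normed_vector"
  assumes "continuous_on {0..} f" "0 <= a"
  shows "set_integrable lebesgue {a..b} (%t. (norm (f t))\<^sup>2)" "set_integrable lebesgue {a<..<b} (%t. (norm (f t))\<^sup>2)"
proof -
  show 1: "set_integrable lebesgue {a..b} (%t. (norm (f t))\<^sup>2)"
    by (intro absolutely_integrable_continuous_real continuous_intros continuous_on_sub0 assms)
  show "set_integrable lebesgue {a<..<b} (%t. (norm (f t))\<^sup>2)"
    by (rule set_integrable_subset[OF 1]) auto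
qed

text \<open>Links the open intervals of the function spaces with the closed ones of
  \<open>l2n\<close>. The integrands agree off the end points, and null sets do not affect
  measurability for \<open>lebesgue\<close>; without measurability both integrals have the default
  value zero.\<close>

lemma lint_open_closed:
  fixes g :: "real => real"
  shows "(LINT t:{a<..<b}|lebesgue. g t) = (LINT t:{a..b}|lebesgue. g t)"
    "set_integrable lebesgue {a<..<b} g \<longleftrightarrow> set_integrable lebesgue {a..b} g"
proof -
  have n: "sym_diff {a<..<b} {a..b} \<in> null_sets lebesgue"
  proof -
    have "sym_diff {a<..<b} {a..b} \<subseteq> {a, b}" by auto
    then have "negligible (sym_diff {a<..<b} {a..b})" by (rule negligible_subset[rotated]) simp
    then show ?thesis by (simp add: negligible_iff_null_sets)
  qed
  have AE: "AE t in lebesgue. indicator {a<..<b} t *\<^sub>R g t = indicator {a..b} t *\<^sub>R g t"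
    by (rule AE_I'[OF n]) (auto simp: indicator_def)
  have AE2: "AE t in lebesgue. indicator {a..b} t *\<^sub>R g t = indicator {a<..<b} t *\<^sub>R g t"
    by (rule AE_I'[OF n]) (auto simp: indicator_def)
  have m: "(%t. indicator {a<..<b} t *\<^sub>R g t) \<in> borel_measurable lebesgue \<longleftrightarrow> (%t. indicator {a..b} t *\<^sub>R g t) \<in> borel_measurable lebesgue"
    using borel_measurable_AE[OF _ AE] borel_measurable_AE[OF _ AE2] by blast
  show "set_integrable lebesgue {a<..<b} g \<longleftrightarrow> set_integrable lebesgue {a..b} g"
    unfolding set_integrable_def using m integrable_cong_AE[OF _ _ AE] borel_measurable_integrable by blast
  show "(LINT t:{a<..<b}|lebesgue. g t) = (LINT t:{a..b}|lebesgue. g t)"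
  proof (cases "(%t. indicator {a<..<b} t *\<^sub>R g t) \<in> borel_measurable lebesgue")
    case True
    then show ?thesis unfolding set_lebesgue_integral_def using m by (intro integral_cong_AE AE) auto
  next
    case False
    then have F: "\<not> integrable lebesgue (%t. indicator {a<..<b} t *\<^sub>R g t)" "\<not> integrable lebesgue (%t. indicator {a..b} t *\<^sub>R g t)"
      using m borel_measurable_integrable by blast+
    show ?thesis unfolding set_lebesgue_integral_def
      by (rule trans[OF not_integrable_integral_eq[OF F(1)] not_integrable_integral_eq[OF F(2), symmetric]])
  qed
qed

lemma L2_norm_cont:
  assumes "continuous_on {0..} f"
  shows "L2_norm {0<..<\<tau>} f = l2n \<tau> f"
  unfolding L2_norm_def lint_open_closed(1) lint_sq[OF continuous_on_sub0[OF assms order_refl]] by simp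

lemma L2_on_cont:
  assumes "continuous_on {0..} f" "!!t. 0 <= t ==> f t \<in> V"
  shows "L2_on {0<..<\<tau>} V f"
  unfolding L2_on_def
proof (intro conjI)
  show "f measurable_on {0<..<\<tau>}" by (rule measurable_on_cont[OF assms(1)]) auto
  show "AE t in lebesgue. t \<in> {0<..<\<tau>} --> f t \<in> V" using assms(2) by (intro always_eventually) auto
  show "set_integrable lebesgue {0<..<\<tau>} (%t. (norm (f t))\<^sup>2)" by (rule cont_sq_integrable[OF assms(1) order_refl])
qed

section \<open>Completeness and integrals of mean-square limits\<close>

lemma nn_integral_cont:
  fixes g :: "real => real"
  assumes g: "continuous_on {0..\<tau>} g" "!!t. 0 <= g t"
  shows "(\<integral>\<^sup>+ t. ennreal (indicator {0..\<tau>} t *\<^sub>R g t) \<partial>lebesgue) = ennreal (integral {0..\<tau>} g)"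
proof -
  have si: "set_integrable lebesgue {0..\<tau>} g" by (rule absolutely_integrable_continuous_real[OF g(1)])
  have "(\<integral>\<^sup>+ t. ennreal (indicator {0..\<tau>} t *\<^sub>R g t) \<partial>lebesgue) = ennreal (LINT t:{0..\<tau>}|lebesgue. g t)"
    unfolding set_lebesgue_integral_def
    by (rule nn_integral_eq_integral[OF si[unfolded set_integrable_def]]) (use g(2) in auto)
  then show ?thesis by (simp add: set_lebesgue_integral_eq_integral(2)[OF si])
qed

text \<open>The Riesz--Fischer theorem, for possibly nonseparable ranges. The sequence \<open>H\<close> of horizons
  is either constant or unbounded.\<close>

lemma l2_limit:
  fixes f :: "nat => real => 'a::banach" and H :: "nat => real"
  assumes c: "!!n. continuous_on {0..} (f n)" and V: "0 \<in> V" "closed V" "!!n t. 0 <= t ==> f n t \<in> V"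
    and H: "!!k. 0 <= H k" "incseq H" "!!t. (!!k. H k < t) ==> \<exists>d>0. \<forall>k. H k + d <= t"
    and L: "!!k. l2cauchy (H k) f"
  obtains y where "y measurable_on (\<Union>k. {0..H k})" "!!t. y t \<in> V"
    "!!k. set_integrable lebesgue {0..H k} (%t. (norm (y t))\<^sup>2)"
    "!!k n. set_integrable lebesgue {0..H k} (%t. (norm (f n t - y t))\<^sup>2)"
    "!!k. (%n. LINT t:{0..H k}|lebesgue. (norm (f n t - y t))\<^sup>2) \<longlonglongrightarrow> 0"
proof -
  have "\<exists>N. \<forall>m\<ge>N. \<forall>n\<ge>N. l2n (H k) (%t. f m t - f n t) <= (1/2)^k" for k
    using L[of k] unfolding l2cauchy_def by (meson zero_less_divide_1_iff zero_less_numeral zero_less_power)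
  then obtain Nf where Nf: "!!k m n. Nf k <= m ==> Nf k <= n ==> l2n (H k) (%t. f m t - f n t) <= (1/2)^k" by metis
  \<comment> \<open>A subsequence whose consecutive differences are at most \<open>(1/2)^k\<close>
    on the horizon \<open>H k\<close>; adding \<open>k\<close> makes the indices unbounded.\<close>
  define r where "r k = (\<Sum>i\<le>k. Nf i) + k" for k
  have rN: "Nf k <= r k" "k <= r k" for k
    using member_le_sum[of k "{..k}" Nf] by (auto simp: r_def)
  have rN': "Nf k <= r (Suc k)" for k using rN(1)[of k] by (simp add: r_def)
  define G where "G k t = norm (f (r (Suc k)) t - f (r k) t)" for k t
  have Gc: "continuous_on {0..} (G k)" for k unfolding G_def by (intro continuous_intros c)
  have conv: "AE t in lebesgue. t \<in> {0..H j} --> convergent (%k. f (r k) t)" for j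
  proof -
    define a where "a k = integral {0..H j} (G k)" for k
    have a0: "0 <= a k" for k unfolding a_def
      by (intro integral_nonneg integrable_cont continuous_on_sub0[OF Gc]) (auto simp: G_def)
    have ak: "a k <= sqrt (H j) * (1/2)^k" if "j <= k" for k
    proof -
      have "norm (a k) <= sqrt (H j) * l2n (H j) (G k)"
        unfolding a_def by (rule norm_integral_le_l2n) (use H in \<open>auto intro!: continuous_on_sub0 Gc\<close>)
      also have "l2n (H j) (G k) <= (1/2)^k"
      proof -
        have "l2n (H j) (G k) = l2n (H j) (%t. f (r (Suc k)) t - f (r k) t)" unfolding G_def by (rule l2n_norm)
        also have "\<dots> <= l2n (H k) (%t. f (r (Suc k)) t - f (r k) t)"
          using H(2) that by (intro l2n_mono_time continuous_intros continuous_on_sub0 c) (auto simp: incseq_def)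
        also have "\<dots> <= (1/2)^k" by (rule Nf[OF rN' rN(1)])
        finally show ?thesis .
      qed
      finally show ?thesis using a0[of k] H(1)[of j] by (simp add: mult_left_mono)
    qed
    have sa: "summable a"
    proof (rule summable_comparison_test)
      show "summable (%k. sqrt (H j) * (1/2::real)^k)" by (intro summable_mult summable_geometric) simp
      show "\<exists>N. \<forall>n\<ge>N. norm (a n) <= sqrt (H j) * (1/2)^n" using ak a0 by auto
    qed
    let ?g = "%k t. ennreal (indicator {0..H j} t *\<^sub>R G k t)"
    have gm: "?g k \<in> borel_measurable lebesgue" for k
    proof -
      have "set_integrable lebesgue {0..H j} (G k)"
        by (intro absolutely_integrable_continuous_real continuous_on_sub0[OF Gc]) simp
      then show ?thesis unfolding set_integrable_def by (intro measurable_compose[OF borel_measurable_integrable measurable_ennreal])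
    qed
    have "(\<integral>\<^sup>+ t. (\<Sum>k. ?g k t) \<partial>lebesgue) = (\<Sum>k. \<integral>\<^sup>+ t. ?g k t \<partial>lebesgue)"
      by (rule nn_integral_suminf) (rule gm)
    also have "\<dots> = (\<Sum>k. ennreal (a k))"
      unfolding a_def by (intro suminf_cong nn_integral_cont continuous_on_sub0[OF Gc]) (auto simp: G_def)
    also have "\<dots> = ennreal (suminf a)" by (rule suminf_ennreal2[OF a0 sa])
    finally have fin: "(\<integral>\<^sup>+ t. (\<Sum>k. ?g k t) \<partial>lebesgue) \<noteq> \<infinity>" by simp
    have "AE t in lebesgue. (\<Sum>k. ?g k t) \<noteq> \<infinity>"
      by (rule nn_integral_PInf_AE[OF _ fin]) (intro borel_measurable_suminf_order gm)
    then show ?thesis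
    proof (rule AE_mp, intro AE_I2 impI)
      fix t assume t: "(\<Sum>k. ?g k t) \<noteq> \<infinity>" "t \<in> {0..H j}"
      have "summable (%k. G k t)"
        by (rule summable_suminf_not_top) (use t in \<open>auto simp: G_def\<close>)
      then have "summable (%k. f (r (Suc k)) t - f (r k) t)"
        unfolding G_def by (rule summable_norm_cancel)
      then have "(%n. (\<Sum>k<n. f (r (Suc k)) t - f (r k) t) + f (r 0) t) \<longlonglongrightarrow> suminf (%k. f (r (Suc k)) t - f (r k) t) + f (r 0) t"
        by (intro tendsto_add tendsto_const summable_LIMSEQ)
      moreover have "(\<Sum>k<n. f (r (Suc k)) t - f (r k) t) + f (r 0) t = f (r n) t" for n
        using sum_lessThan_telescope[of "%k. f (r k) t" n] by simp
      ultimately show "convergent (%k. f (r k) t)"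
        unfolding convergent_def by auto
    qed
  qed
  define D where "D = (\<Union>k. {0..H k})"
  \<comment> \<open>The default value zero off the set of convergence lies in \<open>V\<close>, so
    every value of \<open>y\<close> does.\<close>
  define y where "y t = (if t \<in> D & convergent (%k. f (r k) t) then lim (%k. f (r k) t) else 0)" for t
  have "AE t in lebesgue. \<forall>j. t \<in> {0..H j} --> convergent (%k. f (r k) t)"
    unfolding AE_all_countable using conv by blast
  then have AEy: "AE t in lebesgue. t \<in> D --> (%k. f (r k) t) \<longlonglongrightarrow> y t"
    by (rule AE_mp) (auto simp: D_def y_def convergent_LIMSEQ_iff intro!: AE_I2)
  have yV: "y t \<in> V" for t
  proof (cases "t \<in> D & convergent (%k. f (r k) t)")
    case True
    then have "(%k. f (r k) t) \<longlonglongrightarrow> y t" "0 <= t" by (auto simp: y_def convergent_LIMSEQ_iff D_def)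
    then show ?thesis using closed_sequentially[OF V(2), of "%k. f (r k) t"] V(3) by auto
  qed (auto simp: y_def V)
  have ym: "y measurable_on D"
  proof -
    obtain N where N: "{t \<in> space lebesgue. \<not> (t \<in> D --> (%k. f (r k) t) \<longlonglongrightarrow> y t)} \<subseteq> N"
        "emeasure lebesgue N = 0" "N \<in> sets lebesgue"
      by (rule AE_E[OF AEy])
    then have N: "N \<in> null_sets lebesgue" "{t. \<not> (t \<in> D --> (%k. f (r k) t) \<longlonglongrightarrow> y t)} \<subseteq> N"
      by (auto intro: null_setsI)
    \<comment> \<open>\<open>measurable_on\<close> asks for continuous functions on the whole line.
      The cutoff tends to one on the union of the horizons and to zero elsewhere; past a finite
      supremum the third condition on \<open>H\<close> leaves a gap, so that it vanishes there for
      large \<open>k\<close>.\<close>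
    define cut where "cut k t = max 0 (min 1 (1 + real k * t)) * max 0 (min 1 (1 - real k * (t - H k)))" for k t
    show ?thesis
      unfolding measurable_on_def
    proof (intro exI[of _ N] exI[of _ "%k t. cut k t *\<^sub>R f (r k) (max 0 t)"] conjI allI impI)
      show "negligible N" using N by (simp add: negligible_iff_null_sets)
      show "continuous_on UNIV (%t. cut k t *\<^sub>R f (r k) (max 0 t))" for k
        unfolding cut_def by (intro continuous_intros continuous_on_compose2[OF c]) auto
      fix t assume tN: "t \<notin> N"
      show "(%k. cut k t *\<^sub>R f (r k) (max 0 t)) \<longlonglongrightarrow> (if t \<in> D then y t else 0)"
      proof (cases "t \<in> D")
        case True
        then obtain k0 where k0: "0 <= t" "t <= H k0" by (auto simp: D_def)
        have "(%k. f (r k) t) \<longlonglongrightarrow> y t" using N(2) tN True by auto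
        moreover have "\<forall>\<^sub>F k in sequentially. f (r k) t = cut k t *\<^sub>R f (r k) (max 0 t)"
        proof (rule eventually_sequentiallyI[of k0])
          fix k assume "k0 <= k"
          then have "t <= H k" using H(2) k0 by (meson incseq_def order_trans)
          then have "cut k t = 1" using k0 by (simp add: cut_def mult_nonneg_nonpos)
          then show "f (r k) t = cut k t *\<^sub>R f (r k) (max 0 t)" using k0 by simp
        qed
        ultimately show ?thesis using True by (simp add: tendsto_cong)
      next
        case False
        have "\<exists>k0. \<forall>k\<ge>k0. cut k t = 0"
        proof (cases "t < 0")
          case True
          obtain k0 :: nat where k0: "1 / (- t) < real k0" using reals_Archimedean2 by blast
          have "cut k t = 0" if "k0 <= k" for k
          proof -
            have "1 / (- t) < real k" using k0 that by linarith
            then have "1 / (- t) * (- t) < real k * (- t)" using True by (intro mult_strict_right_mono) auto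
            moreover have "1 / (- t) * (- t) = 1" using True by simp
            ultimately have "1 < real k * (- t)" by (simp only:)
            then show ?thesis by (simp add: cut_def)
          qed
          then show ?thesis by blast
        next
          case t0: False
          have "H k < t" for k using False t0 by (auto simp: D_def not_le[symmetric])
          then obtain d where d: "0 < d" "!!k. H k + d <= t" using H(3) by blast
          obtain k0 :: nat where k0: "1 / d < real k0" using reals_Archimedean2 by blast
          have "cut k t = 0" if "k0 <= k" for k
          proof -
            have "1 / d < real k" using k0 that by linarith
            then have "1 < real k * d" using d by (simp add: pos_divide_less_eq)
            also have "\<dots> <= real k * (t - H k)" using d(2)[of k] by (intro mult_left_mono) auto
            finally show ?thesis by (simp add: cut_def)
          qed
          then show ?thesis by blast
        qed
        then have "\<forall>\<^sub>F k in sequentially. cut k t *\<^sub>R f (r k) (max 0 t) = 0"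
          unfolding eventually_sequentially by auto
        then show ?thesis using False by (simp add: tendsto_eventually)
      qed
    qed
  qed
  have HD: "{0..H k} \<subseteq> D" for k by (auto simp: D_def)
  have ymk: "y measurable_on {0..H k}" for k by (rule measurable_on_subset[OF ym HD]) simp
  have dm: "(%t. f n t - y t) measurable_on {0..H k}" for n k
    by (intro measurable_on_diff ymk measurable_on_cont c) auto
  \<comment> \<open>Fatou's lemma along the subsequence: a bound for \<open>f n - f m\<close> valid
    for all late \<open>m\<close> is inherited by \<open>f n - y\<close>. A crude bound gives
    integrability, a small one convergence.\<close>
  have fatou: "set_integrable lebesgue {0..H j} (%t. (norm (f n t - y t))\<^sup>2) &
      (LINT t:{0..H j}|lebesgue. (norm (f n t - y t))\<^sup>2) <= e\<^sup>2"
    if e: "0 <= e" and ev: "!!m. M <= m ==> l2n (H j) (%t. f n t - f m t) <= e" for n j e M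
  proof -
    let ?h = "%t. indicator {0..H j} t *\<^sub>R (norm (f n t - y t))\<^sup>2"
    let ?u = "%k t. indicator {0..H j} t *\<^sub>R (norm (f n t - f (r k) t))\<^sup>2"
    have hm: "?h \<in> borel_measurable lebesgue"
      using measurable_on_norm_sq(1)[OF dm[of n j]] by (simp add: set_borel_measurable_def)
    have um: "?u k \<in> borel_measurable lebesgue" for k
      using cont_sq_integrable(1)[OF continuous_on_diff[OF c[of n] c[of "r k"]], of 0 "H j"]
      by (auto simp: set_integrable_def)
    have "(\<integral>\<^sup>+ t. ennreal (?h t) \<partial>lebesgue) <= (\<integral>\<^sup>+ t. liminf (%k. ennreal (?u k t)) \<partial>lebesgue)"
    proof (rule nn_integral_mono_AE, rule AE_mp[OF AEy], intro AE_I2 impI)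
      fix t assume t: "t \<in> D --> (%k. f (r k) t) \<longlonglongrightarrow> y t"
      have "(%k. ?u k t) \<longlonglongrightarrow> ?h t"
        using t HD[of j] by (cases "t \<in> {0..H j}") (auto intro!: tendsto_intros)
      then have "(%k. ennreal (?u k t)) \<longlonglongrightarrow> ennreal (?h t)" by (intro tendsto_ennrealI)
      then show "ennreal (?h t) <= liminf (%k. ennreal (?u k t))"
        using lim_imp_Liminf[OF sequentially_bot] by fastforce
    qed
    also have "\<dots> <= liminf (%k. \<integral>\<^sup>+ t. ennreal (?u k t) \<partial>lebesgue)"
      by (rule nn_integral_liminf) (intro measurable_compose[OF um measurable_ennreal])
    also have "\<dots> <= limsup (%k. \<integral>\<^sup>+ t. ennreal (?u k t) \<partial>lebesgue)"
      by (rule Liminf_le_Limsup) simp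
    also have "\<dots> <= ennreal (e\<^sup>2)"
    proof (rule Limsup_bounded, rule eventually_sequentiallyI[of M])
      fix k assume k: "M <= k"
      have "(\<integral>\<^sup>+ t. ennreal (?u k t) \<partial>lebesgue) = ennreal (integral {0..H j} (%t. (norm (f n t - f (r k) t))\<^sup>2))"
        by (rule nn_integral_cont) (auto intro!: continuous_intros continuous_on_sub0[OF c])
      also have "integral {0..H j} (%t. (norm (f n t - f (r k) t))\<^sup>2) = (l2n (H j) (%t. f n t - f (r k) t))\<^sup>2"
        by (rule l2n_sq[symmetric]) (auto intro!: continuous_intros continuous_on_sub0[OF c])
      also have "\<dots> <= e\<^sup>2" using ev[of "r k"] k rN(2)[of k] by (intro power_mono) auto
      finally show "(\<integral>\<^sup>+ t. ennreal (?u k t) \<partial>lebesgue) <= ennreal (e\<^sup>2)" by (simp add: ennreal_leI)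
    qed
    finally have le: "(\<integral>\<^sup>+ t. ennreal (?h t) \<partial>lebesgue) <= ennreal (e\<^sup>2)" .
    then have "(\<integral>\<^sup>+ t. ennreal (?h t) \<partial>lebesgue) < \<infinity>" by (simp add: order_le_less_trans)
    then have hi: "integrable lebesgue ?h"
      by (intro integrableI_nonneg hm) auto
    have "ennreal (LINT t|lebesgue. ?h t) = (\<integral>\<^sup>+ t. ennreal (?h t) \<partial>lebesgue)"
      by (rule nn_integral_eq_integral[symmetric, OF hi]) auto
    then have "ennreal (LINT t|lebesgue. ?h t) <= ennreal (e\<^sup>2)" using le by simp
    then have "(LINT t|lebesgue. ?h t) <= e\<^sup>2" by (simp add: ennreal_le_iff)
    then show ?thesis using hi by (simp add: set_integrable_def set_lebesgue_integral_def)
  qed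
  have si: "set_integrable lebesgue {0..H k} (%t. (norm (f n t - y t))\<^sup>2)" for n k
  proof -
    obtain B where B: "0 <= B" "!!m. l2n (H k) (f m) <= B"
      using l2cauchy_bounded[OF c L[of k]] by metis
    have "l2n (H k) (%t. f n t - f m t) <= 2 * B" for m
      using l2n_diff[OF continuous_on_sub0[OF c[of n] order_refl] continuous_on_sub0[OF c[of m] order_refl], of "H k"] B(2)[of m] B(2)[of n]
      by linarith
    then show ?thesis using fatou[of "2 * B" 0 k n] B by simp
  qed
  show ?thesis
  proof (rule that[of y])
    show "y measurable_on (\<Union>k. {0..H k})" using ym by (simp add: D_def)
    show "y t \<in> V" for t by (rule yV)
    show "set_integrable lebesgue {0..H k} (%t. (norm (f n t - y t))\<^sup>2)" for k n by (rule si)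
    show "set_integrable lebesgue {0..H k} (%t. (norm (y t))\<^sup>2)" for k
    proof (rule set_integrable_bound)
      show "set_integrable lebesgue {0..H k} (%t. 2 * (norm (f 0 t))\<^sup>2 + 2 * (norm (f 0 t - y t))\<^sup>2)"
        by (intro set_integral_add set_integrable_mult_right si cont_sq_integrable c order_refl)
      show "set_borel_measurable lebesgue {0..H k} (%t. (norm (y t))\<^sup>2)" by (rule measurable_on_norm_sq(1)[OF ymk])
      show "AE t in lebesgue. t \<in> {0..H k} --> norm ((norm (y t))\<^sup>2) <= norm (2 * (norm (f 0 t))\<^sup>2 + 2 * (norm (f 0 t - y t))\<^sup>2)"
      proof (intro always_eventually allI impI)
        fix t
        show "norm ((norm (y t))\<^sup>2) <= norm (2 * (norm (f 0 t))\<^sup>2 + 2 * (norm (f 0 t - y t))\<^sup>2)"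
          using norm_sq_diff_le[of "f 0 t" "f 0 t - y t"] by simp
      qed
    qed
    show "(%n. LINT t:{0..H k}|lebesgue. (norm (f n t - y t))\<^sup>2) \<longlonglongrightarrow> 0" for k
    proof (rule LIMSEQ_I)
      fix e :: real assume e: "0 < e"
      define e' where "e' = sqrt (e / 2)"
      have e': "0 < e'" "e'\<^sup>2 < e" using e by (auto simp: e'_def)
      obtain M where M: "!!m n. M <= m ==> M <= n ==> l2n (H k) (%t. f m t - f n t) <= e'"
        using L[of k] e'(1) unfolding l2cauchy_def by metis
      have "norm ((LINT t:{0..H k}|lebesgue. (norm (f n t - y t))\<^sup>2) - 0) < e" if "M <= n" for n
      proof -
        have "(LINT t:{0..H k}|lebesgue. (norm (f n t - y t))\<^sup>2) <= e'\<^sup>2"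
          using fatou[of e' M k n] e' M that by simp
        moreover have "0 <= (LINT t:{0..H k}|lebesgue. (norm (f n t - y t))\<^sup>2)"
          unfolding set_lebesgue_integral_def by (rule integral_nonneg_AE) auto
        ultimately show ?thesis using e'(2) by simp
      qed
      then show "\<exists>M. \<forall>n\<ge>M. norm ((LINT t:{0..H k}|lebesgue. (norm (f n t - y t))\<^sup>2) - 0) < e" by blast
    qed
  qed
qed

lemma has_integral_gauge:
  fixes h :: "real => 'a::real_normed_vector"
  assumes "(h has_integral J) {s..t}" "0 < e"
  obtains \<gamma> where "gauge \<gamma>" "!!\<D>. \<D> tagged_division_of cbox s t ==> \<gamma> fine \<D> ==>
      norm ((\<Sum>(x,k)\<in>\<D>. measure lborel k *\<^sub>R h x) - J) < e"
proof -
  have "(h has_integral J) (cbox s t)" using assms(1) by simp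
  from this[unfolded has_integral, rule_format, OF assms(2)]
  obtain \<gamma> where g: "gauge \<gamma> & (\<forall>\<D>. \<D> tagged_division_of cbox s t & \<gamma> fine \<D> -->
      norm ((\<Sum>(x,k)\<in>\<D>. measure lborel k *\<^sub>R h x) - J) < e)" by (elim exE)
  show ?thesis by (rule that[OF conjunct1[OF g]]) (use conjunct2[OF g] in simp)
qed

text \<open>The Henstock sums of the error \<open>p m - y\<close> are dominated by those of the scalar function
  \<open>(\<parallel>p m - y\<parallel>\<^sup>2 / e + e) / 2\<close>.\<close>

lemma l2_limit_has_integral:
  fixes p :: "nat => real => 'a::banach"
  assumes c: "!!m. continuous_on {0..} (p m)"
    and si: "!!m. set_integrable lebesgue {0..\<tau>} (%t. (norm (p m t - y t))\<^sup>2)"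
    and lim: "(%m. LINT t:{0..\<tau>}|lebesgue. (norm (p m t - y t))\<^sup>2) \<longlonglongrightarrow> 0"
    and I: "(%m. integral {s..t} (p m)) \<longlonglongrightarrow> I" and st: "0 <= s" "s <= t" "t <= \<tau>"
  shows "(y has_integral I) {s..t}"
  unfolding has_integral box_real(2)[symmetric]
proof (intro allI impI)
  fix \<epsilon> :: real assume \<epsilon>: "0 < \<epsilon>"
  \<comment> \<open>The final estimate has four terms \<open>e\<close> and one term
    \<open>\<tau> * e\<close>.\<close>
  define e where "e = \<epsilon> / (4 + \<tau>)"
  have e: "0 < e" "e * (4 + \<tau>) = \<epsilon>" using \<epsilon> st by (auto simp: e_def)
  obtain M1 where M1: "!!m. M1 <= m ==> norm ((LINT t:{0..\<tau>}|lebesgue. (norm (p m t - y t))\<^sup>2) - 0) < e\<^sup>2"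
    using LIMSEQ_D[OF lim, of "e\<^sup>2"] e by auto
  obtain M2 where M2: "!!m. M2 <= m ==> norm (integral {s..t} (p m) - I) < e"
    using LIMSEQ_D[OF I e(1)] by auto
  define m where "m = max M1 M2"
  \<comment> \<open>By the inequality of arithmetic and geometric means \<open>w\<close> dominates
    the norm of the error, and its integral is known before the error itself is known to be
    integrable.\<close>
  define w where "w r = ((norm (p m r - y r))\<^sup>2 / e + e) / 2" for r
  have wb: "norm (y r - p m r) <= w r" for r
  proof -
    have "2 * e * norm (p m r - y r) <= (norm (p m r - y r))\<^sup>2 + e\<^sup>2"
      using sum_squares_bound[of e "norm (p m r - y r)"] by simp
    then show ?thesis using e by (simp add: w_def norm_minus_commute field_simps power2_eq_square)
  qed
  have "set_integrable lebesgue {s..t} (%t. (norm (p m t - y t))\<^sup>2)"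
    by (rule set_integrable_subset[OF si]) (use st in auto)
  from has_integral_set_lebesgue[OF this]
  have "((%r. (norm (p m r - y r))\<^sup>2) has_integral (LINT r:{s..t}|lebesgue. (norm (p m r - y r))\<^sup>2)) {s..t}" .
  then have "((%r. ((norm (p m r - y r))\<^sup>2 * (1/e) + e) * (1/2)) has_integral
      ((LINT r:{s..t}|lebesgue. (norm (p m r - y r))\<^sup>2) * (1/e) + (t - s) *\<^sub>R e) * (1/2)) {s..t}"
    by (intro has_integral_mult_left has_integral_add) (use has_integral_const_real[of e s t] st in auto)
  moreover have "(%r. ((norm (p m r - y r))\<^sup>2 * (1/e) + e) * (1/2)) = w" by (simp add: w_def fun_eq_iff)
  ultimately have wi: "(w has_integral ((LINT r:{s..t}|lebesgue. (norm (p m r - y r))\<^sup>2) * (1/e) + (t - s) *\<^sub>R e) * (1/2)) {s..t}" (is "(w has_integral ?J) _")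
    by simp
  have "(LINT r:{s..t}|lebesgue. (norm (p m r - y r))\<^sup>2) <= (LINT r:{0..\<tau>}|lebesgue. (norm (p m r - y r))\<^sup>2)"
    unfolding set_lebesgue_integral_def
  proof (rule integral_mono)
    show "integrable lebesgue (%x. indicat_real {s..t} x *\<^sub>R (norm (p m x - y x))\<^sup>2)"
      using set_integrable_subset[OF si[of m], of "{s..t}"] st by (simp add: set_integrable_def)
    show "integrable lebesgue (%x. indicat_real {0..\<tau>} x *\<^sub>R (norm (p m x - y x))\<^sup>2)"
      using si[of m] by (simp add: set_integrable_def)
  qed (use st in \<open>auto simp: indicator_def\<close>)
  also have "\<dots> <= e\<^sup>2" using M1[of m] by (simp add: m_def)
  finally have "(LINT r:{s..t}|lebesgue. (norm (p m r - y r))\<^sup>2) * (1/e) <= e\<^sup>2 * (1/e)"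
    using e by (intro mult_right_mono) auto
  moreover have "e\<^sup>2 * (1/e) = e" using e by (simp add: power2_eq_square)
  moreover have "(t - s) * e <= \<tau> * e" using st e by (intro mult_right_mono) auto
  moreover have "0 <= e" "0 <= \<tau> * e" using e st by auto
  moreover have "(A + B) * (1/2) <= c + d" if "A <= c" "B <= d" "0 <= c" "0 <= d" for A B c d :: real
    using that by simp
  ultimately have J: "?J <= e + \<tau> * e" by (simp only: real_scaleR_def)
  obtain \<gamma>1 where \<gamma>1: "gauge \<gamma>1" "!!\<D>. \<D> tagged_division_of cbox s t ==> \<gamma>1 fine \<D> ==>
      norm ((\<Sum>(x,k)\<in>\<D>. measure lborel k *\<^sub>R w x) - ?J) < e"
    by (rule has_integral_gauge[OF wi e(1)]) (rule that)
  have pi: "(p m has_integral integral {s..t} (p m)) {s..t}"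
    by (intro integrable_integral integrable_cont continuous_on_sub0 c st)
  obtain \<gamma>2 where \<gamma>2: "gauge \<gamma>2" "!!\<D>. \<D> tagged_division_of cbox s t ==> \<gamma>2 fine \<D> ==>
      norm ((\<Sum>(x,k)\<in>\<D>. measure lborel k *\<^sub>R p m x) - integral {s..t} (p m)) < e"
    by (rule has_integral_gauge[OF pi e(1)]) (rule that)
  show "\<exists>\<gamma>. gauge \<gamma> & (\<forall>\<D>. \<D> tagged_division_of cbox s t & \<gamma> fine \<D> -->
      norm ((\<Sum>(x,k)\<in>\<D>. measure lborel k *\<^sub>R y x) - I) < \<epsilon>)"
  proof (intro exI[of _ "%x. \<gamma>1 x \<inter> \<gamma>2 x"] conjI allI impI gauge_Int \<gamma>1(1) \<gamma>2(1))
    fix \<D> assume D: "\<D> tagged_division_of cbox s t & (%x. \<gamma>1 x \<inter> \<gamma>2 x) fine \<D>"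
    then have D1: "\<D> tagged_division_of cbox s t" "\<gamma>1 fine \<D>" "\<gamma>2 fine \<D>" by (auto simp: fine_Int)
    have "norm (\<Sum>(x,k)\<in>\<D>. measure lborel k *\<^sub>R (y x - p m x)) <= (\<Sum>(x,k)\<in>\<D>. measure lborel k *\<^sub>R w x)"
      by (rule sum_norm_le) (auto intro!: mult_left_mono wb split: prod.splits)
    moreover have "a <= c + e" if "a <= b" "norm (b - J) < e" "J <= c" for a b c J :: real
      using that by simp
    ultimately have a: "norm (\<Sum>(x,k)\<in>\<D>. measure lborel k *\<^sub>R (y x - p m x)) <= (e + \<tau> * e) + e"
      using \<gamma>1(2)[OF D1(1,2)] J by blast
    have "(\<Sum>(x,k)\<in>\<D>. measure lborel k *\<^sub>R y x) - I = (\<Sum>(x,k)\<in>\<D>. measure lborel k *\<^sub>R (y x - p m x))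
        + ((\<Sum>(x,k)\<in>\<D>. measure lborel k *\<^sub>R p m x) - integral {s..t} (p m)) + (integral {s..t} (p m) - I)"
      by (simp add: scaleR_diff_right sum_subtractf split_def)
    also have "norm \<dots> <= norm (\<Sum>(x,k)\<in>\<D>. measure lborel k *\<^sub>R (y x - p m x))
        + norm ((\<Sum>(x,k)\<in>\<D>. measure lborel k *\<^sub>R p m x) - integral {s..t} (p m)) + norm (integral {s..t} (p m) - I)"
      by (intro order_trans[OF norm_triangle_ineq] add_right_mono norm_triangle_ineq)
    also have "\<dots> < (e + \<tau> * e + e) + e + e"
      using a \<gamma>2(2)[OF D1(1,3)] M2[of m] by (simp add: m_def)
    also have "\<dots> = \<epsilon>" using e(2) by (simp add: algebra_simps)
    finally show "norm ((\<Sum>(x,k)\<in>\<D>. measure lborel k *\<^sub>R y x) - I) < \<epsilon>" .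
  qed
qed

section \<open>The regulator equations\<close>

lemma scaleC_minus1: "(-1) *\<^sub>C (x::'a::chilbert_space) = - x"
  using scaleC_of_real[of "-1" x] by simp

lemma scaleC_diff_right: "c *\<^sub>C (x - y) = c *\<^sub>C x - c *\<^sub>C (y::'a::chilbert_space)"
proof -
  have "c *\<^sub>C (x + (-1) *\<^sub>C y) = c *\<^sub>C x + (-1) *\<^sub>C (c *\<^sub>C y)"
    by (simp only: scaleC_add_right scaleC_scaleC mult.commute[of c])
  then show ?thesis by (simp add: scaleC_minus1)
qed

lemma scaleC_i_i: "\<i> *\<^sub>C \<i> *\<^sub>C (x::'a::chilbert_space) = - x"
  by (simp add: scaleC_scaleC scaleC_minus1)

lemma scaleC_scaleR: "c *\<^sub>C s *\<^sub>R (x::'a::chilbert_space) = s *\<^sub>R c *\<^sub>C x"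
  by (simp add: scaleC_of_real[symmetric] scaleC_scaleC mult.commute)

text \<open>Inverts the passage from cosine and sine coefficients to the amplitudes at the two
  conjugate frequencies.\<close>

lemma cos_sin_half:
  fixes y z :: "'a::chilbert_space"
  shows "(1/2) *\<^sub>R ((y - z) + (y + z)) = y" "(1/2) *\<^sub>R \<i> *\<^sub>C ((y - \<i> *\<^sub>C z) - (y + \<i> *\<^sub>C z)) = z"
proof -
  have "(y - z) + (y + z) = 2 *\<^sub>R y" by (simp add: scaleR_2)
  then show "(1/2) *\<^sub>R ((y - z) + (y + z)) = y" by simp
  have "(y - \<i> *\<^sub>C z) - (y + \<i> *\<^sub>C z) = (-2) *\<^sub>R \<i> *\<^sub>C z" by (simp add: scaleR_2)
  then show "(1/2) *\<^sub>R \<i> *\<^sub>C ((y - \<i> *\<^sub>C z) - (y + \<i> *\<^sub>C z)) = z"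
    by (simp only: scaleC_scaleR scaleC_i_i) simp
qed

lemma clinear_on_scaleC: "clinear_on V W f ==> x \<in> V ==> f (c *\<^sub>C x) = c *\<^sub>C f x"
  by (simp add: clinear_on_def)

section \<open>Calculus of trigonometric signals\<close>

lemma trig_signal_continuous: "continuous_on S (trig_signal q \<omega> a (b :: nat => 'a::real_normed_vector))"
  unfolding trig_signal_def by (intro continuous_intros)

lemma trig_signal_in:
  assumes "subspace V" "!!k. k <= q ==> a k \<in> V" "!!k. k \<in> {1..q} ==> b k \<in> V"
  shows "trig_signal q \<omega> a b t \<in> V"
  unfolding trig_signal_def using assms
  by (auto intro!: subspace_add subspace_sum subspace_scale)

lemma trig_signal_cong:
  assumes "!!k. k <= q ==> a k = a' k" "!!k. k \<in> {1..q} ==> b k = b' k"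
  shows "trig_signal q \<omega> a b t = trig_signal q \<omega> a' b' t"
  unfolding trig_signal_def using assms by auto

lemma trig_signal_add:
  "trig_signal q \<omega> a b t + trig_signal q \<omega> a' b' t = trig_signal q \<omega> (%k. a k + a' k) (%k. b k + b' k) t"
  unfolding trig_signal_def by (simp add: sum.distrib scaleR_add_right algebra_simps)

lemma trig_signal_bounded:
  fixes a b :: "nat => 'a::real_normed_vector"
  obtains K where "K \<ge> 0" "!!t. norm (trig_signal q \<omega> a b t) <= K"
proof -
  let ?K = "norm (a 0) + (\<Sum>k=1..q. norm (a k) + norm (b k))"
  have K: "?K \<ge> 0" by (intro add_nonneg_nonneg sum_nonneg) auto
  have "norm (trig_signal q \<omega> a b t) <= ?K" for t
    unfolding trig_signal_def
  proof (rule norm_triangle_le, rule add_mono[OF order_refl], rule sum_norm_le)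
    fix k
    have "norm (cos (\<omega> k * t) *\<^sub>R a k + sin (\<omega> k * t) *\<^sub>R b k)
      <= \<bar>cos (\<omega> k * t)\<bar> * norm (a k) + \<bar>sin (\<omega> k * t)\<bar> * norm (b k)"
      by (rule norm_triangle_le) simp
    also have "\<dots> <= 1 * norm (a k) + 1 * norm (b k)"
      by (intro add_mono mult_right_mono abs_cos_le_one abs_sin_le_one norm_ge_zero)
    finally show "norm (cos (\<omega> k * t) *\<^sub>R a k + sin (\<omega> k * t) *\<^sub>R b k) <= norm (a k) + norm (b k)" by simp
  qed
  from that[OF K this] show ?thesis .
qed

lemma trig_signal_deriv:
  fixes a b :: "nat => 'a::real_normed_vector"
  shows "(trig_signal q \<omega> a b has_vector_derivative
    trig_signal q \<omega> (%k. if k = 0 then 0 else \<omega> k *\<^sub>R b k) (%k. - \<omega> k *\<^sub>R a k) t) (at t)"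
proof -
  have "((%t. cos (\<omega> k * t) *\<^sub>R a k + sin (\<omega> k * t) *\<^sub>R b k) has_vector_derivative
    cos (\<omega> k * t) *\<^sub>R \<omega> k *\<^sub>R b k + sin (\<omega> k * t) *\<^sub>R (- \<omega> k *\<^sub>R a k)) (at t)" for k
    by (rule has_vector_derivative_eq_rhs, (rule derivative_eq_intros refl | simp add: has_vector_derivative_def)+)
  then have "((%t. \<Sum>k=1..q. cos (\<omega> k * t) *\<^sub>R a k + sin (\<omega> k * t) *\<^sub>R b k) has_vector_derivative
    (\<Sum>k=1..q. cos (\<omega> k * t) *\<^sub>R \<omega> k *\<^sub>R b k + sin (\<omega> k * t) *\<^sub>R (- \<omega> k *\<^sub>R a k))) (at t)"
    by (intro has_vector_derivative_sum) auto
  from has_vector_derivative_add[OF has_vector_derivative_const[of "a 0"] this]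
  show ?thesis unfolding trig_signal_def by simp
qed

lemma trig_signal_lipschitz:
  fixes a b :: "nat => 'a::real_normed_vector"
  obtains L where "L \<ge> 0" "!!s t. norm (trig_signal q \<omega> a b t - trig_signal q \<omega> a b s) <= L * \<bar>t - s\<bar>"
proof -
  obtain K where K: "K \<ge> 0" "!!t. norm (trig_signal q \<omega> (%k. if k = 0 then 0 else \<omega> k *\<^sub>R b k) (%k. - \<omega> k *\<^sub>R a k) t) <= K"
    by (rule trig_signal_bounded) (rule that)
  have "norm (trig_signal q \<omega> a b t - trig_signal q \<omega> a b s) <= K * norm (t - s)" for s t
  proof (rule differentiable_bound[OF convex_UNIV])
    show "(trig_signal q \<omega> a b has_derivative (%h. h *\<^sub>R
      trig_signal q \<omega> (%k. if k = 0 then 0 else \<omega> k *\<^sub>R b k) (%k. - \<omega> k *\<^sub>R a k) t)) (at t within UNIV)" for t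
      using trig_signal_deriv[of q \<omega> a b t] by (simp add: has_vector_derivative_def)
    show "onorm (%h. h *\<^sub>R
      trig_signal q \<omega> (%k. if k = 0 then 0 else \<omega> k *\<^sub>R b k) (%k. - \<omega> k *\<^sub>R a k) t) <= K" for t
      by (rule onorm_bound[OF K(1)]) (use K(2)[of t] in \<open>simp add: mult.commute[of K] mult_left_mono\<close>)
  qed auto
  then show ?thesis using that[OF K(1)] by simp
qed

lemma trig_signal_image:
  assumes D: "subspace D" and add: "!!x y. x \<in> D ==> y \<in> D ==> F (x + y) = F x + F y"
    and scale: "!!c x. x \<in> D ==> F (c *\<^sub>R x) = c *\<^sub>R F x"
    and ab: "!!k. k <= q ==> a k \<in> D" "!!k. k \<in> {1..q} ==> b k \<in> D"
  shows "F (trig_signal q \<omega> a b t) = trig_signal q \<omega> (%k. F (a k)) (%k. F (b k)) t"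
proof -
  define v where "v k = cos (\<omega> k * t) *\<^sub>R a k + sin (\<omega> k * t) *\<^sub>R b k" for k
  have v: "v k \<in> D" "F (v k) = cos (\<omega> k * t) *\<^sub>R F (a k) + sin (\<omega> k * t) *\<^sub>R F (b k)" if "k \<in> {1..q}" for k
    unfolding v_def using that ab by (auto simp: add scale subspace_scale[OF D] intro!: subspace_add[OF D])
  have F0: "F 0 = 0" using scale[OF subspace_0[OF D], of 0] by simp
  have "finite I ==> I \<subseteq> {1..q} ==> F (sum v I) = (\<Sum>k\<in>I. F (v k))" for I
  proof (induction I rule: finite_induct)
    case (insert k I)
    have "sum v I \<in> D" by (rule subspace_sum[OF D]) (use v(1) insert in auto)
    then show ?case using insert v(1)[of k] by (simp add: add)
  qed (simp add: F0)
  then have "F (\<Sum>k=1..q. v k) = (\<Sum>k=1..q. F (v k))" by simp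
  moreover have "(\<Sum>k=1..q. v k) \<in> D" by (rule subspace_sum[OF D]) (rule v(1))
  ultimately have "F (a 0 + (\<Sum>k=1..q. v k)) = F (a 0) + (\<Sum>k=1..q. F (v k))" using ab(1) by (simp add: add)
  then show ?thesis unfolding trig_signal_def v_def[symmetric] using v(2) by simp
qed

text \<open>In this form the feedforward shares the calculus of the other signals. Index zero
  carries the mean value, and the amplitudes at conjugate frequencies are halved into cosine and
  sine coefficients.\<close>

lemma feedforward_trig:
  "feedforward U S \<kappa> q \<omega> a b c d t = trig_signal q \<omega>
     (%k. if k = 0 then (if a 0 = 0 & c 0 = 0 then 0 else ff_coeff U S \<kappa> 0 (a 0) (c 0))
       else (1/2) *\<^sub>R (ff_coeff U S \<kappa> (\<i> * of_real (\<omega> k)) (a k - \<i> *\<^sub>C b k) (c k - \<i> *\<^sub>C d k)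
          + ff_coeff U S \<kappa> (- \<i> * of_real (\<omega> k)) (a k + \<i> *\<^sub>C b k) (c k + \<i> *\<^sub>C d k)))
     (%k. (1/2) *\<^sub>R \<i> *\<^sub>C (ff_coeff U S \<kappa> (\<i> * of_real (\<omega> k)) (a k - \<i> *\<^sub>C b k) (c k - \<i> *\<^sub>C d k)
          - ff_coeff U S \<kappa> (- \<i> * of_real (\<omega> k)) (a k + \<i> *\<^sub>C b k) (c k + \<i> *\<^sub>C d k))) t"
proof -
  have *: "(\<i> * of_real s) *\<^sub>C u = s *\<^sub>R \<i> *\<^sub>C u" for s and u :: 'a
    by (simp add: scaleC_scaleC[symmetric] scaleC_of_real scaleC_scaleR)
  show ?thesis unfolding feedforward_def trig_signal_def Let_def *
    unfolding scaleR_sum_right by (intro arg_cong2[where f = "(+)"] sum.cong) (auto simp: scaleR_add_right mult.commute)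
qed

section \<open>The resolvent problem of the closed loop and the regulated trajectory\<close>

context passive_node
begin

lemma Dom_scaleC: "x \<in> Dom S ==> c *\<^sub>C x \<in> Dom S"
  using node unfolding boundary_node_def csubspace_def by auto

lemma U_scaleC: "u \<in> U ==> c *\<^sub>C u \<in> U"
  using U_csubspace unfolding csubspace_def by auto

lemma op_scaleC:
  assumes "x \<in> Dom S"
  shows "opA S (c *\<^sub>C x) = c *\<^sub>C opA S x" "opBc S (c *\<^sub>C x) = c *\<^sub>C opBc S x"
    "opBd S (c *\<^sub>C x) = c *\<^sub>C opBd S x" "opC S (c *\<^sub>C x) = c *\<^sub>C opC S x"
  using clinears[THEN clinear_on_scaleC, OF assms, of c] by (auto simp: scaleC_prod_def)

lemma B1_scaleC: "opB1 S (c *\<^sub>C w) = c *\<^sub>C opB1 S w"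
  using B1 unfolding bounded_clinear_on_def clinear_on_def by auto

text \<open>The node provides a right inverse for the open-loop boundary operators, not for the
  closed loop. On static states with \<open>opA S p = p\<close> the output is, by passivity, a
  monotone Lipschitz function of the input, so
  \<open>u + \<kappa> *\<^sub>R opC S (h u) = v'\<close> is solved by a damped Banach
  iteration.\<close>

lemma feedback_right_inverse:
  assumes \<kappa>: "0 <= \<kappa>" and v: "v \<in> U"
  obtains p where "p \<in> Dom S" "opBc S p + \<kappa> *\<^sub>R opC S p = v" "opBd S p = w"
proof -
  obtain Br K' where Br: "!!z. fst z \<in> U ==> Br z \<in> Dom S" "!!z. fst z \<in> U ==> opBc S (Br z) = fst z"
    "!!z. fst z \<in> U ==> opBd S (Br z) = snd z"
    "!!y z. fst y \<in> U ==> fst z \<in> U ==> Br (y - z) = Br y - Br z" "0 <= K'"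
    "!!z. fst z \<in> U ==> norm (Br z) <= K' * norm z" "!!z. fst z \<in> U ==> norm (opA S (Br z)) <= K' * norm z"
    by (rule right_inverse) (rule that)
  have U0: "0 \<in> U" using subspace_0[OF U_subspace] .
  define b where "b = Br (0, w)"
  have b: "b \<in> Dom S" "opBc S b = 0" "opBd S b = w" using Br(1-3)[of "(0, w)"] U0 by (auto simp: b_def)
  define v' where "v' = v - \<kappa> *\<^sub>R opC S b"
  have v': "v' \<in> U" unfolding v'_def using v b op_U by (intro subspace_diff[OF U_subspace] subspace_scale[OF U_subspace]) auto
  have "\<forall>u\<in>U. \<exists>p. p \<in> Dom S & opA S p = p & opBc S p = u & opBd S p = 0"
    using static_solution[of 1] by (metis scaleR_one zero_less_one)
  then obtain h where h: "!!u. u \<in> U ==> h u \<in> Dom S & opA S (h u) = h u & opBc S (h u) = u & opBd S (h u) = 0"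
    by metis
  obtain K where K: "0 < K" "!!x. x \<in> Dom S ==> norm (opC S x) <= K * (norm x + norm (opA S x))"
    by (rule op_bound) (rule that)
  have est: "0 <= (u - u') \<bullet> (opC S (h u) - opC S (h u')) & norm (opC S (h u) - opC S (h u')) <= 4 * K\<^sup>2 * norm (u - u')"
    if u: "u \<in> U" "u' \<in> U" for u u'
  proof -
    define d where "d = h u - h u'"
    have d: "d \<in> Dom S" "opA S d = d" "opBc S d = u - u'" "opBd S d = 0" "opC S d = opC S (h u) - opC S (h u')"
      using h[OF u(1)] h[OF u(2)] by (auto simp: d_def op_diff Dom_simps)
    have pas: "d \<bullet> d <= (u - u') \<bullet> opC S d" using imp_passive[OF d(1,4)] d by simp
    have Cd: "norm (opC S d) <= 2 * K * norm d" using K(2)[OF d(1)] d(2) by simp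
    have "(norm d)\<^sup>2 <= norm (u - u') * (2 * K * norm d)"
      using pas norm_cauchy_schwarz[of "u - u'" "opC S d"] mult_left_mono[OF Cd norm_ge_zero[of "u - u'"]]
      by (simp add: power2_norm_eq_inner)
    then have "norm d <= 2 * K * norm (u - u')"
      by (cases "d = 0") (use K(1) in \<open>auto simp: power2_eq_square mult.commute[of _ "2 * K"]\<close>)
    then have "2 * K * norm d <= 2 * K * (2 * K * norm (u - u'))" using K(1) by (intro mult_left_mono) auto
    then have "norm (opC S d) <= 4 * K\<^sup>2 * norm (u - u')" using Cd by (simp add: power2_eq_square)
    moreover have "0 <= (u - u') \<bullet> opC S d" using pas inner_ge_zero[of d] by linarith
    ultimately show ?thesis using d(5) by simp
  qed
  define M where "M = 4 * K\<^sup>2"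
  \<comment> \<open>The damping that minimises the contraction factor, as for \<open>step\<close>,
    here with the static Lipschitz bound \<open>M\<close>.\<close>
  define \<rho> where "\<rho> = 1 / (1 + \<kappa>\<^sup>2 * M\<^sup>2)"
  have \<rho>: "0 < \<rho>" "\<rho> <= 1" "\<rho> * (1 + \<kappa>\<^sup>2 * M\<^sup>2) = 1"
  proof -
    have "0 < 1 + \<kappa>\<^sup>2 * M\<^sup>2" by (simp add: add_pos_nonneg)
    then show "0 < \<rho>" "\<rho> <= 1" "\<rho> * (1 + \<kappa>\<^sup>2 * M\<^sup>2) = 1" by (auto simp: \<rho>_def)
  qed
  define F where "F u = u - \<rho> *\<^sub>R (u + \<kappa> *\<^sub>R opC S (h u) - v')" for u
  have "\<exists>!u. u \<in> U & F u = u"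
  proof (rule Banach_fix[of U "sqrt (1 - \<rho>)"])
    show "complete U" using U_closed by (simp add: complete_eq_closed)
    show "U \<noteq> {}" using U0 by auto
    show "F ` U \<subseteq> U"
      unfolding F_def using v' h op_U
      by (auto intro!: subspace_diff[OF U_subspace] subspace_scale[OF U_subspace] subspace_add[OF U_subspace])
    fix x y assume xy: "x \<in> U" "y \<in> U"
    let ?u = "x - y" and ?c = "opC S (h x) - opC S (h y)"
    have "(norm ((1 - \<rho>) *\<^sub>R ?u - (\<rho> * \<kappa>) *\<^sub>R ?c))\<^sup>2
      = (1 - \<rho>)\<^sup>2 * (norm ?u)\<^sup>2 - 2 * ((1 - \<rho>) * (\<rho> * \<kappa>)) * (?u \<bullet> ?c) + (\<rho> * \<kappa>)\<^sup>2 * (norm ?c)\<^sup>2"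
      unfolding power2_norm_eq_inner inner_diff_left[of "(1 - \<rho>) *\<^sub>R ?u"] inner_diff_right[of _ "(1 - \<rho>) *\<^sub>R ?u"]
        inner_scaleR_left inner_scaleR_right inner_commute[of ?c ?u] by algebra
    also have "\<dots> <= (1 - \<rho>)\<^sup>2 * (norm ?u)\<^sup>2 - 0 + (\<rho> * \<kappa>)\<^sup>2 * (M * norm ?u)\<^sup>2"
      using est[OF xy] \<rho> \<kappa> unfolding M_def
      by (intro add_mono diff_mono mult_left_mono power_mono mult_nonneg_nonneg) auto
    also have "\<dots> = ((1 - \<rho>)\<^sup>2 + \<rho> * (\<rho> * (1 + \<kappa>\<^sup>2 * M\<^sup>2)) - \<rho>\<^sup>2) * (norm ?u)\<^sup>2"
      by (simp add: power_mult_distrib power2_eq_square algebra_simps)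
    also have "\<dots> = (1 - \<rho>) * (norm ?u)\<^sup>2" unfolding \<rho>(3) by (simp add: power2_eq_square algebra_simps)
    also have "\<dots> = (sqrt (1 - \<rho>) * norm ?u)\<^sup>2" using \<rho> by (simp add: power_mult_distrib)
    finally have "norm ((1 - \<rho>) *\<^sub>R ?u - (\<rho> * \<kappa>) *\<^sub>R ?c) <= sqrt (1 - \<rho>) * norm ?u"
      by (rule power2_le_imp_le) (use \<rho> in simp)
    moreover have "F x - F y = (1 - \<rho>) *\<^sub>R ?u - (\<rho> * \<kappa>) *\<^sub>R ?c"
      by (simp add: F_def algebra_simps)
    ultimately show "dist (F x) (F y) <= sqrt (1 - \<rho>) * dist x y" by (simp add: dist_norm)
  qed (use \<rho> in \<open>auto simp: real_sqrt_lt_1_iff\<close>)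
  then obtain u where u: "u \<in> U" "F u = u" by auto
  then have e: "u + \<kappa> *\<^sub>R opC S (h u) = v'" using \<rho> by (simp add: F_def)
  note hu = h[OF u(1)]
  show ?thesis
  proof (rule that[of "h u + b"])
    show "h u + b \<in> Dom S" "opBd S (h u + b) = w" using hu b by (auto simp: Dom_simps op_add)
    show "opBc S (h u + b) + \<kappa> *\<^sub>R opC S (h u + b) = v"
      using hu b e by (simp add: op_add v'_def algebra_simps)
  qed
qed

text \<open>A state with the right boundary values is corrected inside \<open>cl_dom\<close> by the
  closed-loop resolvent; injectivity gives uniqueness, so the definite description in
  \<open>cl_state\<close> denotes a solution.\<close>

lemma cl_state:
  assumes \<kappa>: "0 <= \<kappa>" and \<mu>: "\<mu> \<in> resolvent_set (cl_dom \<kappa> S) (opA S)" and u: "u \<in> U" and w: "w \<in> dist_space U"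
  defines "x \<equiv> cl_state \<kappa> S \<mu> u w"
  shows "x \<in> Dom S" "\<mu> *\<^sub>C x - opA S x = opB1 S (fst w)"
    "opBc S x + \<kappa> *\<^sub>R opC S x = u + fst (snd w)" "opBd S x = snd (snd w)"
proof -
  let ?P = "%x. x \<in> Dom S & \<mu> *\<^sub>C x - opA S x = opB1 S (fst w) &
     opBc S x + \<kappa> *\<^sub>R opC S x = u + fst (snd w) & opBd S x = snd (snd w)"
  have bij: "bij_betw (%x. \<mu> *\<^sub>C x - opA S x) (cl_dom \<kappa> S) UNIV" using \<mu> by (simp add: resolvent_set_def)
  have uw: "u + fst (snd w) \<in> U" using u w by (auto simp: dist_space_def intro: subspace_add[OF U_subspace])
  have "\<exists>!x. ?P x"
  proof (rule ex_ex1I)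
    obtain p where p: "p \<in> Dom S" "opBc S p + \<kappa> *\<^sub>R opC S p = u + fst (snd w)" "opBd S p = snd (snd w)"
      using feedback_right_inverse[OF \<kappa> uw] by metis
    obtain k where k: "k \<in> cl_dom \<kappa> S" "\<mu> *\<^sub>C k - opA S k = opB1 S (fst w) - (\<mu> *\<^sub>C p - opA S p)"
      using bij unfolding bij_betw_def by (metis (no_types, lifting) UNIV_I imageE)
    have k': "k \<in> Dom S" "opBc S k + \<kappa> *\<^sub>R opC S k = 0" "opBd S k = 0" using k(1) by (auto simp: cl_dom_def)
    have "opBc S (p + k) + \<kappa> *\<^sub>R opC S (p + k) = (opBc S p + \<kappa> *\<^sub>R opC S p) + (opBc S k + \<kappa> *\<^sub>R opC S k)"
      using p(1) k'(1) by (simp add: op_add scaleR_add_right)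
    moreover have "\<mu> *\<^sub>C (p + k) - opA S (p + k) = (\<mu> *\<^sub>C p - opA S p) + (\<mu> *\<^sub>C k - opA S k)"
      using p(1) k'(1) by (simp add: op_add scaleC_add_right)
    ultimately show "\<exists>x. ?P x" using p k' k(2) by (intro exI[of _ "p + k"]) (auto simp: op_add Dom_simps)
  next
    fix x y assume x: "?P x" and y: "?P y"
    have "opBc S (x - y) + \<kappa> *\<^sub>R opC S (x - y) = (opBc S x + \<kappa> *\<^sub>R opC S x) - (opBc S y + \<kappa> *\<^sub>R opC S y)"
      using conjunct1[OF x] conjunct1[OF y] by (simp add: op_diff scaleR_diff_right)
    then have xy: "x - y \<in> cl_dom \<kappa> S" using x y by (simp add: cl_dom_def op_diff Dom_simps)
    have 0: "0 \<in> cl_dom \<kappa> S" by (simp add: cl_dom_def op_0)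
    have "\<mu> *\<^sub>C (x - y) - opA S (x - y) = (\<mu> *\<^sub>C x - opA S x) - (\<mu> *\<^sub>C y - opA S y)"
      using conjunct1[OF x] conjunct1[OF y] by (simp add: op_diff scaleC_diff_right)
    also have "\<dots> = \<mu> *\<^sub>C 0 - opA S 0" using x y scaleC_diff_right[of \<mu> 0 0] by (simp add: op_0)
    finally have "x - y = 0" by (rule inj_onD[OF bij_betw_imp_inj_on[OF bij] _ xy 0])
    then show "x = y" by simp
  qed
  from theI'[OF this] have P: "?P x" unfolding x_def cl_state_def .
  show "x \<in> Dom S" by (rule conjunct1[OF P])
  show "\<mu> *\<^sub>C x - opA S x = opB1 S (fst w)" by (rule conjunct1[OF conjunct2[OF P]])
  show "opBc S x + \<kappa> *\<^sub>R opC S x = u + fst (snd w)" by (rule conjunct1[OF conjunct2[OF conjunct2[OF P]]])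
  show "opBd S x = snd (snd w)" by (rule conjunct2[OF conjunct2[OF conjunct2[OF P]]])
qed

text \<open>Superposition of the responses to \<open>f\<close>,
  \<open>\<kappa> *\<^sub>R \<alpha>\<close> and \<open>\<beta>\<close>. The choice of
  \<open>f\<close> makes the output equal to \<open>\<alpha>\<close>; then the feedback term cancels
  against \<open>\<kappa> *\<^sub>R \<alpha>\<close> and the open-loop boundary value
  remains.\<close>

lemma feedforward_state:
  assumes \<kappa>: "0 <= \<kappa>" and \<mu>: "\<mu> \<in> resolvent_set (cl_dom \<kappa> S) (opA S)"
    and inv: "boundedly_invertible_on U (Pc \<kappa> S \<mu>)" and \<alpha>: "\<alpha> \<in> U" and \<beta>: "\<beta> \<in> dist_space U"
  defines "f \<equiv> ff_coeff U S \<kappa> \<mu> \<alpha> \<beta>"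
  obtains x where "f \<in> U" "x \<in> Dom S" "opA S x = \<mu> *\<^sub>C x - opB1 S (fst \<beta>)" "opBc S x = f + fst (snd \<beta>)"
    "opBd S x = snd (snd \<beta>)" "opC S x = \<alpha>"
proof -
  have U0: "0 \<in> U" using subspace_0[OF U_subspace] .
  have d0: "(0::'d1 \<times> 'u \<times> 'd3) \<in> dist_space U" using U0 by (auto simp: dist_space_def zero_prod_def)
  have B0: "opB1 S 0 = 0" using linear_simps(3)[OF B1_linear] .
  have PcU: "Pc \<kappa> S \<mu> u \<in> U" if "u \<in> U" for u
    unfolding Pc_def by (rule op_U(2)[OF cl_state(1)[OF \<kappa> \<mu> that d0]])
  have PdU: "Pd \<kappa> S \<mu> \<beta> \<in> U" unfolding Pd_def by (rule op_U(2)[OF cl_state(1)[OF \<kappa> \<mu> U0 \<beta>]])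
  define t where "t = (\<alpha> - \<kappa> *\<^sub>R Pc \<kappa> S \<mu> \<alpha>) - Pd \<kappa> S \<mu> \<beta>"
  have tU: "t \<in> U" unfolding t_def
    by (intro subspace_diff[OF U_subspace] subspace_scale[OF U_subspace] PcU PdU \<alpha>)
  have timg: "t \<in> Pc \<kappa> S \<mu> ` U"
  proof -
    from inv obtain Rv where Rv: "bounded_clinear_on U norm U norm Rv" "\<forall>u\<in>U. Rv (Pc \<kappa> S \<mu> u) = u & Pc \<kappa> S \<mu> (Rv u) = u"
      unfolding boundedly_invertible_on_def by blast
    then have "Rv t \<in> U" using tU unfolding bounded_clinear_on_def clinear_on_def by blast
    then show ?thesis using Rv(2) tU by (metis imageI)
  qed
  have f: "f \<in> U" "Pc \<kappa> S \<mu> f = t"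
    unfolding f_def ff_coeff_def t_def[symmetric] using timg by (auto intro: inv_into_into f_inv_into_f)
  have fa: "\<kappa> *\<^sub>R \<alpha> \<in> U" "f + \<kappa> *\<^sub>R \<alpha> \<in> U"
    using f \<alpha> by (auto intro!: subspace_add[OF U_subspace] subspace_scale[OF U_subspace])
  note x1 = cl_state[OF \<kappa> \<mu> f(1) d0] and x2 = cl_state[OF \<kappa> \<mu> \<alpha> d0] and x3 = cl_state[OF \<kappa> \<mu> U0 \<beta>]
  define x where "x = cl_state \<kappa> S \<mu> f 0 + \<kappa> *\<^sub>R cl_state \<kappa> S \<mu> \<alpha> 0 + cl_state \<kappa> S \<mu> 0 \<beta>"
  have D: "x \<in> Dom S" unfolding x_def by (intro Dom_simps x1 x2 x3)
  have C: "opC S x = \<alpha>"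
  proof -
    have "opC S x = Pc \<kappa> S \<mu> f + \<kappa> *\<^sub>R Pc \<kappa> S \<mu> \<alpha> + Pd \<kappa> S \<mu> \<beta>"
      unfolding x_def Pc_def Pd_def using x1(1) x2(1) x3(1) by (simp add: op_add op_scaleR Dom_simps)
    then show ?thesis by (simp add: f t_def)
  qed
  have "opBc S x + \<kappa> *\<^sub>R opC S x = f + \<kappa> *\<^sub>R \<alpha> + fst (snd \<beta>)"
  proof -
    have "opBc S x + \<kappa> *\<^sub>R opC S x
      = (opBc S (cl_state \<kappa> S \<mu> f 0) + \<kappa> *\<^sub>R opC S (cl_state \<kappa> S \<mu> f 0))
        + \<kappa> *\<^sub>R (opBc S (cl_state \<kappa> S \<mu> \<alpha> 0) + \<kappa> *\<^sub>R opC S (cl_state \<kappa> S \<mu> \<alpha> 0))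
        + (opBc S (cl_state \<kappa> S \<mu> 0 \<beta>) + \<kappa> *\<^sub>R opC S (cl_state \<kappa> S \<mu> 0 \<beta>))"
      unfolding x_def using x1(1) x2(1) x3(1) by (simp add: op_add op_scaleR Dom_simps algebra_simps)
    also have "\<dots> = f + \<kappa> *\<^sub>R \<alpha> + fst (snd \<beta>)" unfolding x1(3) x2(3) x3(3) by simp
    finally show ?thesis .
  qed
  then have Bc: "opBc S x = f + fst (snd \<beta>)" using C by (simp add: algebra_simps)
  have "\<mu> *\<^sub>C x - opA S x = opB1 S (fst \<beta>)"
  proof -
    have "\<mu> *\<^sub>C x - opA S x
      = (\<mu> *\<^sub>C cl_state \<kappa> S \<mu> f 0 - opA S (cl_state \<kappa> S \<mu> f 0))
        + \<kappa> *\<^sub>R (\<mu> *\<^sub>C cl_state \<kappa> S \<mu> \<alpha> 0 - opA S (cl_state \<kappa> S \<mu> \<alpha> 0))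
        + (\<mu> *\<^sub>C cl_state \<kappa> S \<mu> 0 \<beta> - opA S (cl_state \<kappa> S \<mu> 0 \<beta>))"
      unfolding x_def using x1(1) x2(1) x3(1)
      by (simp add: op_add op_scaleR Dom_simps scaleC_add_right scaleC_scaleR scaleR_diff_right)
    also have "\<dots> = opB1 S (fst \<beta>)" unfolding x1(2) x2(2) x3(2) by (simp add: B0)
    finally show ?thesis .
  qed
  then have A: "opA S x = \<mu> *\<^sub>C x - opB1 S (fst \<beta>)" by (simp add: algebra_simps)
  have Bd: "opBd S x = snd (snd \<beta>)"
    unfolding x_def using x1(1,4) x2(1,4) x3(1,4) by (simp add: op_add op_scaleR Dom_simps)
  show ?thesis by (rule that[OF f(1) D A Bc Bd C])
qed

lemma dist_space_scaleC_diff: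
  assumes "c \<in> dist_space U" "d \<in> dist_space U"
  shows "c - z *\<^sub>C d \<in> dist_space U" "c + z *\<^sub>C d \<in> dist_space U"
  using assms U_scaleC[of "fst (snd d)" z]
  by (auto simp: dist_space_def scaleC_prod_def intro!: subspace_diff[OF U_subspace] subspace_add[OF U_subspace])

text \<open>The states at the frequencies \<open>\<plusminus>i\<omega>\<close> combine to the coefficients of \<open>cos \<omega>t\<close> and \<open>sin \<omega>t\<close>.\<close>

lemma feedforward_cos_sin:
  assumes \<kappa>: "0 <= \<kappa>" and \<mu>: "!!\<mu>. \<mu> \<in> {\<i> * of_real \<omega>, - \<i> * of_real \<omega>} ==>
      \<mu> \<in> resolvent_set (cl_dom \<kappa> S) (opA S) & boundedly_invertible_on U (Pc \<kappa> S \<mu>)"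
    and ab: "a \<in> U" "b \<in> U" and cd: "c \<in> dist_space U" "d \<in> dist_space U"
  defines "f \<equiv> ff_coeff U S \<kappa> (\<i> * of_real \<omega>) (a - \<i> *\<^sub>C b) (c - \<i> *\<^sub>C d)"
    and "g \<equiv> ff_coeff U S \<kappa> (- \<i> * of_real \<omega>) (a + \<i> *\<^sub>C b) (c + \<i> *\<^sub>C d)"
  obtains x1 x2 where "f \<in> U" "g \<in> U" "x1 \<in> Dom S" "x2 \<in> Dom S"
    "opA S x1 = \<omega> *\<^sub>R x2 - opB1 S (fst c)" "opA S x2 = - \<omega> *\<^sub>R x1 - opB1 S (fst d)"
    "opBc S x1 = (1/2) *\<^sub>R (f + g) + fst (snd c)" "opBc S x2 = (1/2) *\<^sub>R \<i> *\<^sub>C (f - g) + fst (snd d)"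
    "opBd S x1 = snd (snd c)" "opBd S x2 = snd (snd d)" "opC S x1 = a" "opC S x2 = b"
proof -
  have ab': "a - \<i> *\<^sub>C b \<in> U" "a + \<i> *\<^sub>C b \<in> U"
    using ab U_scaleC by (auto intro!: subspace_diff[OF U_subspace] subspace_add[OF U_subspace])
  have \<mu>p: "\<i> * of_real \<omega> \<in> resolvent_set (cl_dom \<kappa> S) (opA S) & boundedly_invertible_on U (Pc \<kappa> S (\<i> * of_real \<omega>))"
    and \<mu>m: "- \<i> * of_real \<omega> \<in> resolvent_set (cl_dom \<kappa> S) (opA S) & boundedly_invertible_on U (Pc \<kappa> S (- \<i> * of_real \<omega>))"
    by (intro \<mu>; simp)+
  obtain p where p: "f \<in> U" "p \<in> Dom S" "opA S p = (\<i> * of_real \<omega>) *\<^sub>C p - opB1 S (fst (c - \<i> *\<^sub>C d))"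
    "opBc S p = f + fst (snd (c - \<i> *\<^sub>C d))" "opBd S p = snd (snd (c - \<i> *\<^sub>C d))" "opC S p = a - \<i> *\<^sub>C b"
    by (rule feedforward_state[OF \<kappa> conjunct1[OF \<mu>p] conjunct2[OF \<mu>p] ab'(1) dist_space_scaleC_diff(1)[OF cd, of \<i>], folded f_def]) (rule that)
  obtain m where m: "g \<in> U" "m \<in> Dom S" "opA S m = (- \<i> * of_real \<omega>) *\<^sub>C m - opB1 S (fst (c + \<i> *\<^sub>C d))"
    "opBc S m = g + fst (snd (c + \<i> *\<^sub>C d))" "opBd S m = snd (snd (c + \<i> *\<^sub>C d))" "opC S m = a + \<i> *\<^sub>C b"
    by (rule feedforward_state[OF \<kappa> conjunct1[OF \<mu>m] conjunct2[OF \<mu>m] ab'(2) dist_space_scaleC_diff(2)[OF cd, of \<i>], folded g_def]) (rule that)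
  define x1 x2 where "x1 = (1/2) *\<^sub>R (p + m)" and "x2 = (1/2) *\<^sub>R \<i> *\<^sub>C (p - m)"
  have D: "p + m \<in> Dom S" "p - m \<in> Dom S" "\<i> *\<^sub>C (p - m) \<in> Dom S" using p(2) m(2) by (auto intro!: Dom_simps Dom_scaleC)
  have pl: "opA S x1 = (1/2) *\<^sub>R (opA S p + opA S m)" "opBc S x1 = (1/2) *\<^sub>R (opBc S p + opBc S m)"
    "opBd S x1 = (1/2) *\<^sub>R (opBd S p + opBd S m)" "opC S x1 = (1/2) *\<^sub>R (opC S p + opC S m)"
    unfolding x1_def op_scaleR[OF D(1)] op_add[OF p(2) m(2)] by auto
  have p2: "opA S x2 = (1/2) *\<^sub>R \<i> *\<^sub>C (opA S p - opA S m)" "opBc S x2 = (1/2) *\<^sub>R \<i> *\<^sub>C (opBc S p - opBc S m)"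
    "opBd S x2 = (1/2) *\<^sub>R \<i> *\<^sub>C (opBd S p - opBd S m)" "opC S x2 = (1/2) *\<^sub>R \<i> *\<^sub>C (opC S p - opC S m)"
    unfolding x2_def op_scaleR[OF D(3)] op_scaleC[OF D(2)] op_diff[OF p(2) m(2)] by auto
  have i\<omega>: "(\<i> * of_real \<omega>) *\<^sub>C y = \<omega> *\<^sub>R \<i> *\<^sub>C y" "(- \<i> * of_real \<omega>) *\<^sub>C y = - (\<omega> *\<^sub>R \<i> *\<^sub>C y)" for y :: 'x
  proof -
    have "(\<i> * of_real \<omega>) *\<^sub>C y = \<i> *\<^sub>C of_real \<omega> *\<^sub>C y" by (simp add: scaleC_scaleC)
    then show 1: "(\<i> * of_real \<omega>) *\<^sub>C y = \<omega> *\<^sub>R \<i> *\<^sub>C y" by (simp add: scaleC_of_real scaleC_scaleR)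
    have "(- \<i> * of_real \<omega>) *\<^sub>C y = (-1) *\<^sub>C (\<i> * of_real \<omega>) *\<^sub>C y" by (simp add: scaleC_scaleC)
    then show "(- \<i> * of_real \<omega>) *\<^sub>C y = - (\<omega> *\<^sub>R \<i> *\<^sub>C y)" using 1 by (simp add: scaleC_minus1)
  qed
  have Bp: "opB1 S (fst (c - \<i> *\<^sub>C d)) = opB1 S (fst c) - \<i> *\<^sub>C opB1 S (fst d)"
    "opB1 S (fst (c + \<i> *\<^sub>C d)) = opB1 S (fst c) + \<i> *\<^sub>C opB1 S (fst d)"
    by (simp_all add: scaleC_prod_def linear_simps[OF B1_linear] B1_scaleC)
  have fs: "fst (snd (c - \<i> *\<^sub>C d)) = fst (snd c) - \<i> *\<^sub>C fst (snd d)" "fst (snd (c + \<i> *\<^sub>C d)) = fst (snd c) + \<i> *\<^sub>C fst (snd d)"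
    "snd (snd (c - \<i> *\<^sub>C d)) = snd (snd c) - \<i> *\<^sub>C snd (snd d)" "snd (snd (c + \<i> *\<^sub>C d)) = snd (snd c) + \<i> *\<^sub>C snd (snd d)"
    by (simp_all add: scaleC_prod_def)
  have A1: "opA S x1 = \<omega> *\<^sub>R x2 - opB1 S (fst c)"
  proof -
    have "opA S x1 = (1/2) *\<^sub>R (opA S p + opA S m)" by (rule pl(1))
    also have "opA S p + opA S m = \<omega> *\<^sub>R \<i> *\<^sub>C (p - m) - ((opB1 S (fst c) - \<i> *\<^sub>C opB1 S (fst d)) + (opB1 S (fst c) + \<i> *\<^sub>C opB1 S (fst d)))"
      unfolding p(3) m(3) i\<omega> Bp by (simp add: scaleC_diff_right scaleR_diff_right)
    also have "(1/2) *\<^sub>R \<dots> = \<omega> *\<^sub>R x2 - opB1 S (fst c)"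
      unfolding scaleR_diff_right cos_sin_half(1) by (simp add: x2_def)
    finally show ?thesis .
  qed
  have A2: "opA S x2 = - \<omega> *\<^sub>R x1 - opB1 S (fst d)"
  proof -
    have "opA S x2 = (1/2) *\<^sub>R \<i> *\<^sub>C (opA S p - opA S m)" by (rule p2(1))
    also have "opA S p - opA S m = \<omega> *\<^sub>R \<i> *\<^sub>C (p + m) - ((opB1 S (fst c) - \<i> *\<^sub>C opB1 S (fst d)) - (opB1 S (fst c) + \<i> *\<^sub>C opB1 S (fst d)))"
      unfolding p(3) m(3) i\<omega> Bp by (simp add: scaleC_add_right scaleR_add_right)
    also have "(1/2) *\<^sub>R \<i> *\<^sub>C \<dots> = (1/2) *\<^sub>R \<i> *\<^sub>C \<omega> *\<^sub>R \<i> *\<^sub>C (p + m) - opB1 S (fst d)"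
      unfolding scaleC_diff_right[of \<i> "\<omega> *\<^sub>R \<i> *\<^sub>C (p + m)"] scaleR_diff_right[of "1/2" "\<i> *\<^sub>C \<omega> *\<^sub>R \<i> *\<^sub>C (p + m)"] cos_sin_half(2) ..
    also have "(1/2) *\<^sub>R \<i> *\<^sub>C \<omega> *\<^sub>R \<i> *\<^sub>C (p + m) = - \<omega> *\<^sub>R x1"
      by (simp add: scaleC_scaleR scaleC_i_i x1_def scaleR_diff_right scaleR_add_right)
    finally show ?thesis .
  qed
  have Bc1: "opBc S x1 = (1/2) *\<^sub>R (f + g) + fst (snd c)"
  proof -
    have "opBc S x1 = (1/2) *\<^sub>R (opBc S p + opBc S m)" by (rule pl(2))
    also have "opBc S p + opBc S m = (f + g) + ((fst (snd c) - \<i> *\<^sub>C fst (snd d)) + (fst (snd c) + \<i> *\<^sub>C fst (snd d)))"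
      unfolding p(4) m(4) fs by simp
    finally show ?thesis unfolding scaleR_add_right[of "1/2" "f + g"] cos_sin_half(1) .
  qed
  have Bc2: "opBc S x2 = (1/2) *\<^sub>R \<i> *\<^sub>C (f - g) + fst (snd d)"
  proof -
    have "opBc S x2 = (1/2) *\<^sub>R \<i> *\<^sub>C (opBc S p - opBc S m)" by (rule p2(2))
    also have "opBc S p - opBc S m = (f - g) + ((fst (snd c) - \<i> *\<^sub>C fst (snd d)) - (fst (snd c) + \<i> *\<^sub>C fst (snd d)))"
      unfolding p(4) m(4) fs by simp
    finally show ?thesis unfolding scaleC_add_right[of \<i> "f - g"] scaleR_add_right[of "1/2" "\<i> *\<^sub>C (f - g)"] cos_sin_half(2) .
  qed
  show ?thesis
  proof (rule that[OF p(1) m(1) _ _ A1 A2 Bc1 Bc2])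
    show "x1 \<in> Dom S" "x2 \<in> Dom S" unfolding x1_def x2_def by (intro Dom_simps D)+
    have "opBd S x1 = (1/2) *\<^sub>R (opBd S p + opBd S m)" by (rule pl(3))
    then show "opBd S x1 = snd (snd c)" unfolding p(5) m(5) fs cos_sin_half(1) .
    have "opBd S x2 = (1/2) *\<^sub>R \<i> *\<^sub>C (opBd S p - opBd S m)" by (rule p2(3))
    then show "opBd S x2 = snd (snd d)" unfolding p(5) m(5) fs cos_sin_half(2) .
    have "opC S x1 = (1/2) *\<^sub>R (opC S p + opC S m)" by (rule pl(4))
    then show "opC S x1 = a" unfolding p(6) m(6) cos_sin_half(1) .
    have "opC S x2 = (1/2) *\<^sub>R \<i> *\<^sub>C (opC S p - opC S m)" by (rule p2(4))
    then show "opC S x2 = b" unfolding p(6) m(6) cos_sin_half(2) .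
  qed
qed

text \<open>At each frequency \<open>opA\<close> rotates the cosine and sine states into each other,
  up to the disturbance, so the signal built from them satisfies the differential equation. If
  \<open>a 0\<close> and \<open>c 0\<close> vanish, the stationary part is the zero state and no
  resolvent at zero is consulted.\<close>

lemma regulator_state:
  assumes \<kappa>: "0 <= \<kappa>"
    and ab: "!!k. k <= q ==> a k \<in> U" "!!k. k \<in> {1..q} ==> b k \<in> U"
    and cd: "!!k. k <= q ==> c k \<in> dist_space U" "!!k. k \<in> {1..q} ==> d k \<in> dist_space U"
    and freq: "!!k \<mu>. k \<in> {1..q} ==> \<mu> \<in> {\<i> * of_real (\<omega> k), - \<i> * of_real (\<omega> k)} ==>
          \<mu> \<in> resolvent_set (cl_dom \<kappa> S) (opA S) & boundedly_invertible_on U (Pc \<kappa> S \<mu>)"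
    and freq0: "a 0 \<noteq> 0 \<or> c 0 \<noteq> 0 ==>
          0 \<in> resolvent_set (cl_dom \<kappa> S) (opA S) & boundedly_invertible_on U (Pc \<kappa> S 0)"
  defines "w \<equiv> trig_signal q \<omega> c d" and "ur \<equiv> feedforward U S \<kappa> q \<omega> a b c d"
  obtains xr K L where "!!t. xr t \<in> Dom S"
    "!!t. (xr has_vector_derivative (opA S (xr t) + opB1 S (fst (w t)))) (at t)"
    "continuous_on UNIV (%t. opA S (xr t) + opB1 S (fst (w t)))"
    "!!t. opBc S (xr t) = ur t + fst (snd (w t))" "!!t. opBd S (xr t) = snd (snd (w t))"
    "!!t. opC S (xr t) = trig_signal q \<omega> a b t" "!!t. norm (xr t) <= K"
    "!!t. ur t \<in> U" "L \<ge> 0" "!!s t. norm (ur t - ur s) <= L * \<bar>t - s\<bar>"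
proof -
  define f0 where "f0 = (if a 0 = 0 & c 0 = 0 then 0 else ff_coeff U S \<kappa> 0 (a 0) (c 0))"
  define f where "f k = ff_coeff U S \<kappa> (\<i> * of_real (\<omega> k)) (a k - \<i> *\<^sub>C b k) (c k - \<i> *\<^sub>C d k)" for k
  define g where "g k = ff_coeff U S \<kappa> (- \<i> * of_real (\<omega> k)) (a k + \<i> *\<^sub>C b k) (c k + \<i> *\<^sub>C d k)" for k
  define p where "p k = (if k = 0 then f0 else (1/2) *\<^sub>R (f k + g k))" for k
  define m where "m k = (1/2) *\<^sub>R \<i> *\<^sub>C (f k - g k)" for k
  have "\<exists>x. p 0 \<in> U & x \<in> Dom S & opA S x = - opB1 S (fst (c 0)) & opBc S x = p 0 + fst (snd (c 0))
    & opBd S x = snd (snd (c 0)) & opC S x = a 0"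
  proof (cases "a 0 = 0 & c 0 = 0")
    case True
    then show ?thesis using subspace_0[OF U_subspace] linear_simps(3)[OF B1_linear]
      by (intro exI[of _ 0]) (auto simp: op_0 p_def f0_def)
  next
    case False
    then have fr: "0 \<in> resolvent_set (cl_dom \<kappa> S) (opA S)" "boundedly_invertible_on U (Pc \<kappa> S 0)"
      using freq0 by auto
    obtain x where "ff_coeff U S \<kappa> 0 (a 0) (c 0) \<in> U" "x \<in> Dom S" "opA S x = 0 *\<^sub>C x - opB1 S (fst (c 0))"
      "opBc S x = ff_coeff U S \<kappa> 0 (a 0) (c 0) + fst (snd (c 0))" "opBd S x = snd (snd (c 0))" "opC S x = a 0"
      by (rule feedforward_state[OF \<kappa> fr ab(1)[of 0] cd(1)[of 0]]) (auto intro: that)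
    moreover have "p 0 = ff_coeff U S \<kappa> 0 (a 0) (c 0)" using False by (auto simp: p_def f0_def)
    moreover have "0 *\<^sub>C x = 0" using scaleC_of_real[of 0 x] by simp
    ultimately show ?thesis by (intro exI[of _ x]) simp
  qed
  then obtain X0 where X0: "p 0 \<in> U" "X0 \<in> Dom S" "opA S X0 = - opB1 S (fst (c 0))" "opBc S X0 = p 0 + fst (snd (c 0))"
    "opBd S X0 = snd (snd (c 0))" "opC S X0 = a 0" by blast
  have "\<exists>x1 x2. p k \<in> U & m k \<in> U & x1 \<in> Dom S & x2 \<in> Dom S & opA S x1 = \<omega> k *\<^sub>R x2 - opB1 S (fst (c k))
    & opA S x2 = - \<omega> k *\<^sub>R x1 - opB1 S (fst (d k)) & opBc S x1 = p k + fst (snd (c k))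
    & opBc S x2 = m k + fst (snd (d k)) & opBd S x1 = snd (snd (c k)) & opBd S x2 = snd (snd (d k))
    & opC S x1 = a k & opC S x2 = b k" if k: "k \<in> {1..q}" for k
  proof -
    have ks: "a k \<in> U" "c k \<in> dist_space U" using ab(1) cd(1) k by auto
    obtain x1 x2 where x: "f k \<in> U" "g k \<in> U" "x1 \<in> Dom S" "x2 \<in> Dom S"
      "opA S x1 = \<omega> k *\<^sub>R x2 - opB1 S (fst (c k))" "opA S x2 = - \<omega> k *\<^sub>R x1 - opB1 S (fst (d k))"
      "opBc S x1 = (1/2) *\<^sub>R (f k + g k) + fst (snd (c k))" "opBc S x2 = (1/2) *\<^sub>R \<i> *\<^sub>C (f k - g k) + fst (snd (d k))"
      "opBd S x1 = snd (snd (c k))" "opBd S x2 = snd (snd (d k))" "opC S x1 = a k" "opC S x2 = b k"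
      by (rule feedforward_cos_sin[OF \<kappa> _ ks(1) ab(2)[OF k] ks(2) cd(2)[OF k], of "\<omega> k", folded f_def g_def],
          rule freq[OF k], assumption) (rule that)
    have "p k = (1/2) *\<^sub>R (f k + g k)" using k by (simp add: p_def)
    moreover from this have "p k \<in> U" "m k \<in> U" unfolding m_def
      by (simp_all add: x subspace_scale[OF U_subspace] subspace_add[OF U_subspace] subspace_diff[OF U_subspace] U_scaleC)
    ultimately show ?thesis using x by (intro exI[of _ x1] exI[of _ x2]) (simp add: m_def)
  qed
  then obtain X Y where XY: "!!k. k \<in> {1..q} ==> p k \<in> U & m k \<in> U & X k \<in> Dom S & Y k \<in> Dom S & opA S (X k) = \<omega> k *\<^sub>R Y k - opB1 S (fst (c k))
    & opA S (Y k) = - \<omega> k *\<^sub>R X k - opB1 S (fst (d k)) & opBc S (X k) = p k + fst (snd (c k))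
    & opBc S (Y k) = m k + fst (snd (d k)) & opBd S (X k) = snd (snd (c k)) & opBd S (Y k) = snd (snd (d k))
    & opC S (X k) = a k & opC S (Y k) = b k" by metis
  \<comment> \<open>Coefficient zero is the stationary state, on which \<open>opA\<close> has to
    cancel the constant part of the disturbance.\<close>
  define Z where "Z k = (if k = 0 then X0 else X k)" for k
  define xr where "xr = trig_signal q \<omega> Z Y"
  have Z: "Z k \<in> Dom S" "p k \<in> U" "opA S (Z k) = (if k = 0 then 0 else \<omega> k *\<^sub>R Y k) - opB1 S (fst (c k))"
    "opBc S (Z k) = p k + fst (snd (c k))" "opBd S (Z k) = snd (snd (c k))" "opC S (Z k) = a k" if "k <= q" for k
    using that by (atomize (full), cases "k = 0") (use X0 XY[of k] in \<open>auto simp: Z_def\<close>)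
  have Y: "Y k \<in> Dom S" "m k \<in> U" "opA S (Y k) = - \<omega> k *\<^sub>R Z k - opB1 S (fst (d k))"
    "opBc S (Y k) = m k + fst (snd (d k))" "opBd S (Y k) = snd (snd (d k))" "opC S (Y k) = b k" if "k \<in> {1..q}" for k
    using XY[OF that] that by (auto simp: Z_def)
  have ur: "ur t = trig_signal q \<omega> p m t" for t
    unfolding ur_def feedforward_trig p_def m_def f_def g_def f0_def ..
  have im: "opA S (xr t) = trig_signal q \<omega> (%k. opA S (Z k)) (%k. opA S (Y k)) t"
    "opBc S (xr t) = trig_signal q \<omega> (%k. opBc S (Z k)) (%k. opBc S (Y k)) t"
    "opBd S (xr t) = trig_signal q \<omega> (%k. opBd S (Z k)) (%k. opBd S (Y k)) t"
    "opC S (xr t) = trig_signal q \<omega> (%k. opC S (Z k)) (%k. opC S (Y k)) t" for t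
    unfolding xr_def by (rule trig_signal_image[OF Dom_subspace]; simp add: op_add op_scaleR Z(1) Y(1))+
  have lin: "opB1 S (fst (w t)) = trig_signal q \<omega> (%k. opB1 S (fst (c k))) (%k. opB1 S (fst (d k))) t"
    "fst (snd (w t)) = trig_signal q \<omega> (%k. fst (snd (c k))) (%k. fst (snd (d k))) t"
    "snd (snd (w t)) = trig_signal q \<omega> (%k. snd (snd (c k))) (%k. snd (snd (d k))) t" for t
    unfolding w_def by (rule trig_signal_image[OF subspace_UNIV]; simp add: linear_simps[OF B1_linear])+
  have A: "opA S (xr t) + opB1 S (fst (w t)) = trig_signal q \<omega> (%k. if k = 0 then 0 else \<omega> k *\<^sub>R Y k) (%k. - \<omega> k *\<^sub>R Z k) t" for t
    unfolding im lin trig_signal_add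
    by (rule trig_signal_cong) (simp_all add: Z Y)
  obtain K where K: "K \<ge> 0" "!!t. norm (xr t) <= K"
    by (rule trig_signal_bounded[of q \<omega> Z Y, folded xr_def]) (rule that)
  obtain L where L: "L \<ge> 0" "!!s t. norm (ur t - ur s) <= L * \<bar>t - s\<bar>"
    by (rule trig_signal_lipschitz[of q \<omega> p m, folded ur]) (rule that)
  show ?thesis
  proof (rule that[OF _ _ _ _ _ _ K(2) _ L])
    show "xr t \<in> Dom S" for t unfolding xr_def by (rule trig_signal_in[OF Dom_subspace Z(1) Y(1)])
    show "(xr has_vector_derivative (opA S (xr t) + opB1 S (fst (w t)))) (at t)" for t
      unfolding A unfolding xr_def by (rule trig_signal_deriv)
    show "continuous_on UNIV (%t. opA S (xr t) + opB1 S (fst (w t)))" unfolding A by (rule trig_signal_continuous)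
    show "opBc S (xr t) = ur t + fst (snd (w t))" for t
      unfolding im lin ur trig_signal_add
      by (rule trig_signal_cong) (simp_all add: Z Y)
    show "opBd S (xr t) = snd (snd (w t))" for t
      unfolding im lin
      by (rule trig_signal_cong) (simp_all add: Z Y)
    show "opC S (xr t) = trig_signal q \<omega> a b t" for t
      unfolding im
      by (rule trig_signal_cong) (simp_all add: Z Y)
    show "ur t \<in> U" for t unfolding ur by (rule trig_signal_in[OF U_subspace Z(2) Y(2)])
  qed
qed

end

section \<open>Uniqueness of generalised solutions\<close>

lemma continuous_on_half_line:
  fixes f :: "real => 'a::topological_space"
  assumes "!!\<tau>. 0 <= \<tau> ==> continuous_on {0..\<tau>} f"
  shows "continuous_on {0..} f"
  unfolding continuous_on_def
proof
  fix t :: real assume t: "t \<in> {0..}"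
  have "at t within {0..t+1} = at t within {0..}"
    by (rule at_within_nhd[of t "{..<t+1}"]) auto
  moreover have "(f \<longlongrightarrow> f t) (at t within {0..t+1})"
    using assms[of "t+1"] t unfolding continuous_on_def by auto
  ultimately show "(f \<longlongrightarrow> f t) (at t within {0..})" by simp
qed

lemma stek_deriv:
  fixes f :: "real => 'a::banach"
  assumes f: "continuous_on {0..} f" and h: "0 < h" and t: "0 <= t"
  shows "(stek h f has_vector_derivative (f (t + h) - f t) /\<^sub>R h) (at t within {0..})"
proof -
  let ?G = "%t. integral {0..t} f"
  have th: "0 <= t + h" using h t by simp
  have "((%t. t + h) has_vector_derivative 1) (at t within {0..})" by (auto intro!: derivative_eq_intros)
  moreover have "(?G has_vector_derivative f (t + h)) (at (t + h) within (%t. t + h) ` {0..})"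
    by (rule has_vector_derivative_within_subset[OF antideriv[OF f th]]) (use h in auto)
  ultimately have "((%t. ?G (t + h)) has_vector_derivative f (t + h)) (at t within {0..})"
    using vector_diff_chain_within[of "%t. t + h" 1 t "{0..}" ?G] by (simp add: o_def)
  from has_vector_derivative_diff[OF this antideriv[OF f t]]
  have "((%t. (?G (t + h) - ?G t) /\<^sub>R h) has_vector_derivative (f (t + h) - f t) /\<^sub>R h) (at t within {0..})"
    by (rule bounded_linear.has_vector_derivative[OF bounded_linear_scaleR_right])
  then show ?thesis
    by (rule has_vector_derivative_transform[rotated 2]) (use t stek_eq[OF f _ h] in auto)
qed

lemma inner_integral_diff:
  fixes a b c d :: "real => 'a::real_inner"
  assumes a: "continuous_on {0..\<tau>} a" and b: "continuous_on {0..\<tau>} b"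
    and c: "continuous_on {0..\<tau>} c" and d: "continuous_on {0..\<tau>} d"
  shows "\<bar>integral {0..\<tau>} (%t. a t \<bullet> b t) - integral {0..\<tau>} (%t. c t \<bullet> d t)\<bar>
    <= l2n \<tau> (%t. a t - c t) * l2n \<tau> b + l2n \<tau> c * l2n \<tau> (%t. b t - d t)"
proof -
  have "integral {0..\<tau>} (%t. a t \<bullet> b t) - integral {0..\<tau>} (%t. c t \<bullet> d t)
    = integral {0..\<tau>} (%t. a t \<bullet> b t - c t \<bullet> d t)"
    by (rule Henstock_Kurzweil_Integration.integral_diff[symmetric]; rule integrable_continuous_real; intro continuous_intros a b c d)
  also have "\<dots> = integral {0..\<tau>} (%t. (a t - c t) \<bullet> b t + c t \<bullet> (b t - d t))"
    by (simp add: inner_diff_left inner_diff_right)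
  also have "\<dots> = integral {0..\<tau>} (%t. (a t - c t) \<bullet> b t) + integral {0..\<tau>} (%t. c t \<bullet> (b t - d t))"
    by (rule Henstock_Kurzweil_Integration.integral_add; rule integrable_continuous_real; intro continuous_intros a b c d)
  finally have eq: "integral {0..\<tau>} (%t. a t \<bullet> b t) - integral {0..\<tau>} (%t. c t \<bullet> d t) = \<dots>" .
  have "\<bar>integral {0..\<tau>} (%t. (a t - c t) \<bullet> b t)\<bar> <= l2n \<tau> (%t. a t - c t) * l2n \<tau> b"
    by (rule l2n_inner[OF _ b]) (intro continuous_intros a c)
  moreover have "\<bar>integral {0..\<tau>} (%t. c t \<bullet> (b t - d t))\<bar> <= l2n \<tau> c * l2n \<tau> (%t. b t - d t)"
    by (rule l2n_inner[OF c]) (intro continuous_intros b d)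
  ultimately show ?thesis unfolding eq by linarith
qed

text \<open>Integrability belongs to the notion, because the integral of a nonintegrable function is
  zero and would imitate convergence.\<close>

definition l2conv :: "real => (nat => real => 'a::real_normed_vector) => (real => 'a) => bool" where
  "l2conv \<tau> f y \<longleftrightarrow> (\<forall>n. set_integrable lebesgue {0..\<tau>} (%t. (norm (f n t - y t))\<^sup>2)) &
     (%n. LINT t:{0..\<tau>}|lebesgue. (norm (f n t - y t))\<^sup>2) \<longlonglongrightarrow> 0"

lemma set_lint_nonneg: "0 <= (LINT t:S|lebesgue. (norm (f t))\<^sup>2)"
  unfolding set_lebesgue_integral_def by (rule integral_nonneg_AE) simp

lemma set_lint_mono_set:
  fixes g :: "real => real"
  assumes "set_integrable lebesgue B g" "A \<in> sets lebesgue" "A \<subseteq> B" "!!t. 0 <= g t"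
  shows "(LINT t:A|lebesgue. g t) <= (LINT t:B|lebesgue. g t)"
  unfolding set_lebesgue_integral_def
proof (rule integral_mono)
  show "integrable lebesgue (%x. indicator A x *\<^sub>R g x)"
    using set_integrable_subset[OF assms(1-3)] by (simp add: set_integrable_def)
  show "integrable lebesgue (%x. indicator B x *\<^sub>R g x)" using assms(1) by (simp add: set_integrable_def)
  show "indicator A x *\<^sub>R g x <= indicator B x *\<^sub>R g x" for x using assms(3,4) by (auto simp: indicator_def)
qed

lemma l2conv_mono:
  assumes c: "l2conv \<tau>' f y" and \<tau>: "\<tau> <= \<tau>'"
  shows "l2conv \<tau> f y"
proof -
  have si: "set_integrable lebesgue {0..\<tau>'} (%t. (norm (f n t - y t))\<^sup>2)" for n using c by (simp add: l2conv_def)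
  have "(%n. LINT t:{0..\<tau>}|lebesgue. (norm (f n t - y t))\<^sup>2) \<longlonglongrightarrow> 0"
  proof (rule real_tendsto_sandwich[OF _ _ tendsto_const])
    show "(%n. LINT t:{0..\<tau>'}|lebesgue. (norm (f n t - y t))\<^sup>2) \<longlonglongrightarrow> 0" using c by (simp add: l2conv_def)
    show "\<forall>\<^sub>F n in sequentially. (LINT t:{0..\<tau>}|lebesgue. (norm (f n t - y t))\<^sup>2) <= (LINT t:{0..\<tau>'}|lebesgue. (norm (f n t - y t))\<^sup>2)"
      by (intro always_eventually allI set_lint_mono_set si) (use \<tau> in auto)
  qed (intro always_eventually allI set_lint_nonneg)
  then show ?thesis unfolding l2conv_def using set_integrable_subset[OF si] \<tau> by auto
qed

lemma l2conv_of_L2: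
  fixes y :: "real => 'a::real_normed_vector"
  assumes c: "!!n. continuous_on {0..} (f n)" and y: "L2_on {0<..<\<tau>} V y"
    and lim: "(%n. L2_norm {0<..<\<tau>} (%t. f n t - y t)) \<longlonglongrightarrow> 0"
  shows "l2conv \<tau> f y"
proof -
  have m: "f n measurable_on {0<..<\<tau>}" for n by (rule measurable_on_cont[OF c]) auto
  have si: "set_integrable lebesgue {0<..<\<tau>} (%t. (norm (f n t - y t))\<^sup>2)" for n
    using y by (intro set_integrable_sq_diff m cont_sq_integrable[OF c]) (auto simp: L2_on_def)
  have eq: "(LINT t:{0..\<tau>}|lebesgue. (norm (f n t - y t))\<^sup>2) = (L2_norm {0<..<\<tau>} (%t. f n t - y t))\<^sup>2" for n
    unfolding L2_norm_def lint_open_closed(1) by (rule real_sqrt_pow2[symmetric, OF set_lint_nonneg])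
  show ?thesis unfolding l2conv_def eq using si[unfolded lint_open_closed(2)] tendsto_power[OF lim, of 2] by simp
qed

lemma L2_norm_of_l2conv:
  assumes "l2conv \<tau> f y"
  shows "(%n. L2_norm {0<..<\<tau>} (%t. f n t - y t)) \<longlonglongrightarrow> 0"
proof -
  have "(%n. LINT t:{0..\<tau>}|lebesgue. (norm (f n t - y t))\<^sup>2) \<longlonglongrightarrow> 0" using assms by (simp add: l2conv_def)
  from tendsto_real_sqrt[OF this] show ?thesis unfolding L2_norm_def lint_open_closed(1) by simp
qed

lemma l2conv_sq_le:
  assumes c: "continuous_on {0..} (f n)" "continuous_on {0..} (g m)" and fy: "l2conv \<tau> f y" and gy: "l2conv \<tau> g y"
  shows "(l2n \<tau> (%t. f n t - g m t))\<^sup>2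
    <= 2 * (LINT t:{0..\<tau>}|lebesgue. (norm (f n t - y t))\<^sup>2) + 2 * (LINT t:{0..\<tau>}|lebesgue. (norm (g m t - y t))\<^sup>2)"
proof -
  have "(l2n \<tau> (%t. f n t - g m t))\<^sup>2 = (LINT t:{0..\<tau>}|lebesgue. (norm (f n t - g m t))\<^sup>2)"
    by (rule lint_sq[symmetric]) (intro continuous_intros continuous_on_sub0[OF c(1)] continuous_on_sub0[OF c(2)] order_refl)
  also have "\<dots> <= 2 * (LINT t:{0..\<tau>}|lebesgue. (norm (f n t - y t))\<^sup>2) + 2 * (LINT t:{0..\<tau>}|lebesgue. (norm (y t - g m t))\<^sup>2)"
    using fy gy by (intro set_lint_sq_triangle) (auto simp: l2conv_def norm_minus_commute[of "y _"])
  finally show ?thesis by (simp add: norm_minus_commute[of "y _"])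
qed

lemma l2conv_null:
  assumes c: "!!n. continuous_on {0..} (f n)" "!!n. continuous_on {0..} (g n)" and fy: "l2conv \<tau> f y" and gy: "l2conv \<tau> g y"
  shows "(%n. l2n \<tau> (%t. f n t - g n t)) \<longlonglongrightarrow> 0"
proof -
  have fy': "(%n. LINT t:{0..\<tau>}|lebesgue. (norm (f n t - y t))\<^sup>2) \<longlonglongrightarrow> 0"
    and gy': "(%n. LINT t:{0..\<tau>}|lebesgue. (norm (g n t - y t))\<^sup>2) \<longlonglongrightarrow> 0"
    using fy gy by (auto simp: l2conv_def)
  have "(%n. (l2n \<tau> (%t. f n t - g n t))\<^sup>2) \<longlonglongrightarrow> 0"
  proof (rule real_tendsto_sandwich[OF _ _ tendsto_const])
    show "(%n. 2 * (LINT t:{0..\<tau>}|lebesgue. (norm (f n t - y t))\<^sup>2) + 2 * (LINT t:{0..\<tau>}|lebesgue. (norm (g n t - y t))\<^sup>2)) \<longlonglongrightarrow> 0"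
      using tendsto_add[OF tendsto_mult_left[OF fy', of 2] tendsto_mult_left[OF gy', of 2]] by simp
    show "\<forall>\<^sub>F n in sequentially. (l2n \<tau> (%t. f n t - g n t))\<^sup>2
      <= 2 * (LINT t:{0..\<tau>}|lebesgue. (norm (f n t - y t))\<^sup>2) + 2 * (LINT t:{0..\<tau>}|lebesgue. (norm (g n t - y t))\<^sup>2)"
      by (rule always_eventually, rule allI, rule l2conv_sq_le[OF c fy gy])
    show "\<forall>\<^sub>F n in sequentially. 0 <= (l2n \<tau> (%t. f n t - g n t))\<^sup>2" by simp
  qed
  from tendsto_real_sqrt[OF this] show ?thesis by simp
qed

lemma l2conv_cauchy:
  assumes c: "!!n. continuous_on {0..} (f n)" and fy: "l2conv \<tau> f y"
  shows "l2cauchy \<tau> f"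
  unfolding l2cauchy_def
proof (intro allI impI)
  fix e :: real assume e: "0 < e"
  let ?a = "%n. LINT t:{0..\<tau>}|lebesgue. (norm (f n t - y t))\<^sup>2"
  have "\<forall>\<^sub>F n in sequentially. ?a n < e\<^sup>2 / 4"
    using fy e unfolding l2conv_def by (intro order_tendstoD(2)[of ?a 0]) auto
  then obtain N where N: "!!n. n \<ge> N ==> ?a n < e\<^sup>2 / 4" by (auto simp: eventually_sequentially)
  show "\<exists>N. \<forall>m\<ge>N. \<forall>n\<ge>N. l2n \<tau> (%t. f m t - f n t) <= e"
  proof (intro exI[of _ N] allI impI)
    fix m n assume "m \<ge> N" "n \<ge> N"
    then have "(l2n \<tau> (%t. f m t - f n t))\<^sup>2 <= e\<^sup>2"
      using l2conv_sq_le[OF c c fy fy, of m n] N[of m] N[of n] by linarith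
    then show "l2n \<tau> (%t. f m t - f n t) <= e" by (rule power2_le_imp_le) (use e in simp)
  qed
qed

text \<open>The triangle inequality through \<open>f n\<close> and \<open>g n\<close> gives integral
  zero for the squared difference; its integrability turns this into equality almost
  everywhere.\<close>

lemma l2conv_unique:
  assumes c: "!!n. continuous_on {0..} (f n)" "!!n. continuous_on {0..} (g n)"
    and fy: "l2conv \<tau> f y" and gy: "l2conv \<tau> g y'"
    and si: "set_integrable lebesgue {0..\<tau>} (%t. (norm (y t - y' t))\<^sup>2)"
    and m: "y' measurable_on {0<..<\<tau>}"
    and null: "(%n. l2n \<tau> (%t. f n t - g n t)) \<longlonglongrightarrow> 0"
  shows "AE t in lebesgue. t \<in> {0..\<tau>} --> y t = y' t"
proof -
  let ?I = "%f. LINT t:{0..\<tau>}|lebesgue. (norm (f t))\<^sup>2"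
  have cd: "continuous_on {0..} (%t. f n t - g n t)" for n by (rule continuous_on_diff[OF c])
  have le: "?I (%t. y t - y' t) <= 2 * ?I (%t. f n t - y t) + 4 * (l2n \<tau> (%t. f n t - g n t))\<^sup>2 + 4 * ?I (%t. g n t - y' t)" for n
  proof -
    have 1: "set_integrable lebesgue {0..\<tau>} (%t. (norm (f n t - g n t))\<^sup>2)"
      by (rule cont_sq_integrable(1)[OF cd order_refl])
    have yg: "set_integrable lebesgue {0..\<tau>} (%t. (norm (f n t - y t))\<^sup>2)" "set_integrable lebesgue {0..\<tau>} (%t. (norm (g n t - y' t))\<^sup>2)"
      using fy gy by (auto simp: l2conv_def)
    have 2: "set_integrable lebesgue {0..\<tau>} (%t. (norm (y t - f n t))\<^sup>2)" using yg(1) by (simp add: norm_minus_commute)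
    have 3: "set_integrable lebesgue {0..\<tau>} (%t. (norm (f n t - y' t))\<^sup>2)"
      unfolding lint_open_closed(2)[symmetric]
    proof (rule set_integrable_bound)
      have yg': "set_integrable lebesgue {0<..<\<tau>} (%t. (norm (f n t - g n t))\<^sup>2)"
        "set_integrable lebesgue {0<..<\<tau>} (%t. (norm (g n t - y' t))\<^sup>2)"
        using 1 yg(2) unfolding lint_open_closed(2) by auto
      show "set_integrable lebesgue {0<..<\<tau>} (%t. 2 * (norm (f n t - g n t))\<^sup>2 + 2 * (norm (g n t - y' t))\<^sup>2)"
        by (intro set_integral_add(1) set_integrable_mult_right yg')
      have "(%t. f n t - y' t) measurable_on {0<..<\<tau>}"
        by (intro measurable_on_diff m measurable_on_cont[OF c(1)]) auto
      then show "set_borel_measurable lebesgue {0<..<\<tau>} (%t. (norm (f n t - y' t))\<^sup>2)"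
        by (rule measurable_on_norm_sq(1))
      have "norm ((norm (f n t - y' t))\<^sup>2) <= norm (2 * (norm (f n t - g n t))\<^sup>2 + 2 * (norm (g n t - y' t))\<^sup>2)" for t
        using norm_sq_add_le[of "f n t - g n t" "g n t - y' t"] by simp
      then show "AE t in lebesgue. t \<in> {0<..<\<tau>} --> norm ((norm (f n t - y' t))\<^sup>2) <= norm (2 * (norm (f n t - g n t))\<^sup>2 + 2 * (norm (g n t - y' t))\<^sup>2)"
        by (intro AE_I2) auto
    qed
    have "?I (%t. y t - y' t) <= 2 * ?I (%t. y t - f n t) + 2 * ?I (%t. f n t - y' t)"
      by (rule set_lint_sq_triangle[OF 2 3])
    moreover have "?I (%t. f n t - y' t) <= 2 * ?I (%t. f n t - g n t) + 2 * ?I (%t. g n t - y' t)"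
      by (rule set_lint_sq_triangle[OF 1 yg(2)])
    moreover have "?I (%t. f n t - g n t) = (l2n \<tau> (%t. f n t - g n t))\<^sup>2"
      by (rule lint_sq[OF continuous_on_sub0[OF cd order_refl]])
    ultimately show ?thesis by (simp add: norm_minus_commute[of "y _"])
  qed
  have "(%n. 2 * ?I (%t. f n t - y t) + 4 * (l2n \<tau> (%t. f n t - g n t))\<^sup>2 + 4 * ?I (%t. g n t - y' t)) \<longlonglongrightarrow> 2 * 0 + 4 * 0\<^sup>2 + 4 * 0"
    using fy gy by (intro tendsto_intros null) (auto simp: l2conv_def)
  then have "?I (%t. y t - y' t) <= 0" using LIMSEQ_le_const[of _ 0 "?I (%t. y t - y' t)"] le by force
  then have "?I (%t. y t - y' t) = 0" using set_lint_nonneg by (rule antisym)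
  then have "AE t in lebesgue. indicator {0..\<tau>} t *\<^sub>R (norm (y t - y' t))\<^sup>2 = 0"
    using si unfolding set_lebesgue_integral_def set_integrable_def
    by (subst (asm) integral_nonneg_eq_0_iff_AE) auto
  then show ?thesis by eventually_elim (auto simp: indicator_def split: if_splits)
qed

lemma le_zero_if_le_small:
  fixes x C :: real
  assumes "!!e. 0 < e ==> e <= 1 ==> x <= e * C"
  shows "x <= 0"
proof (rule field_le_epsilon)
  fix e :: real assume e: "0 < e"
  define d where "d = min 1 (e / (\<bar>C\<bar> + 1))"
  have d: "0 < d" "d <= 1" "d * (\<bar>C\<bar> + 1) <= e"
    using e mult_right_mono[of d "e / (\<bar>C\<bar> + 1)" "\<bar>C\<bar> + 1"] by (auto simp: d_def)
  have "x <= d * C" by (rule assms[OF d(1,2)])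
  also have "\<dots> <= d * (\<bar>C\<bar> + 1)" using d(1) by (intro mult_left_mono) auto
  finally show "x <= 0 + e" using d(3) by simp
qed

lemma l2n_null_bound:
  fixes f :: "nat => real => 'a::real_normed_vector" and g :: "nat => real => 'b::real_normed_vector"
  assumes c: "!!n. continuous_on {0..} (f n)" "!!n. continuous_on {0..} (g n)"
    and le: "!!n t. 0 <= t ==> norm (f n t) <= K * norm (g n t)" and K: "0 <= K"
    and g: "(%n. l2n \<tau> (g n)) \<longlonglongrightarrow> 0"
  shows "(%n. l2n \<tau> (f n)) \<longlonglongrightarrow> 0"
proof (rule Lim_null_comparison[OF _ tendsto_mult_right_zero[OF g, of K]], intro always_eventually allI)
  fix n
  have "l2n \<tau> (f n) <= l2n \<tau> (%t. K *\<^sub>R g n t)"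
    using le K by (intro l2n_mono_fun continuous_on_sub0[OF c(1)] continuous_on_scaleR continuous_on_const
        continuous_on_sub0[OF c(2)] order_refl) auto
  then show "norm (l2n \<tau> (f n)) <= K * l2n \<tau> (g n)" using K by (simp add: l2n_scaleR)
qed

lemma l2cauchy_dominated:
  fixes f :: "nat => real => 'a::real_normed_vector" and a :: "nat => real => 'b::real_normed_vector"
    and b :: "nat => real => 'c::real_normed_vector" and c :: "nat => real => 'd::real_normed_vector"
  assumes cf: "!!n. continuous_on {0..} (f n)" and ca: "!!n. continuous_on {0..} (a n)"
    and cb: "!!n. continuous_on {0..} (b n)" and cc: "!!n. continuous_on {0..} (c n)"
    and le: "!!m n t. 0 <= t ==> norm (f m t - f n t) <= norm (a m t - a n t) + k * norm (b m t - b n t) + norm (c m t - c n t)"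
    and k: "0 <= k" and L: "l2cauchy \<tau> a" "l2cauchy \<tau> b" "l2cauchy \<tau> c"
  shows "l2cauchy \<tau> f"
  unfolding l2cauchy_def
proof (intro allI impI)
  fix e :: real assume e: "0 < e"
  define e' where "e' = e / (k + 2)"
  have "(k + 2) * e' = e" using k by (simp add: e'_def)
  then have "e' + k * e' + e' = e" by (simp add: algebra_simps)
  moreover have "0 < e'" using e k by (simp add: e'_def)
  ultimately have e': "0 < e'" "e' + k * e' + e' = e" by auto
  obtain Na Nb Nc where N: "!!m n. m \<ge> Na ==> n \<ge> Na ==> l2n \<tau> (%t. a m t - a n t) <= e'"
    "!!m n. m \<ge> Nb ==> n \<ge> Nb ==> l2n \<tau> (%t. b m t - b n t) <= e'"
    "!!m n. m \<ge> Nc ==> n \<ge> Nc ==> l2n \<tau> (%t. c m t - c n t) <= e'"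
    using L e'(1) unfolding l2cauchy_def by metis
  show "\<exists>N. \<forall>m\<ge>N. \<forall>n\<ge>N. l2n \<tau> (%t. f m t - f n t) <= e"
  proof (intro exI[of _ "max Na (max Nb Nc)"] allI impI)
    fix m n assume mn: "max Na (max Nb Nc) <= m" "max Na (max Nb Nc) <= n"
    let ?a = "%t. norm (a m t - a n t)" and ?b = "%t. norm (b m t - b n t)" and ?c = "%t. norm (c m t - c n t)"
    note s = continuous_on_sub0[OF _ order_refl]
    have ct: "continuous_on {0..\<tau>} ?a" "continuous_on {0..\<tau>} (%t. k *\<^sub>R ?b t)" "continuous_on {0..\<tau>} ?c"
      by (intro continuous_on_norm continuous_on_diff continuous_on_scaleR continuous_on_const s ca cb cc)+
    have "l2n \<tau> (%t. f m t - f n t) <= l2n \<tau> (%t. ?a t + k *\<^sub>R ?b t + ?c t)"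
    proof (rule l2n_mono_fun)
      show "continuous_on {0..\<tau>} (%t. f m t - f n t)" by (intro continuous_on_diff s cf)
      show "continuous_on {0..\<tau>} (%t. ?a t + k *\<^sub>R ?b t + ?c t)" by (intro continuous_on_add ct)
      show "norm (f m t - f n t) <= norm (?a t + k *\<^sub>R ?b t + ?c t)" if "0 <= t" for t
        using le[OF that, of m n] by simp
    qed
    also have "\<dots> <= l2n \<tau> ?a + l2n \<tau> (%t. k *\<^sub>R ?b t) + l2n \<tau> ?c"
      by (rule order_trans[OF l2n_triangle[OF continuous_on_add[OF ct(1,2)] ct(3)]])
        (rule add_right_mono[OF l2n_triangle[OF ct(1,2)]])
    also have "\<dots> <= e' + k * e' + e'"
      unfolding l2n_scaleR l2n_norm using k mn by (intro add_mono mult_mono N) auto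
    finally show "l2n \<tau> (%t. f m t - f n t) <= e" unfolding e'(2) .
  qed
qed

section \<open>Passage to the limit in differences of approximating solutions\<close>

context passive_node
begin

text \<open>The Steklov averages of the limit of the differences \<open>d n\<close> solve the undisturbed system, so
  that the energy balance passes to the limit although the disturbances are not differentiable.\<close>

lemma mild_null:
  assumes D: "!!n t. 0 <= t ==> d n t \<in> Dom S"
    and deriv: "!!n t. 0 <= t ==> (d n has_vector_derivative opA S (d n t) + q n t) (at t within {0..})"
    and cA: "!!n::nat. continuous_on {0..} (%t. opA S (d n t))" and cq: "!!n. continuous_on {0..} (q n)"
    and q: "!!\<tau>. 0 <= \<tau> ==> (%n. l2n \<tau> (q n)) \<longlonglongrightarrow> 0"
    and bd: "!!\<tau>. 0 <= \<tau> ==> (%n. l2n \<tau> (%t. opBd S (d n t))) \<longlonglongrightarrow> 0"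
    and lim: "!!\<tau>. 0 <= \<tau> ==> uniform_limit {0..\<tau>} d \<zeta> sequentially" and \<zeta>0: "\<zeta> 0 = 0"
    and Lu: "!!\<tau>. 0 <= \<tau> ==> l2cauchy \<tau> (%n t. opBc S (d n t))"
    and Ly: "!!\<tau>. 0 <= \<tau> ==> l2cauchy \<tau> (%n t. opC S (d n t))"
    and power: "!!\<tau> e. 0 <= \<tau> ==> 0 < e ==>
      \<forall>\<^sub>F n in sequentially. integral {0..\<tau>} (%t. opBc S (d n t) \<bullet> opC S (d n t)) <= e"
  shows "0 <= \<tau> ==> \<zeta> \<tau> = 0" "0 <= \<tau> ==> (%n. l2n \<tau> (%t. opC S (d n t))) \<longlonglongrightarrow> 0"
proof -
  let ?u = "%n t. opBc S (d n t)" and ?y = "%n t. opC S (d n t)"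
  have cd: "continuous_on {0..} (d n)" for n by (rule continuous_on_of_deriv[OF deriv]) auto
  have cuy: "continuous_on {0..} (?u n)" "continuous_on {0..} (?y n)" "continuous_on {0..} (%t. opBd S (d n t))" for n
    by (rule op_continuous[OF D cd cA]; simp)+
  have c\<zeta>: "continuous_on {0..} \<zeta>"
    by (rule continuous_on_half_line) (rule uniform_limit_cont[OF cd lim])
  have intA: "integral {a..b} (%t. opA S (d n t)) = d n b - d n a - integral {a..b} (q n)" if "0 <= a" "a <= b" for n a b
  proof -
    have "integral {a..b} (%t. opA S (d n t) + q n t) = integral {a..b} (%t. opA S (d n t)) + integral {a..b} (q n)"
      by (rule Henstock_Kurzweil_Integration.integral_add; rule integrable_cont, rule continuous_on_sub0[OF _ that(1)], rule cA cq)
    then show ?thesis using integral_deriv[OF deriv that, of n] by simp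
  qed
  have intD: "integral {a..b} (d n) \<in> Dom S" "opA S (integral {a..b} (d n)) = d n b - d n a - integral {a..b} (q n)"
    "opBc S (integral {a..b} (d n)) = integral {a..b} (?u n)" "opC S (integral {a..b} (d n)) = integral {a..b} (?y n)"
    "opBd S (integral {a..b} (d n)) = integral {a..b} (%t. opBd S (d n t))" if ab: "0 <= a" "a <= b" for n a b
  proof -
    have D': "d n t \<in> Dom S" if "a <= t" "t <= b" for t using that ab by (intro D) simp
    show "integral {a..b} (d n) \<in> Dom S" by (rule op_integral(1)[OF D' continuous_on_sub0[OF cd ab(1)] continuous_on_sub0[OF cA ab(1)]])
    show "opA S (integral {a..b} (d n)) = d n b - d n a - integral {a..b} (q n)"
      unfolding intA[OF ab, symmetric] by (rule op_integral(2)[OF D' continuous_on_sub0[OF cd ab(1)] continuous_on_sub0[OF cA ab(1)]])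
    show "opBc S (integral {a..b} (d n)) = integral {a..b} (?u n)" by (rule op_integral(3)[OF D' continuous_on_sub0[OF cd ab(1)] continuous_on_sub0[OF cA ab(1)]])
    show "opC S (integral {a..b} (d n)) = integral {a..b} (?y n)" by (rule op_integral(4)[OF D' continuous_on_sub0[OF cd ab(1)] continuous_on_sub0[OF cA ab(1)]])
    show "opBd S (integral {a..b} (d n)) = integral {a..b} (%t. opBd S (d n t))" by (rule op_integral(5)[OF D' continuous_on_sub0[OF cd ab(1)] continuous_on_sub0[OF cA ab(1)]])
  qed
  have small: "(%n. integral {a..b} (f n)) \<longlonglongrightarrow> 0"
    if f: "!!n. continuous_on {0..} (f n)" and l: "(%n. l2n b (f n)) \<longlonglongrightarrow> 0" and ab: "0 <= a" "a <= b"
    for f :: "nat => real => 'b::chilbert_space" and a b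
    by (rule Lim_null_comparison[OF _ tendsto_mult_right_zero[OF l, of "sqrt b"]])
      (intro always_eventually allI norm_integral_le_l2n continuous_on_sub0[OF f order_refl] ab order_refl)
  have ptw: "(%n. d n t) \<longlonglongrightarrow> \<zeta> t" if "0 <= t" for t
    by (rule tendsto_uniform_limitI[OF lim[OF that]]) (use that in auto)
  have zero: "\<zeta> \<tau> = 0" if \<tau>: "0 <= \<tau>" for \<tau>
  proof -
  obtain B where B: "0 <= B" "!!n. l2n (\<tau> + 1) (?u n) <= B" by (rule l2cauchy_bounded[OF cuy(1) Lu[of "\<tau> + 1"]]) (use \<tau> that in auto)
  obtain B' where B': "0 <= B'" "!!n. l2n (\<tau> + 1) (?y n) <= B'" by (rule l2cauchy_bounded[OF cuy(2) Ly[of "\<tau> + 1"]]) (use \<tau> that in auto)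
  \<comment> \<open>\<open>e\<close> bounds the averaging errors of inputs, outputs and the limit
    state. The bounds \<open>B\<close> and \<open>B'\<close> do not depend on \<open>e\<close>, so
    letting \<open>e\<close> tend to zero gives \<open>\<zeta> \<tau> = 0\<close>.\<close>
  have main: "(norm (\<zeta> \<tau>))\<^sup>2 <= e * (8 + 4 * B + 4 * B')" if e: "0 < e" "e <= 1" for e
  proof -
    have \<tau>1: "0 <= \<tau> + 1" using \<tau> by simp
    obtain h1 N1 where h1: "0 < h1" "h1 <= 1" "!!h n. 0 < h ==> h <= h1 ==> n \<ge> N1 ==> l2n \<tau> (%t. stek h (?u n) t - ?u n t) <= e"
      by (rule l2cauchy_stek[OF cuy(1) Lu[OF \<tau>1] \<tau> e(1)]) (rule that)
    obtain h2 N2 where h2: "0 < h2" "h2 <= 1" "!!h n. 0 < h ==> h <= h2 ==> n \<ge> N2 ==> l2n \<tau> (%t. stek h (?y n) t - ?y n t) <= e"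
      by (rule l2cauchy_stek[OF cuy(2) Ly[OF \<tau>1] \<tau> e(1)]) (rule that)
    obtain h3 where h3: "0 < h3" "!!h t. 0 < h ==> h <= h3 ==> 0 <= t ==> t <= \<tau> ==> norm (stek h \<zeta> t - \<zeta> t) <= e"
      by (rule stek_close[OF c\<zeta> e(1)]) (rule that)
    \<comment> \<open>One window short enough for inputs, outputs and the limit state; it stays
      fixed while \<open>n\<close> grows.\<close>
    define h where "h = min h1 (min h2 h3)"
    have h: "0 < h" "h <= h1" "h <= h2" "h <= h3" "h <= 1" using h1 h2 h3 by (auto simp: h_def)
    have lo: "(%n. stek h (f n) t) \<longlonglongrightarrow> 0" if f: "!!n. continuous_on {0..} (f n)"
      and l: "!!b. 0 <= b ==> (%n. l2n b (f n)) \<longlonglongrightarrow> 0" and t: "0 <= t" for f :: "nat => real => 'b::chilbert_space" and t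
      unfolding stek_def using tendsto_scaleR[OF tendsto_const small[OF f l t], of "t + h" "inverse h"] h t by simp
    let ?Z = "stek h \<zeta>"
    have Z: "?Z t \<in> Dom S" "opA S (?Z t) = (\<zeta> (t + h) - \<zeta> t) /\<^sub>R h" "opBd S (?Z t) = 0"
      "(%n. stek h (?u n) t) \<longlonglongrightarrow> opBc S (?Z t)" "(%n. stek h (?y n) t) \<longlonglongrightarrow> opC S (?Z t)" if t: "0 <= t" for t
    proof -
      have th: "t <= t + h" "0 <= t + h" using h t by auto
      have Dn: "stek h (d n) t \<in> Dom S" for n unfolding stek_def by (intro Dom_simps intD t th)
      have l1: "(%n. stek h (d n) t) \<longlonglongrightarrow> ?Z t"
      proof -
        have "(%n. (integral {0..t + h} (d n) - integral {0..t} (d n)) /\<^sub>R h) \<longlonglongrightarrow> (integral {0..t + h} \<zeta> - integral {0..t} \<zeta>) /\<^sub>R h"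
          using h t by (intro tendsto_scaleR tendsto_diff tendsto_const integral_tendsto[OF cd lim[OF th(2)]]) auto
        then show ?thesis unfolding stek_eq[OF cd t h(1)] stek_eq[OF c\<zeta> t h(1)] .
      qed
      have "(%n. (d n (t + h) - d n t) /\<^sub>R h - stek h (q n) t) \<longlonglongrightarrow> (\<zeta> (t + h) - \<zeta> t) /\<^sub>R h - 0"
        by (intro tendsto_diff tendsto_scaleR tendsto_const ptw t th lo cq q)
      moreover have "opA S (stek h (d n) t) = (d n (t + h) - d n t) /\<^sub>R h - stek h (q n) t" for n
        unfolding stek_def op_scaleR[OF intD(1)[OF t th(1)]] intD(2)[OF t th(1)] by (simp add: scaleR_diff_right)
      ultimately have l2: "(%n. opA S (stek h (d n) t)) \<longlonglongrightarrow> (\<zeta> (t + h) - \<zeta> t) /\<^sub>R h" by simp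
      have st: "opBc S (stek h (d n) t) = stek h (?u n) t" "opC S (stek h (d n) t) = stek h (?y n) t"
        "opBd S (stek h (d n) t) = stek h (%t. opBd S (d n t)) t" for n
        unfolding stek_def op_scaleR[OF intD(1)[OF t th(1)]] intD(3-5)[OF t th(1)] by auto
      note ol = op_limit[OF Dn l1 l2, unfolded st]
      show "?Z t \<in> Dom S" by (rule ol(1))
      show "opA S (?Z t) = (\<zeta> (t + h) - \<zeta> t) /\<^sub>R h" by (rule ol(2))
      show "opBd S (?Z t) = 0" by (rule LIMSEQ_unique[OF ol(5) lo[OF cuy(3) bd t]])
      show "(%n. stek h (?u n) t) \<longlonglongrightarrow> opBc S (?Z t)" by (rule ol(3))
      show "(%n. stek h (?y n) t) \<longlonglongrightarrow> opC S (?Z t)" by (rule ol(4))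
    qed
    \<comment> \<open>The perturbations \<open>q n\<close> and the values of \<open>opBd\<close>
      tend to zero under the average, so \<open>?Z\<close> is a genuine undisturbed trajectory, to
      which the energy inequality applies.\<close>
    have "lsol ?Z" unfolding lsol_def
    proof (intro conjI allI impI)
      fix t :: real assume t: "0 <= t"
      show "?Z t \<in> Dom S" by (rule Z(1)[OF t])
      show "opBd S (?Z t) = 0" by (rule Z(3)[OF t])
      show "(?Z has_vector_derivative opA S (?Z t)) (at t within {0..})"
        unfolding Z(2)[OF t] by (rule stek_deriv[OF c\<zeta> h(1) t])
    next
      have "continuous_on {0..} (%t. (\<zeta> (t + h) - \<zeta> t) /\<^sub>R h)"
        by (intro continuous_intros continuous_on_shift c\<zeta>) (use h in auto)
      then show "continuous_on {0..} (%t. opA S (?Z t))" by (rule continuous_on_eq) (simp add: Z(2))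
    qed
    note en = lsol_energy[OF this \<tau>] and cZ = lsol_cont[OF this]
    have cs: "continuous_on {0..} (stek h (?u n))" "continuous_on {0..} (stek h (?y n))" for n
      by (intro continuous_on_stek cuy h)+
    have bnd: "norm (stek h (f n) t) <= (sqrt (\<tau> + 1) * C) / h"
      if f: "!!n. continuous_on {0..} (f n)" and C: "!!n. l2n (\<tau> + 1) (f n) <= C" and t: "0 <= t" "t <= \<tau>"
      for f :: "nat => real => 'u" and C t n
    proof -
      have "norm (integral {t..t+h} (f n)) <= sqrt (\<tau> + 1) * l2n (\<tau> + 1) (f n)"
        using h t by (intro norm_integral_le_l2n continuous_on_sub0[OF f]) auto
      also have "\<dots> <= sqrt (\<tau> + 1) * C" using \<tau> by (intro mult_left_mono C) auto
      finally show ?thesis unfolding stek_def using h(1) by (simp add: divide_inverse mult.commute mult_left_mono)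
    qed
    \<comment> \<open>For a fixed window the averages converge pointwise and are bounded through the
      mean-square bounds, which suffices for dominated convergence of the supplied power.\<close>
    have dc: "(%n. integral {0..\<tau>} (%t. stek h (?u n) t \<bullet> stek h (?y n) t)) \<longlonglongrightarrow> integral {0..\<tau>} (%t. opBc S (?Z t) \<bullet> opC S (?Z t))"
    proof (rule dominated_convergence(2))
      show "(%t. stek h (?u n) t \<bullet> stek h (?y n) t) integrable_on {0..\<tau>}" for n
        by (intro integrable_continuous_real continuous_intros continuous_on_sub0[OF cs(1)] continuous_on_sub0[OF cs(2)] order_refl)
      show "(%t. ((sqrt (\<tau> + 1) * B) / h) * ((sqrt (\<tau> + 1) * B') / h)) integrable_on {0..\<tau>}" by (rule integrable_const_ivl)
      show "norm (stek h (?u n) t \<bullet> stek h (?y n) t) <= ((sqrt (\<tau> + 1) * B) / h) * ((sqrt (\<tau> + 1) * B') / h)" if "t \<in> {0..\<tau>}" for n t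
        unfolding real_norm_def using that B(1) \<tau> h(1)
        by (intro order_trans[OF Cauchy_Schwarz_ineq2] mult_mono bnd[of ?u, OF cuy(1) B(2)] bnd[of ?y, OF cuy(2) B'(2)]) auto
      show "(%n. stek h (?u n) t \<bullet> stek h (?y n) t) \<longlonglongrightarrow> opBc S (?Z t) \<bullet> opC S (?Z t)" if "t \<in> {0..\<tau>}" for t
        using that by (intro tendsto_inner Z) auto
    qed
    have "integral {0..\<tau>} (%t. opBc S (?Z t) \<bullet> opC S (?Z t)) <= e + (e * B' + B * e)"
    proof (rule tendsto_upperbound[OF dc])
      show "\<forall>\<^sub>F n in sequentially. integral {0..\<tau>} (%t. stek h (?u n) t \<bullet> stek h (?y n) t) <= e + (e * B' + B * e)"
        using power[OF \<tau> e(1)] eventually_ge_at_top[of N1] eventually_ge_at_top[of N2]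
      proof eventually_elim
        case (elim n)
        have "l2n \<tau> (stek h (?y n)) <= l2n (\<tau> + h) (?y n)" by (rule l2n_stek[OF cuy(2) h(1) \<tau>])
        also have "\<dots> <= l2n (\<tau> + 1) (?y n)" by (rule l2n_mono_time[OF continuous_on_sub0[OF cuy(2)]]) (use h in auto)
        finally have y1: "l2n \<tau> (stek h (?y n)) <= B'" using B'(2)[of n] by simp
        have "l2n \<tau> (?u n) <= l2n (\<tau> + 1) (?u n)" by (rule l2n_mono_time[OF continuous_on_sub0[OF cuy(1)]]) auto
        then have u1: "l2n \<tau> (?u n) <= B" using B(2)[of n] by simp
        have "\<bar>integral {0..\<tau>} (%t. stek h (?u n) t \<bullet> stek h (?y n) t) - integral {0..\<tau>} (%t. ?u n t \<bullet> ?y n t)\<bar>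
          <= l2n \<tau> (%t. stek h (?u n) t - ?u n t) * l2n \<tau> (stek h (?y n)) + l2n \<tau> (?u n) * l2n \<tau> (%t. stek h (?y n) t - ?y n t)"
          by (intro inner_integral_diff continuous_on_sub0[OF cs(1)] continuous_on_sub0[OF cs(2)]
              continuous_on_sub0[OF cuy(1)] continuous_on_sub0[OF cuy(2)] order_refl)
        also have "\<dots> <= e * B' + B * e"
          using e B(1) by (intro add_mono mult_mono h1(3)[OF h(1,2) elim(2)] h2(3)[OF h(1,3) elim(3)] y1 u1) auto
        finally show ?case using elim(1) by linarith
      qed
    qed simp
    moreover have "p <= c + 2 * i ==> i <= w ==> p <= c + 2 * w" for p c i w :: real by linarith
    ultimately have fA: "(norm (?Z \<tau>))\<^sup>2 <= (norm (?Z 0))\<^sup>2 + 2 * (e + (e * B' + B * e))" using en by blast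
    have fB: "(norm (?Z 0))\<^sup>2 <= e"
    proof -
      have "norm (?Z 0) <= e" using h3(2)[OF h(1,4) order_refl \<tau>] \<zeta>0 by simp
      then have "(norm (?Z 0))\<^sup>2 <= e\<^sup>2" by (intro power_mono) auto
      also have "\<dots> <= e" using e by (simp add: power2_eq_square mult_left_le)
      finally show ?thesis .
    qed
    have fC: "(norm (?Z \<tau> - \<zeta> \<tau>))\<^sup>2 <= e"
    proof -
      have "(norm (?Z \<tau> - \<zeta> \<tau>))\<^sup>2 <= e\<^sup>2" using h3(2)[OF h(1,4) \<tau> order_refl] by (intro power_mono) auto
      also have "\<dots> <= e" using e by (simp add: power2_eq_square mult_left_le)
      finally show ?thesis .
    qed
    have fD: "(norm (\<zeta> \<tau>))\<^sup>2 <= 2 * (norm (?Z \<tau>))\<^sup>2 + 2 * (norm (?Z \<tau> - \<zeta> \<tau>))\<^sup>2"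
      using norm_sq_diff_le[of "?Z \<tau>" "?Z \<tau> - \<zeta> \<tau>"] by simp
    have "(norm (\<zeta> \<tau>))\<^sup>2 <= 2 * (e + 2 * (e + (e * B' + B * e))) + 2 * e"
      by (rule order_trans[OF fD add_mono[OF mult_left_mono[OF order_trans[OF fA add_right_mono[OF fB]]] mult_left_mono[OF fC]]]) simp_all
    then show ?thesis by (simp add: algebra_simps)
  qed
  from le_zero_if_le_small[OF main] show ?thesis by simp
  qed
  then show "0 <= \<tau> ==> \<zeta> \<tau> = 0" .
  assume \<tau>: "0 <= \<tau>"
  define T where "T = \<tau> + 1"
  have T: "0 <= T" using \<tau> by (simp add: T_def)
  obtain K where K: "0 < K" "!!x. x \<in> Dom S ==> norm (opC S x) <= K * (norm x + norm (opA S x))"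
    by (rule op_bound) (rule that)
  \<comment> \<open>With the limit state zero, the graph norm bound sends the primitives of the
    outputs to zero uniformly; the Cauchy property then gives strong convergence.\<close>
  have "uniform_limit {0..T} (%n t. integral {0..t} (?y n)) (%t. 0) sequentially"
  proof (rule uniform_limitI)
    fix e :: real assume e: "0 < e"
    define e' where "e' = e / (2 * (K * (T + 3)))"
    have KT: "0 < K * (T + 3)" using K T by simp
    have "P * (e / (2 * P)) = e / 2" if "0 < P" for P :: real using that by simp
    from this[OF KT] have e': "0 < e'" "K * (T + 3) * e' = e / 2" using e KT by (simp_all only: e'_def) simp
    obtain M where M: "!!n t. M <= n ==> t \<in> {0..T} ==> norm (d n t - \<zeta> t) <= e'"
      by (rule uniform_limit_norm[OF lim[OF T] e'(1)]) (rule that)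
    have "\<forall>\<^sub>F n in sequentially. sqrt T * l2n T (q n) < e'"
      using tendsto_mult_right_zero[OF q[OF T], of "sqrt T"] e'(1) by (rule order_tendstoD(2))
    then show "\<forall>\<^sub>F n in sequentially. \<forall>t\<in>{0..T}. dist (integral {0..t} (?y n)) 0 < e"
      using eventually_ge_at_top[of M]
    proof eventually_elim
      case (elim n)
      show ?case
      proof
        fix t assume t: "t \<in> {0..T}"
        have dn: "norm (d n s) <= e'" if "s \<in> {0..T}" for s using M[OF elim(2) that] zero[of s] that by simp
        have "norm (integral {0..t} (d n)) <= e' * (t - 0)"
          by (rule integral_bound[OF _ continuous_on_sub0[OF cd order_refl]]) (use t dn in auto)
        also have "\<dots> <= e' * T" using e'(1) t by (intro mult_left_mono) auto
        finally have 1: "norm (integral {0..t} (d n)) <= e' * T" .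
        have "norm (integral {0..t} (q n)) <= sqrt T * l2n T (q n)"
          using t by (intro norm_integral_le_l2n continuous_on_sub0[OF cq]) auto
        then have 2: "norm (integral {0..t} (q n)) <= e'" using elim(1) by simp
        have "norm (d n t - d n 0 - integral {0..t} (q n)) <= norm (d n t) + norm (d n 0) + norm (integral {0..t} (q n))"
          using norm_triangle_ineq4[of "d n t - d n 0" "integral {0..t} (q n)"] norm_triangle_ineq4[of "d n t" "d n 0"] by linarith
        also have "\<dots> <= 3 * e'" using dn[OF t] dn[of 0] T 2 by simp
        finally have 3: "norm (d n t - d n 0 - integral {0..t} (q n)) <= 3 * e'" .
        have t0: "0 <= t" using t by simp
        have "norm (integral {0..t} (?y n)) <= K * (norm (integral {0..t} (d n)) + norm (d n t - d n 0 - integral {0..t} (q n)))"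
          using K(2)[OF intD(1)[OF order_refl t0, of n]] unfolding intD(2,4)[OF order_refl t0] .
        also have "\<dots> <= K * (e' * T + 3 * e')" using K(1) 1 3 by (intro mult_left_mono add_mono) auto
        also have "\<dots> = e / 2" unfolding e'(2)[symmetric] by (simp add: algebra_simps)
        finally show "dist (integral {0..t} (?y n)) 0 < e" using e by simp
      qed
    qed
  qed
  then show "(%n. l2n \<tau> (%t. opC S (d n t))) \<longlonglongrightarrow> 0"
    unfolding T_def by (intro l2cauchy_weak_to_strong[OF cuy(2) Ly[of "\<tau> + 1"] \<tau>]) (use \<tau> in simp_all)
qed

lemma classicalD:
  assumes c: "classical_solution U S \<phi> \<kappa> x v w y"
  shows "0 <= t ==> x t \<in> Dom S" "0 <= t ==> opBc S (x t) = \<phi> (v t - \<kappa> *\<^sub>R y t) + fst (snd (w t))"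
    "0 <= t ==> opBd S (x t) = snd (snd (w t))" "0 <= t ==> opC S (x t) = y t"
    "0 <= t ==> (x has_vector_derivative opA S (x t) + opB1 S (fst (w t))) (at t within {0..})"
    "continuous_on {0..} v" "continuous_on {0..} y" "continuous_on {0..} w" "continuous_on {0..} (%t. opA S (x t))"
proof -
  obtain x' where x': "continuous_on {0..} x'"
    "\<forall>t\<ge>0. (x has_vector_derivative x' t) (at t within {0..}) & x' t = opA S (x t) + opB1 S (fst (w t))"
    using c unfolding classical_solution_def by blast
  show "0 <= t ==> x t \<in> Dom S" "0 <= t ==> opBc S (x t) = \<phi> (v t - \<kappa> *\<^sub>R y t) + fst (snd (w t))"
    "0 <= t ==> opBd S (x t) = snd (snd (w t))" "0 <= t ==> opC S (x t) = y t"
    using c unfolding classical_solution_def by auto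
  show "0 <= t ==> (x has_vector_derivative opA S (x t) + opB1 S (fst (w t))) (at t within {0..})" using x'(2) by metis
  show v: "continuous_on {0..} v" "continuous_on {0..} y" and w: "continuous_on {0..} w"
    using c unfolding classical_solution_def by auto
  have "continuous_on {0..} (%t. x' t - opB1 S (fst (w t)))"
    by (intro continuous_on_diff x' bounded_linear.continuous_on[OF B1_linear] continuous_on_fst w)
  then show "continuous_on {0..} (%t. opA S (x t))" by (rule continuous_on_eq) (use x'(2) in simp)
qed

end

lemma generalised_solutionD:
  assumes "generalised_solution U S \<phi> \<kappa> x v w y"
  obtains xs vs ws ys where "!!k::nat. classical_solution U S \<phi> \<kappa> (xs k) (vs k) (ws k) (ys k)"
    "!!\<tau>. \<tau> > 0 ==> uniform_limit {0..\<tau>} xs x sequentially"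
    "!!\<tau>. \<tau> > 0 ==> (%k. L2_norm {0<..<\<tau>} (%t. vs k t - v t)) \<longlonglongrightarrow> 0"
    "!!\<tau>. \<tau> > 0 ==> (%k. L2_norm {0<..<\<tau>} (%t. ws k t - w t)) \<longlonglongrightarrow> 0"
    "!!\<tau>. \<tau> > 0 ==> (%k. L2_norm {0<..<\<tau>} (%t. ys k t - y t)) \<longlonglongrightarrow> 0"
proof -
  have "\<exists>xs vs ws ys. (\<forall>k::nat. classical_solution U S \<phi> \<kappa> (xs k) (vs k) (ws k) (ys k)) &
        (\<forall>\<tau>>0. uniform_limit {0..\<tau>} xs x sequentially &
           (%k. L2_norm {0<..<\<tau>} (%t. vs k t - v t)) \<longlonglongrightarrow> 0 &
           (%k. L2_norm {0<..<\<tau>} (%t. ws k t - w t)) \<longlonglongrightarrow> 0 &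
           (%k. L2_norm {0<..<\<tau>} (%t. ys k t - y t)) \<longlonglongrightarrow> 0)"
    using assms unfolding generalised_solution_def by (elim conjE)
  then obtain xs vs ws ys where *: "!!k::nat. classical_solution U S \<phi> \<kappa> (xs k) (vs k) (ws k) (ys k)"
    "\<forall>\<tau>>0. uniform_limit {0..\<tau>} xs x sequentially &
           (%k. L2_norm {0<..<\<tau>} (%t. vs k t - v t)) \<longlonglongrightarrow> 0 &
           (%k. L2_norm {0<..<\<tau>} (%t. ws k t - w t)) \<longlonglongrightarrow> 0 &
           (%k. L2_norm {0<..<\<tau>} (%t. ys k t - y t)) \<longlonglongrightarrow> 0"
    by (elim exE conjE) (rule that, erule spec)
  show ?thesis by (rule that[of xs vs ws ys, OF *(1)]) (simp_all add: *(2))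
qed

section \<open>Uniqueness for the saturated loop\<close>

context sat_node
begin

text \<open>The approximants of the two solutions carry different inputs and disturbances, so the
  feedback of their difference is dissipative only up to terms in \<open>?g\<close> and
  \<open>?W\<close>. These vanish in the mean square and are paired with bounded outputs, so the
  supplied power is asymptotically nonpositive.\<close>

lemma generalised_solution_unique:
  assumes g1: "generalised_solution U S \<Phi> \<kappa> x v w y" and g2: "generalised_solution U S \<Phi> \<kappa> x' v w y'"
    and x0: "x 0 = x' 0"
  shows "0 <= \<tau> ==> x \<tau> = x' \<tau>" "AE t in lebesgue. t > 0 --> y t = y' t"
proof -
  obtain xs vs ws ys where 1: "!!k::nat. classical_solution U S \<Phi> \<kappa> (xs k) (vs k) (ws k) (ys k)"
    "!!\<tau>. \<tau> > 0 ==> uniform_limit {0..\<tau>} xs x sequentially"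
    "!!\<tau>. \<tau> > 0 ==> (%k. L2_norm {0<..<\<tau>} (%t. vs k t - v t)) \<longlonglongrightarrow> 0"
    "!!\<tau>. \<tau> > 0 ==> (%k. L2_norm {0<..<\<tau>} (%t. ws k t - w t)) \<longlonglongrightarrow> 0"
    "!!\<tau>. \<tau> > 0 ==> (%k. L2_norm {0<..<\<tau>} (%t. ys k t - y t)) \<longlonglongrightarrow> 0"
    by (rule generalised_solutionD[OF g1]) (rule that)
  obtain xs' vs' ws' ys' where 2: "!!k::nat. classical_solution U S \<Phi> \<kappa> (xs' k) (vs' k) (ws' k) (ys' k)"
    "!!\<tau>. \<tau> > 0 ==> uniform_limit {0..\<tau>} xs' x' sequentially"
    "!!\<tau>. \<tau> > 0 ==> (%k. L2_norm {0<..<\<tau>} (%t. vs' k t - v t)) \<longlonglongrightarrow> 0"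
    "!!\<tau>. \<tau> > 0 ==> (%k. L2_norm {0<..<\<tau>} (%t. ws' k t - w t)) \<longlonglongrightarrow> 0"
    "!!\<tau>. \<tau> > 0 ==> (%k. L2_norm {0<..<\<tau>} (%t. ys' k t - y' t)) \<longlonglongrightarrow> 0"
    by (rule generalised_solutionD[OF g2]) (rule that)
  have L2v: "L2_on {0<..<\<tau>} U v" and L2w: "L2_on {0<..<\<tau>} (dist_space U) w"
    and L2y: "L2_on {0<..<\<tau>} U y" and L2y': "L2_on {0<..<\<tau>} U y'" if "0 < \<tau>" for \<tau>
    using g1 g2 that unfolding generalised_solution_def L2_loc_def by auto
  note c1 = classicalD[OF 1(1)] and c2 = classicalD[OF 2(1)]
  have cv: "l2conv \<tau> vs v" "l2conv \<tau> vs' v" and cw: "l2conv \<tau> ws w" "l2conv \<tau> ws' w"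
    and cy: "l2conv \<tau> ys y" "l2conv \<tau> ys' y'" if "0 <= \<tau>" for \<tau>
  proof -
    have t: "0 < \<tau> + 1" "\<tau> <= \<tau> + 1" using that by auto
    show "l2conv \<tau> vs v" by (rule l2conv_mono[OF l2conv_of_L2[OF c1(6) L2v[OF t(1)] 1(3)[OF t(1)]] t(2)])
    show "l2conv \<tau> vs' v" by (rule l2conv_mono[OF l2conv_of_L2[OF c2(6) L2v[OF t(1)] 2(3)[OF t(1)]] t(2)])
    show "l2conv \<tau> ws w" by (rule l2conv_mono[OF l2conv_of_L2[OF c1(8) L2w[OF t(1)] 1(4)[OF t(1)]] t(2)])
    show "l2conv \<tau> ws' w" by (rule l2conv_mono[OF l2conv_of_L2[OF c2(8) L2w[OF t(1)] 2(4)[OF t(1)]] t(2)])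
    show "l2conv \<tau> ys y" by (rule l2conv_mono[OF l2conv_of_L2[OF c1(7) L2y[OF t(1)] 1(5)[OF t(1)]] t(2)])
    show "l2conv \<tau> ys' y'" by (rule l2conv_mono[OF l2conv_of_L2[OF c2(7) L2y'[OF t(1)] 2(5)[OF t(1)]] t(2)])
  qed
  let ?d = "%n t. xs n t - xs' n t"
  let ?q = "%n t. opB1 S (fst (ws n t)) - opB1 S (fst (ws' n t))"
  let ?g = "%n t. vs n t - vs' n t" and ?W = "%n t. ws n t - ws' n t" and ?y = "%n t. ys n t - ys' n t"
  let ?f = "%n t. \<Phi> (vs n t - \<kappa> *\<^sub>R ys n t) - \<Phi> (vs' n t - \<kappa> *\<^sub>R ys' n t)"
  have cg: "continuous_on {0..} (?g n)" and cW: "continuous_on {0..} (?W n)" and cY: "continuous_on {0..} (?y n)"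
    and cW2: "continuous_on {0..} (%t. fst (snd (?W n t)))" for n
    by (intro continuous_on_diff continuous_on_fst continuous_on_snd c1 c2)+
  have gz: "(%n. l2n \<tau> (?g n)) \<longlonglongrightarrow> 0" and Wz: "(%n. l2n \<tau> (?W n)) \<longlonglongrightarrow> 0" if "0 <= \<tau>" for \<tau>
    by (rule l2conv_null[OF c1(6) c2(6) cv[OF that]], rule l2conv_null[OF c1(8) c2(8) cw[OF that]])
  have D: "?d n t \<in> Dom S" if "0 <= t" for n t by (intro Dom_simps c1 c2 that)
  have Bc: "opBc S (?d n t) = ?f n t + fst (snd (?W n t))" and Bd: "opBd S (?d n t) = snd (snd (?W n t))"
    and C: "opC S (?d n t) = ?y n t" if "0 <= t" for n t
    unfolding op_diff[OF c1(1)[OF that] c2(1)[OF that]] c1(2-4)[OF that] c2(2-4)[OF that] by simp_all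
  have nw: "norm (fst (snd p)) <= norm p" "norm (snd (snd p)) <= norm p" "norm (fst p) <= norm p"
    for p :: "'d1 \<times> 'u \<times> 'd3"
  proof -
    have "norm (snd p) <= norm p" using norm_snd_le[of "snd p" "fst p"] by simp
    then show "norm (fst (snd p)) <= norm p" "norm (snd (snd p)) <= norm p"
      using norm_fst_le[of "fst (snd p)" "snd (snd p)"] norm_snd_le[of "snd (snd p)" "fst (snd p)"] by auto
    show "norm (fst p) <= norm p" using norm_fst_le[of "fst p" "snd p"] by simp
  qed
  have cA: "continuous_on {0..} (%t. opA S (?d n t))" for n
  proof -
    have "continuous_on {0..} (%t. opA S (xs n t) - opA S (xs' n t))" by (intro continuous_on_diff c1 c2)
    then show ?thesis by (rule continuous_on_eq) (simp add: op_diff[OF c1(1) c2(1)])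
  qed
  have cd: "continuous_on {0..} (?d n)" for n
    by (rule continuous_on_diff; rule continuous_on_of_deriv) (rule c1(5) c2(5), simp)+
  have cuy: "continuous_on {0..} (%t. opBc S (?d n t))" "continuous_on {0..} (%t. opC S (?d n t))"
    "continuous_on {0..} (%t. opBd S (?d n t))" for n
    by (rule op_continuous[OF D cd cA]; simp)+
  have cf: "continuous_on {0..} (?f n)" for n
    by (rule continuous_on_eq[OF continuous_on_diff[OF cuy(1)[of n] cW2[of n]]]) (simp add: Bc)
  have cq: "continuous_on {0..} (?q n)" for n
    by (intro continuous_on_diff bounded_linear.continuous_on[OF B1_linear] continuous_on_fst c1 c2)
  obtain KB where KB: "0 <= KB" "!!v. norm (opB1 S v) <= norm v * KB"
    using bounded_linear.nonneg_bounded[OF B1_linear] by blast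
  have qz: "(%n. l2n \<tau> (?q n)) \<longlonglongrightarrow> 0" if "0 <= \<tau>" for \<tau>
  proof (rule l2n_null_bound[OF cq cW _ KB(1) Wz[OF that]])
    fix n and t :: real
    have "?q n t = opB1 S (fst (?W n t))" by (simp add: linear_simps[OF B1_linear])
    then have "norm (?q n t) <= norm (fst (?W n t)) * KB" using KB(2) by metis
    also have "\<dots> <= norm (?W n t) * KB" by (intro mult_right_mono nw KB)
    finally show "norm (?q n t) <= KB * norm (?W n t)" by (simp only: mult.commute)
  qed
  have Bdz: "(%n. l2n \<tau> (%t. opBd S (?d n t))) \<longlonglongrightarrow> 0" if "0 <= \<tau>" for \<tau>
    by (rule l2n_null_bound[OF cuy(3) cW _ _ Wz[OF that], where K = 1]) (simp_all only: Bd nw mult_1 zero_le_one)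
  have W2z: "(%n. l2n \<tau> (%t. fst (snd (?W n t)))) \<longlonglongrightarrow> 0" if "0 <= \<tau>" for \<tau>
    by (rule l2n_null_bound[OF cW2 cW _ _ Wz[OF that], where K = 1]) (simp_all only: nw mult_1 zero_le_one)
  have lim: "uniform_limit {0..\<tau>} ?d (%t. x t - x' t) sequentially" if "0 <= \<tau>" for \<tau>
  proof -
    have t: "0 < \<tau> + 1" using that by simp
    have "uniform_limit {0..\<tau>+1} ?d (%t. x t - x' t) sequentially"
      by (intro uniform_limit_intros 1(2)[OF t] 2(2)[OF t])
    then show ?thesis by (rule uniform_limit_on_subset) simp
  qed
  have Ly: "l2cauchy \<tau> (%n t. opC S (?d n t))" if t: "0 <= \<tau>" for \<tau>
  proof (rule l2cauchy_dominated[OF cuy(2) c1(7) c1(7) c2(7) _ order_refl l2conv_cauchy[OF c1(7) cy(1)[OF t]]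
          l2conv_cauchy[OF c1(7) cy(1)[OF t]] l2conv_cauchy[OF c2(7) cy(2)[OF t]]])
    fix m n and t :: real assume t: "0 <= t"
    have "?y m t - ?y n t = (ys m t - ys n t) - (ys' m t - ys' n t)" by simp
    then show "norm (opC S (?d m t) - opC S (?d n t)) <= norm (ys m t - ys n t) + 0 * norm (ys m t - ys n t) + norm (ys' m t - ys' n t)"
      unfolding C[OF t] by (simp only: norm_triangle_ineq4 mult_zero_left add_0_right)
  qed
  have cB: "continuous_on {0..} (%t. opBc S (z n t))" "l2cauchy \<tau> (%n t. opBc S (z n t))"
    if cl: "!!k::nat. classical_solution U S \<Phi> \<kappa> (z k) (vz k) (wz k) (yz k)" and t: "0 <= \<tau>"
      and l: "l2conv \<tau> vz v" "l2conv \<tau> wz w" "l2conv \<tau> yz y0" for z vz wz yz y0 \<tau> n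
  proof -
    note c = classicalD[OF cl]
    have cz: "continuous_on {0..} (z n)" for n by (rule continuous_on_of_deriv[OF c(5)]) simp
    have cz': "continuous_on {0..} (%t. opBc S (z n t))" for n by (rule op_continuous[OF c(1) cz c(9)]) simp
    then show "continuous_on {0..} (%t. opBc S (z n t))" .
    show "l2cauchy \<tau> (%n t. opBc S (z n t))"
    proof (rule l2cauchy_dominated[OF cz' c(6) c(7) c(8) _ \<kappa> l2conv_cauchy[OF c(6) l(1)]
          l2conv_cauchy[OF c(7) l(3)] l2conv_cauchy[OF c(8) l(2)]])
      fix m n and t :: real assume t: "0 <= t"
      let ?a = "vz m t - \<kappa> *\<^sub>R yz m t" and ?b = "vz n t - \<kappa> *\<^sub>R yz n t"
      have "opBc S (z m t) - opBc S (z n t) = (\<Phi> ?a - \<Phi> ?b) + fst (snd (wz m t - wz n t))"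
        by (simp add: c(2)[OF t])
      then have "norm (opBc S (z m t) - opBc S (z n t)) <= norm (\<Phi> ?a - \<Phi> ?b) + norm (fst (snd (wz m t - wz n t)))"
        by (simp only: norm_triangle_ineq)
      also have "\<dots> <= norm (?a - ?b) + norm (wz m t - wz n t)" by (intro add_mono \<Phi>_lip nw)
      also have "?a - ?b = (vz m t - vz n t) - \<kappa> *\<^sub>R (yz m t - yz n t)" by (simp add: scaleR_diff_right)
      also have "norm \<dots> <= norm (vz m t - vz n t) + \<kappa> * norm (yz m t - yz n t)"
        using norm_triangle_ineq4[of "vz m t - vz n t" "\<kappa> *\<^sub>R (yz m t - yz n t)"] \<kappa> by simp
      finally show "norm (opBc S (z m t) - opBc S (z n t))
        <= norm (vz m t - vz n t) + \<kappa> * norm (yz m t - yz n t) + norm (wz m t - wz n t)" by simp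
    qed
  qed
  have Lu: "l2cauchy \<tau> (%n t. opBc S (?d n t))" if t: "0 <= \<tau>" for \<tau>
  proof -
    note b1 = cB[OF 1(1) t cv(1)[OF t] cw(1)[OF t] cy(1)[OF t]]
      and b2 = cB[OF 2(1) t cv(2)[OF t] cw(2)[OF t] cy(2)[OF t]]
    show ?thesis
    proof (rule l2cauchy_dominated[OF cuy(1) b1(1) b1(1) b2(1) _ order_refl b1(2) b1(2) b2(2)])
      fix m n and t :: real assume t: "0 <= t"
      have "opBc S (?d m t) - opBc S (?d n t) = (opBc S (xs m t) - opBc S (xs n t)) - (opBc S (xs' m t) - opBc S (xs' n t))"
        unfolding op_diff[OF c1(1)[OF t] c2(1)[OF t]] by simp
      then show "norm (opBc S (?d m t) - opBc S (?d n t)) <= norm (opBc S (xs m t) - opBc S (xs n t))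
        + 0 * norm (opBc S (xs m t) - opBc S (xs n t)) + norm (opBc S (xs' m t) - opBc S (xs' n t))"
        by (simp only: norm_triangle_ineq4 mult_zero_left add_0_right)
    qed
  qed
  \<comment> \<open>For positive \<open>\<kappa>\<close> completing the square after firm
    nonexpansiveness gives the factor \<open>1 / (4 * \<kappa>)\<close>. For
    \<open>\<kappa> = 0\<close> division by zero makes \<open>c = 0\<close>, and nonexpansiveness of
    \<open>\<Phi>\<close> yields the other summand of the bound.\<close>
  define c where "c = 1 / (4 * \<kappa>)"
  have c0: "0 <= c" using \<kappa> by (simp add: c_def)
  have pw: "?f n t \<bullet> ?y n t <= norm (?g n t) * norm (?y n t) + c * (norm (?g n t))\<^sup>2" for n t
  proof (cases "\<kappa> = 0")
    case True
    have "?f n t \<bullet> ?y n t <= norm (?f n t) * norm (?y n t)" by (rule norm_cauchy_schwarz)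
    also have "\<dots> <= norm (?g n t) * norm (?y n t)" using \<Phi>_lip True by (intro mult_right_mono) auto
    finally show ?thesis using True by (simp add: c_def)
  next
    case False
    then have \<kappa>p: "0 < \<kappa>" using \<kappa> by simp
    have "(norm (?f n t))\<^sup>2 <= ?f n t \<bullet> (?g n t - \<kappa> *\<^sub>R ?y n t)"
      using \<Phi>_firm[of "vs n t - \<kappa> *\<^sub>R ys n t" "vs' n t - \<kappa> *\<^sub>R ys' n t"] by (simp add: algebra_simps)
    also have "\<dots> = ?f n t \<bullet> ?g n t - \<kappa> * (?f n t \<bullet> ?y n t)" by (simp only: inner_diff_right inner_scaleR_right)
    finally have "\<kappa> * (?f n t \<bullet> ?y n t) <= ?f n t \<bullet> ?g n t - (norm (?f n t))\<^sup>2" by linarith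
    also have "\<dots> <= norm (?f n t) * norm (?g n t) - (norm (?f n t))\<^sup>2" using norm_cauchy_schwarz[of "?f n t" "?g n t"] by simp
    also have "\<dots> <= (norm (?g n t))\<^sup>2 / 4"
    proof -
      have "a * b - a\<^sup>2 <= b\<^sup>2 / 4" for a b :: real
        using zero_le_power2[of "a - b / 2"] by (simp add: power2_eq_square algebra_simps)
      then show ?thesis .
    qed
    finally have "?f n t \<bullet> ?y n t <= c * (norm (?g n t))\<^sup>2" using \<kappa>p by (simp add: c_def field_simps)
    moreover have "0 <= norm (?g n t) * norm (?y n t)" by simp
    ultimately show ?thesis by linarith
  qed
  have power: "\<forall>\<^sub>F n in sequentially. integral {0..\<tau>} (%t. opBc S (?d n t) \<bullet> opC S (?d n t)) <= e"
    if t: "0 <= \<tau>" and e: "0 < e" for \<tau> e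
  proof -
    obtain B where B: "0 <= B" "!!n. l2n \<tau> (%t. opC S (?d n t)) <= B" by (rule l2cauchy_bounded[OF cuy(2) Ly[OF t]]) (rule that)
    have yB: "l2n \<tau> (?y n) <= B" for n using B(2)[of n] l2n_cong[of \<tau> "%t. opC S (?d n t)" "?y n"] C by simp
    have "(%n. B * l2n \<tau> (?g n) + c * (l2n \<tau> (?g n))\<^sup>2 + B * l2n \<tau> (%t. fst (snd (?W n t)))) \<longlonglongrightarrow> B * 0 + c * 0\<^sup>2 + B * 0"
      by (intro tendsto_add tendsto_mult tendsto_power tendsto_const gz[OF t] W2z[OF t])
    then have "\<forall>\<^sub>F n in sequentially. B * l2n \<tau> (?g n) + c * (l2n \<tau> (?g n))\<^sup>2 + B * l2n \<tau> (%t. fst (snd (?W n t))) < e"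
      by (rule order_tendstoD(2)) (use e in simp)
    then show ?thesis
    proof eventually_elim
      case (elim n)
      note s = continuous_on_sub0[OF _ order_refl, of _ \<tau>]
      let ?n1 = "%t. norm (?g n t) * norm (?y n t)" and ?n2 = "%t. c * (norm (?g n t))\<^sup>2"
        and ?n3 = "%t. norm (fst (snd (?W n t))) * norm (?y n t)"
      have ct: "continuous_on {0..\<tau>} ?n1" "continuous_on {0..\<tau>} ?n2" "continuous_on {0..\<tau>} ?n3"
        by (rule continuous_on_mult continuous_on_power continuous_on_norm continuous_on_const s[OF cg] s[OF cY] s[OF cW2])+
      have "integral {0..\<tau>} (%t. opBc S (?d n t) \<bullet> opC S (?d n t)) <= integral {0..\<tau>} (%t. ?n1 t + ?n2 t + ?n3 t)"
      proof (rule integral_le)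
        show "(%t. opBc S (?d n t) \<bullet> opC S (?d n t)) integrable_on {0..\<tau>}"
          by (rule integrable_continuous_real) (rule continuous_on_inner[OF s[OF cuy(1)] s[OF cuy(2)]])
        show "(%t. ?n1 t + ?n2 t + ?n3 t) integrable_on {0..\<tau>}"
          by (rule integrable_continuous_real) (intro continuous_on_add ct)
        show "opBc S (?d n t) \<bullet> opC S (?d n t) <= ?n1 t + ?n2 t + ?n3 t" if "t \<in> {0..\<tau>}" for t
        proof -
          have t0: "0 <= t" using that by simp
          have "opBc S (?d n t) \<bullet> opC S (?d n t) = ?f n t \<bullet> ?y n t + fst (snd (?W n t)) \<bullet> ?y n t"
            unfolding Bc[OF t0] C[OF t0] by (simp only: inner_add_left)
          also have "\<dots> <= (?n1 t + ?n2 t) + ?n3 t" by (intro add_mono pw norm_cauchy_schwarz)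
          finally show ?thesis .
        qed
      qed
      also have "\<dots> = integral {0..\<tau>} ?n1 + integral {0..\<tau>} ?n2 + integral {0..\<tau>} ?n3"
        by (subst Henstock_Kurzweil_Integration.integral_add[OF integrable_continuous_real integrable_continuous_real])
          (intro continuous_on_add ct, intro ct,
           subst Henstock_Kurzweil_Integration.integral_add[OF integrable_continuous_real integrable_continuous_real],
           intro ct, intro ct, rule refl)
      also have "integral {0..\<tau>} ?n2 = c * (l2n \<tau> (?g n))\<^sup>2" by (simp add: l2n_sq[OF s[OF cg]])
      also have "integral {0..\<tau>} ?n1 <= l2n \<tau> (?g n) * l2n \<tau> (?y n)" by (rule l2n_norm_mult[OF s[OF cg] s[OF cY]])
      also have "\<dots> <= l2n \<tau> (?g n) * B" by (intro mult_left_mono yB l2n_nonneg)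
      also have "integral {0..\<tau>} ?n3 <= l2n \<tau> (%t. fst (snd (?W n t))) * l2n \<tau> (?y n)" by (rule l2n_norm_mult[OF s[OF cW2] s[OF cY]])
      also have "\<dots> <= l2n \<tau> (%t. fst (snd (?W n t))) * B" by (intro mult_left_mono yB l2n_nonneg)
      finally show ?case using elim by (simp add: mult.commute)
    qed
  qed
  have deriv: "(?d n has_vector_derivative opA S (?d n t) + ?q n t) (at t within {0..})" if t: "0 <= t" for n t
    using has_vector_derivative_diff[OF c1(5)[OF t, of n] c2(5)[OF t, of n]]
    unfolding op_diff[OF c1(1)[OF t] c2(1)[OF t]] by (simp add: algebra_simps)
  have z0: "x 0 - x' 0 = 0" using x0 by simp
  have mn1: "x \<tau> - x' \<tau> = 0" if "0 <= \<tau>" for \<tau>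
    by (rule mild_null(1)[where d = ?d and q = ?q and \<zeta> = "%t. x t - x' t", OF D deriv cA cq qz Bdz lim z0 Lu Ly power that])
  have mn2: "(%n. l2n \<tau> (%t. opC S (?d n t))) \<longlonglongrightarrow> 0" if "0 <= \<tau>" for \<tau>
    by (rule mild_null(2)[where d = ?d and q = ?q and \<zeta> = "%t. x t - x' t", OF D deriv cA cq qz Bdz lim z0 Lu Ly power that])
  show "x \<tau> = x' \<tau>" if "0 <= \<tau>" using mn1[OF that] by simp
  have "AE t in lebesgue. t \<in> {0..real (Suc k)} --> y t = y' t" for k
  proof -
    have k: "0 < real (Suc k)" "0 <= real (Suc k)" by auto
    have m: "y measurable_on {0<..<real (Suc k)}" "y' measurable_on {0<..<real (Suc k)}"
      "set_integrable lebesgue {0<..<real (Suc k)} (%t. (norm (y t))\<^sup>2)" "set_integrable lebesgue {0<..<real (Suc k)} (%t. (norm (y' t))\<^sup>2)"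
      using L2y[OF k(1)] L2y'[OF k(1)] by (auto simp: L2_on_def)
    have "(%n. l2n (real (Suc k)) (?y n)) \<longlonglongrightarrow> 0"
    proof -
      have "l2n (real (Suc k)) (%t. opC S (?d n t)) = l2n (real (Suc k)) (?y n)" for n by (rule l2n_cong) (rule C)
      then show ?thesis using mn2[OF k(2)] by simp
    qed
    moreover have "set_integrable lebesgue {0..real (Suc k)} (%t. (norm (y t - y' t))\<^sup>2)"
      using set_integrable_sq_diff[OF m(1,3,2,4)] lint_open_closed(2) by blast
    ultimately show ?thesis
      by (intro l2conv_unique[OF c1(7) c2(7) cy(1)[OF k(2)] cy(2)[OF k(2)] _ m(2)])
  qed
  then have "AE t in lebesgue. \<forall>k. t \<in> {0..real (Suc k)} --> y t = y' t" unfolding AE_all_countable by (rule allI)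
  then show "AE t in lebesgue. t > 0 --> y t = y' t"
  proof eventually_elim
    case (elim t)
    show ?case
    proof
      assume "t > 0"
      moreover obtain k where "t <= real k" using real_arch_simple by blast
      ultimately show "y t = y' t" using elim[rule_format, of k] by simp
    qed
  qed
qed

end

section \<open>Existence and tracking\<close>

text \<open>The function switches from the square to the identity at one, and its slope never
  exceeds two, the slope of the square at the switch.\<close>

lemma min_sq_lipschitz:
  fixes a b :: real
  assumes "0 <= a" "0 <= b"
  shows "min b (b\<^sup>2) <= min a (a\<^sup>2) + 2 * \<bar>a - b\<bar>"
proof (cases "b <= a")
  case True
  then have "min b (b\<^sup>2) <= min a (a\<^sup>2)" using assms by (intro min.mono power_mono) auto
  then show ?thesis by (rule order_trans) simp
next
  case False
  then have ab: "a < b" by simp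
  have sq: "d\<^sup>2 - a\<^sup>2 <= 2 * d - 2 * a" if "a <= d" "d <= 1" for d
  proof -
    have "d\<^sup>2 - a\<^sup>2 = (d - a) * (d + a)" by (simp add: power2_eq_square algebra_simps)
    also have "\<dots> <= (d - a) * 2" using that by (intro mult_left_mono) auto
    finally show ?thesis by simp
  qed
  show ?thesis
  proof (cases "1 <= a")
    case True
    then have "min a (a\<^sup>2) = a" by (simp add: power2_eq_square min_def)
    then show ?thesis using ab by simp
  next
    case a: False
    have "a\<^sup>2 <= a * 1" unfolding power2_eq_square using a assms by (intro mult_left_mono) auto
    then have m: "min a (a\<^sup>2) = a\<^sup>2" by simp
    show ?thesis
    proof (cases "b <= 1")
      case True
      have "b\<^sup>2 <= a\<^sup>2 + 2 * \<bar>a - b\<bar>" using sq[OF less_imp_le[OF ab] True] ab by simp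
      then show ?thesis unfolding m by (rule order_trans[OF min.cobounded2])
    next
      case False
      have abs: "\<bar>a - b\<bar> = b - a" using ab by simp
      have "1 - a\<^sup>2 <= 2 - 2 * a" using sq[of 1] a by simp
      then have "b <= a\<^sup>2 + 2 * \<bar>a - b\<bar>" using False unfolding abs right_diff_distrib by linarith
      then show ?thesis unfolding m by (rule order_trans[OF min.cobounded1])
    qed
  qed
qed

text \<open>Monotone convergence along the horizons \<open>{0..real k}\<close>.\<close>

lemma set_integrable_half_line:
  fixes g :: "real => real"
  assumes g: "!!t. 0 <= g t" and si: "!!k::nat. set_integrable lebesgue {0..real k} g"
    and le: "!!k::nat. (LINT t:{0..real k}|lebesgue. g t) <= C"
  shows "set_integrable lebesgue {0..} g"
proof -
  let ?f = "%(k::nat) t. indicator {0..real k} t *\<^sub>R g t"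
  have i: "integrable lebesgue (?f k)" for k using si by (simp add: set_integrable_def)
  have mono: "?f k t <= ?f l t" if "k <= l" for k l t using that g[of t] by (auto simp: indicator_def)
  have lim: "(%k. ?f k t) \<longlonglongrightarrow> indicator {0..} t *\<^sub>R g t" for t
  proof (rule tendsto_eventually)
    obtain N where N: "t <= real N" using real_arch_simple by blast
    show "\<forall>\<^sub>F k in sequentially. ?f k t = indicator {0..} t *\<^sub>R g t"
      using eventually_ge_at_top[of N]
    proof eventually_elim
      case (elim k)
      then have "t <= real k" using N by (meson of_nat_le_iff order_trans)
      then show ?case by (simp add: indicator_def)
    qed
  qed
  have "incseq (%k. integral\<^sup>L lebesgue (?f k))" by (intro incseq_SucI integral_mono i mono) simp
  moreover have "integral\<^sup>L lebesgue (?f k) <= C" for k using le[of k] by (simp add: set_lebesgue_integral_def)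
  ultimately obtain L where L: "(%k. integral\<^sup>L lebesgue (?f k)) \<longlonglongrightarrow> L"
    using incseq_convergent[of "%k. integral\<^sup>L lebesgue (?f k)" C] by blast
  have "integrable lebesgue (%t. indicator {0..} t *\<^sub>R g t)"
  proof (rule integrable_monotone_convergence[OF i _ _ L])
    show "AE t in lebesgue. mono (%k. ?f k t)" by (intro AE_I2 monoI mono)
    show "AE t in lebesgue. (%k. ?f k t) \<longlonglongrightarrow> indicator {0..} t *\<^sub>R g t" by (intro AE_I2 lim)
    show "(%t. indicator {0..} t *\<^sub>R g t) \<in> borel_measurable lebesgue"
      by (rule borel_measurable_LIMSEQ_real[OF lim]) (use i in \<open>auto simp: integrable_iff_bounded\<close>)
  qed
  then show ?thesis by (simp add: set_integrable_def)
qed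

lemma classical_solution_cong:
  assumes "classical_solution U S \<phi> \<kappa> x v w y" and x: "!!t. 0 <= t ==> x' t = x t" and w: "!!t. 0 <= t ==> w' t = w t"
  shows "classical_solution U S \<phi> \<kappa> x' v w' y"
proof -
  obtain d where d: "continuous_on {0..} d"
    "!!t. 0 <= t ==> (x has_vector_derivative d t) (at t within {0..})" "!!t. 0 <= t ==> d t = opA S (x t) + opB1 S (fst (w t))"
    using assms(1) unfolding classical_solution_def by blast
  have 1: "(x' has_vector_derivative d t) (at t within {0..})" if "0 <= t" for t
    by (rule has_vector_derivative_transform[OF _ _ d(2)[OF that]]) (use that x in auto)
  have "continuous_on {0..} w" using assms(1) unfolding classical_solution_def by blast
  then have 2: "continuous_on {0..} w'" by (rule continuous_on_eq) (simp add: w)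
  have 3: "continuous_on {0..} v" "continuous_on {0..} y"
    and 4: "\<forall>t\<ge>0. v t \<in> U & y t \<in> U & w t \<in> dist_space U & x t \<in> Dom S &
        opBc S (x t) = \<phi> (v t - \<kappa> *\<^sub>R y t) + fst (snd (w t)) & opBd S (x t) = snd (snd (w t)) & y t = opC S (x t)"
    using assms(1) unfolding classical_solution_def by blast+
  show ?thesis unfolding classical_solution_def
  proof (intro conjI exI[of _ d])
    show "\<forall>t\<ge>0. (x' has_vector_derivative d t) (at t within {0..}) & d t = opA S (x' t) + opB1 S (fst (w' t))"
      using 1 d(3) by (metis x w)
    show "\<forall>t\<ge>0. v t \<in> U & y t \<in> U & w' t \<in> dist_space U & x' t \<in> Dom S &
        opBc S (x' t) = \<phi> (v t - \<kappa> *\<^sub>R y t) + fst (snd (w' t)) & opBd S (x' t) = snd (snd (w' t)) & y t = opC S (x' t)"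
    proof (intro allI impI)
      fix t :: real assume t: "0 <= t"
      show "v t \<in> U & y t \<in> U & w' t \<in> dist_space U & x' t \<in> Dom S &
        opBc S (x' t) = \<phi> (v t - \<kappa> *\<^sub>R y t) + fst (snd (w' t)) & opBd S (x' t) = snd (snd (w' t)) & y t = opC S (x' t)"
        unfolding x[OF t] w[OF t] by (rule 4[rule_format, OF t])
    qed
  qed (rule d(1) 2 3)+
qed

lemma generalised_of_classical:
  assumes c: "classical_solution U S \<phi> \<kappa> x v w y" and x: "continuous_on {0..} x"
  shows "generalised_solution U S \<phi> \<kappa> x v w y"
proof -
  have z: "L2_norm A (%t. 0) = 0" for A unfolding L2_norm_def set_lebesgue_integral_def by simp
  have cont: "continuous_on {0..} v" "continuous_on {0..} y" "continuous_on {0..} w"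
    using c unfolding classical_solution_def by auto
  have vals: "v t \<in> U" "y t \<in> U" "w t \<in> dist_space U" if "0 <= t" for t
    using c that unfolding classical_solution_def by auto
  have "L2_loc U v" "L2_loc U y" "L2_loc (dist_space U) w"
    unfolding L2_loc_def by (intro allI impI L2_on_cont cont vals; assumption)+
  moreover have "\<forall>\<tau>>0. uniform_limit {0..\<tau>} (%k::nat. x) x sequentially" by (simp add: uniform_limit_const)
  ultimately show ?thesis unfolding generalised_solution_def
    by (intro conjI x exI[of _ "%_. x"] exI[of _ "%_. v"] exI[of _ "%_. w"] exI[of _ "%_. y"]) (simp_all add: c z)
qed

lemma tendsto_0_inverse_Suc: "(%n. c * (1 / (real n + 1))) \<longlonglongrightarrow> 0"
  using tendsto_mult_right_zero[OF LIMSEQ_inverse_real_of_nat, of c] by (simp add: inverse_eq_divide add.commute)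

section \<open>Existence around a regulated trajectory\<close>

context sat_node
begin

lemma lsol_energy_resid:
  assumes z: "lsol z" and t: "0 <= t"
  shows "(norm (z t))\<^sup>2 <= (norm (z 0))\<^sup>2 + 2 * (l2n t (resid z) * l2n t (%s. opC S (z s)))
    + 2 * integral {0..t} (%s. N s (opC S (z s)) \<bullet> opC S (z s))"
proof -
  note s = continuous_on_sub0[OF _ order_refl, of _ t]
  note ct = s[OF resid_cont[OF z]] s[OF lsol_cont(4)[OF z]] s[OF N_cont[OF lsol_cont(4)[OF z]]]
  have "integral {0..t} (%s. opBc S (z s) \<bullet> opC S (z s))
    = integral {0..t} (%s. resid z s \<bullet> opC S (z s) + N s (opC S (z s)) \<bullet> opC S (z s))"
    by (simp add: resid_def inner_diff_left)
  also have "\<dots> = integral {0..t} (%s. resid z s \<bullet> opC S (z s)) + integral {0..t} (%s. N s (opC S (z s)) \<bullet> opC S (z s))"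
    by (rule Henstock_Kurzweil_Integration.integral_add; rule integrable_continuous_real) (intro continuous_on_inner ct)+
  finally have eq: "integral {0..t} (%s. opBc S (z s) \<bullet> opC S (z s)) = \<dots>" .
  have "integral {0..t} (%s. resid z s \<bullet> opC S (z s)) <= l2n t (resid z) * l2n t (%s. opC S (z s))"
    using l2n_inner[OF ct(1,2)] by simp
  moreover have "p <= c + (2 * i + 2 * j) ==> i <= w ==> p <= c + 2 * w + 2 * j" for p c i j w :: real by linarith
  ultimately show ?thesis using lsol_energy[OF z t] unfolding eq distrib_left by blast
qed

end

text \<open>What is kept of the regulator equations: a trajectory \<open>xr\<close> that produces
  \<open>y_ref\<close> under the input \<open>ur\<close> and the disturbance \<open>w_d\<close>. The
  trigonometric form of the signals is no longer visible.\<close>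

locale regulated = sat_node U S \<Phi> Q \<kappa> R L ur
  for U :: "'u::chilbert_space set"
    and S :: "('x::chilbert_space, 'u, 'd1::chilbert_space, 'd3::chilbert_space) bcs" and \<Phi> Q \<kappa> R L ur +
  fixes xr :: "real => 'x" and y_ref :: "real => 'u" and w_d :: "real => 'd1 \<times> 'u \<times> 'd3"
  assumes xr_Dom: "xr t \<in> Dom S"
    and xr_deriv: "(xr has_vector_derivative (opA S (xr t) + opB1 S (fst (w_d t)))) (at t)"
    and xr_cont: "continuous_on UNIV (%t. opA S (xr t) + opB1 S (fst (w_d t)))"
    and xr_Bc: "opBc S (xr t) = ur t + fst (snd (w_d t))" and xr_Bd: "opBd S (xr t) = snd (snd (w_d t))"
    and xr_C: "opC S (xr t) = y_ref t"
    and y_ref_cont: "continuous_on UNIV y_ref" and w_d_cont: "continuous_on UNIV w_d" and w_d_in: "w_d t \<in> dist_space U"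
begin

lemma y_ref_U: "y_ref t \<in> U" using op_U(2)[OF xr_Dom] unfolding xr_C .

lemma xr_continuous: "continuous_on {0..} xr"
  by (rule continuous_on_of_deriv[OF has_vector_derivative_at_within[OF xr_deriv]])

lemma resid_U: "lsol z ==> 0 <= t ==> resid z t \<in> U"
  unfolding resid_def by (intro subspace_diff[OF U_subspace] N_U lsolD)

text \<open>Superposition, with the residual of \<open>z\<close> booked as a perturbation of the
  boundary disturbance. This makes trajectories with small residual admissible approximants of a
  generalised solution.\<close>

lemma classical_of_lsol:
  assumes z: "lsol z"
  shows "classical_solution U S \<Phi> \<kappa> (%t. xr t + z t) (%t. ur t + \<kappa> *\<^sub>R y_ref t)
    (%t. w_d t + (0, resid z t, 0)) (%t. y_ref t + opC S (z t))"
proof -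
  let ?x' = "%t. (opA S (xr t) + opB1 S (fst (w_d t))) + opA S (z t)"
  have 1: "continuous_on {0..} ?x'"
    by (intro continuous_on_add continuous_on_subset[OF xr_cont] lsol_cont(2)[OF z]) auto
  have 2: "((%t. xr t + z t) has_vector_derivative ?x' t) (at t within {0..})" if "0 <= t" for t
    by (rule has_vector_derivative_add[OF has_vector_derivative_at_within[OF xr_deriv] lsolD(3)[OF z that]])
  have op: "opA S (xr t + z t) = opA S (xr t) + opA S (z t)" "opBc S (xr t + z t) = ur t + fst (snd (w_d t)) + opBc S (z t)"
    "opBd S (xr t + z t) = snd (snd (w_d t))" "opC S (xr t + z t) = y_ref t + opC S (z t)" "xr t + z t \<in> Dom S" if "0 <= t" for t
    using op_add[OF xr_Dom lsolD(1)[OF z that]] lsolD(1,2)[OF z that]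
    by (auto simp: xr_Bc xr_Bd xr_C intro: Dom_simps xr_Dom)
  have 3: "continuous_on {0..} (%t. ur t + \<kappa> *\<^sub>R y_ref t)" "continuous_on {0..} (%t. y_ref t + opC S (z t))"
    "continuous_on {0..} (%t. w_d t + (0, resid z t, 0))"
    by (intro continuous_on_add ur_cont continuous_on_scaleR continuous_on_const continuous_on_subset[OF y_ref_cont]
        continuous_on_subset[OF w_d_cont] continuous_on_Pair resid_cont[OF z] lsol_cont(4)[OF z] subset_UNIV)+
  have 4: "ur t + \<kappa> *\<^sub>R y_ref t \<in> U" "y_ref t + opC S (z t) \<in> U" if "0 <= t" for t
    using that by (auto intro!: subspace_add[OF U_subspace] subspace_scale[OF U_subspace] ur_U y_ref_U lsolD(5)[OF z])
  have 5: "w_d t + (0, resid z t, 0) \<in> dist_space U" if "0 <= t" for t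
    using w_d_in[of t] resid_U[OF z that] by (auto simp: dist_space_def intro: subspace_add[OF U_subspace])
  have 6: "opBc S (xr t + z t) = \<Phi> (ur t + \<kappa> *\<^sub>R y_ref t - \<kappa> *\<^sub>R (y_ref t + opC S (z t))) + fst (snd (w_d t + (0, resid z t, 0)))"
    if "0 <= t" for t
    unfolding op(2)[OF that] by (simp add: resid_def N_def scaleR_add_right algebra_simps)
  show ?thesis unfolding classical_solution_def
    by (intro conjI exI[of _ ?x'] allI impI 1 2 3 4 5 6 op(4)[symmetric] op(5)) (simp_all add: op)
qed

text \<open>The initial error is approximated from \<open>ker_B\<close>, dense as the domain of a
  generator. Membership in \<open>ker_B\<close> is recorded for the later comparison with semigroup
  orbits.\<close>

lemma generalised_exists:
  obtains zs z e where "!!n. lsol (zs n)" "!!n. zs n 0 \<in> ker_B S"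
    "!!n \<tau>. \<tau> <= real n ==> l2n \<tau> (resid (zs n)) <= 1 / (real n + 1)"
    "!!\<tau>. 0 <= \<tau> ==> uniform_limit {0..\<tau>} zs z sequentially" "z 0 = x0 - xr 0"
    "e measurable_on {0..}" "!!t. e t \<in> U" "!!\<tau>. set_integrable lebesgue {0..\<tau>} (%t. (norm (e t))\<^sup>2)"
    "!!\<tau>. l2conv \<tau> (%n t. opC S (zs n t)) e"
    "generalised_solution U S \<Phi> \<kappa> (%t. xr t + z t) (%t. ur t + \<kappa> *\<^sub>R y_ref t) w_d (%t. y_ref t + e t)"
proof -
  have "x0 - xr 0 \<in> closure (ker_B S)" by (simp add: sg.D_dense)
  then obtain z0 where z0: "!!n. z0 n \<in> ker_B S" "z0 \<longlonglongrightarrow> x0 - xr 0" unfolding closure_sequential by blast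
  have D: "z0 n \<in> Dom S" "opBd S (z0 n) = 0" for n using z0(1)[of n] by (auto simp: ker_B_def)
  obtain zs z where zs: "!!n. lsol (zs n)" "!!n. zs n 0 = z0 n"
    "!!n \<tau>. \<tau> <= real n ==> l2n \<tau> (resid (zs n)) <= 1 / (real n + 1)"
    "!!\<tau>. 0 <= \<tau> ==> uniform_limit {0..\<tau>} zs z sequentially"
    "!!\<tau>. 0 <= \<tau> ==> l2cauchy \<tau> (%n t. opBc S (zs n t))"
    "!!\<tau>. 0 <= \<tau> ==> l2cauchy \<tau> (%n t. opC S (zs n t))"
    by (rule generalised_limit[OF D z0(2)]) (rule that)
  have "(%n. zs n 0) \<longlonglongrightarrow> z 0" by (rule tendsto_uniform_limitI[OF zs(4)[OF order_refl]]) simp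
  then have z0': "z 0 = x0 - xr 0" unfolding zs(2) by (rule LIMSEQ_unique[OF _ z0(2)])
  have cC: "continuous_on {0..} (%t. opC S (zs n t))" for n by (rule lsol_cont(4)[OF zs(1)])
  have H3: "\<exists>d>0. \<forall>k. real k + d <= t" if "!!k. real k < t" for t :: real
    using that reals_Archimedean2[of t] less_asym by blast
  obtain e where e: "e measurable_on (\<Union>k. {0..real k})" "!!t. e t \<in> U"
    "!!k. set_integrable lebesgue {0..real k} (%t. (norm (e t))\<^sup>2)"
    "!!k n. set_integrable lebesgue {0..real k} (%t. (norm (opC S (zs n t) - e t))\<^sup>2)"
    "!!k. (%n. LINT t:{0..real k}|lebesgue. (norm (opC S (zs n t) - e t))\<^sup>2) \<longlonglongrightarrow> 0"
  proof (rule l2_limit[of "%n t. opC S (zs n t)" U real])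
    show "continuous_on {0..} (%t. opC S (zs n t))" for n by (rule cC)
    show "0 \<in> U" by (rule subspace_0[OF U_subspace])
    show "closed U" by (rule U_closed)
    show "opC S (zs n t) \<in> U" if "0 <= t" for n t by (rule lsolD(5)[OF zs(1) that])
    show "0 <= real k" for k by simp
    show "incseq real" by (simp add: incseq_def)
    show "\<exists>d>0. \<forall>k. real k + d <= t" if "!!k. real k < t" for t using that by (rule H3)
    show "l2cauchy (real k) (%n t. opC S (zs n t))" for k by (rule zs(6)) simp
  qed (rule that)
  have Un: "(\<Union>k. {0..real k}) = {0..}" by (auto intro: real_arch_simple)
  have em: "e measurable_on {0..}" using e(1) unfolding Un .
  have esi: "set_integrable lebesgue {0..\<tau>} (%t. (norm (e t))\<^sup>2)" for \<tau>
  proof -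
    obtain k where k: "\<tau> <= real k" using real_arch_simple by blast
    show ?thesis by (rule set_integrable_subset[OF e(3)[of k]]) (use k in simp_all)
  qed
  have cv: "l2conv \<tau> (%n t. opC S (zs n t)) e" for \<tau>
  proof -
    obtain k where k: "\<tau> <= real k" using real_arch_simple by blast
    have "l2conv (real k) (%n t. opC S (zs n t)) e" unfolding l2conv_def using e(4,5) by blast
    then show ?thesis by (rule l2conv_mono[OF _ k])
  qed
  have cz: "continuous_on {0..} z"
    by (rule continuous_on_half_line) (rule uniform_limit_cont[OF lsol_cont(1)[OF zs(1)] zs(4)])
  have cyr: "continuous_on {0..} y_ref" and cwd: "continuous_on {0..} w_d"
    by (rule continuous_on_subset[OF y_ref_cont], simp, rule continuous_on_subset[OF w_d_cont], simp)
  have Ly: "L2_on {0<..<\<tau>} U (%t. y_ref t + e t)" for \<tau>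
  proof -
    have m: "e measurable_on {0<..<\<tau>}" by (rule measurable_on_subset[OF em]) auto
    have m': "(%t. - y_ref t) measurable_on {0<..<\<tau>}" by (rule measurable_on_cont) (auto intro: continuous_on_minus cyr)
    have "set_integrable lebesgue {0<..<\<tau>} (%t. (norm (e t - - y_ref t))\<^sup>2)"
      by (rule set_integrable_sq_diff[OF m _ m' cont_sq_integrable(2)[OF continuous_on_minus[OF cyr] order_refl]])
        (use esi[of \<tau>] lint_open_closed(2) in blast)
    moreover have "(%t. y_ref t + e t) measurable_on {0<..<\<tau>}" using measurable_on_diff[OF m m'] by (simp add: add.commute)
    ultimately show ?thesis unfolding L2_on_def
      using y_ref_U e(2) by (auto simp: add.commute intro!: AE_I2 subspace_add[OF U_subspace])
  qed
  let ?v = "%t. ur t + \<kappa> *\<^sub>R y_ref t"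
  have rz: "(%n. l2n \<tau> (resid (zs n))) \<longlonglongrightarrow> 0" for \<tau>
  proof (rule Lim_null_comparison[OF _ tendsto_0_inverse_Suc[of 1]])
    obtain N where N: "\<tau> <= real N" using real_arch_simple by blast
    show "\<forall>\<^sub>F n in sequentially. norm (l2n \<tau> (resid (zs n))) <= 1 * (1 / (real n + 1))"
      using eventually_ge_at_top[of N]
    proof eventually_elim
      case (elim n)
      then have "\<tau> <= real n" using N by (meson of_nat_le_iff order_trans)
      then show ?case using zs(3)[of \<tau> n] by simp
    qed
  qed
  have "generalised_solution U S \<Phi> \<kappa> (%t. xr t + z t) ?v w_d (%t. y_ref t + e t)"
    unfolding generalised_solution_def
  proof (intro conjI)
    show "continuous_on {0..} (%t. xr t + z t)" by (intro continuous_on_add xr_continuous cz)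
    have "continuous_on {0..} ?v" by (intro continuous_on_add ur_cont continuous_on_scaleR continuous_on_const cyr)
    then show "L2_loc U ?v" unfolding L2_loc_def
      by (auto intro!: L2_on_cont subspace_add[OF U_subspace] subspace_scale[OF U_subspace] ur_U y_ref_U)
    show "L2_loc U (%t. y_ref t + e t)" unfolding L2_loc_def using Ly by blast
    show "L2_loc (dist_space U) w_d" unfolding L2_loc_def by (auto intro!: L2_on_cont cwd w_d_in)
    have z: "L2_norm A (%t. 0) = 0" for A unfolding L2_norm_def set_lebesgue_integral_def by simp
    have conv: "uniform_limit {0..\<tau>} (%n t. xr t + zs n t) (%t. xr t + z t) sequentially &
      (%k. L2_norm {0<..<\<tau>} (%t. ?v t - ?v t)) \<longlonglongrightarrow> 0 &
      (%k. L2_norm {0<..<\<tau>} (%t. (w_d t + (0, resid (zs k) t, 0)) - w_d t)) \<longlonglongrightarrow> 0 &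
      (%k. L2_norm {0<..<\<tau>} (%t. (y_ref t + opC S (zs k t)) - (y_ref t + e t))) \<longlonglongrightarrow> 0" if \<tau>: "0 < \<tau>" for \<tau>
    proof (intro conjI)
      show "uniform_limit {0..\<tau>} (%n t. xr t + zs n t) (%t. xr t + z t) sequentially"
        using \<tau> by (intro uniform_limit_intros zs(4)) simp
      show "(%k. L2_norm {0<..<\<tau>} (%t. ?v t - ?v t)) \<longlonglongrightarrow> 0" by (simp add: z)
      have "L2_norm {0<..<\<tau>} (%t. (w_d t + (0, resid (zs k) t, 0)) - w_d t) = L2_norm {0<..<\<tau>} (resid (zs k))" for k
        unfolding L2_norm_def by (simp add: norm_Pair)
      then show "(%k. L2_norm {0<..<\<tau>} (%t. (w_d t + (0, resid (zs k) t, 0)) - w_d t)) \<longlonglongrightarrow> 0"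
        using rz by (simp add: L2_norm_cont[OF resid_cont[OF zs(1)]])
      show "(%k. L2_norm {0<..<\<tau>} (%t. (y_ref t + opC S (zs k t)) - (y_ref t + e t))) \<longlonglongrightarrow> 0"
        using L2_norm_of_l2conv[OF cv[of \<tau>]] by simp
    qed
    show "\<exists>xs u1s wds ys. (\<forall>k::nat. classical_solution U S \<Phi> \<kappa> (xs k) (u1s k) (wds k) (ys k)) &
        (\<forall>\<tau>>0. uniform_limit {0..\<tau>} xs (%t. xr t + z t) sequentially &
           (%k. L2_norm {0<..<\<tau>} (%t. u1s k t - ?v t)) \<longlonglongrightarrow> 0 &
           (%k. L2_norm {0<..<\<tau>} (%t. wds k t - w_d t)) \<longlonglongrightarrow> 0 &
           (%k. L2_norm {0<..<\<tau>} (%t. ys k t - (y_ref t + e t))) \<longlonglongrightarrow> 0)"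
      by (rule exI[of _ "%k t. xr t + zs k t"], rule exI[of _ "%k. ?v"], rule exI[of _ "%k t. w_d t + (0, resid (zs k) t, 0)"],
          rule exI[of _ "%k t. y_ref t + opC S (zs k t)"], rule conjI, rule allI, rule classical_of_lsol[OF zs(1)],
          rule allI, rule impI, rule conv)
  qed
  moreover have "zs n 0 \<in> ker_B S" for n unfolding zs(2) by (rule z0(1))
  ultimately show ?thesis by (intro that[OF zs(1) _ zs(3,4) z0' em e(2) esi cv])
qed

text \<open>The regular trajectory is built independently of the generalised one, so the claim on
  \<open>H1_loc\<close> is made for every \<open>e\<close> that agrees with its output almost
  everywhere. The weak derivative is the mean-square limit of the sequence kept by
  \<open>classical_exists\<close>.\<close>

lemma classical_regular:
  assumes x0: "x0 \<in> Dom S" "opBd S x0 = snd (snd (w_d 0))"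
    "opBc S x0 = \<Phi> (ur 0 + \<kappa> *\<^sub>R y_ref 0 - \<kappa> *\<^sub>R opC S x0) + fst (snd (w_d 0))"
  obtains zc where "zc 0 = x0 - xr 0" "continuous_on {0..} zc"
    "classical_solution U S \<Phi> \<kappa> (%t. xr t + zc t) (%t. ur t + \<kappa> *\<^sub>R y_ref t) w_d (%t. y_ref t + opC S (zc t))"
    "!!e. L2_loc U e ==> (AE t in lebesgue. t > 0 --> e t = opC S (zc t)) ==> H1_loc U e"
proof -
  note d = op_diff[OF x0(1) xr_Dom[of 0]]
  have z0: "x0 - xr 0 \<in> Dom S" "opBd S (x0 - xr 0) = 0" unfolding d by (auto intro: Dom_simps x0 xr_Dom simp: x0 xr_Bd)
  have comp: "opBc S (x0 - xr 0) = N 0 (opC S (x0 - xr 0))"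
    unfolding d by (simp add: x0(3) xr_Bc xr_C N_def scaleR_diff_right algebra_simps)
  obtain zc where zc: "lsol zc" "zc 0 = x0 - xr 0" "!!t. 0 <= t ==> resid zc t = 0"
    "!!\<tau>. 0 <= \<tau> ==> \<exists>p. (\<forall>m::nat. continuous_on {0..} (p m) & (\<forall>t\<ge>0. p m t \<in> U)) & l2cauchy \<tau> p &
       (\<forall>t. 0 <= t --> t <= \<tau> --> (%m. integral {0..t} (p m)) \<longlonglongrightarrow> opC S (zc t) - opC S (x0 - xr 0))"
    by (rule classical_exists[OF z0 comp]) (rule that)
  have cl: "classical_solution U S \<Phi> \<kappa> (%t. xr t + zc t) (%t. ur t + \<kappa> *\<^sub>R y_ref t) w_d (%t. y_ref t + opC S (zc t))"
    by (rule classical_solution_cong[OF classical_of_lsol[OF zc(1)]]) (simp_all add: zc(3) zero_prod_def[symmetric])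
  have "H1_loc U e" if e: "L2_loc U e" "AE t in lebesgue. t > 0 --> e t = opC S (zc t)" for e
    unfolding H1_loc_def
  proof (intro allI impI)
    fix \<tau> :: real assume \<tau>: "0 < \<tau>"
    obtain p where p: "!!m::nat. continuous_on {0..} (p m)" "!!m t. 0 <= t ==> p m t \<in> U" "l2cauchy \<tau> p"
      "!!t. 0 <= t ==> t <= \<tau> ==> (%m. integral {0..t} (p m)) \<longlonglongrightarrow> opC S (zc t) - opC S (x0 - xr 0)"
      using zc(4)[of \<tau>] \<tau> by auto
    have H3: "\<exists>d>0. \<forall>k::nat. \<tau> + d <= t" if "!!k::nat. \<tau> < t" for t
      using that by (intro exI[of _ "t - \<tau>"]) auto
    obtain g where g: "g measurable_on (\<Union>k::nat. {0..\<tau>})" "!!t. g t \<in> U"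
      "!!k::nat. set_integrable lebesgue {0..\<tau>} (%t. (norm (g t))\<^sup>2)"
      "!!(k::nat) n. set_integrable lebesgue {0..\<tau>} (%t. (norm (p n t - g t))\<^sup>2)"
      "!!k::nat. (%n. LINT t:{0..\<tau>}|lebesgue. (norm (p n t - g t))\<^sup>2) \<longlonglongrightarrow> 0"
    proof (rule l2_limit[of p U "%_. \<tau>"])
      show "continuous_on {0..} (p m)" for m by (rule p(1))
      show "0 \<in> U" by (rule subspace_0[OF U_subspace])
      show "closed U" by (rule U_closed)
      show "p m t \<in> U" if "0 <= t" for m t by (rule p(2)[OF that])
      show "0 <= \<tau>" using \<tau> by simp
      show "incseq (%_::nat. \<tau>)" by (simp add: incseq_def)
      show "\<exists>d>0. \<forall>k::nat. \<tau> + d <= t" if "!!k::nat. \<tau> < t" for t using that by (rule H3)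
      show "l2cauchy \<tau> p" by (rule p(3))
    qed (rule that)
    have gm: "g measurable_on {0<..<\<tau>}" by (rule measurable_on_subset[OF g(1)]) auto
    have L2g: "L2_on {0<..<\<tau>} U g" unfolding L2_on_def lint_open_closed(2) using gm g(2,3) by auto
    have gi: "(g has_integral (opC S (zc t) - opC S (zc s))) {s..t}" if st: "s \<in> {0<..<\<tau>}" "t \<in> {0<..<\<tau>}" "s <= t" for s t
    proof (rule l2_limit_has_integral[OF p(1) g(4) g(5)])
      have "(%m. integral {0..t} (p m) - integral {0..s} (p m)) \<longlonglongrightarrow>
        (opC S (zc t) - opC S (x0 - xr 0)) - (opC S (zc s) - opC S (x0 - xr 0))"
        using st by (intro tendsto_diff p(4)) auto
      then show "(%m. integral {s..t} (p m)) \<longlonglongrightarrow> opC S (zc t) - opC S (zc s)"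
        using st integral_split[OF p(1), of s t] by simp
    qed (use st in auto)
    have "AE t in lebesgue. t \<in> {0<..<\<tau>} --> e t = opC S (zc t)" using e(2) by eventually_elim simp
    then show "H1_on {0<..<\<tau>} U e" unfolding H1_on_def
      using e(1) \<tau> L2g gi unfolding L2_loc_def by (intro conjI exI[of _ "%t. opC S (zc t)"] exI[of _ g]) auto
  qed
  from that[OF zc(2) lsol_cont(1)[OF zc(1)] cl this] show ?thesis .
qed

end

section \<open>Asymptotics of the regulation error\<close>

lemma set_borel_measurable_min_sq:
  assumes "set_borel_measurable M A (%t. norm (f t))"
  shows "set_borel_measurable M A (%t. min (norm (f t)) ((norm (f t))\<^sup>2))"
proof -
  have "(%t. indicator A t *\<^sub>R min (norm (f t)) ((norm (f t))\<^sup>2))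
    = (%t. min (indicator A t *\<^sub>R norm (f t)) ((indicator A t *\<^sub>R norm (f t))\<^sup>2))"
    by (auto simp: indicator_def)
  moreover have "(%t. min (indicator A t *\<^sub>R norm (f t)) ((indicator A t *\<^sub>R norm (f t))\<^sup>2)) \<in> borel_measurable M"
    by (intro borel_measurable_min borel_measurable_power) (use assms in \<open>auto simp: set_borel_measurable_def\<close>)
  ultimately show ?thesis by (simp add: set_borel_measurable_def)
qed

text \<open>Fixes one sequence of approximants with its limit, so that all asymptotic statements
  concern the same \<open>z\<close> and \<open>e\<close>. The margin \<open>\<epsilon>\<close>
  appears as balls inside \<open>Q\<close>, whose points can be used to test the variational
  inequality.\<close>

locale saturation_interior = regulated U S \<Phi> Q \<kappa> R L ur xr y_ref w_d
  for U :: "'u::chilbert_space set"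
    and S :: "('x::chilbert_space, 'u, 'd1::chilbert_space, 'd3::chilbert_space) bcs"
    and \<Phi> Q \<kappa> R L ur xr y_ref w_d +
  fixes \<epsilon> :: real and zs :: "nat => real => 'x" and z :: "real => 'x" and e :: "real => 'u"
  assumes \<epsilon>: "0 < \<epsilon>" and interior: "0 <= t ==> cball (ur t) \<epsilon> \<subseteq> Q"
    and zs: "lsol (zs n)" "zs n 0 \<in> ker_B S" and resid_zs: "\<tau> <= real n ==> l2n \<tau> (resid (zs n)) <= 1 / (real n + 1)"
    and zs_lim: "0 <= \<tau> ==> uniform_limit {0..\<tau>} zs z sequentially"
    and e_meas: "e measurable_on {0..}" and e_U: "e t \<in> U"
    and e_sq: "set_integrable lebesgue {0..\<tau>} (%t. (norm (e t))\<^sup>2)"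
    and e_lim: "l2conv \<tau> (%n t. opC S (zs n t)) e"
begin

lemma zs_tendsto: "0 <= t ==> (%n. zs n t) \<longlonglongrightarrow> z t"
  by (rule tendsto_uniform_limitI[OF zs_lim]) auto

lemma C_cont: "continuous_on {0..} (%t. opC S (zs n t))"
  by (rule lsol_cont(4)[OF zs(1)])

lemma C_bounded: obtains B where "0 <= B" "!!n. l2n \<tau> (%t. opC S (zs n t)) <= B"
  by (rule l2cauchy_bounded[OF C_cont l2conv_cauchy[OF C_cont e_lim]]) (rule that)

lemma N_zero: "0 <= t ==> N t 0 = 0"
proof -
  assume "0 <= t"
  then have "ur t \<in> Q" using interior[of t] \<epsilon> by auto
  from \<Phi>_VI[OF this, of "ur t"] have "(ur t - \<Phi> (ur t)) \<bullet> (ur t - \<Phi> (ur t)) <= 0" .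
  then have "ur t - \<Phi> (ur t) = 0" using inner_ge_zero[of "ur t - \<Phi> (ur t)"] by (simp add: order_antisym)
  then show "N t 0 = 0" by (simp add: N_def)
qed

lemma N_nonpos: "0 <= t ==> N t y \<bullet> y <= 0"
  using N_mono[of t y 0] N_zero[of t] by simp

text \<open>The variational inequality is tested with the point of the ball around
  \<open>ur t\<close> farthest in the direction of the clipped part \<open>m\<close>, which gives
  \<open>*\<close> below. Since \<open>v = n - m\<close>, one of \<open>n\<close> and
  \<open>m\<close> has at least half the norm of \<open>v\<close>: the former case yields the
  quadratic bound, the latter the linear one.\<close>

lemma N_dissipative:
  assumes \<kappa>p: "0 < \<kappa>" and t: "0 <= t"
  shows "min (\<kappa> / 4) (\<epsilon> / 2) * min (norm y) ((norm y)\<^sup>2) <= - (N t y \<bullet> y)"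
proof -
  define v n m where "v = \<kappa> *\<^sub>R y" and "n = - N t y" and "m = n - v"
  \<comment> \<open>For \<open>m = 0\<close> the quotient is zero by convention and
    \<open>k = ur t\<close>.\<close>
  define k where "k = ur t + (\<epsilon> / norm m) *\<^sub>R m"
  have "norm ((\<epsilon> / norm m) *\<^sub>R m) <= \<epsilon>" using \<epsilon> by (cases "m = 0") auto
  then have "norm (k - ur t) <= \<epsilon>" by (simp add: k_def)
  then have "k \<in> cball (ur t) \<epsilon>" by (simp add: dist_norm norm_minus_commute)
  then have kQ: "k \<in> Q" using interior[OF t] by blast
  have w: "(ur t - v) - \<Phi> (ur t - v) = m" "k - \<Phi> (ur t - v) = n + (\<epsilon> / norm m) *\<^sub>R m"
    unfolding m_def n_def N_def k_def v_def by auto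
  have "m \<bullet> (n + (\<epsilon> / norm m) *\<^sub>R m) <= 0" using \<Phi>_VI[OF kQ, of "ur t - v"] unfolding w .
  moreover have "m \<bullet> ((\<epsilon> / norm m) *\<^sub>R m) = \<epsilon> * norm m"
    by (cases "m = 0") (auto simp: power2_norm_eq_inner[symmetric] power2_eq_square)
  moreover have "m \<bullet> n = (norm n)\<^sup>2 - \<kappa> * (n \<bullet> y)"
    by (simp add: m_def v_def inner_diff_left inner_diff_right power2_norm_eq_inner inner_commute)
  ultimately have *: "(norm n)\<^sup>2 + \<epsilon> * norm m <= \<kappa> * (n \<bullet> y)" by (simp add: inner_add_right)
  have nm: "norm v <= norm n + norm m" using norm_triangle_ineq4[of n m] by (simp add: m_def)
  have nv: "norm v = \<kappa> * norm y" using \<kappa>p by (simp add: v_def)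
  have "min (\<kappa> / 4) (\<epsilon> / 2) * min (norm y) ((norm y)\<^sup>2) <= n \<bullet> y"
  proof (cases "norm v / 2 <= norm n")
    case True
    have "\<kappa> * (\<kappa> / 4 * (norm y)\<^sup>2) = (norm v / 2)\<^sup>2" by (simp add: nv power2_eq_square)
    also have "\<dots> <= (norm n)\<^sup>2" using True by (intro power_mono) auto
    also have "\<dots> <= (norm n)\<^sup>2 + \<epsilon> * norm m" using \<epsilon> by simp
    also note *
    finally have "\<kappa> / 4 * (norm y)\<^sup>2 <= n \<bullet> y" using \<kappa>p by (simp only: mult_le_cancel_left_pos)
    moreover have "min (\<kappa> / 4) (\<epsilon> / 2) * min (norm y) ((norm y)\<^sup>2) <= \<kappa> / 4 * (norm y)\<^sup>2"
      using \<kappa>p \<epsilon> by (intro mult_mono) auto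
    ultimately show ?thesis by simp
  next
    case False
    then have "norm v / 2 <= norm m" using nm by simp
    then have "\<epsilon> * (norm v / 2) <= \<epsilon> * norm m" using \<epsilon> by (intro mult_left_mono) auto
    also have "\<dots> <= (norm n)\<^sup>2 + \<epsilon> * norm m" by simp
    also note *
    finally have "\<kappa> * (\<epsilon> / 2 * norm y) <= \<kappa> * (n \<bullet> y)" by (simp add: nv algebra_simps)
    then have "\<epsilon> / 2 * norm y <= n \<bullet> y" using \<kappa>p by (simp only: mult_le_cancel_left_pos)
    moreover have "min (\<kappa> / 4) (\<epsilon> / 2) * min (norm y) ((norm y)\<^sup>2) <= \<epsilon> / 2 * norm y"
      using \<kappa>p \<epsilon> by (intro mult_mono) auto
    ultimately show ?thesis by simp
  qed
  then show ?thesis by (simp add: n_def)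
qed

text \<open>The residual term of the energy balance is paired with bounded outputs and tends to
  zero, so \<open>b\<close> tends to the initial energy. \<open>J\<close> is a placeholder for a
  lower bound of the dissipation: zero for boundedness of the state, the integral of
  \<open>m\<close> for the error bound.\<close>

lemma energy_limit:
  assumes t: "0 <= t"
    and J: "!!n. c * J n <= - 2 * integral {0..t} (%s. N s (opC S (zs n s)) \<bullet> opC S (zs n s))"
  shows "\<exists>b. b \<longlonglongrightarrow> (norm (z 0))\<^sup>2 & (\<forall>\<^sub>F n in sequentially. (norm (zs n t))\<^sup>2 + c * J n <= b n)"
proof -
  obtain B where B: "0 <= B" "!!n. l2n t (%t. opC S (zs n t)) <= B" by (rule C_bounded) (rule that)
  obtain M where M: "t <= real M" using real_arch_simple by blast
  let ?b = "%n. (norm (zs n 0))\<^sup>2 + (2 * B) * (1 / (real n + 1))"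
  have "?b \<longlonglongrightarrow> (norm (z 0))\<^sup>2 + 0"
    by (intro tendsto_add tendsto_power tendsto_norm zs_tendsto tendsto_0_inverse_Suc) simp
  moreover have "\<forall>\<^sub>F n in sequentially. (norm (zs n t))\<^sup>2 + c * J n <= ?b n"
    using eventually_ge_at_top[of M]
  proof eventually_elim
    case (elim n)
    then have "t <= real n" using M by (meson of_nat_le_iff order_trans)
    then have "l2n t (resid (zs n)) * l2n t (%s. opC S (zs n s)) <= 1 / (real n + 1) * B"
      by (intro mult_mono resid_zs B) auto
    moreover have "p <= a + 2 * w + 2 * i ==> w <= r ==> j <= - 2 * i ==> p + j <= a + 2 * r" for p a w i r j :: real
      by linarith
    ultimately have "(norm (zs n t))\<^sup>2 + c * J n <= (norm (zs n 0))\<^sup>2 + 2 * (1 / (real n + 1) * B)"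
      using lsol_energy_resid[OF zs(1)[of n] t] J[of n] by blast
    then show ?case by (simp add: mult.commute)
  qed
  ultimately show ?thesis by (intro exI[of _ ?b]) simp
qed

lemma state_bound: "0 <= t ==> norm (z t) <= norm (z 0)"
proof -
  assume t: "0 <= t"
  have "integral {0..t} (%s. N s (opC S (zs n s)) \<bullet> opC S (zs n s)) <= integral {0..t} (%s. 0)" for n
  proof (rule integral_le)
    show "(%s. N s (opC S (zs n s)) \<bullet> opC S (zs n s)) integrable_on {0..t}"
      by (rule integrable_continuous_real)
        (rule continuous_on_inner[OF continuous_on_sub0[OF N_cont[OF C_cont] order_refl] continuous_on_sub0[OF C_cont order_refl]])
  qed (auto intro: N_nonpos)
  then have J: "0 * (0::real) <= - 2 * integral {0..t} (%s. N s (opC S (zs n s)) \<bullet> opC S (zs n s))" for n by simp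
  obtain b where b: "b \<longlonglongrightarrow> (norm (z 0))\<^sup>2" "\<forall>\<^sub>F n in sequentially. (norm (zs n t))\<^sup>2 + 0 * 0 <= b n"
    using energy_limit[OF t J] by blast
  have "(norm (z t))\<^sup>2 <= (norm (z 0))\<^sup>2"
    by (rule tendsto_le[OF sequentially_bot b(1) tendsto_power[OF tendsto_norm[OF zs_tendsto[OF t]]]]) (use b(2) in simp)
  then show "norm (z t) <= norm (z 0)" by (rule power2_le_imp_le) simp
qed

definition m :: "'u => real" where "m y = min (norm y) ((norm y)\<^sup>2)"

lemma m_nonneg: "0 <= m y" by (simp add: m_def)

lemma m_integrable: "set_integrable lebesgue {0..\<tau>} (%t. m (e t))"
proof (rule set_integrable_bound[OF e_sq[of \<tau>]])
  have "e measurable_on {0..\<tau>}" by (rule measurable_on_subset[OF e_meas]) auto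
  then show "set_borel_measurable lebesgue {0..\<tau>} (%t. m (e t))"
    unfolding m_def by (intro set_borel_measurable_min_sq measurable_on_norm_sq(2))
qed (simp add: m_def)

text \<open>\<open>m\<close> is Lipschitz with constant two in the norm. Young's inequality splits
  the resulting error into \<open>\<eta>\<close> and a multiple of the squared distance of the
  outputs; the latter vanishes with \<open>n\<close>, and \<open>\<eta>\<close> tends to zero
  afterwards.\<close>

lemma dissipation_bound:
  assumes \<kappa>p: "0 < \<kappa>" and \<tau>: "0 <= \<tau>"
  shows "min (\<kappa> / 4) (\<epsilon> / 2) * (LINT t:{0..\<tau>}|lebesgue. m (e t)) <= (norm (z 0))\<^sup>2 / 2"
proof -
  define c where "c = min (\<kappa> / 4) (\<epsilon> / 2)"
  let ?I = "LINT t:{0..\<tau>}|lebesgue. m (e t)"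
  define J where "J n = integral {0..\<tau>} (%t. m (opC S (zs n t)))" for n
  define a where "a n = (LINT t:{0..\<tau>}|lebesgue. (norm (opC S (zs n t) - e t))\<^sup>2)" for n
  have a: "a \<longlonglongrightarrow> 0" "!!n. set_integrable lebesgue {0..\<tau>} (%t. (norm (opC S (zs n t) - e t))\<^sup>2)"
    using e_lim[of \<tau>] by (auto simp: l2conv_def a_def[abs_def])
  have c: "0 < c" using \<kappa>p \<epsilon> by (simp add: c_def)
  have mc: "continuous_on {0..\<tau>} (%t. m (opC S (zs n t)))" for n
    unfolding m_def by (intro continuous_on_min continuous_on_power continuous_on_norm continuous_on_sub0[OF C_cont order_refl])
  have J: "(2 * c) * J n <= - 2 * integral {0..\<tau>} (%s. N s (opC S (zs n s)) \<bullet> opC S (zs n s))" for n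
  proof -
    have ci: "(%s. N s (opC S (zs n s)) \<bullet> opC S (zs n s)) integrable_on {0..\<tau>}"
      by (rule integrable_continuous_real)
        (rule continuous_on_inner[OF continuous_on_sub0[OF N_cont[OF C_cont] order_refl] continuous_on_sub0[OF C_cont order_refl]])
    have "integral {0..\<tau>} (%t. c * m (opC S (zs n t))) <= integral {0..\<tau>} (%s. - (N s (opC S (zs n s)) \<bullet> opC S (zs n s)))"
    proof (rule integral_le)
      show "(%t. c * m (opC S (zs n t))) integrable_on {0..\<tau>}"
        by (rule integrable_continuous_real) (intro continuous_on_mult continuous_on_const mc)
      show "(%s. - (N s (opC S (zs n s)) \<bullet> opC S (zs n s))) integrable_on {0..\<tau>}" by (rule integrable_neg[OF ci])
      show "c * m (opC S (zs n t)) <= - (N t (opC S (zs n t)) \<bullet> opC S (zs n t))" if "t \<in> {0..\<tau>}" for t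
        unfolding m_def c_def by (rule N_dissipative[OF \<kappa>p]) (use that in simp)
    qed
    then have "c * J n <= - integral {0..\<tau>} (%s. N s (opC S (zs n s)) \<bullet> opC S (zs n s))"
      by (simp only: J_def integral_mult_right Henstock_Kurzweil_Integration.integral_neg)
    then have "2 * (c * J n) <= 2 * (- integral {0..\<tau>} (%s. N s (opC S (zs n s)) \<bullet> opC S (zs n s)))"
      by (rule mult_left_mono) simp
    then show ?thesis by (simp only: mult.assoc mult_minus_right mult_minus_left)
  qed
  obtain b where b: "b \<longlonglongrightarrow> (norm (z 0))\<^sup>2" "\<forall>\<^sub>F n in sequentially. (norm (zs n \<tau>))\<^sup>2 + (2 * c) * J n <= b n"
    using energy_limit[OF \<tau> J] by blast
  have main: "c * ?I - (norm (z 0))\<^sup>2 / 2 <= \<eta> * (c * \<tau>)" if \<eta>: "0 < \<eta>" for \<eta>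
  proof -
    have I: "?I <= J n + \<eta> * \<tau> + (1 / \<eta>) * a n" for n
    proof -
      have cc: "continuous_on {0..\<tau>} (%t. m (opC S (zs n t)) + \<eta>)" by (intro continuous_on_add mc continuous_on_const)
      have s1: "set_integrable lebesgue {0..\<tau>} (%t. m (opC S (zs n t)) + \<eta>)" by (rule absolutely_integrable_continuous_real[OF cc])
      have s2: "set_integrable lebesgue {0..\<tau>} (%t. (1 / \<eta>) * (norm (opC S (zs n t) - e t))\<^sup>2)"
        by (intro set_integrable_mult_right a(2))
      have "?I <= (LINT t:{0..\<tau>}|lebesgue. (m (opC S (zs n t)) + \<eta>) + (1 / \<eta>) * (norm (opC S (zs n t) - e t))\<^sup>2)"
      proof (rule set_integral_mono[OF m_integrable set_integral_add(1)[OF s1 s2]])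
        fix t
        have "m (e t) <= m (opC S (zs n t)) + 2 * \<bar>norm (opC S (zs n t)) - norm (e t)\<bar>"
          unfolding m_def by (rule min_sq_lipschitz) auto
        also have "\<dots> <= m (opC S (zs n t)) + 2 * norm (opC S (zs n t) - e t)" using norm_triangle_ineq3 by simp
        also have "2 * norm (opC S (zs n t) - e t) <= \<eta> + (1 / \<eta>) * (norm (opC S (zs n t) - e t))\<^sup>2"
        proof -
          have "2 * x <= \<eta> + (1 / \<eta>) * x\<^sup>2" for x :: real
          proof -
            have "\<eta> + (1 / \<eta>) * x\<^sup>2 - 2 * x = (\<eta> - x)\<^sup>2 / \<eta>" using \<eta> by (simp add: field_simps power2_eq_square)
            also have "\<dots> \<ge> 0" using \<eta> by simp
            finally show ?thesis by simp
          qed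
          then show ?thesis .
        qed
        finally show "m (e t) <= (m (opC S (zs n t)) + \<eta>) + (1 / \<eta>) * (norm (opC S (zs n t) - e t))\<^sup>2" by simp
      qed
      also have "\<dots> = (LINT t:{0..\<tau>}|lebesgue. m (opC S (zs n t)) + \<eta>) + (1 / \<eta>) * a n"
        unfolding set_integral_add(2)[OF s1 s2] a_def by simp
      also have "(LINT t:{0..\<tau>}|lebesgue. m (opC S (zs n t)) + \<eta>) = integral {0..\<tau>} (%t. m (opC S (zs n t)) + \<eta>)"
        by (rule set_lebesgue_integral_eq_integral(2)[OF s1])
      also have "\<dots> = J n + integral {0..\<tau>} (%t. \<eta>)" unfolding J_def
        by (rule Henstock_Kurzweil_Integration.integral_add; rule integrable_continuous_real) (intro mc continuous_on_const)+
      finally show ?thesis using \<tau> by (simp add: mult.commute)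
    qed
    have ev: "\<forall>\<^sub>F n in sequentially. c * ?I <= b n / 2 + c * (\<eta> * \<tau> + (1 / \<eta>) * a n)" using b(2)
    proof eventually_elim
      case (elim n)
      have "c * ?I <= c * (J n + \<eta> * \<tau> + (1 / \<eta>) * a n)" using c I by (intro mult_left_mono) auto
      also have "\<dots> = c * J n + c * (\<eta> * \<tau> + (1 / \<eta>) * a n)" by (simp add: distrib_left)
      also have "c * J n <= b n / 2"
      proof -
        have "0 <= (norm (zs n \<tau>))\<^sup>2" by simp
        moreover have "0 <= p ==> p + (2 * c) * j <= d ==> c * j <= d / 2" for p c j d :: real by simp
        ultimately show ?thesis using elim by blast
      qed
      finally show ?case by simp
    qed
    have "(%n. b n / 2 + c * (\<eta> * \<tau> + (1 / \<eta>) * a n)) \<longlonglongrightarrow> (norm (z 0))\<^sup>2 / 2 + c * (\<eta> * \<tau> + (1 / \<eta>) * 0)"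
      by (rule tendsto_add[OF tendsto_divide[OF b(1) tendsto_const] tendsto_mult_left[OF tendsto_add[OF tendsto_const tendsto_mult_left[OF a(1)]]]]) simp
    from tendsto_lowerbound[OF this ev sequentially_bot]
    have "c * ?I <= (norm (z 0))\<^sup>2 / 2 + c * (\<eta> * \<tau> + (1 / \<eta>) * 0)" .
    then show ?thesis by (simp add: mult.left_commute)
  qed
  have "c * ?I - (norm (z 0))\<^sup>2 / 2 <= 0" by (rule le_zero_if_le_small[OF main])
  then show ?thesis unfolding c_def[symmetric] by simp
qed

text \<open>\<open>\<Omega>\<close> is where the error has norm at least one. There
  \<open>m (e t)\<close> equals the norm and dominates the constant one, which bounds the measure;
  elsewhere on the half-line it equals the squared norm.\<close>

lemma error_split:
  assumes \<kappa>p: "0 < \<kappa>"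
  shows "\<exists>\<Omega>\<in>lmeasurable. \<Omega> \<subseteq> {0..} & L2_on ({0..} - \<Omega>) U e & L1_on \<Omega> U e"
proof -
  let ?c = "min (\<kappa> / 4) (\<epsilon> / 2)"
  have c: "0 < ?c" using \<kappa>p \<epsilon> by simp
  have G: "set_integrable lebesgue {0..} (%t. m (e t))"
  proof (rule set_integrable_half_line[OF m_nonneg m_integrable])
    show "(LINT t:{0..real k}|lebesgue. m (e t)) <= (norm (z 0))\<^sup>2 / 2 / ?c" for k
      using dissipation_bound[OF \<kappa>p, of "real k"] c by (simp only: pos_le_divide_eq) (simp add: mult.commute)
  qed
  define \<Omega> where "\<Omega> = {t. 0 <= t & 1 <= norm (e t)}"
  have ms: "\<Omega> \<in> sets lebesgue"
  proof -
    have "(%t. indicator {0..} t *\<^sub>R norm (e t)) \<in> borel_measurable lebesgue"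
      using measurable_on_norm_sq(2)[OF e_meas] by (simp add: set_borel_measurable_def)
    then have "{t \<in> space lebesgue. 1 <= indicator {0..} t *\<^sub>R norm (e t)} \<in> sets lebesgue"
      by (intro borel_measurable_le borel_measurable_const)
    moreover have "{t \<in> space lebesgue. 1 <= indicator {0..} t *\<^sub>R norm (e t)} = \<Omega>"
      by (auto simp: \<Omega>_def indicator_def split: if_splits)
    ultimately show ?thesis by simp
  qed
  have sub: "\<Omega> \<subseteq> {0..}" "{0..} - \<Omega> \<subseteq> {0..}" "{0..} - \<Omega> \<in> sets lebesgue" using ms by (auto simp: \<Omega>_def)
  have on: "m (e t) = norm (e t)" if "t \<in> \<Omega>" for t
  proof -
    have "norm (e t) * 1 <= norm (e t) * norm (e t)" using that by (intro mult_left_mono) (auto simp: \<Omega>_def)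
    then show ?thesis by (simp add: m_def power2_eq_square)
  qed
  have off: "m (e t) = (norm (e t))\<^sup>2" if "t \<in> {0..} - \<Omega>" for t
  proof -
    have "norm (e t) * norm (e t) <= norm (e t) * 1" using that by (intro mult_left_mono) (auto simp: \<Omega>_def)
    then show ?thesis by (simp add: m_def power2_eq_square)
  qed
  have i1: "set_integrable lebesgue \<Omega> (%t. norm (e t))"
    by (rule iffD1[OF set_integrable_cong[OF refl refl on] set_integrable_subset[OF G ms sub(1)]])
  have i2: "set_integrable lebesgue ({0..} - \<Omega>) (%t. (norm (e t))\<^sup>2)"
    by (rule iffD1[OF set_integrable_cong[OF refl refl off] set_integrable_subset[OF G sub(3,2)]])
  have "set_integrable lebesgue \<Omega> (%t. 1::real)"
  proof (rule set_integrable_bound[OF i1])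
    show "set_borel_measurable lebesgue \<Omega> (%t. 1::real)" using ms by (simp add: set_borel_measurable_def)
  qed (auto simp: \<Omega>_def)
  then have "integrable lebesgue (indicator \<Omega> :: real => real)" by (simp add: set_integrable_def)
  then have "emeasure lebesgue (\<Omega> \<inter> space lebesgue) < \<infinity>" unfolding integrable_indicator_iff by (rule conjunct2)
  moreover have "\<Omega> \<inter> space lebesgue = \<Omega>" by simp
  ultimately have "\<Omega> \<in> lmeasurable" by (intro fmeasurableI ms) (simp only:)
  moreover have "e measurable_on \<Omega>" "e measurable_on ({0..} - \<Omega>)"
    using measurable_on_subset[OF e_meas] ms sub by auto
  ultimately show ?thesis using i1 i2 sub(1) e_U by (intro bexI[of _ \<Omega>]) (auto simp: L1_on_def L2_on_def)
qed

section \<open>The open loop \<open>\<kappa> = 0\<close>\<close>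

lemma resid_open_loop: "\<kappa> = 0 ==> 0 <= t ==> resid v t = opBc S (v t)"
proof -
  assume \<kappa>0: "\<kappa> = 0" and t: "0 <= t"
  have "N t (opC S (v t)) = N t 0" unfolding N_def by (simp add: \<kappa>0)
  then show "resid v t = opBc S (v t)" using N_zero[OF t] unfolding resid_def by simp
qed

text \<open>Restarted at time \<open>s\<close>, an approximant has only its residual as input, so
  well-posedness bounds the output on the next unit interval by the state at \<open>s\<close>. The
  factor two comes from the squared triangle inequality.\<close>

lemma error_le_state:
  assumes \<kappa>0: "\<kappa> = 0" and g: "good \<sigma> K" and \<sigma>: "1 <= \<sigma>" and s: "0 <= s"
  shows "(LINT t:{s..s+1}|lebesgue. (norm (e t))\<^sup>2) <= 2 * (K * norm (z s))\<^sup>2"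
proof -
  define a where "a n = (LINT t:{0..s+1}|lebesgue. (norm (opC S (zs n t) - e t))\<^sup>2)" for n
  have a: "a \<longlonglongrightarrow> 0" "!!n. set_integrable lebesgue {0..s+1} (%t. (norm (opC S (zs n t) - e t))\<^sup>2)"
    using e_lim[of "s+1"] by (auto simp: l2conv_def a_def[abs_def])
  obtain M where M: "\<sigma> + s <= real M" using real_arch_simple by blast
  have ev: "\<forall>\<^sub>F n in sequentially. (LINT t:{s..s+1}|lebesgue. (norm (e t))\<^sup>2)
    <= 2 * a n + 2 * (K * (norm (zs n s) + 1 * (1 / (real n + 1))))\<^sup>2"
    using eventually_ge_at_top[of M]
  proof eventually_elim
    case (elim n)
    then have n: "\<sigma> + s <= real n" using M by (meson of_nat_le_iff order_trans)
    let ?w = "%t. zs n (t + s)"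
    note w = lsol_shift[OF zs(1)[of n] s]
    have "l2n \<sigma> (%t. opBc S (?w t)) = l2n \<sigma> (%t. resid (zs n) (t + s))"
      by (rule l2n_cong) (simp add: resid_open_loop[OF \<kappa>0] s)
    also have "\<dots> <= l2n (\<sigma> + s) (resid (zs n))" by (rule l2n_shift[OF resid_cont[OF zs(1)] s])
    also have "\<dots> <= 1 / (real n + 1)" by (rule resid_zs[OF n])
    finally have Bw: "l2n \<sigma> (%t. opBc S (?w t)) <= 1 / (real n + 1)" .
    have "l2n 1 (%t. opC S (?w t)) <= l2n \<sigma> (%t. opC S (?w t))"
      by (rule l2n_mono_time[OF continuous_on_sub0[OF lsol_cont(4)[OF w] order_refl] \<sigma>])
    also have "\<dots> <= K * (norm (?w 0) + l2n \<sigma> (%t. opBc S (?w t)))" by (rule goodD(4)[OF g w])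
    also have "\<dots> <= K * (norm (zs n s) + 1 * (1 / (real n + 1)))"
      using Bw goodD(2)[OF g] by (intro mult_left_mono) auto
    finally have Cw: "l2n 1 (%t. opC S (?w t)) <= K * (norm (zs n s) + 1 * (1 / (real n + 1)))" .
    have sub: "{s..s+1} \<subseteq> {0..s+1}" using s by auto
    have cs: "continuous_on {s..s+1} (%t. (norm (opC S (zs n t)))\<^sup>2)"
      by (intro continuous_on_power continuous_on_norm continuous_on_sub0[OF C_cont s])
    have si: "set_integrable lebesgue {s..s+1} (%t. (norm (opC S (zs n t)))\<^sup>2)" by (rule absolutely_integrable_continuous_real[OF cs])
    have "(LINT t:{s..s+1}|lebesgue. (norm (opC S (zs n t)))\<^sup>2) = integral {s..s+1} (%t. (norm (opC S (zs n t)))\<^sup>2)"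
      by (rule set_lebesgue_integral_eq_integral(2)[OF si])
    also have "\<dots> = integral {0..1} (%t. (norm (opC S (?w t)))\<^sup>2)"
      using integral_shift_le[of 0 1 "%t. (norm (opC S (zs n t)))\<^sup>2" s] by (simp add: add.commute)
    also have "\<dots> = (l2n 1 (%t. opC S (?w t)))\<^sup>2"
      by (rule l2n_sq[symmetric, OF continuous_on_sub0[OF lsol_cont(4)[OF w] order_refl]])
    also have "\<dots> <= (K * (norm (zs n s) + 1 * (1 / (real n + 1))))\<^sup>2" by (intro power_mono Cw) simp
    finally have C: "(LINT t:{s..s+1}|lebesgue. (norm (opC S (zs n t)))\<^sup>2) <= \<dots>" .
    have d: "set_integrable lebesgue {s..s+1} (%t. (norm (opC S (zs n t) - e t))\<^sup>2)"
      by (rule set_integrable_subset[OF a(2) _ sub]) simp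
    have "(LINT t:{s..s+1}|lebesgue. (norm (e t - 0))\<^sup>2) <= 2 * (LINT t:{s..s+1}|lebesgue. (norm (e t - opC S (zs n t)))\<^sup>2)
      + 2 * (LINT t:{s..s+1}|lebesgue. (norm (opC S (zs n t) - 0))\<^sup>2)"
      by (rule set_lint_sq_triangle) (use d si in \<open>simp_all add: norm_minus_commute\<close>)
    moreover have "(LINT t:{s..s+1}|lebesgue. (norm (opC S (zs n t) - e t))\<^sup>2) <= a n"
      unfolding a_def by (rule set_lint_mono_set[OF a(2) _ sub]) auto
    ultimately show ?case using C by (simp add: norm_minus_commute[of "e _"])
  qed
  have "(%n. 2 * a n + 2 * (K * (norm (zs n s) + 1 * (1 / (real n + 1))))\<^sup>2) \<longlonglongrightarrow> 2 * 0 + 2 * (K * (norm (z s) + 0))\<^sup>2"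
    by (rule tendsto_add[OF tendsto_mult_left[OF a(1)] tendsto_mult_left[OF tendsto_power[OF tendsto_mult_left[OF
          tendsto_add[OF tendsto_norm[OF zs_tendsto[OF s]] tendsto_0_inverse_Suc]]]]])
  from tendsto_lowerbound[OF this ev sequentially_bot]
  have "(LINT t:{s..s+1}|lebesgue. (norm (e t))\<^sup>2) <= 2 * 0 + 2 * (K * (norm (z s) + 0))\<^sup>2" .
  then show ?thesis by simp
qed

text \<open>The orbit of \<open>zs n 0\<close> is a trajectory with zero input; its difference from
  \<open>zs n\<close> starts at zero and has the residual as input.\<close>

lemma state_semigroup:
  assumes \<kappa>0: "\<kappa> = 0" and T: "generates (ker_B S) (opA S) T" and t: "0 <= t"
  shows "z t = T t (z 0)"
proof -
  interpret T: dissipative_semigroup "ker_B S" "opA S" T by (rule dissipative_semigroup_generates[OF T])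
  obtain \<sigma> K where g: "t <= \<sigma>" "good \<sigma> K" by (rule good_exists[OF t]) (rule that)
  obtain M where M: "\<sigma> <= real M" using real_arch_simple by blast
  note lT = lsol_Tsg[OF T zs(2)]
  have "(%n. zs n t - T t (zs n 0)) \<longlonglongrightarrow> 0"
  proof (rule Lim_null_comparison[OF _ tendsto_0_inverse_Suc[of K]])
    show "\<forall>\<^sub>F n in sequentially. norm (zs n t - T t (zs n 0)) <= K * (1 / (real n + 1))"
      using eventually_ge_at_top[of M]
    proof eventually_elim
      case (elim n)
      then have n: "\<sigma> <= real n" using M by (meson of_nat_le_iff order_trans)
      note d = lsol_diff[OF zs(1)[of n] lT(1)[of n]]
      have "opBc S (zs n s - T s (zs n 0)) = resid (zs n) s" if "0 <= s" for s
        using op_diff(2)[OF lsolD(1)[OF zs(1)[of n] that] lsolD(1)[OF lT(1)[of n] that]] lT(2)[OF that, of n]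
        by (simp add: resid_open_loop[OF \<kappa>0 that])
      then have "l2n \<sigma> (%s. opBc S (zs n s - T s (zs n 0))) = l2n \<sigma> (resid (zs n))" by (intro l2n_cong) simp
      then have "norm (zs n t - T t (zs n 0)) <= K * (norm (zs n 0 - T 0 (zs n 0)) + l2n \<sigma> (resid (zs n)))"
        using goodD(3)[OF g(2) d t g(1)] by simp
      also have "\<dots> <= K * (0 + 1 / (real n + 1))"
        using goodD(2)[OF g(2)] resid_zs[OF n] lT(3)[of n] by (intro mult_left_mono add_mono) auto
      finally show ?case by simp
    qed
  qed
  moreover have "(%n. zs n t - T t (zs n 0)) \<longlonglongrightarrow> z t - T t (z 0)"
    by (intro tendsto_diff zs_tendsto t bounded_linear.tendsto[OF T.T_linear[OF t]]) simp
  ultimately have "z t - T t (z 0) = 0" by (rule LIMSEQ_unique[symmetric])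
  then show ?thesis by simp
qed

lemma error_vanishes:
  assumes \<kappa>0: "\<kappa> = 0" and T: "generates (ker_B S) (opA S) T" "strongly_stable T"
  shows "((%t. L2_norm {t..t+1} e) \<longlongrightarrow> 0) at_top"
proof -
  obtain \<sigma> K where g: "1 <= \<sigma>" "good \<sigma> K" by (rule good_exists[of 1]) (simp, rule that)
  have "((%t. sqrt (2 * (K * norm (T t (z 0)))\<^sup>2)) \<longlongrightarrow> sqrt (2 * (K * norm (0::'x))\<^sup>2)) at_top"
    using T(2) unfolding strongly_stable_def by (intro tendsto_intros) auto
  then have lim: "((%t. sqrt (2 * (K * norm (T t (z 0)))\<^sup>2)) \<longlongrightarrow> 0) at_top" by simp
  show ?thesis
  proof (rule real_tendsto_sandwich[OF _ _ tendsto_const lim])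
    show "\<forall>\<^sub>F t in at_top. 0 <= L2_norm {t..t+1} e" unfolding L2_norm_def using set_lint_nonneg by (intro always_eventually) auto
    show "\<forall>\<^sub>F t in at_top. L2_norm {t..t+1} e <= sqrt (2 * (K * norm (T t (z 0)))\<^sup>2)"
      using eventually_ge_at_top[of 0]
    proof eventually_elim
      case (elim t)
      show ?case unfolding L2_norm_def
        using error_le_state[OF \<kappa>0 g(2,1) elim] unfolding state_semigroup[OF \<kappa>0 T(1) elim] by (rule real_sqrt_le_mono)
    qed
  qed
qed

text \<open>On the \<open>k\<close>-th unit interval the weight \<open>exp (\<beta> * t)\<close>
  meets the squared semigroup bound \<open>exp (- 2 * \<beta> * k)\<close>, so the pieces decay like
  \<open>exp (- \<beta>) ^ k\<close> and are summable. Since the weight acts on the squared norm,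
  the rate is \<open>\<beta> / 2\<close>.\<close>

lemma error_exponential:
  assumes \<kappa>0: "\<kappa> = 0" and T: "generates (ker_B S) (opA S) T" "exponentially_stable T"
  shows "\<exists>\<alpha>>0. L2_on {0<..} U (%t. exp (\<alpha> * t) *\<^sub>R e t)"
proof -
  obtain M \<beta> where M: "0 < \<beta>" "!!t x. 0 <= t ==> norm (T t x) <= M * exp (- \<beta> * t) * norm x"
    using T(2) unfolding exponentially_stable_def by blast
  obtain \<sigma> K where g: "1 <= \<sigma>" "good \<sigma> K" by (rule good_exists[of 1]) (simp, rule that)
  define h where "h t = (norm (exp (\<beta> / 2 * t) *\<^sub>R e t))\<^sup>2" for t
  have h: "h t = exp (\<beta> * t) * (norm (e t))\<^sup>2" for t
    by (simp add: h_def power_mult_distrib power2_eq_square exp_add[symmetric])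
  have em: "(%t. exp (\<beta> / 2 * t) *\<^sub>R e t) measurable_on {0..}"
    by (intro measurable_on_scaleR measurable_on_cont e_meas continuous_intros) auto
  have hi: "set_integrable lebesgue {a..b} h" if a: "0 <= a" for a b
  proof (rule set_integrable_bound)
    have "set_integrable lebesgue {a..b} (%t. (norm (e t))\<^sup>2)" by (rule set_integrable_subset[OF e_sq[of b]]) (use a in auto)
    then show "set_integrable lebesgue {a..b} (%t. exp (\<beta> * b) * (norm (e t))\<^sup>2)" by (rule set_integrable_mult_right)
    have "(%t. exp (\<beta> / 2 * t) *\<^sub>R e t) measurable_on {a..b}" by (rule measurable_on_subset[OF em]) (use a in auto)
    then show "set_borel_measurable lebesgue {a..b} h" unfolding h_def by (rule measurable_on_norm_sq(1))
    show "AE t in lebesgue. t \<in> {a..b} --> norm (h t) <= norm (exp (\<beta> * b) * (norm (e t))\<^sup>2)"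
      using M(1) by (auto simp: h abs_mult intro!: AE_I2 mult_right_mono)
  qed
  define C where "C = exp \<beta> * (2 * (K * (M * norm (z 0)))\<^sup>2)"
  have C0: "0 <= C" by (simp add: C_def)
  have piece: "(LINT t:{real k..real k+1}|lebesgue. h t) <= C * exp (- \<beta>) ^ k" for k
  proof -
    have i: "set_integrable lebesgue {real k..real k+1} (%t. (norm (e t))\<^sup>2)" by (rule set_integrable_subset[OF e_sq[of "real k+1"]]) auto
    have "(LINT t:{real k..real k+1}|lebesgue. h t) <= (LINT t:{real k..real k+1}|lebesgue. exp (\<beta> * (real k + 1)) * (norm (e t))\<^sup>2)"
      by (rule set_integral_mono[OF hi set_integrable_mult_right[OF i]]) (use M(1) in \<open>auto simp: h intro!: mult_right_mono\<close>)
    also have "\<dots> = exp (\<beta> * (real k + 1)) * (LINT t:{real k..real k+1}|lebesgue. (norm (e t))\<^sup>2)" by simp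
    also have "\<dots> <= exp (\<beta> * (real k + 1)) * (2 * (K * norm (z (real k)))\<^sup>2)"
      by (intro mult_left_mono error_le_state[OF \<kappa>0 g(2,1)]) auto
    also have "\<dots> <= exp (\<beta> * (real k + 1)) * (2 * (K * (M * exp (- \<beta> * real k) * norm (z 0)))\<^sup>2)"
      unfolding state_semigroup[OF \<kappa>0 T(1) of_nat_0_le_iff[of k]] using goodD(2)[OF g(2)]
      by (intro mult_left_mono power_mono M) auto
    also have "\<dots> = C * exp (- \<beta>) ^ k"
    proof -
      have "exp (\<beta> * (real k + 1)) * (exp (- \<beta> * real k))\<^sup>2 = exp \<beta> * exp (- \<beta> * real k)"
        by (simp add: power2_eq_square exp_add[symmetric] algebra_simps)
      moreover have "exp (- \<beta>) ^ k = exp (- \<beta> * real k)" by (simp add: exp_of_nat_mult[symmetric] mult.commute)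
      ultimately show ?thesis by (simp add: C_def power_mult_distrib algebra_simps)
    qed
    finally show ?thesis .
  qed
  have sum: "(LINT t:{0..real k}|lebesgue. h t) <= (\<Sum>i<k. C * exp (- \<beta>) ^ i)" for k
  proof (induction k)
    case 0
    have "(LINT t:{0..0::real}|lebesgue. h t) = integral {0..0} h" by (rule set_lebesgue_integral_eq_integral(2)[OF hi]) simp
    then show ?case by simp
  next
    case (Suc k)
    have i: "integrable lebesgue (%t. indicator {a..b} t *\<^sub>R h t)" if "0 <= a" for a b using hi[OF that] by (simp add: set_integrable_def)
    have "(LINT t:{0..real (Suc k)}|lebesgue. h t) <= (LINT t|lebesgue. indicator {0..real k} t *\<^sub>R h t + indicator {real k..real k + 1} t *\<^sub>R h t)"
      unfolding set_lebesgue_integral_def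
      by (intro integral_mono Bochner_Integration.integrable_add i) (auto simp: indicator_def h)
    also have "\<dots> = (LINT t:{0..real k}|lebesgue. h t) + (LINT t:{real k..real k+1}|lebesgue. h t)"
      unfolding set_lebesgue_integral_def by (intro Bochner_Integration.integral_add i) auto
    finally show ?case using Suc.IH piece[of k] by simp
  qed
  have "set_integrable lebesgue {0..} h"
  proof (rule set_integrable_half_line)
    fix k :: nat
    show "set_integrable lebesgue {0..real k} h" by (rule hi) simp
    have \<rho>: "exp (- \<beta>) < 1" using M(1) by simp
    have "(\<Sum>i<k. exp (- \<beta>) ^ i) <= 1 / (1 - exp (- \<beta>))"
    proof -
      have "exp (- \<beta>) \<noteq> 1" using \<rho> by simp
      then have "(\<Sum>i<k. exp (- \<beta>) ^ i) = (1 - exp (- \<beta>) ^ k) / (1 - exp (- \<beta>))" by (simp only: sum_gp_strict if_False)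
      also have "\<dots> <= 1 / (1 - exp (- \<beta>))" using \<rho> by (intro divide_right_mono) auto
      finally show ?thesis .
    qed
    then have "C * (\<Sum>i<k. exp (- \<beta>) ^ i) <= C * (1 / (1 - exp (- \<beta>)))" by (rule mult_left_mono[OF _ C0])
    then show "(LINT t:{0..real k}|lebesgue. h t) <= C * (1 / (1 - exp (- \<beta>)))"
      using sum[of k] by (simp only: sum_distrib_left)
  qed (simp add: h)
  then have "set_integrable lebesgue {0<..} h" by (rule set_integrable_subset) auto
  moreover have "(%t. exp (\<beta> / 2 * t) *\<^sub>R e t) measurable_on {0<..}" by (rule measurable_on_subset[OF em]) auto
  ultimately show ?thesis using M(1) e_U unfolding h_def
    by (intro exI[of _ "\<beta> / 2"]) (auto simp: L2_on_def intro!: AE_I2 subspace_scale[OF U_subspace])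
qed

end

section \<open>Saturation\<close>

text \<open>The radial retraction is the metric projection onto the ball: either \<open>v\<close>
  lies inside and \<open>c = 1\<close>, or \<open>c * norm x = d\<close> and Cauchy-Schwarz compares
  \<open>x\<close> with any \<open>n\<close> of norm at most \<open>d\<close>.\<close>

lemma saturation_component:
  fixes v r k :: "'a::real_inner"
  assumes d: "0 < d"
  defines "p \<equiv> r + (d / max d (norm (v - r))) *\<^sub>R (v - r)"
  shows "norm (p - r) <= d" "norm (k - r) <= d ==> (v - p) \<bullet> (k - p) <= 0"
proof -
  define x n c where "x = v - r" and "n = k - r" and "c = d / max d (norm x)"
  have p: "p - r = c *\<^sub>R x" "v - p = (1 - c) *\<^sub>R x" "k - p = n - c *\<^sub>R x"
    by (simp_all add: p_def c_def x_def n_def scaleR_diff_left)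
  have "c = 1 & norm x <= d \<or> c * norm x = d & c <= 1"
    using d by (cases "norm x <= d") (auto simp: c_def max_def)
  moreover have c0: "0 < c" using d by (simp add: c_def)
  ultimately show "norm (p - r) <= d" unfolding p by auto
  assume k: "norm (k - r) <= d"
  from \<open>c = 1 & norm x <= d \<or> c * norm x = d & c <= 1\<close> show "(v - p) \<bullet> (k - p) <= 0"
  proof
    assume c: "c * norm x = d & c <= 1"
    have "x \<bullet> n <= norm x * norm n" by (rule norm_cauchy_schwarz)
    also have "\<dots> <= norm x * d" using k by (intro mult_left_mono) (auto simp: n_def)
    also have "\<dots> = c * (norm x)\<^sup>2" using c by (simp add: power2_eq_square mult.left_commute)
    finally have "x \<bullet> (n - c *\<^sub>R x) <= 0" by (simp add: inner_diff_right power2_norm_eq_inner)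
    then show ?thesis unfolding p inner_scaleR_left using c by (intro mult_nonneg_nonpos) auto
  qed (simp add: p)
qed

lemma norm_vec_le_sum: "norm (w :: 'a::real_normed_vector ^ 'n::finite) <= (\<Sum>k\<in>UNIV. norm (w $ k))"
  unfolding norm_vec_def by (rule L2_set_le_sum) simp

lemma prod_space_csubspace: "(!!k. csubspace (Us k)) ==> csubspace (prod_space Us :: ('v::chilbert_space ^ 'p::finite) set)"
  by (auto simp: csubspace_def prod_space_def scaleC_vec_def)

lemma prod_space_closed:
  assumes "!!k. closed (Us k)"
  shows "closed (prod_space Us :: ('v::chilbert_space ^ 'p::finite) set)"
proof -
  have "closed ((%u :: 'v ^ 'p. u $ k) -` Us k)" for k
    by (rule closed_vimage[OF assms]) (intro continuous_intros)
  then have "closed (\<Inter>k. (%u :: 'v ^ 'p. u $ k) -` Us k)" by (intro closed_INT) auto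
  moreover have "prod_space Us = (\<Inter>k. (%u :: 'v ^ 'p. u $ k) -` Us k)" by (auto simp: prod_space_def)
  ultimately show ?thesis by simp
qed

theorem theorem4p3:
  fixes Us :: "'p::finite \<Rightarrow> 'v::chilbert_space set"
    and r :: "'p \<Rightarrow> 'v" and \<delta> :: "'p \<Rightarrow> real"
    and U :: "('v ^ 'p) set" and \<phi> :: "'v ^ 'p \<Rightarrow> 'v ^ 'p"
    and S :: "('x::chilbert_space, 'v ^ 'p, 'd1::chilbert_space, 'd3::chilbert_space) bcs"
    and \<kappa> :: real and q :: nat and \<omega> :: "nat \<Rightarrow> real"
    and a b :: "nat \<Rightarrow> 'v ^ 'p" and c d :: "nat \<Rightarrow> 'd1 \<times> ('v ^ 'p) \<times> 'd3"
    and y_ref u_reg :: "real \<Rightarrow> 'v ^ 'p" and w_d :: "real \<Rightarrow> 'd1 \<times> ('v ^ 'p) \<times> 'd3"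
    and x0 :: 'x
  assumes Us: "\<And>k. csubspace (Us k)" "\<And>k. closed (Us k)"
    and U: "U = prod_space Us"
    and r: "\<And>k. r k \<in> Us k" and \<delta>: "\<And>k. \<delta> k > 0"
    and \<phi>: "\<phi> = saturation r \<delta>"
    and \<kappa>: "\<kappa> \<ge> 0"
    (* (a) *)
    and B1: "bounded_clinear_on UNIV norm UNIV norm (opB1 S)"
    and node: "boundary_node U S" and wp: "well_posed U S"
    and imp_passive: "\<And>x. x \<in> Dom S \<Longrightarrow> opBd S x = 0 \<Longrightarrow>
          Re (cinner (opA S x) x) \<le> Re (cinner (opBc S x) (opC S x))"
    (* (b) *)
    and stable: "(\<kappa> = 0 \<and> (\<exists>T. generates (ker_B S) (opA S) T \<and> strongly_stable T)) \<or>
          (\<kappa> > 0 \<and> (\<forall>k. norm (r k) < \<delta> k) \<and>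
             (\<exists>T. generates (cl_dom \<kappa> S) (opA S) T \<and> strongly_stable T))"
    and \<omega>: "\<And>k. k \<in> {1..q} \<Longrightarrow> \<omega> k > 0"
    and ab: "\<And>k. k \<le> q \<Longrightarrow> a k \<in> U" "\<And>k. k \<in> {1..q} \<Longrightarrow> b k \<in> U"
    and cd: "\<And>k. k \<le> q \<Longrightarrow> c k \<in> dist_space U" "\<And>k. k \<in> {1..q} \<Longrightarrow> d k \<in> dist_space U"
    (* (c) *)
    and freq: "\<And>k \<mu>. k \<in> {1..q} \<Longrightarrow> \<mu> \<in> {\<i> * of_real (\<omega> k), - \<i> * of_real (\<omega> k)} \<Longrightarrow>
          \<mu> \<in> resolvent_set (cl_dom \<kappa> S) (opA S) \<and> boundedly_invertible_on U (Pc \<kappa> S \<mu>)"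
    and freq0: "a 0 \<noteq> 0 \<or> c 0 \<noteq> 0 \<Longrightarrow>
          0 \<in> resolvent_set (cl_dom \<kappa> S) (opA S) \<and> boundedly_invertible_on U (Pc \<kappa> S 0)"
    and y_ref: "y_ref = trig_signal q \<omega> a b" and w_d: "w_d = trig_signal q \<omega> c d"
    and u_reg: "u_reg = feedforward U S \<kappa> q \<omega> a b c d"
  shows "\<exists>x y.
    generalised_solution U S \<phi> \<kappa> x (\<lambda>t. u_reg t + \<kappa> *\<^sub>R y_ref t) w_d y \<and> x 0 = x0 \<and>
    (\<forall>x' y'. generalised_solution U S \<phi> \<kappa> x' (\<lambda>t. u_reg t + \<kappa> *\<^sub>R y_ref t) w_d y' \<and> x' 0 = x0 \<longrightarrow>
       (\<forall>t\<ge>0. x' t = x t) \<and> (AE t in lebesgue. t > 0 \<longrightarrow> y' t = y t)) \<and>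
    ((\<exists>\<epsilon>>0. (\<forall>k. \<epsilon> < \<delta> k) \<and> (\<forall>t\<ge>0. u_reg t \<in> sat_interior Us r \<delta> \<epsilon>)) \<longrightarrow>
       (\<exists>M. \<forall>t\<ge>0. norm (x t) \<le> M) \<and>
       (\<kappa> > 0 \<longrightarrow>
          (\<exists>\<Omega>\<in>lmeasurable. \<Omega> \<subseteq> {0..} \<and>
             L2_on ({0..} - \<Omega>) U (\<lambda>t. y t - y_ref t) \<and> L1_on \<Omega> U (\<lambda>t. y t - y_ref t))) \<and>
       (\<kappa> = 0 \<longrightarrow>
          ((\<lambda>t. L2_norm {t..t+1} (\<lambda>s. y s - y_ref s)) \<longlongrightarrow> 0) at_top \<and>
          ((\<exists>T. generates (ker_B S) (opA S) T \<and> exponentially_stable T) \<longrightarrow>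
             (\<exists>\<alpha>>0. L2_on {0<..} U (\<lambda>t. exp (\<alpha> * t) *\<^sub>R (y t - y_ref t)))))) \<and>
    (x0 \<in> Dom S \<and>
     opBc S x0 = \<phi> (u_reg 0 + \<kappa> *\<^sub>R y_ref 0 - \<kappa> *\<^sub>R opC S x0) + fst (snd (w_d 0)) \<and>
     opBd S x0 = snd (snd (w_d 0)) \<longrightarrow>
       (\<exists>y\<^sub>c. (AE t in lebesgue. t > 0 \<longrightarrow> y\<^sub>c t = y t) \<and>
          classical_solution U S \<phi> \<kappa> x (\<lambda>t. u_reg t + \<kappa> *\<^sub>R y_ref t) w_d y\<^sub>c) \<and>
       H1_loc U (\<lambda>t. y t - y_ref t))"
proof -
  \<comment> \<open>\<open>\<phi>\<close> is the metric projection onto this product of balls,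
    component by component; \<open>R\<close> is a crude bound for its elements.\<close>
  define Q where "Q = {w :: 'v ^ 'p. \<forall>k. norm (w $ k - r k) <= \<delta> k}"
  define R where "R = (\<Sum>k\<in>UNIV. \<delta> k + norm (r k))"
  interpret pn: passive_node U S
  proof
    show "csubspace U" "closed U" unfolding U using Us by (auto intro: prod_space_csubspace prod_space_closed)
    show "opA S x \<bullet> x <= opBc S x \<bullet> opC S x" if "x \<in> Dom S" "opBd S x = 0" for x
      using imp_passive[OF that] by (simp add: Re_cinner)
  qed (rule node wp B1)+
  obtain xr Kr L where xr: "!!t. xr t \<in> Dom S"
    "!!t. (xr has_vector_derivative (opA S (xr t) + opB1 S (fst (w_d t)))) (at t)"
    "continuous_on UNIV (%t. opA S (xr t) + opB1 S (fst (w_d t)))"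
    "!!t. opBc S (xr t) = u_reg t + fst (snd (w_d t))" "!!t. opBd S (xr t) = snd (snd (w_d t))"
    "!!t. opC S (xr t) = y_ref t" "!!t. norm (xr t) <= Kr"
    "!!t. u_reg t \<in> U" "L \<ge> 0" "!!s t. norm (u_reg t - u_reg s) <= L * \<bar>t - s\<bar>"
    by (rule pn.regulator_state[where a = a and b = b and c = c and d = d and q = q and \<omega> = \<omega> and \<kappa> = \<kappa>,
          folded y_ref w_d u_reg], rule \<kappa>, erule ab(1), erule ab(2), erule cd(1), erule cd(2), erule freq, assumption, erule freq0, rule that)
  have \<phi>_nth: "\<phi> w $ k = r k + (\<delta> k / max (\<delta> k) (norm (w $ k - r k))) *\<^sub>R (w $ k - r k)" for w k
    by (simp add: \<phi> saturation_def)
  have subd: "subspace (dist_space U :: ('d1 \<times> ('v ^ 'p) \<times> 'd3) set)"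
    unfolding dist_space_def by (auto simp: subspace_def zero_prod_def subspace_0[OF pn.U_subspace]
      intro: subspace_add[OF pn.U_subspace] subspace_scale[OF pn.U_subspace])
  interpret rg: regulated U S \<phi> Q \<kappa> R L u_reg xr y_ref w_d
  proof
    show "\<phi> w \<in> Q" for w unfolding Q_def mem_Collect_eq \<phi>_nth using saturation_component(1)[OF \<delta>] by blast
    show "(w - \<phi> w) \<bullet> (k - \<phi> w) <= 0" if k: "k \<in> Q" for k w
      unfolding inner_vec_def
    proof (rule sum_nonpos)
      fix i
      show "(w - \<phi> w) $ i \<bullet> (k - \<phi> w) $ i <= 0"
        unfolding vector_minus_component \<phi>_nth by (rule saturation_component(2)[OF \<delta>]) (use k in \<open>simp add: Q_def\<close>)
    qed
    show "\<phi> w \<in> U" if "w \<in> U" for w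
    proof -
      have "r k + c *\<^sub>R (w $ k - r k) \<in> Us k" for k c
        using that r by (intro subspace_add[OF csubspace_subspace[OF Us(1)]] subspace_scale[OF csubspace_subspace[OF Us(1)]]
          subspace_diff[OF csubspace_subspace[OF Us(1)]]) (auto simp: U prod_space_def)
      then show ?thesis unfolding U prod_space_def by (simp add: \<phi>_nth)
    qed
    show "norm k <= R" if k: "k \<in> Q" for k
    proof (rule order_trans[OF norm_vec_le_sum], unfold R_def, rule sum_mono)
      fix i
      have "norm (k $ i) <= norm (k $ i - r i) + norm (r i)" using norm_triangle_ineq[of "k $ i - r i" "r i"] by simp
      then show "norm (k $ i) <= \<delta> i + norm (r i)" using k by (auto simp: Q_def intro: order_trans)
    qed
    show "continuous_on UNIV y_ref" "continuous_on UNIV w_d" unfolding y_ref w_d by (rule trig_signal_continuous)+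
    show "w_d t \<in> dist_space U" for t unfolding w_d by (rule trig_signal_in[OF subd]) (rule cd; assumption)+
  qed (rule \<kappa> xr)+
  obtain zs z e where z: "!!n. pn.lsol (zs n)" "!!n. zs n 0 \<in> ker_B S"
    "!!n \<tau>. \<tau> <= real n ==> l2n \<tau> (rg.resid (zs n)) <= 1 / (real n + 1)"
    "!!\<tau>. 0 <= \<tau> ==> uniform_limit {0..\<tau>} zs z sequentially" "z 0 = x0 - xr 0"
    "e measurable_on {0..}" "!!t. e t \<in> U" "!!\<tau>. set_integrable lebesgue {0..\<tau>} (%t. (norm (e t))\<^sup>2)"
    "!!\<tau>. l2conv \<tau> (%n t. opC S (zs n t)) e"
    "generalised_solution U S \<phi> \<kappa> (%t. xr t + z t) (%t. u_reg t + \<kappa> *\<^sub>R y_ref t) w_d (%t. y_ref t + e t)"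
    by (rule rg.generalised_exists[of x0]) (rule that)
  have ey: "(%t. y_ref t + e t - y_ref t) = e" by simp
  have start: "xr 0 + z 0 = x0" by (simp add: z(5))
  have asym: "(\<exists>M. \<forall>t\<ge>0. norm (xr t + z t) <= M) &
       (\<kappa> > 0 --> (\<exists>\<Omega>\<in>lmeasurable. \<Omega> \<subseteq> {0..} & L2_on ({0..} - \<Omega>) U e & L1_on \<Omega> U e)) &
       (\<kappa> = 0 --> ((%t. L2_norm {t..t+1} e) \<longlongrightarrow> 0) at_top &
          ((\<exists>T. generates (ker_B S) (opA S) T & exponentially_stable T) -->
             (\<exists>\<alpha>>0. L2_on {0<..} U (%t. exp (\<alpha> * t) *\<^sub>R e t))))"
    if \<epsilon>: "0 < \<epsilon>" and int: "\<forall>t\<ge>0. u_reg t \<in> sat_interior Us r \<delta> \<epsilon>" for \<epsilon>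
  proof -
    interpret si: saturation_interior U S \<phi> Q \<kappa> R L u_reg xr y_ref w_d \<epsilon> zs z e
    proof
      \<comment> \<open>A component of a vector is no larger than the vector, so a margin
        \<open>\<epsilon>\<close> in every component leaves room for the whole ball.\<close>
      show "cball (u_reg t) \<epsilon> \<subseteq> Q" if t: "0 <= t" for t
      proof
        fix w assume w: "w \<in> cball (u_reg t) \<epsilon>"
        have "norm (w $ k - r k) <= \<delta> k" for k
        proof -
          have "norm ((w - u_reg t) $ k) <= \<epsilon>" using w Finite_Cartesian_Product.norm_nth_le[of "w - u_reg t" k] by (simp add: dist_norm norm_minus_commute)
          moreover have "norm (u_reg t $ k - r k) <= \<delta> k - \<epsilon>" using int t by (simp add: sat_interior_def)
          ultimately show ?thesis using norm_triangle_ineq[of "(w - u_reg t) $ k" "u_reg t $ k - r k"] by simp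
        qed
        then show "w \<in> Q" by (simp add: Q_def)
      qed
    qed (rule \<epsilon> z; assumption?)+
    have "norm (xr t + z t) <= Kr + norm (z 0)" if "0 <= t" for t
      by (rule norm_triangle_le) (rule add_mono[OF xr(7) si.state_bound[OF that]])
    moreover have "\<exists>T. generates (ker_B S) (opA S) T & strongly_stable T" if "\<kappa> = 0" using stable that by auto
    ultimately show ?thesis using si.error_split si.error_vanishes si.error_exponential by blast
  qed
  have classical: "(\<exists>y\<^sub>c. (AE t in lebesgue. t > 0 --> y\<^sub>c t = y_ref t + e t) &
          classical_solution U S \<phi> \<kappa> (%t. xr t + z t) (%t. u_reg t + \<kappa> *\<^sub>R y_ref t) w_d y\<^sub>c) & H1_loc U e"
    if x0: "x0 \<in> Dom S" "opBc S x0 = \<phi> (u_reg 0 + \<kappa> *\<^sub>R y_ref 0 - \<kappa> *\<^sub>R opC S x0) + fst (snd (w_d 0))"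
      "opBd S x0 = snd (snd (w_d 0))"
  proof -
    \<comment> \<open>This trajectory is constructed independently; as a generalised solution with
      the same initial state it is identified with \<open>xr t + z t\<close> by uniqueness. The
      outputs then agree almost everywhere, which is why a separate version \<open>y\<^sub>c\<close>
      appears.\<close>
    obtain zc where zc: "zc 0 = x0 - xr 0" "continuous_on {0..} zc"
      "classical_solution U S \<phi> \<kappa> (%t. xr t + zc t) (%t. u_reg t + \<kappa> *\<^sub>R y_ref t) w_d (%t. y_ref t + opC S (zc t))"
      "!!e. L2_loc U e ==> (AE t in lebesgue. t > 0 --> e t = opC S (zc t)) ==> H1_loc U e"
      by (rule rg.classical_regular[OF x0(1,3,2)]) (rule that)
    have g: "generalised_solution U S \<phi> \<kappa> (%t. xr t + zc t) (%t. u_reg t + \<kappa> *\<^sub>R y_ref t) w_d (%t. y_ref t + opC S (zc t))"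
      by (rule generalised_of_classical[OF zc(3) continuous_on_add[OF rg.xr_continuous zc(2)]])
    have i: "xr 0 + z 0 = xr 0 + zc 0" using zc(1) z(5) by simp
    note un = rg.generalised_solution_unique[OF z(10) g i]
    have "classical_solution U S \<phi> \<kappa> (%t. xr t + z t) (%t. u_reg t + \<kappa> *\<^sub>R y_ref t) w_d (%t. y_ref t + opC S (zc t))"
      by (rule classical_solution_cong[OF zc(3) un(1) refl])
    moreover have "AE t in lebesgue. t > 0 --> y_ref t + opC S (zc t) = y_ref t + e t" using un(2) by eventually_elim simp
    moreover have "H1_loc U e"
    proof (rule zc(4))
      show "AE t in lebesgue. t > 0 --> e t = opC S (zc t)" using un(2) by eventually_elim simp
      have em: "e measurable_on {0<..<\<tau>}" for \<tau>
      proof (rule measurable_on_subset[OF z(6)])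
        show "{0<..<\<tau>} \<subseteq> {0..}" by (simp add: subset_iff)
      qed simp
      have "L2_on {0<..<\<tau>} U e" for \<tau>
        unfolding L2_on_def
      proof (intro conjI)
        show "e measurable_on {0<..<\<tau>}" by (rule em)
        show "AE t in lebesgue. t \<in> {0<..<\<tau>} --> e t \<in> U" by (simp add: z(7))
        show "set_integrable lebesgue {0<..<\<tau>} (%t. (norm (e t))\<^sup>2)" unfolding lint_open_closed(2) by (rule z(8))
      qed
      then show "L2_loc U e" by (simp add: L2_loc_def)
    qed
    ultimately show ?thesis by (intro conjI exI[of _ "%t. y_ref t + opC S (zc t)"])
  qed
  have uniq: "(\<forall>t\<ge>0. x' t = xr t + z t) & (AE t in lebesgue. t > 0 --> y' t = y_ref t + e t)"
    if g: "generalised_solution U S \<phi> \<kappa> x' (%t. u_reg t + \<kappa> *\<^sub>R y_ref t) w_d y'" and "x' 0 = x0" for x' y'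
  proof -
    have i: "x' 0 = xr 0 + z 0" using that(2) start by simp
    show ?thesis using rg.generalised_solution_unique[OF g z(10) i] by blast
  qed
  show ?thesis
  proof (rule exI[of _ "%t. xr t + z t"], rule exI[of _ "%t. y_ref t + e t"], intro conjI, rule z(10), rule start, goal_cases)
    case 1
    show ?case by (intro allI impI, elim conjE, rule uniq)
  next
    case 2
    show ?case by (intro impI, elim exE conjE, unfold add_diff_cancel_left', rule asym)
  next
    case 3
    show ?case by (intro impI, elim conjE, unfold add_diff_cancel_left', rule classical)
  qed
qed

end
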